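(* Let $\mathbb{S}^1=\mathbb{R}/\mathbb{Z}$, $\mathbb{C}^\times=\mathbb{C}\setminus\{0\}$, and let $\Lambda\mathbb{C}^\times=W^{2,2}(\mathbb{S}^1,\mathbb{C}^\times)$, an open subset of the scale Hilbert space $\Lambda\mathbb{C}=W^{2,2}(\mathbb{S}^1,\mathbb{C})$ with levels $\Lambda\mathbb{C}_k=W^{2+k,2}(\mathbb{S}^1,\mathbb{C})$, $k\in\mathbb{N}_0$. For $z\in\Lambda\mathbb{C}^\times$ let $t_z\colon\mathbb{S}^1\to\mathbb{S}^1$ be the bijection $$t_z(\tau)=\frac{1}{\|z\|_{L^2}^2}\int_0^\tau|z(s)|^2\,ds ,$$ and let $\tau_z:=t_z^{-1}$ be its inverse. Then the rescale-square map $$\mathcal{R}\colon\Lambda\mathbb{C}^\times\to\Lambda\mathbb{C}^\times,\qquad \mathcal{R}(z)=z^2\circ\tau_z=[t\mapsto z(\tau_z(t))^2],$$ is scale smooth ($\mathrm{sc}^\infty$).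
   Context: Here $\|z\|_{L^2}^2=\int_0^1|z(s)|^2\,ds$. In the definition of $t_z$ one takes $\tau\in[0,1]$; since $t_z(0)=0$ and $t_z(1)=1$ coincide modulo $1$, this defines a map $\mathbb{S}^1\to\mathbb{S}^1$, which is a bijection because its derivative $|z(\tau)|^2/\|z\|_{L^2}^2$ is continuous and strictly positive. The levels of $\Lambda\mathbb{C}^\times$ are $\Lambda\mathbb{C}^\times_k:=\Lambda\mathbb{C}^\times\cap\Lambda\mathbb{C}_k=W^{2+k,2}(\mathbb{S}^1,\mathbb{C}^\times)$, $k\in\mathbb{N}_0$. Complex-valued Sobolev spaces are regarded as real Hilbert spaces. Scale calculus (Hofer-Wysocki-Zehnder). A scale Hilbert space is a Hilbert space $E=E_0$ with a nested sequence of Hilbert spaces $E_0\supset E_1\supset E_2\supset\dots$ such that each inclusion $E_{k+1}\to E_k$ is compact and $E_\infty:=\bigcap_k E_k$ is dense in every $E_k$. For $U\subset E$ open set $U_k:=U\cap E_k$ with the topology of $E_k$. For $m\in\mathbb{N}_0$ let $E^m$ and $U^m$ denote the shifted scales with levels $(E^m)_k=E_{m+k}$, $(U^m)_k=U_{m+k}$. The tangent bundle is $TU:=U^1\oplus E$, with levels $(TU)_k=U_{k+1}\oplus E_k$. Let $E,F$ be scale Hilbert spaces and $U\subset E$, $V\subset F$ open. A map $f\colon U\to V$ is $\mathrm{sc}^0$ if $f(U_k)\subset V_k$ and $f\colon U_k\to V_k$ is continuous for every $k\in\mathbb{N}_0$. It is $\mathrm{sc}^1$ if it is $\mathrm{sc}^0$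 and for every $x\in U_1$ there is a bounded linear map $Df(x)\colon E_0\to F_0$ with $$\lim_{h\in E_1,\ \|h\|_{E_1}\to0}\frac{\|f(x+h)-f(x)-Df(x)h\|_{F_0}}{\|h\|_{E_1}}=0,$$ such that the tangent map $Tf\colon TU\to TV$, $(x,h)\mapsto(f(x),Df(x)h)$, is $\mathrm{sc}^0$. Inductively, for $n\ge2$, $f$ is $\mathrm{sc}^n$ if it is $\mathrm{sc}^1$ and $Tf$ is $\mathrm{sc}^{n-1}$. It is scale smooth, or $\mathrm{sc}^\infty$, if it is $\mathrm{sc}^n$ for every $n\in\mathbb{N}_0$. *)

theory Defs
  imports "HOL-Analysis.Analysis" "HOL-Library.Function_Algebras"
begin

instantiation "fun" :: (type, real_vector) real_vector
begin

definition scaleR_fun :: "real \<Rightarrow> ('a \<Rightarrow> 'b) \<Rightarrow> 'a \<Rightarrow> 'b"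
  where "scaleR_fun c f = (\<lambda>x. c *\<^sub>R f x)"

instance
  by standard (auto simp: scaleR_fun_def fun_eq_iff scaleR_add_right scaleR_add_left)

end

section \<open>Scale Hilbert spaces\<close>

text \<open>
  The levels of a scale are subsets of one ambient real vector space, the type \<^typ>\<open>'a\<close>.
  The inner product of a level is meaningful on that level only.
\<close>

record 'a scale =
  level :: "nat \<Rightarrow> 'a set"
  ip :: "nat \<Rightarrow> 'a \<Rightarrow> 'a \<Rightarrow> real"

definition lnorm :: "'a scale \<Rightarrow> nat \<Rightarrow> 'a \<Rightarrow> real"
  where "lnorm E k x = sqrt (ip E k x x)"

definition level_topology :: "('a::real_vector) scale \<Rightarrow> nat \<Rightarrow> 'a topology"
  where "level_topology E k = topology (\<lambda>S. S \<subseteq> level E k \<and>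
           (\<forall>x\<in>S. \<exists>r>0. \<forall>y\<in>level E k. lnorm E k (y - x) < r \<longrightarrow> y \<in> S))"

lemma openin_level_topology:
  "openin (level_topology E k) S \<longleftrightarrow> S \<subseteq> level E k \<and>
     (\<forall>x\<in>S. \<exists>r>0. \<forall>y\<in>level E k. lnorm E k (y - x) < r \<longrightarrow> y \<in> S)"
proof -
  let ?P = "\<lambda>S. S \<subseteq> level E k \<and>
     (\<forall>x\<in>S. \<exists>r>0. \<forall>y\<in>level E k. lnorm E k (y - x) < r \<longrightarrow> y \<in> S)"
  have "?P (S \<inter> T)" if S: "?P S" and T: "?P T" for S T
  proof (intro conjI ballI)
    show "S \<inter> T \<subseteq> level E k"
      using S by blast
    fix x assume x: "x \<in> S \<inter> T"
    obtain r where "r > 0" "\<forall>y\<in>level E k. lnorm E k (y - x) < r \<longrightarrow> y \<in> S"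
      using S x by blast
    moreover obtain s where "s > 0" "\<forall>y\<in>level E k. lnorm E k (y - x) < s \<longrightarrow> y \<in> T"
      using T x by blast
    ultimately show "\<exists>r>0. \<forall>y\<in>level E k. lnorm E k (y - x) < r \<longrightarrow> y \<in> S \<inter> T"
      by (intro exI[of _ "min r s"]) auto
  qed
  moreover have "?P (\<Union>K)" if K: "\<forall>S\<in>K. ?P S" for K
  proof (intro conjI ballI)
    show "\<Union>K \<subseteq> level E k"
      using K by blast
    fix x assume "x \<in> \<Union>K"
    then obtain S where "S \<in> K" "x \<in> S"
      by blast
    moreover from this obtain r
      where "r > 0" "\<forall>y\<in>level E k. lnorm E k (y - x) < r \<longrightarrow> y \<in> S"
      using K by blast
    ultimately show "\<exists>r>0. \<forall>y\<in>level E k. lnorm E k (y - x) < r \<longrightarrow> y \<in> \<Union>K"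
      by blast
  qed
  ultimately have "istopology ?P"
    unfolding istopology_def by simp
  then show ?thesis
    by (simp add: level_topology_def)
qed

definition hilbert_on :: "('a::real_vector) set \<Rightarrow> ('a \<Rightarrow> 'a \<Rightarrow> real) \<Rightarrow> bool"
  where "hilbert_on H B \<longleftrightarrow>
    subspace H \<and>
    (\<forall>x\<in>H. \<forall>y\<in>H. B x y = B y x) \<and>
    (\<forall>x\<in>H. \<forall>y\<in>H. \<forall>z\<in>H. B (x + y) z = B x z + B y z) \<and>
    (\<forall>c. \<forall>x\<in>H. \<forall>y\<in>H. B (c *\<^sub>R x) y = c * B x y) \<and>
    (\<forall>x\<in>H. 0 \<le> B x x \<and> (B x x = 0 \<longleftrightarrow> x = 0)) \<and>
    (\<forall>X. (\<forall>n. X n \<in> H) \<and>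
         (\<forall>\<epsilon>>0. \<exists>N. \<forall>m\<ge>N. \<forall>n\<ge>N. sqrt (B (X m - X n) (X m - X n)) < \<epsilon>) \<longrightarrow>
         (\<exists>l\<in>H. (\<lambda>n::nat. sqrt (B (X n - l) (X n - l))) \<longlonglongrightarrow> 0))"

definition scale_hilbert_space :: "('a::real_vector) scale \<Rightarrow> bool"
  where "scale_hilbert_space E \<longleftrightarrow>
    (\<forall>k. hilbert_on (level E k) (ip E k)) \<and>
    (\<forall>k. level E (Suc k) \<subseteq> level E k) \<and>
    (\<forall>k X. (\<forall>n. X n \<in> level E (Suc k)) \<and> (\<exists>C. \<forall>n. lnorm E (Suc k) (X n) \<le> C) \<longrightarrow>
       (\<exists>l\<in>level E k. \<exists>r::nat \<Rightarrow> nat. strict_mono r \<and>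
          (\<lambda>n. lnorm E k (X (r n) - l)) \<longlonglongrightarrow> 0)) \<and>
    (\<forall>k. level_topology E k closure_of (\<Inter>j. level E j) = level E k)"

definition bounded_linear_levels ::
    "('a::real_vector) scale \<Rightarrow> ('b::real_vector) scale \<Rightarrow> ('a \<Rightarrow> 'b) \<Rightarrow> bool"
  where "bounded_linear_levels E F L \<longleftrightarrow>
    (\<forall>x\<in>level E 0. L x \<in> level F 0) \<and>
    (\<forall>x\<in>level E 0. \<forall>y\<in>level E 0. L (x + y) = L x + L y) \<and>
    (\<forall>c. \<forall>x\<in>level E 0. L (c *\<^sub>R x) = c *\<^sub>R L x) \<and>
    (\<exists>C. \<forall>x\<in>level E 0. lnorm F 0 (L x) \<le> C * lnorm E 0 x)"

section \<open>Scale smooth maps\<close>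

definition sc0 ::
    "('a::real_vector) scale \<Rightarrow> 'a set \<Rightarrow> ('b::real_vector) scale \<Rightarrow> 'b set \<Rightarrow> ('a \<Rightarrow> 'b) \<Rightarrow> bool"
  where "sc0 E U F V f \<longleftrightarrow>
    (\<forall>k. continuous_map (subtopology (level_topology E k) U)
                        (subtopology (level_topology F k) V) f)"

definition sc_derivative ::
    "('a::real_vector) scale \<Rightarrow> 'a set \<Rightarrow> ('b::real_vector) scale \<Rightarrow> ('a \<Rightarrow> 'b) \<Rightarrow> ('a \<Rightarrow> 'a \<Rightarrow> 'b) \<Rightarrow> bool"
  where "sc_derivative E U F f D \<longleftrightarrow>
    (\<forall>x\<in>U \<inter> level E 1.
       bounded_linear_levels E F (D x) \<and>
       (\<forall>\<epsilon>>0. \<exists>\<delta>>0. \<forall>h\<in>level E 1. 0 < lnorm E 1 h \<and> lnorm E 1 h < \<delta> \<longrightarrow>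
          lnorm F 0 (f (x + h) - f x - D x h) / lnorm E 1 h < \<epsilon>))"

text \<open>
  The recursion defining $\mathrm{sc}^n$ passes from a space \<open>E\<close> to \<open>E\<^sup>1 \<oplus> E\<close>, which would change
  the ambient type in every step. All iterated tangent spaces are therefore realised in the single
  type of families indexed by binary words: the empty word carries an element of the original
  space, and a pair \<open>(x, h)\<close> is the family that is \<open>x\<close> below the letter \<^const>\<open>False\<close> and \<open>h\<close> below
  the letter \<^const>\<open>True\<close>.
\<close>

type_synonym 'a tower = "bool list \<Rightarrow> 'a"

definition tip :: "'a::zero \<Rightarrow> 'a tower"
  where "tip x = (\<lambda>w. case w of [] \<Rightarrow> x | b # v \<Rightarrow> 0)"

definition untip :: "'a tower \<Rightarrow> 'a"
  where "untip a = a []"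

definition tpair :: "'a::zero tower \<Rightarrow> 'a tower \<Rightarrow> 'a tower"
  where "tpair x h = (\<lambda>w. case w of [] \<Rightarrow> 0 | b # v \<Rightarrow> (if b then h v else x v))"

definition tfst :: "'a tower \<Rightarrow> 'a tower"
  where "tfst a = (\<lambda>v. a (False # v))"

definition tsnd :: "'a tower \<Rightarrow> 'a tower"
  where "tsnd a = (\<lambda>v. a (True # v))"

lemma untip_tip [simp]: "untip (tip x) = x"
  by (simp add: untip_def tip_def)

lemma tfst_tpair [simp]: "tfst (tpair x h) = x"
  by (simp add: tfst_def tpair_def)

lemma tsnd_tpair [simp]: "tsnd (tpair x h) = h"
  by (simp add: tsnd_def tpair_def)

definition sc_tip :: "('a::zero) scale \<Rightarrow> 'a tower scale"
  where "sc_tip E = \<lparr>level = (\<lambda>k. tip ` level E k),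
                     ip = (\<lambda>k a b. ip E k (untip a) (untip b))\<rparr>"

definition sc_shift :: "nat \<Rightarrow> 'a scale \<Rightarrow> 'a scale"
  where "sc_shift m E = \<lparr>level = (\<lambda>k. level E (m + k)), ip = (\<lambda>k. ip E (m + k))\<rparr>"

definition sc_sum :: "('a::zero) tower scale \<Rightarrow> 'a tower scale \<Rightarrow> 'a tower scale"
  where "sc_sum E F =
    \<lparr>level = (\<lambda>k. {tpair x h | x h. x \<in> level E k \<and> h \<in> level F k}),
     ip = (\<lambda>k a b. ip E k (tfst a) (tfst b) + ip F k (tsnd a) (tsnd b))\<rparr>"

definition sc_tangent :: "('a::zero) tower scale \<Rightarrow> 'a tower scale"
  where "sc_tangent E = sc_sum (sc_shift 1 E) E"

definition tangent_set :: "('a::zero) tower scale \<Rightarrow> 'a tower set \<Rightarrow> 'a tower set"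
  where "tangent_set E U = {tpair x h | x h. x \<in> U \<inter> level E 1 \<and> h \<in> level E 0}"

definition tangent_map ::
    "('a tower \<Rightarrow> 'b::zero tower) \<Rightarrow> ('a tower \<Rightarrow> 'a tower \<Rightarrow> 'b tower) \<Rightarrow> 'a tower \<Rightarrow> 'b tower"
  where "tangent_map f D a = tpair (f (tfst a)) (D (tfst a) (tsnd a))"

text \<open>
  Since \<open>E\<^sub>1\<close> is dense in \<open>E\<^sub>0\<close>, the derivative, and hence the tangent map on
  \<^const>\<open>tangent_set\<close>, is uniquely determined. The successor case reads: $f$ is $\mathrm{sc}^0$ with
  a derivative whose tangent map is $\mathrm{sc}^n$. For $n = 0$ this is the definition of
  $\mathrm{sc}^1$; for $n > 0$ it is ``$\mathrm{sc}^1$ with $Tf$ being $\mathrm{sc}^n$'', because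
  $\mathrm{sc}^n$ maps are $\mathrm{sc}^0$.
\<close>

primrec sc_pow ::
    "nat \<Rightarrow> ('a::real_vector) tower scale \<Rightarrow> 'a tower set \<Rightarrow> ('b::real_vector) tower scale \<Rightarrow> 'b tower set \<Rightarrow>
     ('a tower \<Rightarrow> 'b tower) \<Rightarrow> bool"
where
  "sc_pow 0 E U F V f = sc0 E U F V f"
| "sc_pow (Suc n) E U F V f =
     (sc0 E U F V f \<and>
      (\<exists>D. sc_derivative E U F f D \<and>
           sc_pow n (sc_tangent E) (tangent_set E U) (sc_tangent F) (tangent_set F V)
                  (tangent_map f D)))"

definition scale_smooth ::
    "('a::real_vector) scale \<Rightarrow> 'a set \<Rightarrow> ('b::real_vector) scale \<Rightarrow> 'b set \<Rightarrow> ('a \<Rightarrow> 'b) \<Rightarrow> bool"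
  where "scale_smooth E U F V f \<longleftrightarrow>
    scale_hilbert_space E \<and> scale_hilbert_space F \<and>
    openin (level_topology E 0) U \<and> openin (level_topology F 0) V \<and>
    (\<forall>n. sc_pow n (sc_tip E) (tip ` U) (sc_tip F) (tip ` V) (\<lambda>a. tip (f (untip a))))"

section \<open>Sobolev spaces on the circle\<close>

text \<open>
  Functions on the circle $\mathbb{R}/\mathbb{Z}$ are functions on the real line of period 1.
  They are integrated over a fundamental domain.
\<close>

definition circle_test :: "(real \<Rightarrow> real) \<Rightarrow> bool"
  where "circle_test \<phi> \<longleftrightarrow>
    (\<forall>t. \<phi> (t + 1) = \<phi> t) \<and> (\<forall>j t. (deriv ^^ j) \<phi> field_differentiable at t)"

definition circle_L2 :: "(real \<Rightarrow> complex) \<Rightarrow> bool"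
  where "circle_L2 g \<longleftrightarrow>
    (\<forall>t. g (t + 1) = g t) \<and> g \<in> borel_measurable borel \<and>
    set_integrable lborel {0..1} (\<lambda>t. (cmod (g t))\<^sup>2)"

definition circle_L2_norm :: "(real \<Rightarrow> complex) \<Rightarrow> real"
  where "circle_L2_norm g = sqrt (LINT t:{0..1}|lborel. (cmod (g t))\<^sup>2)"

definition has_weak_deriv :: "nat \<Rightarrow> (real \<Rightarrow> complex) \<Rightarrow> (real \<Rightarrow> complex) \<Rightarrow> bool"
  where "has_weak_deriv j f g \<longleftrightarrow> circle_L2 g \<and>
    (\<forall>\<phi>. circle_test \<phi> \<longrightarrow>
       (LINT t:{0..1}|lborel. (deriv ^^ j) \<phi> t *\<^sub>R f t) =
       (-1) ^ j * (LINT t:{0..1}|lborel. \<phi> t *\<^sub>R g t))"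

text \<open>The chosen weak derivative is unique up to a null set.\<close>

definition weak_deriv :: "nat \<Rightarrow> (real \<Rightarrow> complex) \<Rightarrow> real \<Rightarrow> complex"
  where "weak_deriv j f = (SOME g. has_weak_deriv j f g)"

text \<open>
  $W^{m,2}(\mathbb{S}^1,\mathbb{C})$ for $m \ge 1$: every class has exactly one continuous
  representative, which is taken as the element of the space. (For $m = 0$ this would not be $L^2$.)
\<close>

definition sobolev :: "nat \<Rightarrow> (real \<Rightarrow> complex) set"
  where "sobolev m = {f. (\<forall>t. f (t + 1) = f t) \<and> continuous_on UNIV f \<and>
                         (\<forall>j\<le>m. \<exists>g. has_weak_deriv j f g)}"

text \<open>On \<^typ>\<open>complex\<close>, \<open>x \<bullet> y\<close> is the real part of $x\bar y$.\<close>

definition sobolev_ip :: "nat \<Rightarrow> (real \<Rightarrow> complex) \<Rightarrow> (real \<Rightarrow> complex) \<Rightarrow> real"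
  where "sobolev_ip m f g =
    (\<Sum>j\<le>m. LINT t:{0..1}|lborel. weak_deriv j f t \<bullet> weak_deriv j g t)"

section \<open>The rescale-square map\<close>

definition loop_scale :: "(real \<Rightarrow> complex) scale"
  where "loop_scale = \<lparr>level = (\<lambda>k. sobolev (2 + k)), ip = (\<lambda>k. sobolev_ip (2 + k))\<rparr>"

definition punctured_loops :: "(real \<Rightarrow> complex) set"
  where "punctured_loops = {z \<in> sobolev 2. \<forall>t. z t \<noteq> 0}"

definition loop_time :: "(real \<Rightarrow> complex) \<Rightarrow> real \<Rightarrow> real"
  where "loop_time z \<tau> =
    1 / (circle_L2_norm z)\<^sup>2 * (LINT s:{0..\<tau>}|lborel. (cmod (z s))\<^sup>2)"

text \<open>
  The half-open interval $[0,1)$ represents each point of the circle once; for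
  \<open>z \<in> punctured_loops\<close>, the map \<^term>\<open>loop_time z\<close> is a bijection of it onto itself.
\<close>

definition loop_time_inv :: "(real \<Rightarrow> complex) \<Rightarrow> real \<Rightarrow> real"
  where "loop_time_inv z t = the_inv_into {0..<1} (loop_time z) (frac t)"

definition rescale_square :: "(real \<Rightarrow> complex) \<Rightarrow> real \<Rightarrow> complex"
  where "rescale_square z = (\<lambda>t. (z (loop_time_inv z t))\<^sup>2)"

end

theory Submission
  imports Defs "HOL-Complex_Analysis.Great_Picard"
begin

text \<open>
  The iterated tangent maps of the rescale-square map are all built from the coordinates of the
  iterated tangent space by sums, products, inversion, continuous linear operators, differentiation
  \<open>d/dt\<close> (which costs one level) and reparametrisation \<open>rep \<rho> u = u \<circ> \<tau>\<close>, where \<open>\<tau>\<close> is the inverse of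
  the primitive of a probability density \<open>\<rho>\<close> on the circle. The class of such maps is continuous on
  every level, because \<open>(rep \<rho> u)' = rep \<rho> (u' / \<rho>)\<close>, and it is closed under directional derivatives,
  because \<open>rep\<close> has the derivative \<open>rep \<rho> v - rep \<rho> (u' / \<rho> * P)\<close> in the direction \<open>(\<sigma>, v)\<close>, where
  \<open>P\<close> is the primitive of \<open>\<sigma>\<close>; here the derivative \<open>u'\<close> costs exactly the level that the tangent
  space provides. Directional derivatives that are continuous in the point give the limit in the
  definition of \<open>sc\<^sup>1\<close>: a mean value inequality reduces the remainder to differences of the derivative
  along segments, which tend to zero since the inclusion of level one in level zero is compact.
\<close>

section \<open>Semi-inner products\<close>

text \<open>The obstacle is the loss of a derivative: the map (\<rho>, u) -> u o \<tau> is
  continuous on every level, but its derivative contains u', so it is not C^1 on any fixed level and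
  the chain rule of Banach calculus is not at hand. Instead of a chain rule for sc-maps, a syntactic
  class is differentiated term by term, and the index r of \<open>tame n r\<close> keeps account of
  surplus orders: passing to the base of a tangent space earns one (\<open>tame_lift\<close>), and
  the derivative of \<open>rep\<close> spends it at once. Norm convergence of the difference
  quotients of \<open>rep\<close> is not estimated directly; their pointwise limit, which follows
  from calculus on the line, is enough, because the mean value inequality only compares values of
  the derivative. Levels are sets inside one function type and not types, so continuity is handled
  by sequences (\<open>cv\<close>, \<open>tcv\<close>). The Sobolev norms are first rewritten as a
  recursion over primitives that starts at L^2, so that statements about order m + 1 reduce to order
  m.\<close>

lemma quadratic_nonneg_imp:
  fixes A B C :: real
  assumes "\<And>x. 0 \<le> A - 2 * x * B + x\<^sup>2 * C" "0 \<le> C"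
  shows "B\<^sup>2 \<le> A * C"
proof (cases "C = 0")
  case True
  show ?thesis
  proof (cases "B = 0")
    case False
    \<comment> \<open>For \<open>C = 0\<close> the expression is affine in x, and this x gives it
      the value -1.\<close>
    then show ?thesis using assms(1)[of "(A + 1) / (2 * B)"] True by (simp add: field_simps)
  qed (use True in simp)
next
  case False
  with assms(2) have "C > 0" by simp
  \<comment> \<open>The quadratic attains its minimum A - B^2 / C there.\<close>
  then show ?thesis using assms(1)[of "B / C"]
    by (simp add: field_simps power2_eq_square)
qed

text \<open>Nonnegative but not definite: elements of L^2 are functions here rather than classes,
  and a function that vanishes almost everywhere has norm zero. The locale serves L^2, every Sobolev
  order and every level of every iterated tangent space.\<close>

locale semi_ip =
  fixes H :: "'a::real_vector set" and B :: "'a \<Rightarrow> 'a \<Rightarrow> real"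
  assumes sub: "subspace H"
    and sym: "x \<in> H \<Longrightarrow> y \<in> H \<Longrightarrow> B x y = B y x"
    and add: "x \<in> H \<Longrightarrow> y \<in> H \<Longrightarrow> z \<in> H \<Longrightarrow> B (x + y) z = B x z + B y z"
    and scale: "x \<in> H \<Longrightarrow> y \<in> H \<Longrightarrow> B (c *\<^sub>R x) y = c * B x y"
    and nonneg: "x \<in> H \<Longrightarrow> 0 \<le> B x x"
begin

abbreviation N where "N x \<equiv> sqrt (B x x)"

lemma zero_in: "0 \<in> H" and add_in: "x \<in> H \<Longrightarrow> y \<in> H \<Longrightarrow> x + y \<in> H"
  and scale_in: "x \<in> H \<Longrightarrow> c *\<^sub>R x \<in> H" and diff_in: "x \<in> H \<Longrightarrow> y \<in> H \<Longrightarrow> x - y \<in> H"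
  and neg_in: "x \<in> H \<Longrightarrow> - x \<in> H"
  using sub subspace_0 subspace_add subspace_scale subspace_diff subspace_neg by metis+

lemma add_r: "x \<in> H \<Longrightarrow> y \<in> H \<Longrightarrow> z \<in> H \<Longrightarrow> B z (x + y) = B z x + B z y"
  using add sym add_in by metis

lemma scale_r: "x \<in> H \<Longrightarrow> y \<in> H \<Longrightarrow> B y (c *\<^sub>R x) = c * B y x"
  using scale sym scale_in by metis

lemma neg: "x \<in> H \<Longrightarrow> y \<in> H \<Longrightarrow> B (- x) y = - B x y"
  using scale[of x y "-1"] by simp

lemma diff: "x \<in> H \<Longrightarrow> y \<in> H \<Longrightarrow> z \<in> H \<Longrightarrow> B (x - y) z = B x z - B y z"
  using add[of x "-y" z] neg neg_in by simp

lemma diff_r: "x \<in> H \<Longrightarrow> y \<in> H \<Longrightarrow> z \<in> H \<Longrightarrow> B z (x - y) = B z x - B z y"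
  using diff sym diff_in by metis

lemma zero_zero: "B 0 0 = 0"
  using scale[of 0 0 0] zero_in by simp

lemma N_0: "N 0 = 0" by (simp add: zero_zero)

lemma N_nonneg: "x \<in> H \<Longrightarrow> 0 \<le> N x" by (simp add: nonneg)

lemma Cauchy_Schwarz_sq: assumes "x \<in> H" "y \<in> H" shows "(B x y)\<^sup>2 \<le> B x x * B y y"
proof (rule quadratic_nonneg_imp)
  fix c
  have "0 \<le> B (x - c *\<^sub>R y) (x - c *\<^sub>R y)" using assms by (intro nonneg diff_in scale_in)
  also have "\<dots> = B x x - 2 * c * B x y + c\<^sup>2 * B y y"
    using assms sym[of x y]
    by (simp add: diff diff_r diff_in scale_in scale scale_r power2_eq_square algebra_simps)
  finally show "0 \<le> B x x - 2 * c * B x y + c\<^sup>2 * B y y" .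
qed (use assms nonneg in auto)

lemma Cauchy_Schwarz: assumes "x \<in> H" "y \<in> H" shows "\<bar>B x y\<bar> \<le> N x * N y"
  using real_sqrt_le_mono[OF Cauchy_Schwarz_sq[OF assms]] by (simp add: real_sqrt_mult)

lemma triangle: assumes "x \<in> H" "y \<in> H" shows "N (x + y) \<le> N x + N y"
proof (rule power2_le_imp_le)
  have "(N (x + y))\<^sup>2 = B x x + 2 * B x y + B y y"
    using assms sym[of x y] nonneg[OF add_in[OF assms]] by (simp add: add add_r add_in)
  also have "\<dots> \<le> (N x)\<^sup>2 + 2 * (N x * N y) + (N y)\<^sup>2"
    using Cauchy_Schwarz[OF assms] assms nonneg by simp
  finally show "(N (x + y))\<^sup>2 \<le> (N x + N y)\<^sup>2" by (simp add: power2_sum algebra_simps)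
qed (use assms nonneg in auto)

lemma N_scale: "x \<in> H \<Longrightarrow> N (c *\<^sub>R x) = \<bar>c\<bar> * N x"
  by (simp add: scale scale_r scale_in real_sqrt_mult mult.assoc[symmetric])

lemma N_minus: "x \<in> H \<Longrightarrow> N (- x) = N x"
  using N_scale[of x "-1"] by simp

lemma N_minus_commute: "x \<in> H \<Longrightarrow> y \<in> H \<Longrightarrow> N (x - y) = N (y - x)"
  using N_minus[of "x - y"] diff_in by simp

lemma triangle_diff: "x \<in> H \<Longrightarrow> y \<in> H \<Longrightarrow> N (x - y) \<le> N x + N y"
  using triangle[of x "-y"] N_minus[of y] neg_in by simp

lemma triangle3: "x \<in> H \<Longrightarrow> y \<in> H \<Longrightarrow> z \<in> H \<Longrightarrow> N (x - z) \<le> N (x - y) + N (y - z)"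
  using triangle[of "x - y" "y - z"] diff_in by simp

lemma triangle_rev: "x \<in> H \<Longrightarrow> y \<in> H \<Longrightarrow> \<bar>N x - N y\<bar> \<le> N (x - y)"
  using triangle[of "x - y" y] triangle[of "y - x" x] N_minus_commute[of x y] diff_in by fastforce

lemma tendsto_N: assumes "\<And>n. X n \<in> H" "x \<in> H" "(\<lambda>n. N (X n - x)) \<longlonglongrightarrow> 0"
  shows "(\<lambda>n. N (X n)) \<longlonglongrightarrow> N x"
  by (rule Lim_transform2[where f="\<lambda>n. N x"], simp, rule Lim_null_comparison[OF _ assms(3)])
    (use triangle_rev[OF assms(2) assms(1)] N_minus_commute[OF assms(2) assms(1)] in auto)

lemma tendsto_B: assumes "\<And>n. X n \<in> H" "x \<in> H" "(\<lambda>n. N (X n - x)) \<longlonglongrightarrow> 0" "y \<in> H"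
  shows "(\<lambda>n. B (X n) y) \<longlonglongrightarrow> B x y"
proof (rule Lim_transform2[where f="\<lambda>n. B x y"], simp, rule Lim_null_comparison)
  show "\<forall>\<^sub>F n in sequentially. norm (B x y - B (X n) y) \<le> N (X n - x) * N y"
  proof (intro always_eventually allI)
    fix n show "norm (B x y - B (X n) y) \<le> N (X n - x) * N y"
      using Cauchy_Schwarz[of "X n - x" y] assms diff_in by (simp add: diff)
  qed
  show "(\<lambda>n. N (X n - x) * N y) \<longlonglongrightarrow> 0" using assms(3) by (rule tendsto_mult_left_zero)
qed

end

section \<open>Square-integrable functions on the circle\<close>

text \<open>A fundamental domain with both ends included: 0 and 1 are the same point of the circle,
  but single points are null sets.\<close>

definition circ :: "real measure" where "circ = restrict_space lborel {0..1}"

lemma space_circ [simp]: "space circ = {0..1}" by (simp add: circ_def space_restrict_space)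

lemma emeasure_circ: "emeasure circ (space circ) = 1"
  by (simp add: circ_def emeasure_restrict_space)

interpretation circ: finite_measure circ
  by standard (simp add: emeasure_circ del: space_circ)

lemma measure_circ [simp]: "measure circ {0..1} = 1"
  using emeasure_circ by (simp add: measure_def)

lemma borel_circ [intro]: "f \<in> borel_measurable borel \<Longrightarrow> f \<in> borel_measurable circ"
  unfolding circ_def by (simp add: measurable_restrict_space1)

lemma set_integral_circ:
  fixes f :: "real \<Rightarrow> 'b::{banach, second_countable_topology}"
  shows "(LINT t:{0..1}|lborel. f t) = integral\<^sup>L circ f"
  by (simp add: circ_def integral_restrict_space set_lebesgue_integral_def)

lemma set_integrable_circ:
  fixes f :: "real \<Rightarrow> 'b::{banach, second_countable_topology}"
  shows "set_integrable lborel {0..1} f \<longleftrightarrow> integrable circ f"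
  by (simp add: circ_def integrable_restrict_space set_integrable_def)

definition l2ip :: "(real \<Rightarrow> complex) \<Rightarrow> (real \<Rightarrow> complex) \<Rightarrow> real"
  where "l2ip f g = integral\<^sup>L circ (\<lambda>t. f t \<bullet> g t)"

lemma circle_L2_norm_eq: "circle_L2_norm f = sqrt (l2ip f f)"
  by (simp add: circle_L2_norm_def l2ip_def set_integral_circ power2_norm_eq_inner)

lemma circle_L2_iff: "circle_L2 f \<longleftrightarrow>
    (\<forall>t. f (t + 1) = f t) \<and> f \<in> borel_measurable borel \<and> integrable circ (\<lambda>t. (cmod (f t))\<^sup>2)"
  by (simp add: circle_L2_def set_integrable_circ)

lemma circle_L2_measurable [measurable_dest]: "circle_L2 f \<Longrightarrow> f \<in> borel_measurable borel"
  by (simp add: circle_L2_iff)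

lemma abs_inner_le: fixes x y :: "'a::real_inner" shows "\<bar>x \<bullet> y\<bar> \<le> (norm x)\<^sup>2 + (norm y)\<^sup>2"
proof -
  have "\<bar>x \<bullet> y\<bar> \<le> norm x * norm y" by (rule Cauchy_Schwarz_ineq2)
  moreover have "0 \<le> (norm x - norm y)\<^sup>2" "0 \<le> norm x * norm y" by simp_all
  ultimately show ?thesis unfolding power2_diff by linarith
qed

lemma circle_L2_inner_integrable:
  assumes "circle_L2 f" "circle_L2 g" shows "integrable circ (\<lambda>t. f t \<bullet> g t)"
proof (rule Bochner_Integration.integrable_bound)
  show "integrable circ (\<lambda>t. (cmod (f t))\<^sup>2 + (cmod (g t))\<^sup>2)" using assms by (simp add: circle_L2_iff)
  have [measurable]: "f \<in> borel_measurable borel" "g \<in> borel_measurable borel" using assms by (auto dest: circle_L2_measurable)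
  have "(\<lambda>t. f t \<bullet> g t) \<in> borel_measurable borel" by measurable
  then show "(\<lambda>t. f t \<bullet> g t) \<in> borel_measurable circ" by (rule borel_circ)
  show "AE x in circ. norm (f x \<bullet> g x) \<le> norm ((cmod (f x))\<^sup>2 + (cmod (g x))\<^sup>2)"
    using abs_inner_le by (intro AE_I2) (simp add: abs_inner_le)
qed

lemma circle_L2_add: assumes "circle_L2 f" "circle_L2 g" shows "circle_L2 (\<lambda>t. f t + g t)"
  unfolding circle_L2_iff
proof (intro conjI allI)
  have *: "integrable circ (\<lambda>t. (cmod (f t))\<^sup>2 + 2 * (f t \<bullet> g t) + (cmod (g t))\<^sup>2)"
    using assms circle_L2_inner_integrable[OF assms] by (simp add: circle_L2_iff)
  have "(\<lambda>t. (cmod (f t + g t))\<^sup>2) = (\<lambda>t. (cmod (f t))\<^sup>2 + 2 * (f t \<bullet> g t) + (cmod (g t))\<^sup>2)"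
    by (simp add: power2_norm_eq_inner inner_add inner_commute algebra_simps)
  with * show "integrable circ (\<lambda>t. (cmod (f t + g t))\<^sup>2)" by simp
qed (use assms in \<open>auto simp: circle_L2_iff\<close>)

lemma circle_L2_mult:
  assumes "circle_L2 f" "\<And>t. h (t + 1) = h t" "h \<in> borel_measurable borel" "\<And>t. cmod (h t) \<le> M"
  shows "circle_L2 (\<lambda>t. h t * f t)"
  unfolding circle_L2_iff
proof (intro conjI allI)
  have [measurable]: "f \<in> borel_measurable borel" "h \<in> borel_measurable borel" using assms by (auto dest: circle_L2_measurable)
  show "(\<lambda>t. h t * f t) \<in> borel_measurable borel" by measurable
  have M: "0 \<le> M" using assms(4)[of 0] norm_ge_zero[of "h 0"] by linarith
  show "integrable circ (\<lambda>t. (cmod (h t * f t))\<^sup>2)"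
  proof (rule Bochner_Integration.integrable_bound)
    show "integrable circ (\<lambda>t. M\<^sup>2 * (cmod (f t))\<^sup>2)" using assms by (simp add: circle_L2_iff)
    have "(\<lambda>t. (cmod (h t * f t))\<^sup>2) \<in> borel_measurable borel" by measurable
    then show "(\<lambda>t. (cmod (h t * f t))\<^sup>2) \<in> borel_measurable circ" by (rule borel_circ)
    show "AE x in circ. norm ((cmod (h x * f x))\<^sup>2) \<le> norm (M\<^sup>2 * (cmod (f x))\<^sup>2)"
      using assms(4) M by (intro AE_I2) (simp add: norm_mult power_mult_distrib mult_right_mono power_mono)
  qed
qed (use assms in \<open>auto simp: circle_L2_iff\<close>)

lemma circle_L2_continuous:
  assumes "continuous_on UNIV f" "\<And>t. f (t + 1) = f t" shows "circle_L2 f"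
  unfolding circle_L2_iff
proof (intro conjI allI)
  have "continuous_on {0..1} (\<lambda>t. (cmod (f t))\<^sup>2)"
    using continuous_on_subset[OF assms(1)] by (intro continuous_intros) auto
  then have "set_integrable lborel {0..1} (\<lambda>t. (cmod (f t))\<^sup>2)"
    unfolding set_integrable_def by (intro borel_integrable_compact) auto
  then show "integrable circ (\<lambda>t. (cmod (f t))\<^sup>2)" by (simp add: set_integrable_circ)
qed (use assms in \<open>auto simp: borel_measurable_continuous_onI\<close>)

lemma circle_L2_cmult: "circle_L2 f \<Longrightarrow> circle_L2 (\<lambda>t. c * f t)"
  by (rule circle_L2_mult[where M="cmod c"]) auto

lemma scaleR_fun_apply [simp]: "(c *\<^sub>R f) x = c *\<^sub>R f x"
  by (simp add: scaleR_fun_def)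

lemma subspace_circle_L2: "subspace (Collect circle_L2)"
proof (rule subspaceI)
  show "0 \<in> Collect circle_L2" by (auto intro!: circle_L2_continuous simp: zero_fun_def)
  show "x + y \<in> Collect circle_L2" if "x \<in> Collect circle_L2" "y \<in> Collect circle_L2" for x y
    using that circle_L2_add[of x y] by (simp add: plus_fun_def)
  show "c *\<^sub>R x \<in> Collect circle_L2" if "x \<in> Collect circle_L2" for c x
    using that circle_L2_cmult[of x "of_real c"] by (simp add: scaleR_fun_def scaleR_conv_of_real)
qed

interpretation L2: semi_ip "Collect circle_L2" l2ip
proof
  show "subspace (Collect circle_L2)" by (rule subspace_circle_L2)
  fix x y z :: "real \<Rightarrow> complex" and c assume "x \<in> Collect circle_L2"
  then have x: "circle_L2 x" by simp
  show "0 \<le> l2ip x x" by (simp add: l2ip_def)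
  assume "y \<in> Collect circle_L2"
  then have y: "circle_L2 y" by simp
  show "l2ip x y = l2ip y x" by (simp add: l2ip_def inner_commute)
  show "l2ip (c *\<^sub>R x) y = c * l2ip x y" by (simp add: l2ip_def)
  assume "z \<in> Collect circle_L2"
  then have z: "circle_L2 z" by simp
  show "l2ip (x + y) z = l2ip x z + l2ip y z" 
    by (simp add: l2ip_def inner_add_left circle_L2_inner_integrable x y z)
qed

abbreviation l2 where "l2 f \<equiv> sqrt (l2ip f f)"

lemma circle_L2_integrable: assumes "circle_L2 f" shows "integrable circ f"
proof (rule Bochner_Integration.integrable_bound)
  show "integrable circ (\<lambda>t. 1 + (cmod (f t))\<^sup>2)" using assms by (simp add: circle_L2_iff)
  show "f \<in> borel_measurable circ" using assms by (auto simp: circle_L2_iff)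
  have "x \<le> 1 + x\<^sup>2" for x :: real
  proof -
    have "0 \<le> (x - 1/2)\<^sup>2" by simp
    then show ?thesis unfolding power2_diff by (simp add: power2_eq_square)
  qed
  then show "AE x in circ. cmod (f x) \<le> norm (1 + (cmod (f x))\<^sup>2)"
    by (intro AE_I2) (simp add: order.trans[OF _ abs_ge_self])
qed

lemma circle_L2_norm_fun: assumes "circle_L2 f" shows "circle_L2 (\<lambda>t. of_real (cmod (f t)))"
  using assms by (auto simp: circle_L2_iff)

lemma l2ip_self: "l2ip f f = (\<integral>t. (cmod (f t))\<^sup>2 \<partial>circ)"
  by (simp add: l2ip_def power2_norm_eq_inner)

lemma l2_bound: assumes "circle_L2 f" "\<And>t. t \<in> {0..1} \<Longrightarrow> cmod (f t) \<le> M" "0 \<le> M" shows "l2 f \<le> M"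
proof -
  have "l2ip f f \<le> (\<integral>t. M\<^sup>2 \<partial>circ)" unfolding l2ip_self
    by (rule integral_mono) (use assms in \<open>auto simp: circle_L2_iff power_mono\<close>)
  then show ?thesis using assms(3) by (simp add: real_le_lsqrt)
qed

lemma l2_mult_bound: assumes "circle_L2 f" "circle_L2 (\<lambda>t. h t * f t)" "\<And>t. t \<in> {0..1} \<Longrightarrow> cmod (h t) \<le> M" "0 \<le> M"
  shows "l2 (\<lambda>t. h t * f t) \<le> M * l2 f"
proof -
  have "l2ip (\<lambda>t. h t * f t) (\<lambda>t. h t * f t) \<le> (\<integral>t. M\<^sup>2 * (cmod (f t))\<^sup>2 \<partial>circ)" unfolding l2ip_self
  proof (rule integral_mono)
    show "(cmod (h t * f t))\<^sup>2 \<le> M\<^sup>2 * (cmod (f t))\<^sup>2" if "t \<in> space circ" for t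
      using that assms(3)[of t] by (simp add: norm_mult power_mult_distrib mult_right_mono power_mono)
  qed (use assms in \<open>auto simp: circle_L2_iff\<close>)
  also have "\<dots> = M\<^sup>2 * l2ip f f" by (simp add: l2ip_self)
  finally show ?thesis using assms(4) by (metis real_sqrt_le_iff real_sqrt_mult real_sqrt_abs abs_of_nonneg)
qed

text \<open>Cauchy-Schwarz against the constant loop 1, which has norm one. The modulus is embedded
  as a complex function because \<open>l2ip\<close> pairs complex functions.\<close>

lemma norm_integral_le_l2:
  assumes "circle_L2 f" shows "(\<integral>t. cmod (f t) \<partial>circ) \<le> l2 f"
proof -
  have "circle_L2 (\<lambda>t. 1)" by (rule circle_L2_continuous) auto
  from L2.Cauchy_Schwarz[OF _ _, of "\<lambda>t. of_real (cmod (f t))" "\<lambda>t. 1"] this circle_L2_norm_fun[OF assms]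
  have "\<bar>l2ip (\<lambda>t. of_real (cmod (f t))) (\<lambda>t. 1)\<bar> \<le> l2 (\<lambda>t. of_real (cmod (f t))) * l2 (\<lambda>t. 1)" by simp
  moreover have "l2 (\<lambda>t. 1) = 1" by (simp add: l2ip_self)
  moreover have "l2 (\<lambda>t. of_real (cmod (f t))) = l2 f" by (simp add: l2ip_self)
  moreover have "l2ip (\<lambda>t. of_real (cmod (f t))) (\<lambda>t. 1) = (\<integral>t. cmod (f t) \<partial>circ)"
    by (simp add: l2ip_def inner_complex_def)
  ultimately show ?thesis by simp
qed

text \<open>The factor \<open>sqrt (t - s)\<close> makes bounded sets of \<open>W\<^sup>1\<^sup>,\<^sup>2\<close> equicontinuous.\<close>

lemma norm_set_integral_le_l2:
  assumes "circle_L2 f" "0 \<le> s" "s \<le> t" "t \<le> 1"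
  shows "set_integrable lborel {s..t} f" "cmod (LINT x:{s..t}|lborel. f x) \<le> sqrt (t - s) * l2 f"
proof -
  have i: "set_integrable lborel {0..1} f" using circle_L2_integrable[OF assms(1)] by (simp add: set_integrable_circ)
  show I: "set_integrable lborel {s..t} f" by (rule set_integrable_subset[OF i]) (use assms in auto)
  let ?c = "indicator {s..t} :: real \<Rightarrow> real"
  let ?g = "\<lambda>x. of_real (cmod (f x)) :: complex"
  \<comment> \<open>\<open>circle_L2\<close> demands periodicity, so the indicator is composed with
    \<open>frac\<close>; on the unit interval this can change its value at the point 1 only.\<close>
  let ?h = "\<lambda>x. complex_of_real (?c (frac x))"
  have [measurable]: "frac \<in> borel_measurable (borel :: real measure)"
    unfolding frac_def by measurable
  have h: "circle_L2 ?h"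
  proof -
    have 1: "circle_L2 (\<lambda>t. 1)" by (rule circle_L2_continuous) auto
    have "circle_L2 (\<lambda>x. ?h x * 1)"
    proof (rule circle_L2_mult[OF 1, where M=1])
      show "?h \<in> borel_measurable borel" by measurable
      show "?h (t + 1) = ?h t" for t by (simp add: frac_1_eq)
      show "cmod (?h t) \<le> 1" for t by (auto simp: indicator_def)
    qed
    then show ?thesis by simp
  qed
  have fr: "AE x in circ. ?c (frac x) = ?c x"
  proof -
    have "AE x in lborel. x \<noteq> (1::real)" by (rule AE_lborel_singleton)
    then have A: "AE x in circ. x \<noteq> (1::real)" unfolding circ_def by (subst AE_restrict_space_iff) auto
    have B: "x = 1 \<or> frac x = x" if "x \<in> space circ" for x
      using that by (auto simp: frac_eq)
    show ?thesis using A AE_space[of circ] by eventually_elim (use B in metis)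
  qed
  have [measurable]: "f \<in> borel_measurable borel" using assms(1) by (rule circle_L2_measurable)
  have "l2ip ?h ?h = (\<integral>x. ?c x \<partial>circ)" unfolding l2ip_self
    by (rule integral_cong_AE) (use fr in \<open>auto intro!: borel_circ simp: indicator_def elim!: AE_mp\<close>)
  also have "\<dots> = (\<integral>x. ?c x \<partial>lborel)"
    unfolding set_integral_circ[symmetric] set_lebesgue_integral_def
    by (rule Bochner_Integration.integral_cong) (use assms in \<open>auto simp: indicator_def\<close>)
  finally have hn: "l2ip ?h ?h = t - s" using assms by simp
  have gn: "l2ip ?g ?g = l2ip f f" by (simp add: l2ip_self)
  have "cmod (LINT x:{s..t}|lborel. f x) \<le> (LINT x:{s..t}|lborel. cmod (f x))"
    by (rule set_integral_norm_bound[OF I])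
  also have "\<dots> = (LINT x:{0..1}|lborel. cmod (f x) * ?c x)"
    using assms unfolding set_lebesgue_integral_def
    by (intro Bochner_Integration.integral_cong) (auto simp: indicator_def)
  also have "\<dots> = (\<integral>x. cmod (f x) * ?c x \<partial>circ)" by (simp add: set_integral_circ)
  also have "\<dots> = l2ip ?g ?h" unfolding l2ip_def
    by (rule integral_cong_AE) (use fr in \<open>auto intro!: borel_circ simp: inner_complex_def elim!: AE_mp\<close>)
  also have "\<dots> \<le> l2 ?g * l2 ?h"
    using L2.Cauchy_Schwarz[of ?g ?h] h circle_L2_norm_fun[OF assms(1)] by simp
  finally show "cmod (LINT x:{s..t}|lborel. f x) \<le> sqrt (t - s) * l2 f" by (simp add: hn gn mult.commute)
qed

text \<open>Bridge to the gauge integral, for which the fundamental theorem of calculus is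
  available.\<close>

lemma has_integral_circle_L2:
  assumes "circle_L2 f" "0 \<le> s" "s \<le> t" "t \<le> 1"
  shows "f integrable_on {s..t}" "integral {s..t} f = (LINT x:{s..t}|lborel. f x)"
    "cmod (integral {s..t} f) \<le> sqrt (t - s) * l2 f"
  using set_borel_integral_eq_integral[OF norm_set_integral_le_l2(1)[OF assms]] norm_set_integral_le_l2(2)[OF assms] by auto

lemma l2_eq_0_AE: assumes "circle_L2 f" "l2ip f f = 0" shows "AE t in circ. f t = 0"
proof -
  have "AE t in circ. (cmod (f t))\<^sup>2 = 0"
    using assms integral_nonneg_eq_0_iff_AE[of circ "\<lambda>t. (cmod (f t))\<^sup>2"] by (simp add: circle_L2_iff l2ip_self)
  then show ?thesis by simp
qed

subsection \<open>Completeness\<close>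

lemma integral_norm_le_l2: "circle_L2 f \<Longrightarrow> (\<integral>\<^sup>+t. ennreal (cmod (f t)) \<partial>circ) \<le> ennreal (l2 f)"
  using norm_integral_le_l2[of f] circle_L2_integrable[of f]
  by (subst nn_integral_eq_integral) (auto intro!: ennreal_leI)

lemma nn_integral_l2: "circle_L2 f \<Longrightarrow> (\<integral>\<^sup>+t. ennreal ((cmod (f t))\<^sup>2) \<partial>circ) = ennreal (l2ip f f)"
  by (subst nn_integral_eq_integral) (auto simp: circle_L2_iff l2ip_self)

lemma circle_L2_diff: "circle_L2 f \<Longrightarrow> circle_L2 g \<Longrightarrow> circle_L2 (f - g)"
  using L2.diff_in by simp

text \<open>Riesz-Fischer. Along indices with steps below (1/2)^k the sum of the steps is
  integrable, hence finite almost everywhere, and the terms converge almost everywhere. Fatou's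
  lemma turns this into convergence of the whole sequence in norm.\<close>

lemma circle_L2_complete:
  assumes X: "\<And>n. circle_L2 (X n)"
    and Cauchy: "\<And>e. 0 < e \<Longrightarrow> \<exists>N. \<forall>m\<ge>N. \<forall>n\<ge>N. l2 (X m - X n) < e"
  obtains l where "circle_L2 l" "(\<lambda>n. l2 (X n - l)) \<longlonglongrightarrow> 0"
proof -
  have "\<forall>k::nat. \<exists>N. \<forall>m\<ge>N. \<forall>n\<ge>N. l2 (X m - X n) < (1/2)^k" using Cauchy by simp
  then obtain N where N: "\<And>k m n. m \<ge> N k \<Longrightarrow> n \<ge> N k \<Longrightarrow> l2 (X m - X n) < (1/2)^k" by metis
  \<comment> \<open>Partial sums of the thresholds dominate every earlier threshold.\<close>
  define r where "r k = (\<Sum>i\<le>k. N i)" for k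
  have r: "N k \<le> r j" if "k \<le> j" for k j
    unfolding r_def by (rule member_le_sum) (use that in auto)
  define Y where "Y k = X (r k)" for k
  have Y: "circle_L2 (Y k)" for k using X by (simp add: Y_def)
  have XY: "l2 (X n - Y j) < (1/2)^k" if "N k \<le> n" "k \<le> j" for n k j
    unfolding Y_def by (rule N) (use that r in auto)
  have YY: "l2 (Y (Suc k) - Y k) < (1/2)^k" for k
    using XY[of k "r (Suc k)" k] r[of k "Suc k"] by (simp add: Y_def)
  have [measurable]: "Y k \<in> borel_measurable borel" "X k \<in> borel_measurable borel" for k
    using Y X by (auto dest: circle_L2_measurable)
  then have [measurable]: "Y k \<in> borel_measurable circ" "X k \<in> borel_measurable circ" for k by (auto intro: borel_circ)
  have "(\<integral>\<^sup>+t. (\<Sum>k. ennreal (cmod ((Y (Suc k) - Y k) t))) \<partial>circ)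
      = (\<Sum>k. (\<integral>\<^sup>+t. ennreal (cmod ((Y (Suc k) - Y k) t)) \<partial>circ))"
    by (rule nn_integral_suminf) simp
  also have "\<dots> \<le> (\<Sum>k. ennreal ((1/2)^k))"
  proof (rule suminf_le)
    show "(\<integral>\<^sup>+t. ennreal (cmod ((Y (Suc k) - Y k) t)) \<partial>circ) \<le> ennreal ((1/2)^k)" for k
      using integral_norm_le_l2[of "Y (Suc k) - Y k"] circle_L2_diff[OF Y Y] YY[of k]
      by (meson ennreal_leI less_imp_le order.trans)
  qed auto
  also have "\<dots> < \<infinity>"
  proof -
    have "summable (\<lambda>k. (1/2::real)^k)" by simp
    then show ?thesis by (simp add: suminf_ennreal2 less_top[symmetric])
  qed
  finally have "AE t in circ. (\<Sum>k. ennreal (cmod ((Y (Suc k) - Y k) t))) \<noteq> \<infinity>"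
    by (intro nn_integral_PInf_AE) auto
  then have conv: "AE t in circ. (\<lambda>k. Y k t) \<longlonglongrightarrow> lim (\<lambda>k. Y k t)"
  proof eventually_elim
    case (elim t)
    then have "summable (\<lambda>k. cmod (Y (Suc k) t - Y k t))"
      by (intro summable_suminf_not_top) auto
    then have "summable (\<lambda>k. Y (Suc k) t - Y k t)" by (rule summable_norm_cancel)
    then have "convergent (\<lambda>n. Y n t)"
      by (simp add: summable_iff_convergent sum_lessThan_telescope[of "\<lambda>i. Y i t"] convergent_diff_const_right_iff)
    then show ?case by (rule convergent_LIMSEQ_iff[THEN iffD1])
  qed
  \<comment> \<open>\<open>lim\<close> depends only on the sequence of values, so l is exactly
    periodic, also at points where the sequence diverges.\<close>
  define l where "l t = lim (\<lambda>k. Y k t)" for t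
  have [measurable]: "l \<in> borel_measurable borel" unfolding l_def by measurable
  then have [measurable]: "l \<in> borel_measurable circ" by (rule borel_circ)
  have lper: "l (t + 1) = l t" for t
    using Y by (simp add: l_def circle_L2_iff)
  \<comment> \<open>Fatou's lemma in j with n fixed: the bound \<open>XY\<close> on X n - Y j passes
    to X n - l.\<close>
  have F: "(\<integral>\<^sup>+t. ennreal ((cmod ((X n - l) t))\<^sup>2) \<partial>circ) \<le> ennreal (((1/2)^k)\<^sup>2)" if n: "N k \<le> n" for n k
  proof -
    have "AE t in circ. ennreal ((cmod ((X n - l) t))\<^sup>2) = liminf (\<lambda>j. ennreal ((cmod ((X n - Y j) t))\<^sup>2))"
      using conv
    proof eventually_elim
      case (elim t)
      have "(\<lambda>j. ennreal ((cmod (X n t - Y j t))\<^sup>2)) \<longlonglongrightarrow> ennreal ((cmod (X n t - l t))\<^sup>2)"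
        using elim by (intro tendsto_intros) (simp add: l_def)
      then show ?case using lim_imp_Liminf[OF sequentially_bot] by fastforce
    qed
    then have "(\<integral>\<^sup>+t. ennreal ((cmod ((X n - l) t))\<^sup>2) \<partial>circ)
      = (\<integral>\<^sup>+t. liminf (\<lambda>j. ennreal ((cmod ((X n - Y j) t))\<^sup>2)) \<partial>circ)"
      by (rule nn_integral_cong_AE)
    also have "\<dots> \<le> liminf (\<lambda>j. (\<integral>\<^sup>+t. ennreal ((cmod ((X n - Y j) t))\<^sup>2) \<partial>circ))"
      by (rule nn_integral_liminf) simp
    also have "\<dots> \<le> ennreal (((1/2)^k)\<^sup>2)"
    proof (rule Liminf_le)
      show "\<forall>\<^sub>F j in sequentially. (\<integral>\<^sup>+t. ennreal ((cmod ((X n - Y j) t))\<^sup>2) \<partial>circ) \<le> ennreal (((1/2)^k)\<^sup>2)"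
        using eventually_ge_at_top[of k]
      proof eventually_elim
        case (elim j)
        have c: "circle_L2 (X n - Y j)" by (rule circle_L2_diff[OF X Y])
        have "l2ip (X n - Y j) (X n - Y j) = (l2 (X n - Y j))\<^sup>2" using L2.nonneg c by simp
        also have "\<dots> \<le> ((1/2)^k)\<^sup>2" using XY[OF n elim] by (intro power_mono) (auto simp: l2ip_self)
        finally show ?case by (subst nn_integral_l2[OF c]) (rule ennreal_leI)
      qed
    qed simp
    finally show ?thesis .
  qed
  have XL: "circle_L2 (X n - l)" if "N k \<le> n" for n k
    unfolding circle_L2_iff
  proof (intro conjI allI)
    show "integrable circ (\<lambda>t. (cmod ((X n - l) t))\<^sup>2)"
    proof (rule integrableI_bounded)
      have "(\<integral>\<^sup>+t. ennreal ((cmod ((X n - l) t))\<^sup>2) \<partial>circ) < \<infinity>"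
        using F[OF that] by (rule order.strict_trans1) simp
      then show "(\<integral>\<^sup>+t. ennreal (norm ((cmod ((X n - l) t))\<^sup>2)) \<partial>circ) < \<infinity>" by simp
    qed simp
    show "X n - l \<in> borel_measurable borel" unfolding fun_diff_def by measurable
  qed (use X lper in \<open>auto simp: circle_L2_iff\<close>)
  \<comment> \<open>l is the difference of X n and X n - l for n = N 0.\<close>
  have lL: "circle_L2 l" using circle_L2_diff[OF X XL[of 0 "N 0"], of "N 0"] by simp
  show ?thesis
  proof (rule that[OF lL], rule LIMSEQ_I)
    fix e :: real assume "0 < e"
    then obtain k where k: "(1/2)^k < e" using real_arch_pow_inv[of e "1/2"] by auto
    have "norm (l2 (X n - l) - 0) < e" if "N k \<le> n" for n
    proof -
      have "ennreal (l2ip (X n - l) (X n - l)) \<le> ennreal (((1/2)^k)\<^sup>2)"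
        using F[OF that] nn_integral_l2[OF XL[OF that]] by simp
      then have "l2ip (X n - l) (X n - l) \<le> ((1/2)^k)\<^sup>2" by (simp add: ennreal_le_iff)
      then have "l2 (X n - l) \<le> (1/2)^k" by (simp add: real_le_lsqrt)
      then show ?thesis using k L2.nonneg[of "X n - l"] XL[OF that] by simp
    qed
    then show "\<exists>no. \<forall>n\<ge>no. norm (l2 (X n - l) - 0) < e" by blast
  qed
qed

subsection \<open>Density of smooth functions\<close>

text \<open>The whole chain of derivatives is carried as one witness, so closure properties are
  proved by exhibiting the new chain.\<close>

definition smooth_loop :: "(real \<Rightarrow> complex) \<Rightarrow> bool"
  where "smooth_loop f \<longleftrightarrow> (\<exists>F::nat \<Rightarrow> real \<Rightarrow> complex. F 0 = f \<and>
     (\<forall>j t. F j (t + 1) = F j t \<and> (F j has_vector_derivative F (Suc j) t) (at t)))"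

lemma smooth_loopI:
  assumes "\<And>t. f (t + 1) = f t" "\<And>t. (f has_vector_derivative g t) (at t)" "smooth_loop g"
  shows "smooth_loop f"
proof -
  obtain F where F: "F 0 = g" "\<And>j t. F j (t + 1) = F j t" "\<And>j t. (F j has_vector_derivative F (Suc j) t) (at t)"
    using assms(3) unfolding smooth_loop_def by blast
  show ?thesis unfolding smooth_loop_def
    by (rule exI[of _ "case_nat f F"]) (use F assms in \<open>auto split: nat.split\<close>)
qed

lemma smooth_loopE:
  assumes "smooth_loop f"
  obtains g where "\<And>t. (f has_vector_derivative g t) (at t)" "smooth_loop g"
proof -
  obtain F where F: "F 0 = f" "\<And>j t. F j (t + 1) = F j t" "\<And>j t. (F j has_vector_derivative F (Suc j) t) (at t)"
    using assms(1) unfolding smooth_loop_def by blast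
  have "smooth_loop (F (Suc 0))" unfolding smooth_loop_def
    by (rule exI[of _ "\<lambda>j. F (Suc j)"]) (use F in auto)
  then show ?thesis using F(1) F(3)[of 0] by (intro that) auto
qed

lemma smooth_loop_periodic: "smooth_loop f \<Longrightarrow> f (t + 1) = f t"
  unfolding smooth_loop_def by blast

lemma smooth_loop_continuous: "smooth_loop f \<Longrightarrow> continuous_on S f"
  by (metis smooth_loopE continuous_at_imp_continuous_on has_vector_derivative_continuous)

lemma smooth_loop_L2: "smooth_loop f \<Longrightarrow> circle_L2 f"
  by (intro circle_L2_continuous smooth_loop_continuous smooth_loop_periodic)

lemma smooth_loop_lincomb:
  assumes "smooth_loop f" "smooth_loop g" shows "smooth_loop (\<lambda>t. a * f t + b * g t)"
proof -
  obtain F where F: "F 0 = f" "\<And>j t. F j (t + 1) = F j t" "\<And>j t. (F j has_vector_derivative F (Suc j) t) (at t)"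
    using assms(1) unfolding smooth_loop_def by blast
  obtain G where G: "G 0 = g" "\<And>j t. G j (t + 1) = G j t" "\<And>j t. (G j has_vector_derivative G (Suc j) t) (at t)"
    using assms(2) unfolding smooth_loop_def by blast
  show ?thesis unfolding smooth_loop_def
    by (rule exI[of _ "\<lambda>j t. a * F j t + b * G j t"]) (auto simp: F G intro!: derivative_eq_intros)
qed

lemma smooth_loop_const: "smooth_loop (\<lambda>t. c)"
  unfolding smooth_loop_def by (rule exI[of _ "\<lambda>j t. if j = 0 then c else 0"]) auto

section \<open>Trigonometric polynomials\<close>

abbreviation ucirc :: "real \<Rightarrow> complex" where "ucirc t \<equiv> cis (2 * pi * t)"

lemma ucirc_add1: "ucirc (t + 1) = ucirc t"
  by (simp add: distrib_left flip: cis_mult)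

lemma ucirc_deriv: "(ucirc has_vector_derivative (2 * pi * \<i>) * ucirc t) (at t)"
proof -
  have "((\<lambda>t. exp (of_real t * (2 * pi * \<i>))) has_vector_derivative (2 * pi * \<i>) * exp (of_real t * (2 * pi * \<i>))) (at t)"
    by (rule has_vector_derivative_eq_rhs)
       (rule has_vector_derivative_real_field | auto intro!: derivative_eq_intros)+
  then show ?thesis by (simp add: cis_conv_exp mult_ac)
qed

text \<open>Restricted to the unit circle, real polynomials of the plane are trigonometric
  polynomials. Along \<open>ucirc\<close> the velocity is the rotated and scaled position, so the
  derivative of a linear form is again a linear form.\<close>

lemma real_polynomial_function_ucirc_deriv:
  assumes "real_polynomial_function p"
  shows "\<exists>q. real_polynomial_function q \<and> (\<forall>t. ((\<lambda>t. p (ucirc t)) has_real_derivative q (ucirc t)) (at t))"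
  using assms
proof induction
  case (linear f)
  show ?case
  proof (intro exI conjI allI)
    show "real_polynomial_function (\<lambda>w. f ((2 * pi * \<i>) * w))"
      by (intro real_polynomial_function.intros(1) bounded_linear_compose[OF linear] bounded_linear_mult_right)
    show "((\<lambda>t. f (ucirc t)) has_real_derivative f ((2 * pi * \<i>) * ucirc t)) (at t)" for t
      using bounded_linear.has_vector_derivative[OF linear ucirc_deriv, of t]
      by (simp add: has_real_derivative_iff_has_vector_derivative)
  qed
next
  case (const c)
  show ?case by (rule exI[of _ "\<lambda>x. 0"]) auto
next
  case (add f g)
  then obtain f' g' where "real_polynomial_function f'" "real_polynomial_function g'"
    "\<And>t. ((\<lambda>t. f (ucirc t)) has_real_derivative f' (ucirc t)) (at t)"
    "\<And>t. ((\<lambda>t. g (ucirc t)) has_real_derivative g' (ucirc t)) (at t)" by blast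
  then show ?case by (intro exI[of _ "\<lambda>x. f' x + g' x"]) (auto intro!: derivative_eq_intros)
next
  case (mult f g)
  then obtain f' g' where "real_polynomial_function f'" "real_polynomial_function g'"
    "\<And>t. ((\<lambda>t. f (ucirc t)) has_real_derivative f' (ucirc t)) (at t)"
    "\<And>t. ((\<lambda>t. g (ucirc t)) has_real_derivative g' (ucirc t)) (at t)" by blast
  then show ?case using mult.hyps by (intro exI[of _ "\<lambda>x. f' x * g x + g' x * f x"]) (auto intro!: derivative_eq_intros)
qed

lemma smooth_loop_polynomial:
  assumes "real_polynomial_function p" shows "smooth_loop (\<lambda>t. of_real (p (ucirc t)))"
proof -
  obtain D where D: "\<And>p. real_polynomial_function p \<Longrightarrow> real_polynomial_function (D p)"
    "\<And>p t. real_polynomial_function p \<Longrightarrow> ((\<lambda>t. p (ucirc t)) has_real_derivative D p (ucirc t)) (at t)"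
    using real_polynomial_function_ucirc_deriv by metis
  have p: "real_polynomial_function ((D ^^ j) p)" for j
    by (induction j) (use assms D in auto)
  show ?thesis unfolding smooth_loop_def
  proof (intro exI[of _ "\<lambda>j t. of_real ((D ^^ j) p (ucirc t))"] conjI allI)
    show "((\<lambda>t. complex_of_real ((D ^^ j) p (ucirc t))) has_vector_derivative complex_of_real ((D ^^ Suc j) p (ucirc t))) (at t)" for j t
      using D(2)[OF p, of j t] bounded_linear.has_vector_derivative[OF bounded_linear_of_real]
      by (auto simp: has_real_derivative_iff_has_vector_derivative)
  qed (simp_all add: ucirc_add1)
qed

section \<open>Density of trigonometric polynomials among the square-integrable real loops\<close>

definition loop_of :: "(complex \<Rightarrow> real) \<Rightarrow> real \<Rightarrow> complex"
  where "loop_of u t = of_real (u (ucirc t))"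

lemma borel_ucirc [measurable]: "ucirc \<in> borel_measurable borel"
  by (intro borel_measurable_continuous_onI continuous_intros)

lemma circle_L2_loop_of:
  "u \<in> borel_measurable borel \<Longrightarrow> circle_L2 (loop_of u) \<longleftrightarrow> integrable circ (\<lambda>t. (u (ucirc t))\<^sup>2)"
proof -
  assume [measurable]: "u \<in> borel_measurable borel"
  have "loop_of u \<in> borel_measurable borel" unfolding loop_of_def[abs_def] by measurable
  then show ?thesis by (simp add: circle_L2_iff loop_of_def ucirc_add1)
qed

text \<open>Real loops are viewed as functions of the plane evaluated along \<open>ucirc\<close>,
  where the Stone-Weierstrass theorem and inner regularity can be applied. Square integrability is a
  premise inside the predicate, so that the induction over Borel functions may pass through
  functions outside L^2.\<close>

definition poly_approx :: "(complex \<Rightarrow> real) \<Rightarrow> bool"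
  where "poly_approx u \<longleftrightarrow> (circle_L2 (loop_of u) \<longrightarrow>
     (\<forall>e>0. \<exists>p. real_polynomial_function p \<and> l2 (loop_of u - loop_of p) < e))"

lemma L2_loop_poly: "real_polynomial_function p \<Longrightarrow> circle_L2 (loop_of p)"
  using smooth_loop_L2[OF smooth_loop_polynomial] by (simp add: loop_of_def [abs_def])

lemma poly_approx_limit:
  assumes u: "circle_L2 (loop_of u)"
    and v: "\<And>n. poly_approx (v n)" "\<And>n. circle_L2 (loop_of (v n))"
    and lim: "(\<lambda>n. l2 (loop_of u - loop_of (v n))) \<longlonglongrightarrow> 0"
  shows "poly_approx u"
  unfolding poly_approx_def
proof (intro impI allI)
  fix e :: real assume e: "0 < e"
  then obtain n where n: "l2 (loop_of u - loop_of (v n)) < e / 2"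
    using order_tendstoD(2)[OF lim, of "e/2"] by (auto simp: eventually_sequentially)
  obtain p where p: "real_polynomial_function p" "l2 (loop_of (v n) - loop_of p) < e / 2"
    using v e unfolding poly_approx_def by (meson half_gt_zero)
  have "l2 (loop_of u - loop_of p) < e"
    using L2.triangle3[of "loop_of u" "loop_of (v n)" "loop_of p"] u v(2) L2_loop_poly[OF p(1)] n p(2) by simp
  with p(1) show "\<exists>p. real_polynomial_function p \<and> l2 (loop_of u - loop_of p) < e" by blast
qed

lemma poly_approx_dominated:
  assumes u: "circle_L2 (loop_of u)" "u \<in> borel_measurable borel"
    and v: "\<And>n. poly_approx (v n)" "\<And>n. v n \<in> borel_measurable borel" 
    and b: "circle_L2 (loop_of b)" "b \<in> borel_measurable borel" "\<And>n w. \<bar>v n w\<bar> \<le> b w"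
    and lim: "\<And>t. (\<lambda>n. v n (ucirc t)) \<longlonglongrightarrow> u (ucirc t)"
  shows "poly_approx u"
proof (rule poly_approx_limit[OF u(1) v(1)])
  have [measurable]: "u \<in> borel_measurable borel" "b \<in> borel_measurable borel" "\<And>n. v n \<in> borel_measurable borel" using u b v by auto
  have bI: "integrable circ (\<lambda>t. (b (ucirc t))\<^sup>2)" using b circle_L2_loop_of by blast
  show vL: "circle_L2 (loop_of (v n))" for n
    unfolding circle_L2_loop_of[OF v(2)]
  proof (rule Bochner_Integration.integrable_bound[OF bI])
    have "(\<lambda>t. (v n (ucirc t))\<^sup>2) \<in> borel_measurable borel" by measurable
    then show "(\<lambda>t. (v n (ucirc t))\<^sup>2) \<in> borel_measurable circ" by (rule borel_circ)
    show "AE x in circ. norm ((v n (ucirc x))\<^sup>2) \<le> norm ((b (ucirc x))\<^sup>2)"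
      using b(3)[of n] by (intro AE_I2) (simp add: abs_le_square_iff[symmetric] order.trans[OF _ abs_ge_self])
  qed
  have ub: "\<bar>u (ucirc t)\<bar> \<le> b (ucirc t)" for t
    by (rule LIMSEQ_le_const2[OF tendsto_rabs[OF lim]]) (use b(3) in auto)
  have "(\<lambda>n. \<integral>t. (u (ucirc t) - v n (ucirc t))\<^sup>2 \<partial>circ) \<longlonglongrightarrow> (\<integral>t. 0 \<partial>circ)"
  \<comment> \<open>The limit inherits the bound b, so the difference is at most 2 b; the 4 comes
    from squaring.\<close>
  proof (rule integral_dominated_convergence[where w="\<lambda>t. 4 * (b (ucirc t))\<^sup>2"])
    have "(\<lambda>t. (u (ucirc t) - v n (ucirc t))\<^sup>2) \<in> borel_measurable borel" for n by measurable
    then show "(\<lambda>t. (u (ucirc t) - v n (ucirc t))\<^sup>2) \<in> borel_measurable circ" for n by (rule borel_circ)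
    show "AE t in circ. norm ((u (ucirc t) - v n (ucirc t))\<^sup>2) \<le> 4 * (b (ucirc t))\<^sup>2" for n
    proof (rule AE_I2)
      fix t
      have "\<bar>u (ucirc t) - v n (ucirc t)\<bar> \<le> 2 * b (ucirc t)"
        using ub[of t] b(3)[of n "ucirc t"] by linarith
      then have "\<bar>u (ucirc t) - v n (ucirc t)\<bar>\<^sup>2 \<le> (2 * b (ucirc t))\<^sup>2" by (intro power_mono) auto
      then show "norm ((u (ucirc t) - v n (ucirc t))\<^sup>2) \<le> 4 * (b (ucirc t))\<^sup>2" by (simp add: power_mult_distrib)
    qed
    show "AE t in circ. (\<lambda>n. (u (ucirc t) - v n (ucirc t))\<^sup>2) \<longlonglongrightarrow> 0"
    proof (rule AE_I2)
      fix t show "(\<lambda>n. (u (ucirc t) - v n (ucirc t))\<^sup>2) \<longlonglongrightarrow> 0"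
        using tendsto_power[OF tendsto_diff[OF tendsto_const lim], of "u (ucirc t)" t 2] by simp
    qed
  qed (use bI in auto)
  moreover have "l2ip (loop_of u - loop_of (v n)) (loop_of u - loop_of (v n)) = (\<integral>t. (u (ucirc t) - v n (ucirc t))\<^sup>2 \<partial>circ)" for n
    unfolding l2ip_self loop_of_def by (simp flip: of_real_diff)
  ultimately show "(\<lambda>n. l2 (loop_of u - loop_of (v n))) \<longlonglongrightarrow> 0"
    using tendsto_real_sqrt[of _ 0] by simp
qed

lemma circle_L2_loop_bounded:
  assumes "u \<in> borel_measurable borel" "\<And>w. \<bar>u w\<bar> \<le> M" shows "circle_L2 (loop_of u)"
proof -
  have "circle_L2 (\<lambda>t. loop_of u t * 1)"
  proof (rule circle_L2_mult[where M=M])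
    show "circle_L2 (\<lambda>t. 1)" by (rule circle_L2_continuous) auto
  qed (use assms in \<open>auto simp: loop_of_def ucirc_add1\<close>)
  then show ?thesis by simp
qed

text \<open>Stone-Weierstrass on the unit circle as a compact subset of the plane; uniform closeness
  there bounds the L^2 distance.\<close>

lemma poly_approx_continuous: assumes "continuous_on UNIV u" shows "poly_approx u"
  unfolding poly_approx_def
proof (intro impI allI)
  fix e :: real assume u: "circle_L2 (loop_of u)" and e: "0 < e"
  have c: "continuous_on (sphere 0 1) u" using assms continuous_on_subset by blast
  obtain p where p: "real_polynomial_function p" "\<And>x. x \<in> sphere 0 1 \<Longrightarrow> \<bar>u x - p x\<bar> < e / 2"
    using Stone_Weierstrass_real_polynomial_function[OF compact_sphere c half_gt_zero[OF e]] by blast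
  have "l2 (loop_of u - loop_of p) \<le> e / 2"
  proof (rule l2_bound)
    show "circle_L2 (loop_of u - loop_of p)" by (rule circle_L2_diff[OF u L2_loop_poly[OF p(1)]])
    show "cmod ((loop_of u - loop_of p) t) \<le> e / 2" for t
      using p(2)[of "ucirc t"] by (simp add: loop_of_def less_imp_le flip: of_real_diff)
  qed (use e in auto)
  then show "\<exists>p. real_polynomial_function p \<and> l2 (loop_of u - loop_of p) < e"
    using p(1) e by (intro exI[of _ p]) auto
qed

text \<open>The continuous functions max(0, 1 - n dist(w, K)) decrease to the indicator. The empty
  set is excluded since \<open>infdist\<close> to it is 0 by convention.\<close>

lemma poly_approx_closed: assumes K: "closed K" "K \<noteq> {}" shows "poly_approx (indicator K)"
proof (rule poly_approx_dominated[where b="\<lambda>_. 1" and v="\<lambda>n w. max 0 (1 - real n * infdist w K)"])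
  have cont: "continuous_on UNIV (\<lambda>w. max 0 (1 - real n * infdist w K))" for n
    by (intro continuous_intros)
  show "poly_approx (\<lambda>w. max 0 (1 - real n * infdist w K))" for n
    by (rule poly_approx_continuous[OF cont])
  show "(\<lambda>w. max 0 (1 - real n * infdist w K)) \<in> borel_measurable borel" for n
    by (rule borel_measurable_continuous_onI[OF cont])
  have "(\<lambda>n. max 0 (1 - real n * infdist w K)) \<longlonglongrightarrow> indicator K w" for w
  proof (cases "w \<in> K")
    case False
    then have "infdist w K > 0" using K in_closed_iff_infdist_zero[of K w] infdist_nonneg[of w K] by force
    then obtain N :: nat where "1 < real N * infdist w K" using reals_Archimedean3 by blast
    then have "1 - real n * infdist w K \<le> 0" if "N \<le> n" for n
      using that infdist_nonneg[of w K] mult_right_mono[of "real N" "real n" "infdist w K"] by simp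
    then have "\<forall>\<^sub>F n in sequentially. max 0 (1 - real n * infdist w K) = 0"
      by (auto simp: eventually_sequentially intro!: exI[of _ N] max_absorb1)
    then show ?thesis using False by (simp add: tendsto_eventually)
  qed simp
  then show "(\<lambda>n. max 0 (1 - real n * infdist (ucirc t) K)) \<longlonglongrightarrow> indicator K (ucirc t)" for t .
qed (use K in \<open>auto intro!: circle_L2_loop_bounded[where M=1] simp: indicator_def infdist_nonneg\<close>)

text \<open>Inner regularity of the image measure \<nu> of \<open>circ\<close> under
  \<open>ucirc\<close>: compact subsets exhaust B in measure, and for nested sets the squared L^2
  distance of the indicators is the measure of the difference.\<close>

lemma poly_approx_indicator: assumes B: "B \<in> sets borel" shows "poly_approx (indicator B)"
proof -
  define \<nu> where "\<nu> = distr circ borel ucirc"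
  have uc: "ucirc \<in> measurable circ borel" by (intro borel_circ borel_ucirc)
  interpret \<nu>: finite_measure \<nu> unfolding \<nu>_def by (intro circ.finite_measure_distr uc)
  have ind: "circle_L2 (loop_of (indicator A))" if "A \<in> sets borel" for A
    by (rule circle_L2_loop_bounded[where M=1]) (use that in \<open>auto simp: indicator_def\<close>)
  have "\<exists>K. K \<subseteq> B \<and> compact K \<and> measure \<nu> B - measure \<nu> K < e" if "e > 0" for e
  proof (rule ccontr)
    assume "\<nexists>K. K \<subseteq> B \<and> compact K \<and> measure \<nu> B - measure \<nu> K < e"
    then have *: "measure \<nu> K \<le> measure \<nu> B - e" if "K \<subseteq> B" "compact K" for K using that by force
    from *[of "{}"] have "e \<le> measure \<nu> B" by simp
    have "emeasure \<nu> B = (SUP K \<in> {K. K \<subseteq> B \<and> compact K}. emeasure \<nu> K)"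
      by (rule inner_regular[OF _ _ B]) (auto simp: \<nu>_def intro!: \<nu>.emeasure_finite[unfolded \<nu>_def])
    also have "\<dots> \<le> ennreal (measure \<nu> B - e)"
      by (rule SUP_least) (use * in \<open>auto simp: \<nu>.emeasure_eq_measure intro!: ennreal_leI\<close>)
    finally have "measure \<nu> B \<le> measure \<nu> B - e"
      using \<open>e \<le> measure \<nu> B\<close> by (simp add: \<nu>.emeasure_eq_measure)
    then show False using that by simp
  qed
  then have "\<exists>K. K \<subseteq> B \<and> compact K \<and> measure \<nu> B - measure \<nu> K < 1 / real (Suc n)" for n by simp
  then obtain K where K: "\<And>n. K n \<subseteq> B" "\<And>n. compact (K n)" "\<And>n. measure \<nu> B - measure \<nu> (K n) < 1 / real (Suc n)"
    by metis
  have Kb: "K n \<in> sets borel" for n using K(2) by (simp add: borel_compact)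
  have l: "l2ip (loop_of (indicator B) - loop_of (indicator (K n))) (loop_of (indicator B) - loop_of (indicator (K n)))
      = measure \<nu> B - measure \<nu> (K n)" for n
  proof -
    have "l2ip (loop_of (indicator B) - loop_of (indicator (K n))) (loop_of (indicator B) - loop_of (indicator (K n)))
      = (\<integral>t. indicator (B - K n) (ucirc t) \<partial>circ)" unfolding l2ip_self
      by (rule Bochner_Integration.integral_cong) (use K(1)[of n] in \<open>auto simp: loop_of_def indicator_def\<close>)
    also have "\<dots> = (\<integral>w. indicator (B - K n) w \<partial>\<nu>)" unfolding \<nu>_def
      by (rule integral_distr[symmetric, OF uc]) (use B Kb in auto)
    also have "\<dots> = measure \<nu> (B - K n)" by (simp add: \<nu>_def)
    also have "\<dots> = measure \<nu> B - measure \<nu> (K n)"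
      by (rule \<nu>.finite_measure_Diff) (use B Kb K in \<open>auto simp: \<nu>_def\<close>)
    finally show ?thesis .
  qed
  show ?thesis
  proof (rule poly_approx_limit[where v="\<lambda>n. indicator (K n)"])
    have 0: "poly_approx (indicator {})"
      by (simp add: poly_approx_continuous)
    show "poly_approx (indicator (K n))" for n
      by (cases "K n = {}") (use 0 poly_approx_closed[of "K n"] K(2) in \<open>auto simp: compact_imp_closed\<close>)
    have "(\<lambda>n. measure \<nu> B - measure \<nu> (K n)) \<longlonglongrightarrow> 0"
    proof (rule tendsto_sandwich[OF always_eventually always_eventually tendsto_const])
      show "(\<lambda>n. 1 / real (Suc n)) \<longlonglongrightarrow> 0" using LIMSEQ_inverse_real_of_nat by (simp add: inverse_eq_divide)
      show "\<forall>n. 0 \<le> measure \<nu> B - measure \<nu> (K n)"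
        using \<nu>.finite_measure_mono[of "K n" B for n] K(1) B by (auto simp: \<nu>_def)
      show "\<forall>n. measure \<nu> B - measure \<nu> (K n) \<le> 1 / real (Suc n)" using K(3) by (auto intro: less_imp_le)
    qed
    then show "(\<lambda>n. l2 (loop_of (indicator B) - loop_of (indicator (K n)))) \<longlonglongrightarrow> 0"
      unfolding l using tendsto_real_sqrt[of _ 0] by simp
  qed (use ind B Kb in auto)
qed

lemma loop_of_L2_mono:
  assumes "circle_L2 (loop_of u)" "u \<in> borel_measurable borel" "v \<in> borel_measurable borel" "\<And>w. \<bar>v w\<bar> \<le> \<bar>u w\<bar>"
  shows "circle_L2 (loop_of v)"
  unfolding circle_L2_loop_of[OF assms(3)]
proof (rule Bochner_Integration.integrable_bound)
  show "integrable circ (\<lambda>t. (u (ucirc t))\<^sup>2)" using assms circle_L2_loop_of by blast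
  note [measurable] = assms(3)
  have "(\<lambda>t. (v (ucirc t))\<^sup>2) \<in> borel_measurable borel" by measurable
  then show "(\<lambda>t. (v (ucirc t))\<^sup>2) \<in> borel_measurable circ" by (rule borel_circ)
  show "AE x in circ. norm ((v (ucirc x))\<^sup>2) \<le> norm ((u (ucirc x))\<^sup>2)"
    using assms(4) by (intro AE_I2) (simp add: abs_le_square_iff[symmetric])
qed

text \<open>Induction over nonnegative Borel functions. An increasing sequence is dominated by its
  own limit, and summands of an L^2 sum are in L^2 because everything is nonnegative.\<close>

lemma poly_approx_nonneg:
  assumes "u \<in> borel_measurable borel" "\<And>w. 0 \<le> u w" shows "poly_approx u"
  using assms
proof (induction rule: borel_measurable_induct_real)
  case (set A)
  then show ?case by (rule poly_approx_indicator)
next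
  case (mult u c)
  show ?case
  proof (cases "c = 0")
    case True
    then show ?thesis using poly_approx_continuous[of "\<lambda>_. 0"] by simp
  next
    case False
    show ?thesis unfolding poly_approx_def
    proof (intro allI impI)
      fix e :: real assume cu: "circle_L2 (loop_of (\<lambda>w. c * u w))" and e: "0 < e"
      have "loop_of u = (\<lambda>t. of_real (1 / c) * loop_of (\<lambda>w. c * u w) t)" using False by (auto simp: loop_of_def)
      then have u: "circle_L2 (loop_of u)" using circle_L2_cmult[OF cu, of "of_real (1 / c)"] by simp
      obtain p where p: "real_polynomial_function p" "l2 (loop_of u - loop_of p) < e / c"
        using mult u e False unfolding poly_approx_def by (metis divide_pos_pos order_less_le)
      have "loop_of (\<lambda>w. c * u w) - loop_of (\<lambda>w. c * p w) = c *\<^sub>R (loop_of u - loop_of p)"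
        by (auto simp: loop_of_def scaleR_conv_of_real algebra_simps)
      then have "l2 (loop_of (\<lambda>w. c * u w) - loop_of (\<lambda>w. c * p w)) = c * l2 (loop_of u - loop_of p)"
        using L2.N_scale[of "loop_of u - loop_of p" c] circle_L2_diff[OF u L2_loop_poly[OF p(1)]] mult by simp
      also have "\<dots> < e" using p(2) mult False by (simp add: field_simps)
      finally show "\<exists>p. real_polynomial_function p \<and> l2 (loop_of (\<lambda>w. c * u w) - loop_of p) < e"
        using p(1) by (intro exI[of _ "\<lambda>w. c * p w"]) auto
    qed
  qed
next
  case (add u v)
  show ?case unfolding poly_approx_def
  proof (intro allI impI)
    fix e :: real assume uv: "circle_L2 (loop_of (\<lambda>w. v w + u w))" and e: "0 < e"
    have u: "circle_L2 (loop_of u)" and v: "circle_L2 (loop_of v)"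
      using loop_of_L2_mono[OF uv] add by force+
    obtain p q where p: "real_polynomial_function p" "l2 (loop_of u - loop_of p) < e / 2"
      and q: "real_polynomial_function q" "l2 (loop_of v - loop_of q) < e / 2"
      using add u v e unfolding poly_approx_def by (meson half_gt_zero)
    have "loop_of (\<lambda>w. v w + u w) - loop_of (\<lambda>w. q w + p w) = (loop_of v - loop_of q) + (loop_of u - loop_of p)"
      by (auto simp: loop_of_def)
    then have "l2 (loop_of (\<lambda>w. v w + u w) - loop_of (\<lambda>w. q w + p w)) < e"
      using L2.triangle[of "loop_of v - loop_of q" "loop_of u - loop_of p"] circle_L2_diff u v L2_loop_poly p q by simp
    then show "\<exists>p. real_polynomial_function p \<and> l2 (loop_of (\<lambda>w. v w + u w) - loop_of p) < e"
      using p(1) q(1) by (intro exI[of _ "\<lambda>w. q w + p w"]) auto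
  qed
next
  case (seq U)
  have le: "U n w \<le> u w" for n w
    by (rule incseq_le[OF _ seq.hyps(4)]) (use seq.hyps(3) in \<open>auto simp: incseq_def le_fun_def\<close>)
  show ?case
  proof (cases "circle_L2 (loop_of u)")
    case True
    show ?thesis
      by (rule poly_approx_dominated[OF True assms(1) _ _ True assms(1), where v=U])
        (use seq le in auto)
  qed (simp add: poly_approx_def)
qed

lemma poly_approx_borel: assumes u: "u \<in> borel_measurable borel" shows "poly_approx u"
  unfolding poly_approx_def
proof (intro allI impI)
  fix e :: real assume U: "circle_L2 (loop_of u)" and e: "0 < e"
  let ?p = "\<lambda>w. max 0 (u w)" let ?n = "\<lambda>w. max 0 (- u w)"
  have m: "?p \<in> borel_measurable borel" "?n \<in> borel_measurable borel" using u by measurable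
  have P: "circle_L2 (loop_of ?p)" "circle_L2 (loop_of ?n)"
    by (rule loop_of_L2_mono[OF U u]; use m in force)+
  obtain p q where p: "real_polynomial_function p" "l2 (loop_of ?p - loop_of p) < e / 2"
    and q: "real_polynomial_function q" "l2 (loop_of ?n - loop_of q) < e / 2"
    using poly_approx_nonneg[OF m(1)] poly_approx_nonneg[OF m(2)] P e unfolding poly_approx_def
    by (meson half_gt_zero max.cobounded1)
  have "loop_of u - loop_of (\<lambda>w. p w - q w) = (loop_of ?p - loop_of p) - (loop_of ?n - loop_of q)"
    by (auto simp: loop_of_def max_def)
  then have "l2 (loop_of u - loop_of (\<lambda>w. p w - q w)) < e"
    using L2.triangle_diff[of "loop_of ?p - loop_of p" "loop_of ?n - loop_of q"] circle_L2_diff P L2_loop_poly p q by simp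
  then show "\<exists>p. real_polynomial_function p \<and> l2 (loop_of u - loop_of p) < e"
    using p(1) q(1) by (intro exI[of _ "\<lambda>w. p w - q w"]) auto
qed

text \<open>The angle is continuous off the nonnegative real axis, and on this closed set it is
  0.\<close>

lemma borel_measurable_Arg2pi: "Arg2pi \<in> borel_measurable borel"
proof -
  have "(\<lambda>z. if z \<in> \<real>\<^sub>\<ge>\<^sub>0 then 0 else Arg2pi z) \<in> borel_measurable borel"
    by (rule borel_measurable_continuous_on_if)
      (auto intro!: continuous_at_imp_continuous_on continuous_at_Arg2pi)
  also have "(\<lambda>z. if z \<in> \<real>\<^sub>\<ge>\<^sub>0 then 0 else Arg2pi z) = Arg2pi"
    by (auto simp: fun_eq_iff complex_nonneg_Reals_iff Arg2pi_eq_0 complex_is_Real_iff)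
  finally show ?thesis .
qed

text \<open>The angle of \<open>ucirc t\<close> is 2 * pi * frac t, so t is recovered modulo 1 and a
  periodic function factors through the circle.\<close>

lemma loop_of_surj:
  assumes "f \<in> borel_measurable borel" "\<And>t. f (t + 1) = f t"
  obtains u where "u \<in> borel_measurable borel" "loop_of u = (\<lambda>t. complex_of_real (f t))"
proof
  let ?u = "\<lambda>w. f (Arg2pi w / (2 * pi))"
  note [measurable] = assms(1) borel_measurable_Arg2pi
  show "?u \<in> borel_measurable borel" by measurable
  have per: "f (t + of_int n) = f t" for t n
  proof -
    have *: "f (t + of_nat n) = f t" for t n
      by (induction n) (auto simp: assms(2) add.assoc[symmetric] add.commute[of 1])
    show ?thesis
    proof (cases "n \<ge> 0")
      case True then show ?thesis using *[of t "nat n"] by simp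
    next
      case False then show ?thesis using *[of "t + of_int n" "nat (- n)"] by simp
    qed
  qed
  show "loop_of ?u = (\<lambda>t. complex_of_real (f t))"
  proof
    fix t
    have "ucirc t = ucirc (frac t + of_int \<lfloor>t\<rfloor>)" by (simp add: frac_def)
    also have "\<dots> = cis (2 * pi * frac t)" by (simp add: distrib_left flip: cis_mult)
    also have "\<dots> = exp (\<i> * of_real (2 * pi * frac t))" by (simp add: cis_conv_exp)
    finally have "Arg2pi (ucirc t) = 2 * pi * frac t"
      using Arg2pi_unique[of 1 "2 * pi * frac t" "ucirc t"] frac_ge_0[of t] frac_lt_1[of t] by simp
    then have "?u (ucirc t) = f (frac t)" by simp
    also have "\<dots> = f t" using per[of "frac t" "\<lfloor>t\<rfloor>"] by (simp add: frac_def)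
    finally show "loop_of ?u t = complex_of_real (f t)" by (simp add: loop_of_def)
  qed
qed

text \<open>The approximating polynomials are real-valued, so real and imaginary part are treated
  separately with half the tolerance each.\<close>

theorem smooth_loop_dense:
  assumes g: "circle_L2 g" and e: "0 < e"
  obtains p where "smooth_loop p" "l2 (p - g) < e"
proof -
  have *: "\<exists>p. smooth_loop p \<and> l2 ((\<lambda>t. complex_of_real (f t)) - p) < e / 2" if f: "circle_L2 (\<lambda>t. complex_of_real (f t))" for f
  proof -
    have "f \<in> borel_measurable borel" using measurable_compose[OF circle_L2_measurable[OF f] borel_measurable_Re] by simp
    moreover have "f (t + 1) = f t" for t using f by (simp add: circle_L2_iff)
    ultimately obtain u where u: "u \<in> borel_measurable borel" "loop_of u = (\<lambda>t. complex_of_real (f t))" by (rule loop_of_surj)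
    obtain p where "real_polynomial_function p" "l2 (loop_of u - loop_of p) < e / 2"
      using poly_approx_borel[OF u(1)] f e unfolding poly_approx_def u(2) by (meson half_gt_zero)
    then show ?thesis using smooth_loop_polynomial[of p] u(2) by (auto simp: loop_of_def[abs_def])
  qed
  have RI: "circle_L2 (\<lambda>t. complex_of_real (Re (g t)))" "circle_L2 (\<lambda>t. complex_of_real (Im (g t)))"
  proof -
    have b: "g \<in> borel_measurable borel" using g by (rule circle_L2_measurable)
    have i: "integrable circ (\<lambda>t. (cmod (g t))\<^sup>2)" using g by (simp add: circle_L2_iff)
    have le: "(Re z)\<^sup>2 \<le> (cmod z)\<^sup>2" "(Im z)\<^sup>2 \<le> (cmod z)\<^sup>2" for z by (auto simp: cmod_power2)
    have "(\<lambda>t. (Re (g t))\<^sup>2) \<in> borel_measurable borel" "(\<lambda>t. (Im (g t))\<^sup>2) \<in> borel_measurable borel" using b by measurable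
    then have "integrable circ (\<lambda>t. (Re (g t))\<^sup>2)" "integrable circ (\<lambda>t. (Im (g t))\<^sup>2)"
      by (auto intro!: Bochner_Integration.integrable_bound[OF i] borel_circ simp: le)
    then show "circle_L2 (\<lambda>t. complex_of_real (Re (g t)))" "circle_L2 (\<lambda>t. complex_of_real (Im (g t)))"
      using g by (auto simp: circle_L2_iff)
  qed
  obtain p q where p: "smooth_loop p" "l2 ((\<lambda>t. complex_of_real (Re (g t))) - p) < e / 2"
    and q: "smooth_loop q" "l2 ((\<lambda>t. complex_of_real (Im (g t))) - q) < e / 2"
    using *[OF RI(1)] *[OF RI(2)] by blast
  let ?P = "(\<lambda>t. complex_of_real (Re (g t))) - p" and ?Q = "(\<lambda>t. complex_of_real (Im (g t))) - q"
  let ?h = "\<lambda>t. p t + \<i> * q t"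
  have h: "smooth_loop ?h" using smooth_loop_lincomb[OF p(1) q(1), of 1 \<i>] by simp
  have PQ: "circle_L2 ?P" "circle_L2 ?Q" using circle_L2_diff RI p q smooth_loop_L2 by blast+
  have "g - ?h = ?P + (\<lambda>t. \<i> * ?Q t)"
    by (rule ext) (auto simp: complex_eq_iff)
  moreover have "l2 (\<lambda>t. \<i> * ?Q t) = l2 ?Q" unfolding l2ip_self by (simp add: norm_mult)
  ultimately have "l2 (g - ?h) < e"
    using L2.triangle[of ?P "\<lambda>t. \<i> * ?Q t"] PQ circle_L2_cmult[OF PQ(2), of \<i>] p q by simp
  moreover have "l2 (g - ?h) = l2 (?h - g)"
    using L2.N_minus_commute[of g ?h] g smooth_loop_L2[OF h] by simp
  ultimately show ?thesis using h that by simp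
qed

section \<open>Absolutely continuous loops\<close>

abbreviation per :: "(real \<Rightarrow> 'a) \<Rightarrow> bool" where "per f \<equiv> \<forall>t. f (t + 1) = f t"

lemma smooth_loop_per: "smooth_loop f \<Longrightarrow> per f"
  using smooth_loop_periodic by blast

lemma per_int: assumes "per f" shows "f (t + of_int n) = f t"
proof -
  have *: "f (t + of_nat n) = f t" for t n
    by (induction n) (auto simp: assms add.assoc[symmetric] add.commute[of 1])
  show ?thesis
  proof (cases "n \<ge> 0")
    case True then show ?thesis using *[of t "nat n"] by simp
  next
    case False then show ?thesis using *[of "t + of_int n" "nat (- n)"] by simp
  qed
qed

lemma per_frac: "per f \<Longrightarrow> f (frac t) = f t"
  using per_int[of f "frac t" "\<lfloor>t\<rfloor>"] by (simp add: frac_def)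

lemma frac_in_unit: "frac t \<in> {0..1}"
  using frac_ge_0[of t] frac_lt_1[of t] by simp

lemma per_eqI: assumes "per f" "per g" "\<And>t. t \<in> {0..1} \<Longrightarrow> f t = g t" shows "f = g"
proof
  fix t show "f t = g t"
    using per_frac[OF assms(1), of t] per_frac[OF assms(2), of t] assms(3)[OF frac_in_unit, of t] by simp
qed

lemma per_bounded:
  assumes "per f" "continuous_on UNIV f"
  obtains M where "0 < M" "\<And>t. norm (f t) \<le> (M::real)"
proof -
  have "compact (f ` {0..1})"
    by (rule compact_continuous_image[OF continuous_on_subset[OF assms(2)]]) auto
  then obtain M where "0 < M" "\<forall>x\<in>f ` {0..1}. norm x \<le> M" using compact_imp_bounded bounded_pos by metis
  then show ?thesis using that[of M] per_frac[OF assms(1)] frac_in_unit by (metis imageI)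
qed

definition mean :: "(real \<Rightarrow> complex) \<Rightarrow> complex" where "mean f = integral\<^sup>L circ f"

lemma mean_add: "circle_L2 f \<Longrightarrow> circle_L2 g \<Longrightarrow> mean (\<lambda>t. f t + g t) = mean f + mean g"
  and mean_diff: "circle_L2 f \<Longrightarrow> circle_L2 g \<Longrightarrow> mean (\<lambda>t. f t - g t) = mean f - mean g"
  and mean_const: "mean (\<lambda>t. c) = c"
  and mean_cmult: "mean (\<lambda>t. c * f t) = c * mean f"
  by (simp_all add: mean_def circle_L2_integrable)

lemma circle_L2_const: "circle_L2 (\<lambda>t. c)"
  by (rule circle_L2_continuous) auto

lemma cmod_mean_le: "circle_L2 f \<Longrightarrow> cmod (mean f) \<le> l2 f"
  unfolding mean_def by (rule order.trans[OF integral_norm_bound norm_integral_le_l2])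

lemma l2_const: "l2 (\<lambda>t. c) = cmod c" by (simp add: l2ip_self)

lemma integral_unit_mean: "circle_L2 f \<Longrightarrow> (f has_integral mean f) {0..1}"
  using has_integral_circle_L2[of f 0 1] by (simp add: mean_def set_integral_circ has_integral_integrable_integral)

text \<open>Membership of f in W^{1,2} with derivative g. Stated through integrals, it sees g only
  up to null sets; periodicity of f forces g to have mean zero.\<close>

definition prim :: "(real \<Rightarrow> complex) \<Rightarrow> (real \<Rightarrow> complex) \<Rightarrow> bool"
  where "prim f g \<longleftrightarrow> circle_L2 g \<and> per f \<and> (\<forall>t\<in>{0..1}. (g has_integral (f t - f 0)) {0..t})"

lemma prim_L2: "prim f g \<Longrightarrow> circle_L2 g" and prim_per: "prim f g \<Longrightarrow> per f"
  by (auto simp: prim_def)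

lemma prim_mean: assumes "prim f g" shows "mean g = 0"
proof -
  have 1: "(g has_integral (f 1 - f 0)) {0..1}" using assms by (simp add: prim_def)
  have 2: "f 1 = f 0" using assms spec[of "\<lambda>t. f (t + 1) = f t" 0] by (simp add: prim_def)
  show ?thesis using has_integral_unique[OF integral_unit_mean[OF prim_L2[OF assms]] 1] 2 by simp
qed

lemma prim_const: "prim (\<lambda>t. c) (\<lambda>t. 0)"
  by (auto simp: prim_def circle_L2_const)

lemma prim_add: assumes "prim f g" "prim f' g'" shows "prim (\<lambda>t. f t + f' t) (\<lambda>t. g t + g' t)"
  unfolding prim_def
proof (intro conjI ballI)
  fix t assume "t \<in> {0..1::real}"
  then have "((\<lambda>t. g t + g' t) has_integral ((f t - f 0) + (f' t - f' 0))) {0..t}"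
    using assms by (intro has_integral_add) (auto simp: prim_def)
  then show "((\<lambda>t. g t + g' t) has_integral (f t + f' t - (f 0 + f' 0))) {0..t}" by (simp add: algebra_simps)
qed (use assms circle_L2_add in \<open>auto simp: prim_def\<close>)

lemma prim_cmult: assumes "prim f g" shows "prim (\<lambda>t. c * f t) (\<lambda>t. c * g t)"
  unfolding prim_def
proof (intro conjI ballI)
  fix t assume "t \<in> {0..1::real}"
  then have "((\<lambda>t. c * g t) has_integral (c * (f t - f 0))) {0..t}"
    using assms by (intro has_integral_mult_right) (auto simp: prim_def)
  then show "((\<lambda>t. c * g t) has_integral (c * f t - c * f 0)) {0..t}" by (simp add: algebra_simps)
qed (use assms circle_L2_cmult in \<open>auto simp: prim_def\<close>)

lemma prim_diff: assumes "prim f g" "prim f' g'" shows "prim (\<lambda>t. f t - f' t) (\<lambda>t. g t - g' t)"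
  using prim_add[OF assms(1) prim_cmult[OF assms(2), of "-1"]] by simp

lemma prim_cnj: assumes "prim f g" shows "prim (\<lambda>t. cnj (f t)) (\<lambda>t. cnj (g t))"
  unfolding prim_def
proof (intro conjI ballI)
  have "g \<in> borel_measurable borel" using assms by (simp add: prim_def circle_L2_iff)
  then have "(\<lambda>t. cnj (g t)) \<in> borel_measurable borel" 
    by (rule measurable_compose) (intro borel_measurable_continuous_onI continuous_intros)
  then show "circle_L2 (\<lambda>t. cnj (g t))" using assms by (auto simp: prim_def circle_L2_iff)
  fix t assume "t \<in> {0..1::real}"
  then have "((cnj \<circ> g) has_integral (cnj (f t - f 0))) {0..t}"
    using assms by (intro has_integral_linear bounded_linear_cnj) (auto simp: prim_def)
  then show "((\<lambda>t. cnj (g t)) has_integral (cnj (f t) - cnj (f 0))) {0..t}" by (simp add: o_def)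
qed (use assms in \<open>auto simp: prim_def\<close>)

lemma prim_has_integral:
  assumes "prim f g" "0 \<le> s" "s \<le> t" "t \<le> 1" shows "(g has_integral (f t - f s)) {s..t}"
proof -
  have i: "(g has_integral integral {s..t} g) {s..t}"
    using has_integral_circle_L2(1)[OF prim_L2[OF assms(1)] assms(2-4)] by (rule integrable_integral)
  have "(g has_integral ((f s - f 0) + integral {s..t} g)) {0..t}"
    by (rule has_integral_combine[OF assms(2,3) _ i]) (use assms in \<open>auto simp: prim_def\<close>)
  moreover have "(g has_integral (f t - f 0)) {0..t}" using assms by (auto simp: prim_def)
  ultimately have "f s - f 0 + integral {s..t} g = f t - f 0" by (rule has_integral_unique)
  then have "integral {s..t} g = f t - f s" by (simp add: algebra_simps)
  with i show ?thesis by simp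
qed

lemma prim_Hoelder:
  assumes "prim f g" "0 \<le> s" "s \<le> t" "t \<le> 1" shows "cmod (f t - f s) \<le> sqrt (t - s) * l2 g"
  using has_integral_circle_L2(3)[OF prim_L2[OF assms(1)] assms(2-4)] integral_unique[OF prim_has_integral[OF assms]] by simp

lemma prim_diff_le:
  assumes "prim f g" shows "cmod (f t - f 0) \<le> l2 g"
proof -
  have "cmod (f (frac t) - f 0) \<le> sqrt (frac t) * l2 g"
    using prim_Hoelder[OF assms, of 0 "frac t"] frac_in_unit[of t] by simp
  also have "\<dots> \<le> 1 * l2 g"
    by (rule mult_right_mono) (use frac_in_unit[of t] in \<open>auto simp: l2ip_self\<close>)
  finally show ?thesis using per_frac[OF prim_per[OF assms]] by simp
qed

lemma prim_smooth:
  assumes "\<And>t. (f has_vector_derivative g t) (at t)" "per f" "circle_L2 g" shows "prim f g"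
  unfolding prim_def
proof (intro conjI ballI)
  show "(g has_integral (f t - f 0)) {0..t}" if "t \<in> {0..1}" for t
    by (rule fundamental_theorem_of_calculus) (use that assms(1) in \<open>auto intro: has_vector_derivative_at_within\<close>)
qed (rule assms)+

lemma prim_smooth_loop:
  assumes "smooth_loop f" obtains g where "smooth_loop g" "\<And>t. (f has_vector_derivative g t) (at t)" "prim f g"
  using smooth_loopE[OF assms] prim_smooth smooth_loop_periodic[OF assms] smooth_loop_L2 by metis

text \<open>For an antiderivative f the function f (t + 1) - f t has derivative zero; it vanishes at
  0 because g has mean zero, hence everywhere.\<close>

lemma continuous_antiderivative:
  assumes "continuous_on UNIV g" "per g" "mean g = 0"
  obtains f where "f 0 = c" "per f" "\<And>t. (f has_vector_derivative g t) (at t)"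
proof -
  have "isCont g x" for x using assms(1) by (simp add: continuous_on_eq_continuous_at)
  then obtain F where F: "\<And>t. (F has_vector_derivative g t) (at t)"
    using einterval_antiderivative[of "-\<infinity>" "\<infinity>" g] by auto
  define f where "f t = F t - F 0 + c" for t
  have f: "(f has_vector_derivative g t) (at t)" for t
    unfolding f_def by (auto intro!: derivative_eq_intros F)
  have L: "circle_L2 g" using assms by (intro circle_L2_continuous) auto
  have i01: "(g has_integral (f 1 - f 0)) {0..1}"
    by (rule fundamental_theorem_of_calculus) (auto intro: has_vector_derivative_at_within f)
  then have 01: "f 1 = f 0" using has_integral_unique[OF i01 integral_unit_mean[OF L]] assms(3) by simp
  have d0: "((\<lambda>t. f (t + 1) - f t) has_vector_derivative 0) (at t)" for t
  proof -
    have "(((f \<circ> (\<lambda>t. t + 1))) has_vector_derivative 1 *\<^sub>R g (t + 1)) (at t)"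
      by (rule vector_diff_chain_at[where g=f]) (auto intro!: derivative_eq_intros f)
    from has_vector_derivative_diff[OF this f[of t]] show ?thesis using assms(2) by (simp add: o_def)
  qed
  have "per f"
  proof
    fix t
    have c: "f (b + 1) - f b = f (a + 1) - f a" if "a \<le> b" for a b
    proof -
      have "((\<lambda>t. 0) has_integral ((f (b + 1) - f b) - (f (a + 1) - f a))) {a..b}"
        by (rule fundamental_theorem_of_calculus[where f="\<lambda>t. f (t + 1) - f t"]) (auto intro: has_vector_derivative_at_within d0 that)
      from has_integral_unique[OF this has_integral_0] show ?thesis by simp
    qed
    show "f (t + 1) = f t" using c[of 0 t] c[of t 0] 01 by (cases "0 \<le> t") auto
  qed
  then show ?thesis by (intro that[of f] f) (simp_all add: f_def)
qed

text \<open>The classical antiderivative with the same value at 0 has the same integrals, so it is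
  f.\<close>

lemma prim_continuous_deriv:
  assumes "prim f g" "continuous_on UNIV g" shows "(f has_vector_derivative g t) (at t)"
proof -
  have pg: "per g" using prim_L2[OF assms(1)] by (simp add: circle_L2_iff)
  obtain F where F: "F 0 = f 0" "per F" "\<And>t. (F has_vector_derivative g t) (at t)"
    using continuous_antiderivative[OF assms(2) pg prim_mean[OF assms(1)]] by blast
  have pF: "prim F g" by (rule prim_smooth[OF F(3) F(2) prim_L2[OF assms(1)]])
  have "f = F"
  proof (rule per_eqI[OF prim_per[OF assms(1)] F(2)])
    fix t :: real assume "t \<in> {0..1}"
    then have "(g has_integral (f t - f 0)) {0..t}" "(g has_integral (F t - F 0)) {0..t}"
      using pF assms(1) by (auto simp: prim_def)
    then show "f t = F t" using has_integral_unique[of g "f t - f 0" "{0..t}" "F t - F 0"] F(1) by simp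
  qed
  then show ?thesis using F by simp
qed

lemma smooth_antiderivative:
  assumes "smooth_loop g" "mean g = 0"
  obtains f where "f 0 = c" "smooth_loop f" "\<And>t. (f has_vector_derivative g t) (at t)"
proof -
  obtain f where "f 0 = c" "per f" "\<And>t. (f has_vector_derivative g t) (at t)"
    using continuous_antiderivative[of g c] smooth_loop_continuous smooth_loop_periodic assms by metis
  then show ?thesis using smooth_loopI[of f g] assms that by simp
qed

section \<open>Mean-square and uniform convergence of loops\<close>

definition l2conv :: "(nat \<Rightarrow> real \<Rightarrow> complex) \<Rightarrow> (real \<Rightarrow> complex) \<Rightarrow> bool"
  where "l2conv G g \<longleftrightarrow> (\<forall>n. circle_L2 (G n)) \<and> circle_L2 g \<and> (\<lambda>n. l2 (G n - g)) \<longlonglongrightarrow> 0"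

abbreviation uconv :: "(nat \<Rightarrow> real \<Rightarrow> 'a::metric_space) \<Rightarrow> (real \<Rightarrow> 'a) \<Rightarrow> bool"
  where "uconv F f \<equiv> uniform_limit UNIV F f sequentially"

lemma uconv_normI:
  assumes "\<And>n t. norm (F n t - f t) \<le> b n" "b \<longlonglongrightarrow> 0" shows "uconv F f"
proof (rule uniform_limitI)
  fix e :: real assume "0 < e"
  with assms(2) have "\<forall>\<^sub>F n in sequentially. b n < e" by (rule order_tendstoD)
  then show "\<forall>\<^sub>F n in sequentially. \<forall>t\<in>UNIV. dist (F n t) (f t) < e"
    by eventually_elim (use assms(1) in \<open>auto simp: dist_norm intro: le_less_trans\<close>)
qed

lemma l2convI:
  assumes "\<And>n. circle_L2 (G n)" "circle_L2 g" "\<And>n. l2 (G n - g) \<le> b n" "b \<longlonglongrightarrow> 0"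
  shows "l2conv G g"
proof -
  have "(\<lambda>n. l2 (G n - g)) \<longlonglongrightarrow> 0"
  proof (rule Lim_null_comparison[OF always_eventually assms(4)], rule allI)
    fix n
    have "0 \<le> l2 (G n - g)" by (simp add: l2ip_self)
    then show "norm (l2 (G n - g)) \<le> b n" using assms(3)[of n] by (simp only: real_norm_def abs_of_nonneg)
  qed
  then show ?thesis using assms(1,2) by (simp add: l2conv_def)
qed

lemma l2conv_D: assumes "l2conv G g" shows "circle_L2 (G n)" "circle_L2 g" "circle_L2 (G n - g)" "(\<lambda>n. l2 (G n - g)) \<longlonglongrightarrow> 0"
  using assms circle_L2_diff by (auto simp: l2conv_def)

lemma l2conv_add: assumes "l2conv F f" "l2conv G g" shows "l2conv (\<lambda>n t. F n t + G n t) (\<lambda>t. f t + g t)"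
proof (rule l2convI)
  show "(\<lambda>n. l2 (F n - f) + l2 (G n - g)) \<longlonglongrightarrow> 0"
    using tendsto_add[OF l2conv_D(4)[OF assms(1)] l2conv_D(4)[OF assms(2)]] by simp
  fix n
  have "(\<lambda>t. F n t + G n t) - (\<lambda>t. f t + g t) = (F n - f) + (G n - g)" by auto
  then show "l2 ((\<lambda>t. F n t + G n t) - (\<lambda>t. f t + g t)) \<le> l2 (F n - f) + l2 (G n - g)"
    using L2.triangle l2conv_D assms by simp
qed (use assms in \<open>auto intro: circle_L2_add l2conv_D\<close>)

text \<open>From H G - h g = (H - h) G + h (G - g): the first factor of the first term is uniformly
  small while the norms of G stay bounded, and h is bounded in the second term.\<close>

lemma l2conv_mult:
  assumes G: "l2conv G g" and H: "uconv H h" "\<And>n. per (H n)" "\<And>n. continuous_on UNIV (H n)"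
  shows "l2conv (\<lambda>n t. H n t * G n t) (\<lambda>t. h t * g t)"
proof -
  have ch: "continuous_on UNIV h" by (rule uniform_limit_theorem[OF _ H(1)]) (use H in auto)
  have lim: "(\<lambda>n. H n t) \<longlonglongrightarrow> h t" for t using tendsto_uniform_limitI[OF H(1)] by simp
  have ph: "per h"
  proof
    fix t show "h (t + 1) = h t" using LIMSEQ_unique[OF lim[of "t + 1"]] lim[of t] H(2) by simp
  qed
  obtain M where M: "0 < M" "\<And>t. cmod (h t) \<le> M" by (rule per_bounded[OF ph ch]) blast
  have HG: "circle_L2 (\<lambda>t. H n t * G n t)" for n
  proof -
    obtain M' where "\<And>t. cmod (H n t) \<le> M'" by (rule per_bounded[OF H(2,3)]) blast
    then show ?thesis using l2conv_D[OF G] H by (intro circle_L2_mult) (auto intro: borel_measurable_continuous_onI)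
  qed
  have mL: "circle_L2 (\<lambda>t. h t * f t)" if "circle_L2 f" for f
    by (rule circle_L2_mult[OF that]) (use ph M ch in \<open>auto intro: borel_measurable_continuous_onI\<close>)
  have "(\<lambda>n. l2 ((\<lambda>t. H n t * G n t) - (\<lambda>t. h t * g t))) \<longlonglongrightarrow> 0"
  proof (rule LIMSEQ_I)
    fix e :: real assume e: "0 < e"
    \<comment> \<open>Bounds \<open>l2 (G n)\<close> as soon as \<open>l2 (G n - g)\<close> is below
      1; the 1 also keeps it positive.\<close>
    define K where "K = l2 g + 1"
    have "0 \<le> l2 g" by (simp add: l2ip_self)
    then have K: "0 < K" unfolding K_def by linarith
    have "\<forall>\<^sub>F n in sequentially. \<forall>t\<in>UNIV. dist (H n t) (h t) < e / (2 * K)"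
      by (rule uniform_limitD[OF H(1)]) (use e K in auto)
    moreover have "\<forall>\<^sub>F n in sequentially. l2 (G n - g) < min 1 (e / (2 * M))"
      by (rule order_tendstoD(2)[OF l2conv_D(4)[OF G]]) (use e M in auto)
    ultimately have "\<forall>\<^sub>F n in sequentially. norm (l2 ((\<lambda>t. H n t * G n t) - (\<lambda>t. h t * g t)) - 0) < e"
    proof eventually_elim
      case (elim n)
      let ?A = "\<lambda>t. (H n t - h t) * G n t" and ?B = "\<lambda>t. h t * (G n - g) t"
      have eq: "(\<lambda>t. H n t * G n t) - (\<lambda>t. h t * g t) = ?A + ?B" by (auto simp: algebra_simps)
      have B: "circle_L2 ?B" by (rule mL) (rule l2conv_D[OF G])
      have A: "circle_L2 ?A" using circle_L2_diff[OF HG mL[OF l2conv_D(1)[OF G]], of n n]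
        by (simp add: left_diff_distrib fun_diff_def)
      have "l2 ?A \<le> e / (2 * K) * l2 (G n)"
        by (rule l2_mult_bound[OF l2conv_D(1)[OF G] A]) (use elim e K in \<open>auto simp: dist_norm less_imp_le\<close>)
      also have "\<dots> \<le> e / (2 * K) * K"
      proof (rule mult_left_mono)
        have "l2 (G n) \<le> l2 g + l2 (G n - g)" using L2.triangle[of g "G n - g"] l2conv_D(2,3)[OF G] by simp
        then show "l2 (G n) \<le> K" using elim(2) unfolding K_def by linarith
      qed (use e K in auto)
      finally have 1: "l2 ?A \<le> e / 2" using K by simp
      have "l2 ?B \<le> M * l2 (G n - g)"
        by (rule l2_mult_bound[OF l2conv_D(3)[OF G] B]) (use M in auto)
      also have "\<dots> < M * (e / (2 * M))" by (rule mult_strict_left_mono) (use elim M in auto)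
      finally have 2: "l2 ?B < e / 2" using M by simp
      have "l2 (?A + ?B) \<le> l2 ?A + l2 ?B" by (rule L2.triangle) (use A B in auto)
      then have "l2 (?A + ?B) < e" using 1 2 by linarith
      moreover have "0 \<le> l2 (?A + ?B)" by (simp add: l2ip_self)
      ultimately show ?case unfolding eq by simp
    qed
    then show "\<exists>no. \<forall>n\<ge>no. norm (l2 ((\<lambda>t. H n t * G n t) - (\<lambda>t. h t * g t)) - 0) < e"
      by (simp add: eventually_sequentially)
  qed
  then show ?thesis using HG mL l2conv_D[OF G] by (simp add: l2conv_def)
qed

lemma l2conv_mean: assumes "l2conv G g" shows "(\<lambda>n. mean (G n)) \<longlonglongrightarrow> mean g"
proof (rule Lim_transform2[where f="\<lambda>n. mean g"], simp, rule Lim_null_comparison[OF _ l2conv_D(4)[OF assms]], rule always_eventually, rule allI)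
  fix n show "cmod (mean g - mean (G n)) \<le> l2 (G n - g)"
    using cmod_mean_le[OF l2conv_D(3)[OF assms], of n] mean_diff[OF l2conv_D(1,2)[OF assms], of n]
    by (simp add: norm_minus_commute fun_diff_def)
qed

text \<open>This closure property and \<open>prim_approx\<close> below transfer the rules of calculus
  from smooth loops to absolutely continuous ones.\<close>

lemma prim_limit:
  assumes "\<And>n. prim (F n) (G n)" "l2conv G g" "\<And>t. (\<lambda>n. F n t) \<longlonglongrightarrow> f t"
  shows "prim f g"
  unfolding prim_def
proof (intro conjI ballI allI)
  show "f (t + 1) = f t" for t
    using LIMSEQ_unique[OF assms(3)[of "t + 1"]] assms(3)[of t] assms(1) by (auto simp: prim_def)
  show g: "circle_L2 g" by (rule l2conv_D[OF assms(2)])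
  fix t :: real assume t: "t \<in> {0..1}"
  have G: "circle_L2 (G n)" for n by (rule l2conv_D[OF assms(2)])
  have "(\<lambda>n. integral {0..t} (G n)) \<longlonglongrightarrow> integral {0..t} g"
  proof (rule Lim_transform2[where f="\<lambda>n. integral {0..t} g"], simp, rule Lim_null_comparison[OF _ l2conv_D(4)[OF assms(2)]], rule always_eventually, rule allI)
    fix n
    have "integral {0..t} g - integral {0..t} (G n) = - integral {0..t} (G n - g)"
      using has_integral_circle_L2(1)[OF G, of 0 t n] has_integral_circle_L2(1)[OF g, of 0 t] t
      by (simp add: fun_diff_def integral_diff)
    then have "cmod (integral {0..t} g - integral {0..t} (G n)) \<le> sqrt t * l2 (G n - g)"
      using has_integral_circle_L2(3)[OF l2conv_D(3)[OF assms(2)], of 0 t n] t by simp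
    also have "\<dots> \<le> 1 * l2 (G n - g)" by (rule mult_right_mono) (use t in \<open>auto simp: l2ip_self\<close>)
    finally show "cmod (integral {0..t} g - integral {0..t} (G n)) \<le> l2 (G n - g)" by simp
  qed
  moreover have "integral {0..t} (G n) = F n t - F n 0" for n
    using assms(1)[of n] t by (auto simp: prim_def intro!: integral_unique)
  moreover have "(\<lambda>n. F n t - F n 0) \<longlonglongrightarrow> f t - f 0" by (intro tendsto_diff assms)
  ultimately have "integral {0..t} g = f t - f 0" using LIMSEQ_unique by auto
  then show "(g has_integral (f t - f 0)) {0..t}"
    using has_integral_circle_L2(1)[OF g, of 0 t] t by (metis atLeastAtMost_iff integrable_integral order_refl)
qed

lemma prim_approx:
  assumes "prim f g"
  obtains P p where "\<And>n. smooth_loop (P n)" "\<And>n. smooth_loop (p n)"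
    "\<And>n t. (P n has_vector_derivative p n t) (at t)" "\<And>n. prim (P n) (p n)" "l2conv p g" "uconv P f"
proof -
  have g: "circle_L2 g" by (rule prim_L2[OF assms])
  have "\<exists>P p. smooth_loop P \<and> smooth_loop p \<and> (\<forall>t. (P has_vector_derivative p t) (at t)) \<and> P 0 = f 0 \<and>
     l2 (p - g) < 1 / real (Suc n)" for n
  proof -
    obtain q where q: "smooth_loop q" "l2 (q - g) < 1 / real (Suc n) / 2"
      using smooth_loop_dense[OF g, of "1 / real (Suc n) / 2"] by auto
    \<comment> \<open>Only loops of mean zero have periodic antiderivatives. As g itself has mean
      zero, the mean of q is at most the error \<open>l2 (q - g)\<close>; hence the halved tolerance
      for q.\<close>
    define p where "p = (\<lambda>t. q t - mean q)"
    have p: "smooth_loop p" using smooth_loop_lincomb[OF q(1) smooth_loop_const[of "mean q"], of 1 "-1"] by (simp add: p_def)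
    have m: "mean p = 0" unfolding p_def
      by (subst mean_diff) (use q smooth_loop_L2 circle_L2_const mean_const in auto)
    obtain P where P: "P 0 = f 0" "smooth_loop P" "\<And>t. (P has_vector_derivative p t) (at t)"
      using smooth_antiderivative[OF p m] by blast
    have qg: "circle_L2 (q - g)" by (intro circle_L2_diff smooth_loop_L2 q g)
    have "mean (q - g) = mean q"
      using mean_diff[OF smooth_loop_L2[OF q(1)] g] prim_mean[OF assms] by (simp add: fun_diff_def)
    then have "cmod (mean q) \<le> l2 (q - g)" using cmod_mean_le[OF qg] by simp
    moreover have pg: "p - g = (q - g) - (\<lambda>t. mean q)" by (auto simp: p_def)
    moreover have "l2 ((q - g) - (\<lambda>t. mean q)) \<le> l2 (q - g) + l2 (\<lambda>t. mean q)"
      by (rule L2.triangle_diff) (use qg circle_L2_const in auto)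
    moreover have "a \<le> b \<Longrightarrow> c \<le> b + a \<Longrightarrow> b < e / 2 \<Longrightarrow> c < e" for a b c e :: real by linarith
    ultimately have "l2 (p - g) < 1 / real (Suc n)"
      using q(2) unfolding l2_const pg by blast
    with p P show ?thesis by blast
  qed
  then obtain P p where P: "\<And>n. smooth_loop (P n)" "\<And>n. smooth_loop (p n)"
    "\<And>n t. (P n has_vector_derivative p n t) (at t)" "\<And>n. P n 0 = f 0"
    "\<And>n. l2 (p n - g) < 1 / real (Suc n)" by metis
  have lim0: "(\<lambda>n. 1 / real (Suc n)) \<longlonglongrightarrow> 0" using LIMSEQ_inverse_real_of_nat by (simp add: inverse_eq_divide)
  have pr: "prim (P n) (p n)" for n
    using prim_smooth[OF P(3)] smooth_loop_periodic[OF P(1)] smooth_loop_L2[OF P(2)] by blast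
  have "l2conv p g"
    by (rule l2convI[OF smooth_loop_L2[OF P(2)] g less_imp_le[OF P(5)] lim0])
  moreover have "uconv P f"
  proof (rule uconv_normI[OF _ lim0])
    fix n t
    have "cmod ((P n t - f t) - (P n 0 - f 0)) \<le> l2 (p n - g)"
      using prim_diff_le[OF prim_diff[OF pr assms], of n t] by (simp add: fun_diff_def)
    then show "cmod (P n t - f t) \<le> 1 / real (Suc n)" using P(5)[of n] by (simp add: P(4))
  qed
  ultimately show ?thesis using that P pr by blast
qed

lemma prim_continuous: assumes "prim f g" shows "continuous_on UNIV f"
proof -
  obtain P where P: "\<And>n. smooth_loop (P n)" "uconv P f" by (rule prim_approx[OF assms]) blast
  have "\<forall>\<^sub>F n in sequentially. continuous_on UNIV (P n)" by (intro always_eventually allI smooth_loop_continuous P)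
  then show ?thesis by (rule uniform_limit_theorem) (rule P sequentially_bot)+
qed

lemma prim_L2': "prim f g \<Longrightarrow> circle_L2 f"
  by (intro circle_L2_continuous prim_continuous) (auto simp: prim_def)

text \<open>Sobolev embedding by averaging |f t| <= |f s| + 2 l2 g over s; the 2 arises since both
  values are compared with f 0.\<close>

lemma prim_sup_le: assumes "prim f g" shows "cmod (f t) \<le> l2 f + 2 * l2 g"
proof -
  have f: "circle_L2 f" by (rule prim_L2'[OF assms])
  have "cmod (f t) = (\<integral>s. cmod (f t) \<partial>circ)" by simp
  also have "\<dots> \<le> (\<integral>s. cmod (f s) + 2 * l2 g \<partial>circ)"
  proof (rule integral_mono)
    show "integrable circ (\<lambda>s. cmod (f s) + 2 * l2 g)" using circle_L2_integrable[OF f] by simp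
    show "cmod (f t) \<le> cmod (f s) + 2 * l2 g" for s
    proof -
      have "f t = f s + (f t - f 0) - (f s - f 0)" by simp
      then have "cmod (f t) \<le> cmod (f s) + cmod (f t - f 0) + cmod (f s - f 0)"
        by (metis norm_triangle_le norm_triangle_le_diff order_refl add_mono)
      then show ?thesis using prim_diff_le[OF assms, of t] prim_diff_le[OF assms, of s] by linarith
    qed
  qed simp
  also have "\<dots> \<le> l2 f + 2 * l2 g" using circle_L2_integrable[OF f] norm_integral_le_l2[OF f] by simp
  finally show ?thesis .
qed

lemma prim_exists:
  assumes "circle_L2 g" "mean g = 0" obtains f where "prim f g" "f 0 = c"
proof (rule that[of "\<lambda>t. c + integral {0..frac t} g"])
  let ?f = "\<lambda>t. c + integral {0..frac t} g"
  show "?f 0 = c" by simp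
  show "prim ?f g" unfolding prim_def
  proof (intro conjI ballI allI)
    fix t :: real assume t: "t \<in> {0..1}"
    \<comment> \<open>At t = 1 the fractional part drops to 0; there the vanishing mean of g is
      used.\<close>
    have "integral {0..frac t} g = integral {0..t} g"
      using t integral_unit_mean[OF assms(1)] assms(2) by (cases "t = 1") (auto simp: integral_unique frac_eq_id)
    moreover have "(g has_integral integral {0..t} g) {0..t}"
      using has_integral_circle_L2(1)[OF assms(1), of 0 t] t by (auto intro: integrable_integral)
    ultimately show "(g has_integral (?f t - ?f 0)) {0..t}" by simp
  qed (use assms in \<open>auto simp: frac_1_eq\<close>)
qed

lemma uconv_mult:
  fixes F G :: "nat \<Rightarrow> real \<Rightarrow> complex"
  assumes "uconv F f" "uconv G g" "per f" "per g" "continuous_on UNIV f" "continuous_on UNIV g"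
  shows "uconv (\<lambda>n t. F n t * G n t) (\<lambda>t. f t * g t)"
proof (rule uniform_lim_mult[OF assms(1,2)])
  obtain M where "\<And>t. norm (f t) \<le> M" by (rule per_bounded[OF assms(3,5)]) blast
  then show "bounded (range f)" by (auto intro: boundedI)
  obtain M where "\<And>t. norm (g t) \<le> M" by (rule per_bounded[OF assms(4,6)]) blast
  then show "bounded (range g)" by (auto intro: boundedI)
qed

lemma has_vector_derivative_mult_loop:
  fixes f g :: "real \<Rightarrow> complex"
  assumes "(f has_vector_derivative f') (at t)" "(g has_vector_derivative g') (at t)"
  shows "((\<lambda>t. f t * g t) has_vector_derivative g t * f' + f t * g') (at t)"
  by (rule has_vector_derivative_eq_rhs[OF has_vector_derivative_mult[OF assms]]) (simp add: mult.commute add.commute)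

lemma prim_mult: assumes "prim f g" "prim f' g'" shows "prim (\<lambda>t. f t * f' t) (\<lambda>t. f' t * g t + f t * g' t)"
proof -
  obtain P p where P: "\<And>n. smooth_loop (P n)" "\<And>n. smooth_loop (p n)"
    "\<And>n t. (P n has_vector_derivative p n t) (at t)" "\<And>n. prim (P n) (p n)" "l2conv p g" "uconv P f" by (rule prim_approx[OF assms(1)]) (rule that)
  obtain Q q where Q: "\<And>n. smooth_loop (Q n)" "\<And>n. smooth_loop (q n)"
    "\<And>n t. (Q n has_vector_derivative q n t) (at t)" "\<And>n. prim (Q n) (q n)" "l2conv q g'" "uconv Q f'" by (rule prim_approx[OF assms(2)]) (rule that)
  have l: "l2conv (\<lambda>n t. Q n t * p n t + P n t * q n t) (\<lambda>t. f' t * g t + f t * g' t)"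
  proof (rule l2conv_add)
    show "l2conv (\<lambda>n t. Q n t * p n t) (\<lambda>t. f' t * g t)"
      by (rule l2conv_mult[OF P(5) Q(6) smooth_loop_per[OF Q(1)] smooth_loop_continuous[OF Q(1)]])
    show "l2conv (\<lambda>n t. P n t * q n t) (\<lambda>t. f t * g' t)"
      by (rule l2conv_mult[OF Q(5) P(6) smooth_loop_per[OF P(1)] smooth_loop_continuous[OF P(1)]])
  qed
  have 1: "prim (\<lambda>t. P n t * Q n t) (\<lambda>t. Q n t * p n t + P n t * q n t)" for n
  proof (rule prim_smooth)
    show "((\<lambda>t. P n t * Q n t) has_vector_derivative Q n t * p n t + P n t * q n t) (at t)" for t
      by (rule has_vector_derivative_mult_loop[OF P(3) Q(3)])
    show "per (\<lambda>t. P n t * Q n t)" by (simp add: smooth_loop_periodic[OF P(1)] smooth_loop_periodic[OF Q(1)])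
    show "circle_L2 (\<lambda>t. Q n t * p n t + P n t * q n t)" by (rule l2conv_D(1)[OF l])
  qed
  have 2: "(\<lambda>n. P n t * Q n t) \<longlonglongrightarrow> f t * f' t" for t
    by (rule tendsto_mult[OF tendsto_uniform_limitI[OF P(6) UNIV_I] tendsto_uniform_limitI[OF Q(6) UNIV_I]])
  show ?thesis
    by (rule prim_limit[where F="\<lambda>n t. P n t * Q n t" and G="\<lambda>n t. Q n t * p n t + P n t * q n t"]) (fact 1 l 2)+
qed

text \<open>In the seminorm of L^2 the constant sequence g converges to h, so
  \<open>prim_limit\<close> applies.\<close>

lemma prim_AE:
  assumes "prim f g" "circle_L2 h" "AE t in circ. g t = h t" shows "prim f h"
proof -
  have "l2ip (g - h) (g - h) = 0" unfolding l2ip_self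
    by (rule integral_eq_zero_AE) (use assms(3) in auto)
  then have "l2conv (\<lambda>n. g) h" using assms(2) prim_L2[OF assms(1)] by (simp add: l2conv_def)
  then show ?thesis by (rule prim_limit[where F="\<lambda>n. f" and G="\<lambda>n. g", rotated]) (simp_all add: assms(1))
qed

lemma l2_eq_0_continuous:
  assumes "continuous_on UNIV f" "per f" "l2ip f f = 0" shows "f = (\<lambda>t. 0)"
proof (rule per_eqI[OF assms(2)])
  fix t :: real assume t: "t \<in> {0..1}"
  have c: "continuous_on {0..1} (\<lambda>t. (cmod (f t))\<^sup>2)" using continuous_on_subset[OF assms(1)] by (intro continuous_intros) auto
  have L: "circle_L2 f" using assms by (intro circle_L2_continuous) auto
  have "set_integrable lborel {0..1} (\<lambda>t. (cmod (f t))\<^sup>2)" using L by (simp add: circle_L2_def)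
  from set_borel_integral_eq_integral[OF this] assms(3)
  have "((\<lambda>t. (cmod (f t))\<^sup>2) has_integral 0) {0..1}"
    by (simp add: l2ip_self set_integral_circ has_integral_integrable_integral)
  then have "(cmod (f t))\<^sup>2 = 0"
    using has_integral_0_cbox_imp_0[of 0 1 "\<lambda>t. (cmod (f t))\<^sup>2" t] c t by simp
  then show "f t = 0" by simp
qed auto

section \<open>Sobolev spaces by recursion\<close>

lemma circle_L2_mult_continuous:
  assumes "circle_L2 f" "continuous_on UNIV h" "per h" shows "circle_L2 (\<lambda>t. h t * f t)"
proof -
  obtain M where "\<And>t. cmod (h t) \<le> M" by (rule per_bounded[OF assms(3,2)]) blast
  then show ?thesis using assms by (intro circle_L2_mult) (auto intro: borel_measurable_continuous_onI)
qed

section \<open>Test functions and weak derivatives\<close>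

lemma deriv_per: assumes "per (f :: real \<Rightarrow> real)" shows "per (deriv f)"
proof
  fix t
  have "(f has_field_derivative D) (at (t + 1)) \<longleftrightarrow> (f has_field_derivative D) (at t)" for D
    using DERIV_shift[of f D t 1] assms by simp
  then show "deriv f (t + 1) = deriv f t" by (simp add: deriv_def)
qed

lemma circle_test_iter:
  assumes "circle_test \<phi>"
  shows "per ((deriv ^^ j) \<phi>)" "((deriv ^^ j) \<phi> has_real_derivative (deriv ^^ Suc j) \<phi> t) (at t)"
proof -
  show "per ((deriv ^^ j) \<phi>)"
    by (induction j) (use assms deriv_per in \<open>auto simp: circle_test_def\<close>)
  show "((deriv ^^ j) \<phi> has_real_derivative (deriv ^^ Suc j) \<phi> t) (at t)"
    using assms by (simp add: circle_test_def field_differentiable_derivI)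
qed

lemma circle_test_deriv: "circle_test \<phi> \<Longrightarrow> circle_test ((deriv ^^ j) \<phi>)"
  unfolding circle_test_def
  using circle_test_iter(1)[of \<phi> j] by (auto simp: circle_test_def simp flip: funpow_add[unfolded fun_eq_iff o_def, rule_format])

lemma circle_test_smooth_loop:
  assumes "circle_test \<phi>" shows "smooth_loop (\<lambda>t. of_real (\<phi> t))"
  unfolding smooth_loop_def
proof (intro exI[of _ "\<lambda>j t. of_real ((deriv ^^ j) \<phi> t)"] conjI allI)
  show "((\<lambda>t. complex_of_real ((deriv ^^ j) \<phi> t)) has_vector_derivative complex_of_real ((deriv ^^ Suc j) \<phi> t)) (at t)" for j t
    using circle_test_iter(2)[OF assms, of j t] bounded_linear.has_vector_derivative[OF bounded_linear_of_real]
    by (auto simp: has_real_derivative_iff_has_vector_derivative)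
qed (use circle_test_iter(1)[OF assms] in auto)

lemma smooth_loop_circle_test:
  assumes "smooth_loop w" "bounded_linear L" shows "circle_test (\<lambda>t. L (w t))"
proof -
  obtain F where F: "F 0 = w" "\<And>j t. F j (t + 1) = F j t" "\<And>j t. (F j has_vector_derivative F (Suc j) t) (at t)"
    using assms(1) unfolding smooth_loop_def by blast
  have D: "((\<lambda>t. L (F j t)) has_real_derivative L (F (Suc j) t)) (at t)" for j t
    using bounded_linear.has_vector_derivative[OF assms(2) F(3)] by (simp add: has_real_derivative_iff_has_vector_derivative)
  have it: "(deriv ^^ j) (\<lambda>t. L (w t)) = (\<lambda>t. L (F j t))" for j
  proof (induction j)
    case (Suc j)
    have "deriv (\<lambda>t. L (F j t)) = (\<lambda>t. L (F (Suc j) t))" using D DERIV_imp_deriv by blast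
    then show ?case using Suc by simp
  qed (simp add: F)
  show ?thesis unfolding circle_test_def it
    using D F(1) F(2)[of 0] by (auto simp: field_differentiable_def)
qed

lemma circle_test_prim:
  assumes "circle_test \<phi>" shows "prim (\<lambda>t. of_real (\<phi> t)) (\<lambda>t. of_real (deriv \<phi> t))"
proof (rule prim_smooth)
  show "((\<lambda>t. complex_of_real (\<phi> t)) has_vector_derivative complex_of_real (deriv \<phi> t)) (at t)" for t
    using circle_test_iter(2)[OF assms, of 0 t] bounded_linear.has_vector_derivative[OF bounded_linear_of_real]
    by (auto simp: has_real_derivative_iff_has_vector_derivative)
  show "per (\<lambda>t. complex_of_real (\<phi> t))" using assms by (simp add: circle_test_def)
  show "circle_L2 (\<lambda>t. complex_of_real (deriv \<phi> t))"
    using smooth_loop_L2[OF circle_test_smooth_loop[OF circle_test_deriv[OF assms, of 1]]] by simp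
qed

lemma circle_test_antiderivative:
  assumes "circle_test \<psi>" "mean (\<lambda>t. of_real (\<psi> t)) = 0"
  obtains \<phi> where "circle_test \<phi>" "deriv \<phi> = \<psi>"
proof -
  obtain f where f: "smooth_loop f" "\<And>t. (f has_vector_derivative of_real (\<psi> t)) (at t)"
    using smooth_antiderivative[OF circle_test_smooth_loop[OF assms(1)] assms(2)] by blast
  have "((\<lambda>t. Re (f t)) has_real_derivative \<psi> t) (at t)" for t
    using bounded_linear.has_vector_derivative[OF bounded_linear_Re f(2)[of t]]
    by (simp add: has_real_derivative_iff_has_vector_derivative)
  then have "deriv (\<lambda>t. Re (f t)) = \<psi>" by (intro ext DERIV_imp_deriv)
  then show ?thesis using smooth_loop_circle_test[OF f(1) bounded_linear_Re] that by blast
qed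

lemma has_weak_deriv_iff:
  "has_weak_deriv j f g \<longleftrightarrow> circle_L2 g \<and> (\<forall>\<phi>. circle_test \<phi> \<longrightarrow>
     mean (\<lambda>t. of_real ((deriv ^^ j) \<phi> t) * f t) = (-1) ^ j * mean (\<lambda>t. of_real (\<phi> t) * g t))"
  unfolding has_weak_deriv_def set_integral_circ mean_def scaleR_conv_of_real ..

lemma circle_test_mult_L2:
  assumes "circle_test \<phi>" "circle_L2 f" shows "circle_L2 (\<lambda>t. of_real (\<phi> t) * f t)"
  by (rule circle_L2_mult_continuous[OF assms(2) smooth_loop_continuous smooth_loop_per])
    (rule circle_test_smooth_loop[OF assms(1)])+

text \<open>Weak derivatives are tested with real functions, whereas \<open>l2ip\<close> pairs with
  complex loops; the two components of w serve as two test functions.\<close>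

lemma l2ip_Re_Im:
  assumes "circle_test (\<lambda>t. Re (w t))" "circle_test (\<lambda>t. Im (w t))" "circle_L2 h"
  shows "l2ip w h = Re (mean (\<lambda>t. of_real (Re (w t)) * h t)) + Im (mean (\<lambda>t. of_real (Im (w t)) * h t))"
proof -
  note i = circle_L2_integrable[OF circle_test_mult_L2[OF assms(1,3)]] circle_L2_integrable[OF circle_test_mult_L2[OF assms(2,3)]]
  have "l2ip w h = (\<integral>t. Re (of_real (Re (w t)) * h t) + Im (of_real (Im (w t)) * h t) \<partial>circ)"
    by (simp add: l2ip_def inner_complex_def)
  also have "\<dots> = (\<integral>t. Re (of_real (Re (w t)) * h t) \<partial>circ) + (\<integral>t. Im (of_real (Im (w t)) * h t) \<partial>circ)"
    by (rule Bochner_Integration.integral_add[OF integrable_Re[OF i(1)] integrable_Im[OF i(2)]])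
  finally show ?thesis using i by (simp add: mean_def integral_Re[symmetric] integral_Im[symmetric])
qed

text \<open>Fundamental lemma of the calculus of variations: h is orthogonal to all smooth loops,
  and these come arbitrarily close to h.\<close>

lemma weak_zero:
  assumes h: "circle_L2 h" and z: "\<And>\<phi>. circle_test \<phi> \<Longrightarrow> mean (\<lambda>t. of_real (\<phi> t) * h t) = 0"
  shows "l2ip h h = 0"
proof -
  have 0: "l2ip w h = 0" if "smooth_loop w" for w
    using l2ip_Re_Im[OF smooth_loop_circle_test[OF that bounded_linear_Re] smooth_loop_circle_test[OF that bounded_linear_Im] h]
      z smooth_loop_circle_test[OF that bounded_linear_Re] smooth_loop_circle_test[OF that bounded_linear_Im] by simp
  have "\<exists>p. smooth_loop p \<and> l2 (p - h) < 1 / real (Suc n)" for n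
    using smooth_loop_dense[OF h, of "1 / real (Suc n)"] by auto
  then obtain p where p: "\<And>n. smooth_loop (p n)" "\<And>n. l2 (p n - h) < 1 / real (Suc n)" by metis
  have "(\<lambda>n. 1 / real (Suc n)) \<longlonglongrightarrow> 0" using LIMSEQ_inverse_real_of_nat by (simp add: inverse_eq_divide)
  then have "l2conv p h" by (rule l2convI[OF smooth_loop_L2[OF p(1)] h less_imp_le[OF p(2)]])
  then have "(\<lambda>n. l2ip (p n) h) \<longlonglongrightarrow> l2ip h h"
    using L2.tendsto_B[of p h h] l2conv_D by (simp add: h)
  then show ?thesis using 0[OF p(1)] by (simp add: LIMSEQ_const_iff)
qed

lemma weak_unique:
  assumes "circle_L2 g" "circle_L2 h"
    "\<And>\<phi>. circle_test \<phi> \<Longrightarrow> mean (\<lambda>t. of_real (\<phi> t) * g t) = mean (\<lambda>t. of_real (\<phi> t) * h t)"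
  shows "AE t in circ. g t = h t"
proof -
  have d: "circle_L2 (g - h)" by (rule circle_L2_diff[OF assms(1,2)])
  have "l2ip (g - h) (g - h) = 0"
  proof (rule weak_zero[OF d])
    fix \<phi> assume p: "circle_test \<phi>"
    have "mean (\<lambda>t. of_real (\<phi> t) * (g - h) t) = mean (\<lambda>t. of_real (\<phi> t) * g t) - mean (\<lambda>t. of_real (\<phi> t) * h t)"
      using mean_diff[OF circle_test_mult_L2[OF p assms(1)] circle_test_mult_L2[OF p assms(2)]] by (simp add: right_diff_distrib)
    then show "mean (\<lambda>t. of_real (\<phi> t) * (g - h) t) = 0" using assms(3)[OF p] by simp
  qed
  from l2_eq_0_AE[OF d this] show ?thesis by simp
qed

lemma circle_test_by_parts:
  assumes "circle_test \<phi>" "prim f g"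
  shows "mean (\<lambda>t. of_real (deriv \<phi> t) * f t) = - mean (\<lambda>t. of_real (\<phi> t) * g t)"
proof -
  have p: "prim (\<lambda>t. of_real (\<phi> t) * f t) (\<lambda>t. f t * of_real (deriv \<phi> t) + of_real (\<phi> t) * g t)"
    by (rule prim_mult[OF circle_test_prim[OF assms(1)] assms(2)])
  have d: "circle_test (deriv \<phi>)" using circle_test_deriv[OF assms(1), of 1] by simp
  have "mean (\<lambda>t. of_real (deriv \<phi> t) * f t + of_real (\<phi> t) * g t) = 0"
    using prim_mean[OF p] by (simp add: mult.commute)
  then show ?thesis
    using mean_add[OF circle_test_mult_L2[OF d prim_L2'[OF assms(2)]] circle_test_mult_L2[OF assms(1) prim_L2[OF assms(2)]]]
    by (simp add: eq_neg_iff_add_eq_0)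
qed

text \<open>Testing with the constant 1 shows that h has mean zero, so h has a primitive f. Test
  functions of mean zero are derivatives of test functions, so f and g agree when tested with them;
  the remaining constant is fixed by the means.\<close>

lemma du_Bois_Reymond:
  assumes g: "circle_L2 g" and w: "has_weak_deriv 1 g h"
  obtains f where "prim f h" "AE t in circ. f t = g t"
proof -
  have h: "circle_L2 h" using w by (simp add: has_weak_deriv_iff)
  have eq: "mean (\<lambda>t. of_real (deriv \<phi> t) * g t) = - mean (\<lambda>t. of_real (\<phi> t) * h t)" if "circle_test \<phi>" for \<phi>
    using w that by (simp add: has_weak_deriv_iff)
  have "circle_test (\<lambda>t. 1)"
    using smooth_loop_circle_test[OF smooth_loop_const[of 1] bounded_linear_Re] by simp
  from eq[OF this] have "mean h = 0" by (simp add: mean_def)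
  then obtain f where f: "prim f h" using prim_exists[OF h] by blast
  have fL: "circle_L2 f" by (rule prim_L2'[OF f])
  \<comment> \<open>The shift that gives f the mean of g.\<close>
  define c where "c = mean g - mean f"
  have fc: "prim (\<lambda>t. f t + c) h" using prim_add[OF f prim_const[of c]] by simp
  have cL: "circle_L2 (\<lambda>t. f t + c)" by (rule prim_L2'[OF fc])
  have "AE t in circ. f t + c = g t"
  proof (rule weak_unique[OF cL g])
    fix \<psi> assume psi: "circle_test \<psi>"
    define m where "m = Re (mean (\<lambda>t. of_real (\<psi> t)))"
    have sL: "circle_L2 (\<lambda>t. complex_of_real (\<psi> t))" using circle_test_smooth_loop[OF psi] by (rule smooth_loop_L2)
    have mm: "mean (\<lambda>t. of_real (\<psi> t)) = of_real m" unfolding m_def mean_def by simp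
    have sl: "smooth_loop (\<lambda>t. of_real (\<psi> t) - of_real m)"
      using smooth_loop_lincomb[OF circle_test_smooth_loop[OF psi] smooth_loop_const[of "of_real m"], of 1 "-1"] by simp
    have t: "circle_test (\<lambda>t. \<psi> t - m)"
      using smooth_loop_circle_test[OF sl bounded_linear_Re] by simp
    have "mean (\<lambda>t. of_real (\<psi> t - m)) = 0" 
      using mean_diff[OF sL circle_L2_const[of "of_real m"]] mm by (simp add: mean_const)
    then obtain \<phi> where p: "circle_test \<phi>" "deriv \<phi> = (\<lambda>t. \<psi> t - m)" using circle_test_antiderivative[OF t] by blast
    have *: "mean (\<lambda>t. of_real (\<psi> t - m) * f t) = mean (\<lambda>t. of_real (\<psi> t - m) * g t)"
      using eq[OF p(1)] circle_test_by_parts[OF p(1) f] by (simp add: p(2))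
    have e: "mean (\<lambda>t. of_real (\<psi> t - m) * u t) = mean (\<lambda>t. of_real (\<psi> t) * u t) - of_real m * mean u" if "circle_L2 u" for u
      using mean_diff[OF circle_test_mult_L2[OF psi that] circle_L2_cmult[OF that, of "of_real m"]]
      by (simp add: left_diff_distrib mean_cmult)
    have "mean (\<lambda>t. of_real (\<psi> t) * (f t + c)) = mean (\<lambda>t. of_real (\<psi> t) * f t) + c * of_real m"
      using mean_add[OF circle_test_mult_L2[OF psi fL] circle_L2_cmult[OF sL, of c]]
      by (simp add: distrib_left mean_cmult mm mult.commute)
    then show "mean (\<lambda>t. of_real (\<psi> t) * (f t + c)) = mean (\<lambda>t. of_real (\<psi> t) * g t)"
      using * unfolding e[OF fL] e[OF g] by (simp add: c_def algebra_simps)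
  qed
  then show ?thesis using fc that by blast
qed

lemma has_weak_deriv_0: "circle_L2 f \<Longrightarrow> has_weak_deriv 0 f f"
  by (simp add: has_weak_deriv_iff)

text \<open>One integration by parts. This makes the definition, which lists all orders separately,
  recursive in the order.\<close>

lemma has_weak_deriv_Suc:
  assumes "prim f g" shows "has_weak_deriv (Suc j) f x \<longleftrightarrow> has_weak_deriv j g x"
proof -
  have "mean (\<lambda>t. of_real ((deriv ^^ Suc j) \<phi> t) * f t) = - mean (\<lambda>t. of_real ((deriv ^^ j) \<phi> t) * g t)" if "circle_test \<phi>" for \<phi>
    using circle_test_by_parts[OF circle_test_deriv[OF that] assms] by simp
  then show ?thesis unfolding has_weak_deriv_iff by (auto simp: minus_equation_iff[of "mean _"] simp del: funpow.simps)
qed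

lemma has_weak_deriv_unique:
  assumes "has_weak_deriv j f g" "has_weak_deriv j f h" shows "AE t in circ. g t = h t"
  by (rule weak_unique) (use assms in \<open>auto simp: has_weak_deriv_iff\<close>)

lemma has_weak_deriv_cong:
  assumes "AE t in circ. f t = g t" "circle_L2 f" "circle_L2 g"
  shows "has_weak_deriv j f x \<longleftrightarrow> has_weak_deriv j g x"
proof -
  have "mean (\<lambda>t. of_real ((deriv ^^ j) \<phi> t) * f t) = mean (\<lambda>t. of_real ((deriv ^^ j) \<phi> t) * g t)" if "circle_test \<phi>" for \<phi>
    unfolding mean_def
    by (rule integral_cong_AE)
      (use assms circle_test_mult_L2[OF circle_test_deriv[OF that]] circle_L2_measurable in \<open>auto intro!: borel_circ\<close>)
  then show ?thesis by (simp add: has_weak_deriv_iff)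
qed

lemma weak_deriv_Suc: "prim f g \<Longrightarrow> weak_deriv (Suc j) f = weak_deriv j g"
  by (simp add: weak_deriv_def has_weak_deriv_Suc)

lemma weak_deriv_0:
  assumes "circle_L2 f" shows "circle_L2 (weak_deriv 0 f)" "AE t in circ. weak_deriv 0 f t = f t"
proof -
  have w: "has_weak_deriv 0 f (weak_deriv 0 f)"
    unfolding weak_deriv_def by (rule someI[of _ f]) (rule has_weak_deriv_0[OF assms])
  then show "circle_L2 (weak_deriv 0 f)" by (simp add: has_weak_deriv_iff)
  show "AE t in circ. weak_deriv 0 f t = f t"
    by (rule has_weak_deriv_unique[OF w has_weak_deriv_0[OF assms]])
qed

text \<open>The weak derivative of order 0 is chosen arbitrarily and equals f only almost
  everywhere.\<close>

lemma l2ip_weak_deriv_0: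
  assumes "circle_L2 f" "circle_L2 g" shows "l2ip (weak_deriv 0 f) (weak_deriv 0 g) = l2ip f g"
  unfolding l2ip_def
proof (rule integral_cong_AE)
  show "AE t in circ. weak_deriv 0 f t \<bullet> weak_deriv 0 g t = f t \<bullet> g t"
    using weak_deriv_0(2)[OF assms(1)] weak_deriv_0(2)[OF assms(2)] by eventually_elim simp
  have [measurable]: "f \<in> borel_measurable borel" "g \<in> borel_measurable borel"
     "weak_deriv 0 f \<in> borel_measurable borel" "weak_deriv 0 g \<in> borel_measurable borel"
    using assms weak_deriv_0(1) circle_L2_measurable by blast+
  have "(\<lambda>t. weak_deriv 0 f t \<bullet> weak_deriv 0 g t) \<in> borel_measurable borel" "(\<lambda>t. f t \<bullet> g t) \<in> borel_measurable borel"
    by measurable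
  then show "(\<lambda>t. weak_deriv 0 f t \<bullet> weak_deriv 0 g t) \<in> borel_measurable circ" "(\<lambda>t. f t \<bullet> g t) \<in> borel_measurable circ"
    by (auto intro: borel_circ)
qed

text \<open>Order 0 is all of L^2, for which \<open>sobolev 0\<close> would be too small since it
  asks for continuity. With this start, order m + 1 consists of the primitives of order m for every
  m.\<close>

definition W :: "nat \<Rightarrow> (real \<Rightarrow> complex) set"
  where "W m = (if m = 0 then Collect circle_L2 else sobolev m)"

definition wip :: "nat \<Rightarrow> (real \<Rightarrow> complex) \<Rightarrow> (real \<Rightarrow> complex) \<Rightarrow> real"
  where "wip m = (if m = 0 then l2ip else sobolev_ip m)"

lemma W_0 [simp]: "f \<in> W 0 \<longleftrightarrow> circle_L2 f" by (simp add: W_def)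

lemma wip_0 [simp]: "wip 0 f g = l2ip f g" by (simp add: wip_def)

text \<open>The theorem of du Bois-Reymond gives an absolutely continuous function equal to f almost
  everywhere, and continuity makes them equal. For m > 0 it is applied once more, to replace the
  derivative by its continuous representative.\<close>

lemma W_Suc_imp:
  assumes "f \<in> W (Suc m)" obtains g where "g \<in> W m" "prim f g"
proof -
  have f: "per f" "continuous_on UNIV f" "\<And>j. j \<le> Suc m \<Longrightarrow> \<exists>g. has_weak_deriv j f g"
    using assms by (auto simp: W_def sobolev_def)
  have fL: "circle_L2 f" by (rule circle_L2_continuous) (use f in auto)
  obtain g where g: "has_weak_deriv 1 f g" using f(3)[of 1] by auto
  obtain f0 where f0: "prim f0 g" "AE t in circ. f0 t = f t" using du_Bois_Reymond[OF fL g] by blast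
  have "l2ip (f0 - f) (f0 - f) = 0" unfolding l2ip_self by (rule integral_eq_zero_AE) (use f0(2) in auto)
  moreover have "continuous_on UNIV (f0 - f)" unfolding fun_diff_def using prim_continuous[OF f0(1)] f(2) by (intro continuous_intros)
  moreover have "per (f0 - f)" using prim_per[OF f0(1)] f(1) by simp
  ultimately have "f0 - f = (\<lambda>t. 0)" by (intro l2_eq_0_continuous)
  then have "f0 = f" by (auto simp: fun_eq_iff)
  then have fg: "prim f g" using f0 by simp
  show ?thesis
  proof (cases m)
    case 0
    then show ?thesis using that[of g] fg prim_L2[OF fg] by simp
  next
    case (Suc k)
    have gL: "circle_L2 g" by (rule prim_L2[OF fg])
    have wg: "\<exists>x. has_weak_deriv j g x" if "j \<le> m" for j
      using f(3)[of "Suc j"] that has_weak_deriv_Suc[OF fg] by auto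
    obtain h where "has_weak_deriv 1 g h" using wg[of 1] Suc by auto
    then obtain g0 where g0: "prim g0 h" "AE t in circ. g0 t = g t" using du_Bois_Reymond[OF gL] by blast
    have g0L: "circle_L2 g0" by (rule prim_L2'[OF g0(1)])
    have "prim f g0" by (rule prim_AE[OF fg g0L]) (use g0(2) in auto)
    moreover have "\<exists>x. has_weak_deriv j g0 x" if "j \<le> m" for j
      using wg[OF that] has_weak_deriv_cong[OF g0(2) g0L gL] by simp
    then have "g0 \<in> W m"
      using Suc prim_per[OF g0(1)] prim_continuous[OF g0(1)] by (simp add: W_def sobolev_def)
    ultimately show ?thesis using that by blast
  qed
qed

lemma W_L2: "f \<in> W m \<Longrightarrow> circle_L2 f"
  by (cases m) (auto elim: W_Suc_imp intro: prim_L2')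

lemma W_SucI: assumes "g \<in> W m" "prim f g" shows "f \<in> W (Suc m)"
proof -
  have "\<exists>x. has_weak_deriv j f x" if "j \<le> Suc m" for j
  proof (cases j)
    case 0
    then show ?thesis using has_weak_deriv_0[OF prim_L2'[OF assms(2)]] by blast
  next
    case (Suc i)
    have "\<exists>x. has_weak_deriv i g x"
    proof (cases m)
      case 0
      then show ?thesis using has_weak_deriv_0[OF prim_L2[OF assms(2)]] that Suc by auto
    qed (use assms Suc that in \<open>auto simp: W_def sobolev_def\<close>)
    then show ?thesis using has_weak_deriv_Suc[OF assms(2)] Suc by blast
  qed
  then show ?thesis using prim_per[OF assms(2)] prim_continuous[OF assms(2)] by (auto simp: W_def sobolev_def)
qed

lemma W_Suc_iff: "f \<in> W (Suc m) \<longleftrightarrow> (\<exists>g\<in>W m. prim f g)"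
  using W_SucI W_Suc_imp by metis

text \<open>The sum over all orders becomes a recursion: the term of order 0 splits off and the
  others are shifted. All later norm estimates use this form.\<close>

lemma wip_Suc:
  assumes "prim f g" "prim f' g'"
  shows "wip (Suc m) f f' = l2ip f f' + wip m g g'"
proof -
  have ip: "sobolev_ip m f f' = (\<Sum>j\<le>m. l2ip (weak_deriv j f) (weak_deriv j f'))" for m f f'
    by (simp add: sobolev_ip_def l2ip_def set_integral_circ)
  have "wip (Suc m) f f' = l2ip (weak_deriv 0 f) (weak_deriv 0 f') + (\<Sum>j\<le>m. l2ip (weak_deriv (Suc j) f) (weak_deriv (Suc j) f'))"
    by (simp add: wip_def ip sum.atMost_Suc_shift del: sum.atMost_Suc)
  also have "\<dots> = l2ip f f' + (\<Sum>j\<le>m. l2ip (weak_deriv j g) (weak_deriv j g'))"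
    using assms by (simp add: l2ip_weak_deriv_0 prim_L2' weak_deriv_Suc)
  also have "(\<Sum>j\<le>m. l2ip (weak_deriv j g) (weak_deriv j g')) = wip m g g'"
    using assms by (cases m) (simp_all add: wip_def ip l2ip_weak_deriv_0 prim_L2)
  finally show ?thesis .
qed

lemma W_lincomb: "f \<in> W m \<Longrightarrow> g \<in> W m \<Longrightarrow> (\<lambda>t. a * f t + b * g t) \<in> W m"
proof (induction m arbitrary: f g)
  case 0
  then show ?case by (simp add: circle_L2_add circle_L2_cmult)
next
  case (Suc m)
  obtain f' where f: "f' \<in> W m" "prim f f'" using Suc.prems(1) by (rule W_Suc_imp)
  obtain g' where g: "g' \<in> W m" "prim g g'" using Suc.prems(2) by (rule W_Suc_imp)
  show ?case by (rule W_SucI[OF Suc.IH[OF f(1) g(1)] prim_add[OF prim_cmult[OF f(2)] prim_cmult[OF g(2)]]])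
qed

lemma W_const: "(\<lambda>t. c) \<in> W m"
  by (induction m arbitrary: c) (auto intro: circle_L2_const W_SucI prim_const)

interpretation Wm: semi_ip "W m" "wip m" for m
proof
  show "subspace (W m)"
  proof (rule subspaceI)
    show "0 \<in> W m" using W_const[of 0 m] by (simp add: zero_fun_def)
    show "x + y \<in> W m" if "x \<in> W m" "y \<in> W m" for x y
      using W_lincomb[OF that, of 1 1] by (simp add: plus_fun_def)
    show "c *\<^sub>R x \<in> W m" if "x \<in> W m" for c x
      using W_lincomb[OF that that, of "of_real c" 0] by (simp add: scaleR_fun_def scaleR_conv_of_real)
  qed
  \<comment> \<open>The four axioms form one conjunction so that a single induction on m proves them
    all.\<close>
  have P: "(x \<in> W m \<longrightarrow> 0 \<le> wip m x x) \<and>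
     (x \<in> W m \<longrightarrow> y \<in> W m \<longrightarrow> wip m x y = wip m y x) \<and>
     (x \<in> W m \<longrightarrow> y \<in> W m \<longrightarrow> wip m (c *\<^sub>R x) y = c * wip m x y) \<and>
     (x \<in> W m \<longrightarrow> y \<in> W m \<longrightarrow> z \<in> W m \<longrightarrow> wip m (x + y) z = wip m x z + wip m y z)" for x y z c
  proof (induction m arbitrary: x y z c)
    case 0
    show ?case using L2.nonneg L2.sym L2.add L2.scale unfolding W_0 wip_0 mem_Collect_eq by blast
  next
    case (Suc m)
    have nn: "0 \<le> wip m x x" if "x \<in> W m" for x using Suc.IH[of x x 0 x] that by (elim conjE) iprover
    have sy: "wip m x y = wip m y x" if "x \<in> W m" "y \<in> W m" for x y using Suc.IH[of x y 0 x] that by (elim conjE) iprover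
    have sc: "wip m (c *\<^sub>R x) y = c * wip m x y" if "x \<in> W m" "y \<in> W m" for x y c using Suc.IH[of x y c x] that by (elim conjE) iprover
    have ad: "wip m (x + y) z = wip m x z + wip m y z" if "x \<in> W m" "y \<in> W m" "z \<in> W m" for x y z using Suc.IH[of x y 0 z] that by (elim conjE) iprover
    have 1: "0 \<le> wip (Suc m) x x" if xW: "x \<in> W (Suc m)"
    proof -
      obtain x' where x: "x' \<in> W m" "prim x x'" using xW by (rule W_Suc_imp)
      show ?thesis using nn[OF x(1)] L2.nonneg[of x] prim_L2'[OF x(2)] by (simp add: wip_Suc[OF x(2) x(2)])
    qed
    {
      assume xy: "x \<in> W (Suc m)" "y \<in> W (Suc m)"
      obtain x' where x: "x' \<in> W m" "prim x x'" using xy(1) by (rule W_Suc_imp)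
      obtain y' where y: "y' \<in> W m" "prim y y'" using xy(2) by (rule W_Suc_imp)
      have xL: "circle_L2 x" "circle_L2 y" by (rule prim_L2'[OF x(2)], rule prim_L2'[OF y(2)])
      have px: "prim (c *\<^sub>R x) (c *\<^sub>R x')"
        using prim_cmult[OF x(2), of "of_real c"] by (simp add: scaleR_fun_def scaleR_conv_of_real)
      have "wip (Suc m) x y = wip (Suc m) y x"
        using sy[OF x(1) y(1)] L2.sym[of x y] xL by (simp add: wip_Suc[OF x(2) y(2)] wip_Suc[OF y(2) x(2)])
      moreover have "wip (Suc m) (c *\<^sub>R x) y = c * wip (Suc m) x y"
        using sc[OF x(1) y(1), of c] L2.scale[of x y c] xL
        by (simp add: wip_Suc[OF x(2) y(2)] wip_Suc[OF px y(2)] distrib_left)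
      moreover have "wip (Suc m) (x + y) z = wip (Suc m) x z + wip (Suc m) y z" if zW: "z \<in> W (Suc m)"
      proof -
        obtain z' where z: "z' \<in> W m" "prim z z'" using zW by (rule W_Suc_imp)
        have pxy: "prim (x + y) (x' + y')" using prim_add[OF x(2) y(2)] by (simp add: plus_fun_def)
        show ?thesis using ad[OF x(1) y(1) z(1)] L2.add[of x y z] xL prim_L2'[OF z(2)]
          by (simp add: wip_Suc[OF x(2) z(2)] wip_Suc[OF y(2) z(2)] wip_Suc[OF pxy z(2)])
      qed
      ultimately have "wip (Suc m) x y = wip (Suc m) y x \<and> wip (Suc m) (c *\<^sub>R x) y = c * wip (Suc m) x y \<and>
        (z \<in> W (Suc m) \<longrightarrow> wip (Suc m) (x + y) z = wip (Suc m) x z + wip (Suc m) y z)" by blast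
    }
    with 1 show ?case by blast
  qed
  show "wip m x y = wip m y x" if "x \<in> W m" "y \<in> W m" for x y using P that by blast
  show "wip m (x + y) z = wip m x z + wip m y z" if "x \<in> W m" "y \<in> W m" "z \<in> W m" for x y z using P that by blast
  show "wip m (c *\<^sub>R x) y = c * wip m x y" if "x \<in> W m" "y \<in> W m" for x y c using P that by blast
  show "0 \<le> wip m x x" if "x \<in> W m" for x using P that by blast
qed

section \<open>Sobolev norms and the embedding into continuous functions\<close>

abbreviation wn :: "nat \<Rightarrow> (real \<Rightarrow> complex) \<Rightarrow> real" where "wn m f \<equiv> sqrt (wip m f f)"

lemma wn_Suc: "prim f g \<Longrightarrow> g \<in> W m \<Longrightarrow> (wn (Suc m) f)\<^sup>2 = (l2 f)\<^sup>2 + (wn m g)\<^sup>2"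
  using L2.nonneg[of f] Wm.nonneg[of g m] by (simp add: wip_Suc prim_L2')

lemma l2_le_wn: "f \<in> W m \<Longrightarrow> l2 f \<le> wn m f"
proof (cases m)
  case (Suc k)
  assume "f \<in> W m"
  then have "f \<in> W (Suc k)" using Suc by simp
  then obtain g where "g \<in> W k" "prim f g" by (rule W_Suc_imp)
  then show ?thesis using Wm.nonneg[of g k] Suc by (simp add: wip_Suc)
qed simp

lemma wn_le_Suc: assumes "prim f g" "g \<in> W m" shows "wn m g \<le> wn (Suc m) f"
  using assms L2.nonneg[of f] by (simp add: wip_Suc prim_L2')

lemma W_Suc_subset: "f \<in> W (Suc m) \<Longrightarrow> f \<in> W m \<and> wn m f \<le> wn (Suc m) f"
proof (induction m arbitrary: f)
  case 0
  then show ?case using W_L2 l2_le_wn[OF 0] by simp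
next
  case (Suc m)
  obtain g where g: "g \<in> W (Suc m)" "prim f g" using Suc.prems by (rule W_Suc_imp)
  from Suc.IH[OF g(1)] have "g \<in> W m" "wip m g g \<le> wip (Suc m) g g" by auto
  then show ?case using g by (auto simp: wip_Suc[OF g(2) g(2)] intro: W_SucI)
qed

lemma W_antimono: "m \<le> n \<Longrightarrow> f \<in> W n \<Longrightarrow> f \<in> W m \<and> wn m f \<le> wn n f"
proof (induction n rule: dec_induct)
  case (step n)
  then show ?case using W_Suc_subset[of f n] by fastforce
qed simp

lemma W_per: "f \<in> W m \<Longrightarrow> per f" using W_L2 by (simp add: circle_L2_iff)

lemma W_continuous: "f \<in> W m \<Longrightarrow> 1 \<le> m \<Longrightarrow> continuous_on UNIV f"
  by (cases m) (auto simp: W_Suc_iff intro: prim_continuous)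

text \<open>The 3 collects l2 f + 2 l2 g from \<open>prim_sup_le\<close>; either norm is at most the
  one of order one.\<close>

lemma W_sup_le: assumes "f \<in> W m" "1 \<le> m" shows "cmod (f t) \<le> 3 * wn m f"
proof -
  have 1: "f \<in> W (Suc 0)" "wn (Suc 0) f \<le> wn m f" using W_antimono[of "Suc 0" m f] assms by auto
  obtain g where g: "g \<in> W 0" "prim f g" using 1(1) by (rule W_Suc_imp)
  have "l2 f \<le> wn (Suc 0) f" using l2_le_wn[OF 1(1)] .
  moreover have "l2 g \<le> wn (Suc 0) f" using wn_le_Suc[OF g(2,1)] by simp
  ultimately show ?thesis using prim_sup_le[OF g(2), of t] 1(2) by linarith
qed

lemma wip_eq_0: assumes "f \<in> W m" "1 \<le> m" "wip m f f = 0" shows "f = 0"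
  using W_sup_le[OF assms(1,2)] assms(3) by (auto simp: fun_eq_iff)

section \<open>Convergence in Sobolev spaces\<close>

text \<open>Membership is bundled with convergence, so one statement says that an operation maps a
  level to itself and is sequentially continuous there.\<close>

definition cv :: "nat \<Rightarrow> (nat \<Rightarrow> real \<Rightarrow> complex) \<Rightarrow> (real \<Rightarrow> complex) \<Rightarrow> bool"
  where "cv m X x \<longleftrightarrow> (\<forall>n. X n \<in> W m) \<and> x \<in> W m \<and> (\<lambda>n. wn m (X n - x)) \<longlonglongrightarrow> 0"

lemma cv_D: assumes "cv m X x" shows "X n \<in> W m" "x \<in> W m" "X n - x \<in> W m" "(\<lambda>n. wn m (X n - x)) \<longlonglongrightarrow> 0"
  using assms Wm.diff_in by (auto simp: cv_def)

lemma cvI: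
  assumes "\<And>n. X n \<in> W m" "x \<in> W m" "\<And>n. wn m (X n - x) \<le> b n" "b \<longlonglongrightarrow> 0"
  shows "cv m X x"
proof -
  have "(\<lambda>n. wn m (X n - x)) \<longlonglongrightarrow> 0"
  proof (rule Lim_null_comparison[OF always_eventually assms(4)], rule allI)
    fix n
    have "0 \<le> wn m (X n - x)" by (rule Wm.N_nonneg[OF Wm.diff_in[OF assms(1,2)]])
    then show "norm (wn m (X n - x)) \<le> b n" using assms(3)[of n] by (simp only: real_norm_def abs_of_nonneg)
  qed
  then show ?thesis using assms(1,2) by (simp add: cv_def)
qed

lemma cv_0: "cv 0 X x \<longleftrightarrow> l2conv X x"
  by (simp add: cv_def l2conv_def)

lemma cv_const: "x \<in> W m \<Longrightarrow> cv m (\<lambda>n. x) x"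
  by (rule cvI[where b="\<lambda>n. 0"]) (simp_all add: Wm.zero_zero)

lemma cv_l2conv: assumes "cv m X x" shows "l2conv X x"
  by (rule l2convI[OF W_L2[OF cv_D(1)[OF assms]] W_L2[OF cv_D(2)[OF assms]] l2_le_wn[OF cv_D(3)[OF assms]] cv_D(4)[OF assms]])

lemma cv_antimono: assumes "cv n X x" "m \<le> n" shows "cv m X x"
proof (rule cvI[OF _ _ _ cv_D(4)[OF assms(1)]])
  show "X k \<in> W m" for k using W_antimono[OF assms(2) cv_D(1)[OF assms(1)]] by blast
  show "x \<in> W m" using W_antimono[OF assms(2) cv_D(2)[OF assms(1)]] by blast
  show "wn m (X k - x) \<le> wn n (X k - x)" for k using W_antimono[OF assms(2) cv_D(3)[OF assms(1)]] by blast
qed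

lemma cv_uconv: assumes "cv m X x" "1 \<le> m" shows "uconv X x"
proof (rule uconv_normI)
  show "cmod (X n t - x t) \<le> 3 * wn m (X n - x)" for n t
    using W_sup_le[OF cv_D(3)[OF assms(1)] assms(2), of n t] by simp
  show "(\<lambda>n. 3 * wn m (X n - x)) \<longlonglongrightarrow> 0" by (rule tendsto_mult_right_zero[OF cv_D(4)[OF assms(1)]])
qed

lemma cv_pointwise: "cv m X x \<Longrightarrow> 1 \<le> m \<Longrightarrow> (\<lambda>n. X n t) \<longlonglongrightarrow> x t"
  by (rule tendsto_uniform_limitI[OF cv_uconv UNIV_I])

lemma cv_subseq: "cv m X x \<Longrightarrow> strict_mono r \<Longrightarrow> cv m (\<lambda>n. X (r n)) x"
  unfolding cv_def using LIMSEQ_subseq_LIMSEQ[of "\<lambda>n. wn m (X n - x)" 0 r] by (simp add: o_def)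

lemma uconv_l2conv:
  assumes "uconv X x" "\<And>n. circle_L2 (X n)" "circle_L2 x" shows "l2conv X x"
  unfolding l2conv_def
proof (intro conjI allI assms(2,3) LIMSEQ_I)
  fix e :: real assume "0 < e"
  then have "\<forall>\<^sub>F n in sequentially. \<forall>t\<in>UNIV. dist (X n t) (x t) < e / 2" by (intro uniform_limitD[OF assms(1)]) simp
  then obtain N where N: "\<And>n t. N \<le> n \<Longrightarrow> dist (X n t) (x t) < e / 2" by (auto simp: eventually_sequentially)
  have "norm (l2 (X n - x) - 0) < e" if "N \<le> n" for n
  proof -
    have "l2 (X n - x) \<le> e / 2"
      by (rule l2_bound[OF circle_L2_diff[OF assms(2,3)]]) (use N[OF that] \<open>0 < e\<close> in \<open>auto simp: dist_norm less_imp_le\<close>)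
    moreover have "0 \<le> l2 (X n - x)" by (simp add: l2ip_self)
    ultimately show ?thesis using \<open>0 < e\<close> by (simp only: real_norm_def diff_0_right abs_of_nonneg)
  qed
  then show "\<exists>N. \<forall>n\<ge>N. norm (l2 (X n - x) - 0) < e" by blast
qed

lemma prim_fun_diff: "prim f g \<Longrightarrow> prim f' g' \<Longrightarrow> prim (f - f') (g - g')"
  unfolding fun_diff_def by (rule prim_diff)

lemma wn_Suc_le: assumes "prim f g" "g \<in> W m" shows "wn (Suc m) f \<le> l2 f + wn m g"
proof -
  have "(wn (Suc m) f)\<^sup>2 = (l2 f)\<^sup>2 + (wn m g)\<^sup>2" by (rule wn_Suc[OF assms])
  also have "\<dots> \<le> (l2 f + wn m g)\<^sup>2"
    using L2.nonneg[of f] prim_L2'[OF assms(1)] Wm.nonneg[OF assms(2)] by (simp add: power2_sum)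
  finally show ?thesis
    by (rule power2_le_imp_le) (use L2.nonneg[of f] prim_L2'[OF assms(1)] Wm.nonneg[OF assms(2)] in simp)
qed

lemma cv_Suc_prim:
  assumes "cv (Suc m) X x" "\<And>n. prim (X n) (G n)" "prim x g" "\<And>n. G n \<in> W m" "g \<in> W m"
  shows "cv m G g"
  by (rule cvI[OF assms(4,5) wn_le_Suc[OF prim_fun_diff[OF assms(2,3)] Wm.diff_in[OF assms(4,5)]] cv_D(4)[OF assms(1)]])

lemma cv_SucE:
  assumes "cv (Suc m) X x"
  obtains G g where "\<And>n. prim (X n) (G n)" "prim x g" "cv m G g"
proof -
  have "\<exists>G. G \<in> W m \<and> prim (X n) G" for n using cv_D(1)[OF assms, of n] by (auto simp: W_Suc_iff)
  then obtain G where G: "\<And>n. G n \<in> W m" "\<And>n. prim (X n) (G n)" by metis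
  obtain g where g: "g \<in> W m" "prim x g" using cv_D(2)[OF assms] by (rule W_Suc_imp)
  show ?thesis by (rule that[OF G(2) g(2) cv_Suc_prim[OF assms G(2) g(2) G(1) g(1)]])
qed

lemma cv_SucI:
  assumes "\<And>n. prim (X n) (G n)" "prim x g" "cv m G g" "l2conv X x"
  shows "cv (Suc m) X x"
proof (rule cvI)
  show "X n \<in> W (Suc m)" for n by (rule W_SucI[OF cv_D(1)[OF assms(3)] assms(1)])
  show "x \<in> W (Suc m)" by (rule W_SucI[OF cv_D(2)[OF assms(3)] assms(2)])
  show "wn (Suc m) (X n - x) \<le> l2 (X n - x) + wn m (G n - g)" for n
    by (rule wn_Suc_le[OF prim_fun_diff[OF assms(1,2)] cv_D(3)[OF assms(3)]])
  show "(\<lambda>n. l2 (X n - x) + wn m (G n - g)) \<longlonglongrightarrow> 0"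
    using tendsto_add[OF l2conv_D(4)[OF assms(4)] cv_D(4)[OF assms(3)]] by simp
qed

subsection \<open>Completeness, compactness and density\<close>

text \<open>The derivatives converge by induction, the functions converge uniformly by the
  embedding, and \<open>prim_limit\<close> matches the two limits.\<close>

theorem W_complete:
  assumes "\<And>n. X n \<in> W m" "\<And>e. 0 < e \<Longrightarrow> \<exists>N. \<forall>i\<ge>N. \<forall>j\<ge>N. wn m (X i - X j) < e"
  shows "\<exists>x. cv m X x"
  using assms
proof (induction m arbitrary: X)
  case 0
  have X: "circle_L2 (X n)" for n using 0(1)[of n] by simp
  obtain l where "circle_L2 l" "(\<lambda>n. l2 (X n - l)) \<longlonglongrightarrow> 0"
    by (rule circle_L2_complete[OF X 0(2)[unfolded wip_0]])
  then show ?case using X by (auto simp: cv_0 l2conv_def)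
next
  case (Suc m)
  have "\<exists>G. G \<in> W m \<and> prim (X n) G" for n using Suc.prems(1)[of n] by (auto simp: W_Suc_iff)
  then obtain G where G: "\<And>n. G n \<in> W m" "\<And>n. prim (X n) (G n)" by metis
  have le: "wn m (G i - G j) \<le> wn (Suc m) (X i - X j)" for i j
    by (rule wn_le_Suc[OF prim_fun_diff[OF G(2) G(2)] Wm.diff_in[OF G(1) G(1)]])
  have "\<exists>g. cv m G g"
  proof (rule Suc.IH[OF G(1)])
    fix e :: real assume "0 < e"
    then obtain N where "\<forall>i\<ge>N. \<forall>j\<ge>N. wn (Suc m) (X i - X j) < e" using Suc.prems(2) by blast
    then show "\<exists>N. \<forall>i\<ge>N. \<forall>j\<ge>N. wn m (G i - G j) < e" using le le_less_trans by blast
  qed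
  then obtain g where g: "cv m G g" by blast
  have "uniformly_convergent_on UNIV X"
  proof (rule Cauchy_uniformly_convergent, rule uniformly_Cauchy_onI)
    fix e :: real assume e: "0 < e"
    then obtain N where N: "\<And>i j. N \<le> i \<Longrightarrow> N \<le> j \<Longrightarrow> wn (Suc m) (X i - X j) < e / 3"
      using Suc.prems(2)[of "e / 3"] divide_pos_pos[OF e, of 3] zero_less_numeral by blast
    have "dist (X i t) (X j t) < e" if "N \<le> i" "N \<le> j" for i j t
    proof -
      have "cmod ((X i - X j) t) \<le> 3 * wn (Suc m) (X i - X j)"
        by (rule W_sup_le[OF Wm.diff_in[OF Suc.prems(1) Suc.prems(1)]]) simp
      also have "\<dots> < e" using N[OF that] by linarith
      finally show ?thesis by (simp add: dist_norm)
    qed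
    then show "\<exists>M. \<forall>t\<in>UNIV. \<forall>i\<ge>M. \<forall>j\<ge>M. dist (X i t) (X j t) < e" by blast
  qed
  then obtain x where x: "uconv X x" by (auto simp: uniformly_convergent_on_def)
  have px: "prim x g"
    by (rule prim_limit[where F=X and G=G]) (fact G(2), rule cv_l2conv[OF g], rule tendsto_uniform_limitI[OF x UNIV_I])
  have "l2conv X x" by (rule uconv_l2conv[OF x prim_L2'[OF G(2)] prim_L2'[OF px]])
  then show ?case using cv_SucI[OF G(2) px g] by blast
qed

text \<open>Arzela-Ascoli on the unit interval: the common Hoelder-1/2 bound gives equicontinuity,
  and \<open>W_sup_le\<close> gives the bound 3 * C.\<close>

lemma W_1_uniform_subsequence:
  assumes X: "\<And>n. X n \<in> W 1" "\<And>n. wn 1 (X n) \<le> C"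
  obtains r x where "strict_mono (r :: nat \<Rightarrow> nat)" "circle_L2 x" "uconv (\<lambda>n. X (r n)) x"
proof -
  have "\<exists>G. G \<in> W 0 \<and> prim (X n) G" for n using X(1)[of n] by (auto simp: W_Suc_iff)
  then obtain G where G: "\<And>n. G n \<in> W 0" "\<And>n. prim (X n) (G n)" by metis
  have GC: "l2 (G n) \<le> C" for n
    using wn_le_Suc[OF G(2,1), of n] X(2)[of n] by (simp del: real_sqrt_le_iff)
  have C0: "0 \<le> C" using GC[of 0] by (rule order.trans[rotated]) (simp add: l2ip_self)
  have H: "cmod (X n s - X n t) \<le> sqrt \<bar>s - t\<bar> * C" if "s \<in> {0..1}" "t \<in> {0..1}" for n s t
  proof -
    have *: "cmod (X n b - X n a) \<le> sqrt (b - a) * C" if "0 \<le> a" "a \<le> b" "b \<le> 1" for a b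
      by (rule order.trans[OF prim_Hoelder[OF G(2) that] mult_left_mono[OF GC]]) (use that in simp)
    show ?thesis
      using *[of s t] *[of t s] that by (cases "s \<le> t") (auto simp: norm_minus_commute abs_if)
  qed
  obtain g r where g: "continuous_on {0..1} g" "strict_mono (r :: nat \<Rightarrow> nat)"
    "\<And>e. 0 < e \<Longrightarrow> \<exists>N. \<forall>n x. n \<ge> N \<and> x \<in> {0..1} \<longrightarrow> cmod (X (r n) x - g x) < e"
  proof (rule Arzela_Ascoli[of "{0..1::real}" X "3 * C"])
    show "compact {0..1::real}" by simp
    show "cmod (X n x) \<le> 3 * C" for n x
      by (rule order.trans[OF W_sup_le[OF X(1)]]) (use X(2) in auto)
    show "\<exists>d>0. \<forall>n y. y \<in> {0..1} \<and> norm (x - y) < d \<longrightarrow> cmod (X n x - X n y) < e" if x: "x \<in> {0..1}" and e: "0 < e" for x e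
    \<comment> \<open>Inverts the Hoelder bound sqrt |x - y| * C < e; the added 1 covers C =
      0.\<close>
    proof (intro exI[of _ "(e / (C + 1))\<^sup>2"] conjI allI impI)
      have C1: "0 < C + 1" using C0 by simp
      show "0 < (e / (C + 1))\<^sup>2" using e C1 by simp
      fix n y assume y: "y \<in> {0..1} \<and> norm (x - y) < (e / (C + 1))\<^sup>2"
      then have "sqrt \<bar>x - y\<bar> < e / (C + 1)" using e C1 by (intro real_less_lsqrt) auto
      then have "sqrt \<bar>x - y\<bar> * (C + 1) < e" using C1 by (simp add: pos_less_divide_eq)
      moreover have "sqrt \<bar>x - y\<bar> * C \<le> sqrt \<bar>x - y\<bar> * (C + 1)" by (rule mult_left_mono) auto
      ultimately show "cmod (X n x - X n y) < e" using H[of x y n] x y by linarith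
    qed
  qed (rule that)
  \<comment> \<open>The limit is known on the unit interval only and is continued
    periodically.\<close>
  define x where "x t = g (frac t)" for t
  have u: "uconv (\<lambda>n. X (r n)) x"
  proof (rule uniform_limitI)
    fix e :: real assume "0 < e"
    then obtain N where N: "\<And>n x. n \<ge> N \<Longrightarrow> x \<in> {0..1} \<Longrightarrow> cmod (X (r n) x - g x) < e" using g(3) by blast
    have "dist (X (r n) t) (x t) < e" if "N \<le> n" for n t
      using N[OF that frac_in_unit[of t]] per_frac[OF W_per[OF X(1)]] by (simp add: x_def dist_norm)
    then show "\<forall>\<^sub>F n in sequentially. \<forall>t\<in>UNIV. dist (X (r n) t) (x t) < e"
      by (auto simp: eventually_sequentially)
  qed
  have "\<forall>\<^sub>F n in sequentially. continuous_on UNIV (X (r n))"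
    by (intro always_eventually allI W_continuous[OF X(1)]) simp
  then have "continuous_on UNIV x" by (rule uniform_limit_theorem[OF _ u]) simp
  then have "circle_L2 x" by (rule circle_L2_continuous) (simp add: x_def frac_1_eq)
  then show ?thesis by (rule that[OF g(2) _ u])
qed

text \<open>Rellich's theorem: one subsequence makes the derivatives converge, by induction, and a
  further one the functions.\<close>

theorem W_compact:
  assumes "\<And>n. X n \<in> W (Suc m)" "\<And>n. wn (Suc m) (X n) \<le> C"
  shows "\<exists>r x. strict_mono (r :: nat \<Rightarrow> nat) \<and> cv m (\<lambda>n. X (r n)) x"
  using assms
proof (induction m arbitrary: X)
  case 0
  have 1: "X n \<in> W 1" "wn 1 (X n) \<le> C" for n using 0(1)[of n] 0(2)[of n] by simp_all
  obtain r x where r: "strict_mono (r :: nat \<Rightarrow> nat)" "circle_L2 x" "uconv (\<lambda>n. X (r n)) x"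
    using 1 by (rule W_1_uniform_subsequence)
  then have "cv 0 (\<lambda>n. X (r n)) x" unfolding cv_0
    by (intro uconv_l2conv W_L2[OF 1(1)])
  then show ?case using r by blast
next
  case (Suc m)
  have "\<exists>G. G \<in> W (Suc m) \<and> prim (X n) G" for n using Suc.prems(1)[of n] by (simp only: W_Suc_iff[of _ "Suc m"]) blast
  then obtain G where G: "\<And>n. G n \<in> W (Suc m)" "\<And>n. prim (X n) (G n)" by metis
  have GC: "wn (Suc m) (G n) \<le> C" for n
    by (rule order.trans[OF wn_le_Suc[OF G(2,1)] Suc.prems(2)])
  from Suc.IH[of G, OF G(1) GC] obtain r g where r: "strict_mono (r :: nat \<Rightarrow> nat)" "cv m (\<lambda>n. G (r n)) g" by blast
  have X1: "X (r n) \<in> W 1 \<and> wn 1 (X (r n)) \<le> C" for n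
  proof -
    have "1 \<le> Suc (Suc m)" by simp
    from W_antimono[OF this Suc.prems(1)[of "r n"]] show ?thesis using Suc.prems(2)[of "r n"] order.trans by blast
  qed
  obtain r' x where r': "strict_mono (r' :: nat \<Rightarrow> nat)" "circle_L2 x" "uconv (\<lambda>n. X (r (r' n))) x"
    by (rule W_1_uniform_subsequence[of "\<lambda>n. X (r n)" C]) (use X1 in blast)+
  have cG: "cv m (\<lambda>n. G (r (r' n))) g" by (rule cv_subseq[OF r(2) r'(1)])
  have px: "prim x g"
    by (rule prim_limit[where F="\<lambda>n. X (r (r' n))" and G="\<lambda>n. G (r (r' n))"])
      (rule G(2), rule cv_l2conv[OF cG], rule tendsto_uniform_limitI[OF r'(3) UNIV_I])
  have "cv (Suc m) (\<lambda>n. X (r (r' n))) x"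
    by (rule cv_SucI[where G="\<lambda>n. G (r (r' n))", OF G(2) px cG uconv_l2conv[OF r'(3) prim_L2'[OF G(2)] r'(2)]])
  moreover have "strict_mono (\<lambda>n. r (r' n))" using r(1) r'(1) by (simp add: strict_mono_def)
  ultimately show ?case by (intro exI[of _ "\<lambda>n. r (r' n)"] exI[of _ x] conjI)
qed

lemma smooth_loop_W: "smooth_loop w \<Longrightarrow> w \<in> W m"
proof (induction m arbitrary: w)
  case 0
  then show ?case by (simp add: smooth_loop_L2)
next
  case (Suc m)
  obtain g where "smooth_loop g" "prim w g" using Suc.prems by (rule prim_smooth_loop)
  then show ?case using Suc.IH by (blast intro: W_SucI)
qed

lemma wn_const: "wn m (\<lambda>t. c) = cmod c"
proof (cases m)
  case (Suc k)
  have "(wn (Suc k) (\<lambda>t. c))\<^sup>2 = (l2 (\<lambda>t. c))\<^sup>2 + (wn k (\<lambda>t. 0))\<^sup>2" by (rule wn_Suc[OF prim_const W_const])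
  also have "wn k (\<lambda>t. 0) = 0" using Wm.N_0[of k] by (simp add: zero_fun_def)
  finally have "(wn (Suc k) (\<lambda>t. c))\<^sup>2 = (cmod c)\<^sup>2" by (simp only: l2_const) simp
  then show ?thesis using Wm.N_nonneg[OF W_const[of c "Suc k"]] Suc by (simp only: power2_eq_iff_nonneg norm_ge_zero)
qed (simp only: wip_0 l2_const)

text \<open>Approximants of the derivative are corrected to mean zero before integration. The
  corrections tend to zero since the derivative itself has mean zero.\<close>

lemma W_dense_sequence:
  assumes "x \<in> W m" shows "\<exists>P. (\<forall>n. smooth_loop (P n)) \<and> cv m P x"
  using assms
proof (induction m arbitrary: x)
  case 0
  then have x: "circle_L2 x" by simp
  have "\<exists>p. smooth_loop p \<and> l2 (p - x) < 1 / real (Suc n)" for n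
    using smooth_loop_dense[OF x, of "1 / real (Suc n)"] by auto
  then obtain p where p: "\<And>n. smooth_loop (p n)" "\<And>n. l2 (p n - x) < 1 / real (Suc n)" by metis
  have "(\<lambda>n. 1 / real (Suc n)) \<longlonglongrightarrow> 0" using LIMSEQ_inverse_real_of_nat by (simp add: inverse_eq_divide)
  then have "l2conv p x" by (rule l2convI[OF smooth_loop_L2[OF p(1)] x less_imp_le[OF p(2)]])
  then show ?case using p(1) cv_0 by blast
next
  case (Suc m)
  obtain g where g: "g \<in> W m" "prim x g" using Suc.prems by (rule W_Suc_imp)
  obtain P where P: "\<And>n. smooth_loop (P n)" "cv m P g" using Suc.IH[OF g(1)] by blast
  define Q where "Q n t = P n t - mean (P n)" for n t
  have Qs: "smooth_loop (Q n)" for n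
    using smooth_loop_lincomb[OF P(1)[of n] smooth_loop_const[of "mean (P n)"], of 1 "-1"] by (simp add: Q_def[abs_def])
  have Qm: "mean (Q n) = 0" for n
    using mean_diff[OF smooth_loop_L2[OF P(1)[of n]] circle_L2_const[of "mean (P n)"]] by (simp add: Q_def[abs_def] mean_const)
  have mP: "(\<lambda>n. mean (P n)) \<longlonglongrightarrow> 0" using l2conv_mean[OF cv_l2conv[OF P(2)]] prim_mean[OF g(2)] by simp
  have Qc: "cv m Q g"
  proof (rule cvI[OF smooth_loop_W[OF Qs] g(1)])
    show "wn m (Q n - g) \<le> wn m (P n - g) + cmod (mean (P n))" for n
    proof -
      have "Q n - g = (P n - g) - (\<lambda>t. mean (P n))" by (auto simp: Q_def)
      then show ?thesis using Wm.triangle_diff[OF cv_D(3)[OF P(2)] W_const[of "mean (P n)"]] wn_const[of m "mean (P n)"] by metis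
    qed
    show "(\<lambda>n. wn m (P n - g) + cmod (mean (P n))) \<longlonglongrightarrow> 0"
      using tendsto_add[OF cv_D(4)[OF P(2)] tendsto_norm_zero[OF mP]] by simp
  qed
  have "\<exists>R. smooth_loop R \<and> prim R (Q n) \<and> R 0 = x 0" for n
  proof -
    obtain R where R: "R 0 = x 0" "smooth_loop R" "\<And>t. (R has_vector_derivative Q n t) (at t)"
      by (rule smooth_antiderivative[OF Qs[of n] Qm[of n], of "x 0"]) (rule that)
    then show ?thesis using prim_smooth[OF R(3) smooth_loop_per[OF R(2)] smooth_loop_L2[OF Qs]] by blast
  qed
  then obtain R where R: "\<And>n. smooth_loop (R n)" "\<And>n. prim (R n) (Q n)" "\<And>n. R n 0 = x 0" by metis
  have "uconv R x"
  proof (rule uconv_normI)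
    show "cmod (R n t - x t) \<le> l2 (Q n - g)" for n t
      using prim_diff_le[OF prim_fun_diff[OF R(2)[of n] g(2)], of t] R(3)[of n] by simp
    show "(\<lambda>n. l2 (Q n - g)) \<longlonglongrightarrow> 0" by (rule l2conv_D(4)[OF cv_l2conv[OF Qc]])
  qed
  then have "l2conv R x" by (rule uconv_l2conv[OF _ smooth_loop_L2[OF R(1)] W_L2[OF Suc.prems]])
  then have "cv (Suc m) R x" by (rule cv_SucI[OF R(2) g(2) Qc])
  then show ?case using R(1) by blast
qed

text \<open>Integration by parts moves all derivatives of the Sobolev inner product to a smooth argument.\<close>

lemma smooth_loop_dual:
  assumes "smooth_loop w" shows "\<exists>V. smooth_loop V \<and> (\<forall>f\<in>W m. wip m f w = l2ip f V)"
  using assms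
proof (induction m arbitrary: w)
  case 0
  then show ?case by auto
next
  case (Suc m)
  obtain v where v: "smooth_loop v" "prim w v" using Suc.prems by (rule prim_smooth_loop)
  obtain V where V: "smooth_loop V" "\<And>g. g \<in> W m \<Longrightarrow> wip m g v = l2ip g V" using Suc.IH[OF v(1)] by blast
  obtain V' where V': "smooth_loop V'" "prim V V'" using V(1) by (rule prim_smooth_loop)
  \<comment> \<open>The adjoint of d/dt is -d/dt, whence the minus sign of V'.\<close>
  have 1: "smooth_loop (\<lambda>t. w t - V' t)" using smooth_loop_lincomb[OF Suc.prems V'(1), of 1 "-1"] by simp
  have "wip (Suc m) f w = l2ip f (\<lambda>t. w t - V' t)" if f: "f \<in> W (Suc m)" for f
  proof -
    obtain g where g: "g \<in> W m" "prim f g" using f by (rule W_Suc_imp)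
    have fL: "circle_L2 f" and gL: "circle_L2 g" by (rule prim_L2'[OF g(2)], rule prim_L2[OF g(2)])
    \<comment> \<open>The derivative of the loop f * cnj V has mean zero; the real part of this
      identity is the integration by parts.\<close>
    have "prim (\<lambda>t. f t * cnj (V t)) (\<lambda>t. cnj (V t) * g t + f t * cnj (V' t))"
      by (rule prim_mult[OF g(2) prim_cnj[OF V'(2)]])
    then have "Re (mean (\<lambda>t. cnj (V t) * g t + f t * cnj (V' t))) = 0" by (simp add: prim_mean)
    moreover have "Re (mean (\<lambda>t. cnj (V t) * g t + f t * cnj (V' t))) = l2ip g V + l2ip f V'"
    proof -
      have i1: "integrable circ (\<lambda>t. cnj (V t) * g t + f t * cnj (V' t))"
        by (rule circle_L2_integrable[OF prim_L2]) (rule prim_mult[OF g(2) prim_cnj[OF V'(2)]])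
      have "Re (mean (\<lambda>t. cnj (V t) * g t + f t * cnj (V' t))) = (\<integral>t. Re (cnj (V t) * g t + f t * cnj (V' t)) \<partial>circ)"
        unfolding mean_def by (rule integral_Re[OF i1, symmetric])
      also have "\<dots> = (\<integral>t. g t \<bullet> V t + f t \<bullet> V' t \<partial>circ)"
        by (simp add: inner_complex_def algebra_simps)
      also have "\<dots> = l2ip g V + l2ip f V'" unfolding l2ip_def
        by (rule Bochner_Integration.integral_add)
          (rule circle_L2_inner_integrable[OF gL smooth_loop_L2[OF V(1)]], rule circle_L2_inner_integrable[OF fL smooth_loop_L2[OF V'(1)]])
      finally show ?thesis .
    qed
    ultimately have "l2ip g V = - l2ip f V'" by simp
    moreover have "l2ip f (w - V') = l2ip f w - l2ip f V'"
      by (rule L2.diff_r) (use fL smooth_loop_L2[OF Suc.prems] smooth_loop_L2[OF V'(1)] in simp_all)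
    ultimately show ?thesis using V(2)[OF g(1)] by (simp add: wip_Suc[OF g(2) v(2)] fun_diff_def)
  qed
  with 1 show ?case by blast
qed

subsection \<open>Operations\<close>

lemma cv_lincomb:
  assumes "cv m X x" "cv m Y y" shows "cv m (\<lambda>n t. a * X n t + b * Y n t) (\<lambda>t. a * x t + b * y t)"
  using assms
proof (induction m arbitrary: X x Y y)
  case 0
  have *: "l2conv (\<lambda>n t. c * X n t) (\<lambda>t. c * x t)" if "l2conv X x" for c X x
    by (rule l2conv_mult[OF that, where H="\<lambda>n t. c"]) (auto intro: uniform_limit_const)
  show ?case using 0 unfolding cv_0 by (intro l2conv_add *)
next
  case (Suc m)
  obtain G g where G: "\<And>n. prim (X n) (G n)" "prim x g" "cv m G g" using Suc.prems(1) by (rule cv_SucE) (rule that)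
  obtain H h where H: "\<And>n. prim (Y n) (H n)" "prim y h" "cv m H h" using Suc.prems(2) by (rule cv_SucE) (rule that)
  have *: "l2conv (\<lambda>n t. c * X n t) (\<lambda>t. c * x t)" if "l2conv X x" for c X x
    by (rule l2conv_mult[OF that, where H="\<lambda>n t. c"]) (auto intro: uniform_limit_const)
  show ?case
  proof (rule cv_SucI[where G="\<lambda>n t. a * G n t + b * H n t" and g="\<lambda>t. a * g t + b * h t"])
    show "prim (\<lambda>t. a * X n t + b * Y n t) (\<lambda>t. a * G n t + b * H n t)" for n by (rule prim_add[OF prim_cmult[OF G(1)] prim_cmult[OF H(1)]])
    show "prim (\<lambda>t. a * x t + b * y t) (\<lambda>t. a * g t + b * h t)" by (rule prim_add[OF prim_cmult[OF G(2)] prim_cmult[OF H(2)]])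
    show "cv m (\<lambda>n t. a * G n t + b * H n t) (\<lambda>t. a * g t + b * h t)" by (rule Suc.IH[OF G(3) H(3)])
    show "l2conv (\<lambda>n t. a * X n t + b * Y n t) (\<lambda>t. a * x t + b * y t)"
      by (rule l2conv_add[OF *[OF cv_l2conv[OF Suc.prems(1)]] *[OF cv_l2conv[OF Suc.prems(2)]]])
  qed
qed

lemma cv_add: "cv m X x \<Longrightarrow> cv m Y y \<Longrightarrow> cv m (\<lambda>n t. X n t + Y n t) (\<lambda>t. x t + y t)"
  using cv_lincomb[of m X x Y y 1 1] by simp

lemma cv_diff: "cv m X x \<Longrightarrow> cv m Y y \<Longrightarrow> cv m (\<lambda>n t. X n t - Y n t) (\<lambda>t. x t - y t)"
  using cv_lincomb[of m X x Y y 1 "-1"] by simp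

lemma cv_cmult: "cv m X x \<Longrightarrow> cv m (\<lambda>n t. c * X n t) (\<lambda>t. c * x t)"
  using cv_lincomb[of m X x X x c 0] by simp

lemma cv_const_seq: assumes "c \<longlonglongrightarrow> d" shows "cv m (\<lambda>n t. c n) (\<lambda>t. d)"
proof (rule cvI[OF W_const W_const])
  show "wn m ((\<lambda>t. c n) - (\<lambda>t. d)) \<le> cmod (c n - d)" for n
    using wn_const[of m "c n - d"] by (simp add: fun_diff_def)
  show "(\<lambda>n. cmod (c n - d)) \<longlonglongrightarrow> 0" using assms by (simp add: tendsto_norm_zero LIM_zero)
qed

text \<open>The factor Y converges at least in order one: a product of two L^2 functions need not
  lie in L^2, so at m = 0 one factor has to be bounded. In the product rule X, too, appears as such
  a factor, one order below its own.\<close>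

lemma cv_mult:
  assumes "cv m X x" "cv (max m 1) Y y" shows "cv m (\<lambda>n t. Y n t * X n t) (\<lambda>t. y t * x t)"
  using assms
proof (induction m arbitrary: X x Y y)
  case 0
  then have Y: "cv 1 Y y" by simp
  show ?case unfolding cv_0
    by (rule l2conv_mult[OF cv_l2conv[OF 0(1)] cv_uconv[OF Y order_refl] W_per[OF cv_D(1)[OF Y]] W_continuous[OF cv_D(1)[OF Y] order_refl]])
next
  case (Suc m)
  have X: "cv (max m 1) X x" by (rule cv_antimono[OF Suc.prems(1)]) simp
  have YS: "cv (Suc m) Y y" by (rule cv_antimono[OF Suc.prems(2)]) simp
  have Y: "cv (max m 1) Y y" by (rule cv_antimono[OF Suc.prems(2)]) simp
  have Y1: "cv 1 Y y" by (rule cv_antimono[OF Suc.prems(2)]) simp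
  obtain G g where G: "\<And>n. prim (X n) (G n)" "prim x g" "cv m G g" using Suc.prems(1) by (rule cv_SucE) (rule that)
  obtain H h where H: "\<And>n. prim (Y n) (H n)" "prim y h" "cv m H h" using YS by (rule cv_SucE) (rule that)
  show ?case
  proof (rule cv_SucI)
    show "prim (\<lambda>t. Y n t * X n t) (\<lambda>t. X n t * H n t + Y n t * G n t)" for n by (rule prim_mult[OF H(1) G(1)])
    show "prim (\<lambda>t. y t * x t) (\<lambda>t. x t * h t + y t * g t)" by (rule prim_mult[OF H(2) G(2)])
    show "cv m (\<lambda>n t. X n t * H n t + Y n t * G n t) (\<lambda>t. x t * h t + y t * g t)"
      by (rule cv_add[OF Suc.IH[OF H(3) X] Suc.IH[OF G(3) Y]])
    show "l2conv (\<lambda>n t. Y n t * X n t) (\<lambda>t. y t * x t)"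
      by (rule l2conv_mult[OF cv_l2conv[OF Suc.prems(1)] cv_uconv[OF Y1 order_refl] W_per[OF cv_D(1)[OF Y1]] W_continuous[OF cv_D(1)[OF Y1] order_refl]])
  qed
qed

lemma cv_mult': "cv m X x \<Longrightarrow> cv m Y y \<Longrightarrow> 1 \<le> m \<Longrightarrow> cv m (\<lambda>n t. X n t * Y n t) (\<lambda>t. x t * y t)"
  by (rule cv_mult) (simp_all add: max_absorb1)

lemma cv_mean: "cv m X x \<Longrightarrow> cv m (\<lambda>n t. mean (X n)) (\<lambda>t. mean x)"
  by (rule cv_const_seq[OF l2conv_mean[OF cv_l2conv]])

lemma l2conv_cnj: assumes "l2conv X x" shows "l2conv (\<lambda>n t. cnj (X n t)) (\<lambda>t. cnj (x t))"
proof -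
  have c: "circle_L2 (\<lambda>t. cnj (f t))" if "circle_L2 f" for f
  proof -
    have "(\<lambda>t. cnj (f t)) \<in> borel_measurable borel" 
      by (rule measurable_compose[OF circle_L2_measurable[OF that]]) (intro borel_measurable_continuous_onI continuous_intros)
    then show ?thesis using that by (simp add: circle_L2_iff)
  qed
  show ?thesis
  proof (rule l2convI[OF c[OF l2conv_D(1)[OF assms]] c[OF l2conv_D(2)[OF assms]] _ l2conv_D(4)[OF assms]])
    have "l2ip (\<lambda>t. cnj (f t)) (\<lambda>t. cnj (f t)) = l2ip f f" for f by (simp add: l2ip_self)
    from this[of "X n - x" for n] show "l2 ((\<lambda>t. cnj (X n t)) - (\<lambda>t. cnj (x t))) \<le> l2 (X n - x)" for n
      by (simp add: fun_diff_def)
  qed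
qed

lemma cv_cnj: assumes "cv m X x" shows "cv m (\<lambda>n t. cnj (X n t)) (\<lambda>t. cnj (x t))"
  using assms
proof (induction m arbitrary: X x)
  case 0
  then show ?case unfolding cv_0 by (rule l2conv_cnj)
next
  case (Suc m)
  obtain G g where G: "\<And>n. prim (X n) (G n)" "prim x g" "cv m G g" using Suc.prems(1) by (rule cv_SucE) (rule that)
  show ?case by (rule cv_SucI[OF prim_cnj[OF G(1)] prim_cnj[OF G(2)] Suc.IH[OF G(3)] l2conv_cnj[OF cv_l2conv[OF Suc.prems]]])
qed

text \<open>Without subtracting the mean the primitive would not be periodic. Among the primitives
  it is the one that vanishes at 0.\<close>

definition J :: "(real \<Rightarrow> complex) \<Rightarrow> real \<Rightarrow> complex"
  where "J f = (\<lambda>t. integral {0..frac t} (\<lambda>s. f s - mean f))"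

lemma prim_J: assumes "circle_L2 f" shows "prim (J f) (\<lambda>s. f s - mean f)"
proof -
  have g: "circle_L2 (\<lambda>s. f s - mean f)"
    using circle_L2_diff[OF assms circle_L2_const[of "mean f"]] by (simp add: fun_diff_def)
  have "mean (\<lambda>s. f s - mean f) = 0" using mean_diff[OF assms circle_L2_const[of "mean f"]] by (simp add: mean_const)
  with g obtain F where F: "prim F (\<lambda>s. f s - mean f)" "F 0 = 0" by (rule prim_exists)
  have "F = J f"
  proof
    fix t
    have "F t = F (frac t) - F 0" using per_frac[OF prim_per[OF F(1)], of t] F(2) by simp
    also have "\<dots> = J f t" unfolding J_def
      by (rule integral_unique[symmetric]) (use F(1) frac_in_unit[of t] in \<open>simp add: prim_def\<close>)
    finally show "F t = J f t" .
  qed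
  with F(1) show ?thesis by simp
qed

lemma J_0: "J f 0 = 0" by (simp add: J_def)

lemma prim_zero_unique: assumes "prim f h" "prim g h" "f 0 = g 0" shows "f = g"
proof (rule per_eqI[OF prim_per[OF assms(1)] prim_per[OF assms(2)]])
  fix t :: real assume "t \<in> {0..1}"
  then have "(h has_integral (f t - f 0)) {0..t}" "(h has_integral (g t - g 0)) {0..t}" using assms by (simp_all add: prim_def)
  from has_integral_unique[OF this] show "f t = g t" using assms(3) by simp
qed

lemma J_lincomb:
  assumes "circle_L2 f" "circle_L2 g" shows "J (\<lambda>t. a * f t + b * g t) = (\<lambda>t. a * J f t + b * J g t)"
proof (rule prim_zero_unique)
  have L: "circle_L2 (\<lambda>t. a * f t + b * g t)" by (intro circle_L2_add circle_L2_cmult assms)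
  show "prim (J (\<lambda>t. a * f t + b * g t)) (\<lambda>s. (a * f s + b * g s) - mean (\<lambda>t. a * f t + b * g t))" by (rule prim_J[OF L])
  have "mean (\<lambda>t. a * f t + b * g t) = a * mean f + b * mean g"
    by (simp add: mean_add[OF circle_L2_cmult[OF assms(1)] circle_L2_cmult[OF assms(2)]] mean_cmult)
  then show "prim (\<lambda>t. a * J f t + b * J g t) (\<lambda>s. (a * f s + b * g s) - mean (\<lambda>t. a * f t + b * g t))"
    using prim_add[OF prim_cmult[OF prim_J[OF assms(1)], of a] prim_cmult[OF prim_J[OF assms(2)], of b]]
    by (simp add: algebra_simps)
qed (simp add: J_0)

lemma cv_J: assumes "cv m X x" shows "cv m (\<lambda>n. J (X n)) (J x)"
proof -
  have XL: "circle_L2 (X n)" and xL: "circle_L2 x" for n by (rule W_L2[OF cv_D(1)[OF assms]], rule W_L2[OF cv_D(2)[OF assms]])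
  have c: "cv m (\<lambda>n s. X n s - mean (X n)) (\<lambda>s. x s - mean x)" by (rule cv_diff[OF assms cv_mean[OF assms]])
  have "uconv (\<lambda>n. J (X n)) (J x)"
  proof (rule uconv_normI[OF _ l2conv_D(4)[OF cv_l2conv[OF c]]])
    show "cmod (J (X n) t - J x t) \<le> l2 ((\<lambda>s. X n s - mean (X n)) - (\<lambda>s. x s - mean x))" for n t
      using prim_diff_le[OF prim_fun_diff[OF prim_J[OF XL[of n]] prim_J[OF xL]], of t] by (simp add: J_0)
  qed
  then have "l2conv (\<lambda>n. J (X n)) (J x)"
    by (rule uconv_l2conv[OF _ prim_L2'[OF prim_J[OF XL]] prim_L2'[OF prim_J[OF xL]]])
  then have "cv (Suc m) (\<lambda>n. J (X n)) (J x)" by (rule cv_SucI[OF prim_J[OF XL] prim_J[OF xL] c])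
  \<comment> \<open>The order gained by integration is given up, so that \<open>J\<close> preserves
    levels like the other operators.\<close>
  then show ?thesis by (rule cv_antimono) simp
qed

definition loop_deriv :: "(real \<Rightarrow> complex) \<Rightarrow> real \<Rightarrow> complex"
  where "loop_deriv f = (\<lambda>t. vector_derivative f (at t))"

text \<open>For 1 <= m the derivative has a continuous representative, hence it exists classically
  at every point.\<close>

lemma W_loop_deriv: assumes "f \<in> W (Suc m)" "1 \<le> m"
  shows "loop_deriv f \<in> W m" "prim f (loop_deriv f)" "(f has_vector_derivative loop_deriv f t) (at t)"
proof -
  obtain g where g: "g \<in> W m" "prim f g" using assms(1) by (rule W_Suc_imp)
  have d: "(f has_vector_derivative g t) (at t)" for t by (rule prim_continuous_deriv[OF g(2) W_continuous[OF g(1) assms(2)]])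
  then have "loop_deriv f = g" by (auto simp: loop_deriv_def vector_derivative_at)
  then show "loop_deriv f \<in> W m" "prim f (loop_deriv f)" "(f has_vector_derivative loop_deriv f t) (at t)" using g d by auto
qed

lemma cv_loop_deriv: assumes "cv (Suc m) X x" "1 \<le> m" shows "cv m (\<lambda>n. loop_deriv (X n)) (loop_deriv x)"
  by (rule cv_Suc_prim[OF assms(1) W_loop_deriv(2)[OF cv_D(1)[OF assms(1)] assms(2)] W_loop_deriv(2)[OF cv_D(2)[OF assms(1)] assms(2)]
     W_loop_deriv(1)[OF cv_D(1)[OF assms(1)] assms(2)] W_loop_deriv(1)[OF cv_D(2)[OF assms(1)] assms(2)]])

lemma per_bounded_below:
  fixes f :: "real \<Rightarrow> complex"
  assumes "per f" "continuous_on UNIV f" "\<And>t. f t \<noteq> 0"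
  obtains b where "0 < b" "\<And>t. b \<le> cmod (f t)"
proof -
  have "continuous_on {0..1} (\<lambda>t. cmod (f t))" using continuous_on_subset[OF assms(2)] by (intro continuous_intros) auto
  then obtain s where s: "s \<in> {0..1}" "\<And>t. t \<in> {0..1} \<Longrightarrow> cmod (f s) \<le> cmod (f t)"
    using continuous_attains_inf[of "{0..1::real}" "\<lambda>t. cmod (f t)"] by auto
  have "cmod (f s) \<le> cmod (f t)" for t using s(2)[OF frac_in_unit[of t]] per_frac[OF assms(1), of t] by simp
  then show ?thesis using that[of "cmod (f s)"] assms(3) by simp
qed

lemma uconv_inverse:
  fixes f :: "real \<Rightarrow> complex"
  assumes "uconv F f" "per f" "continuous_on UNIV f" "\<And>t. f t \<noteq> 0"
  shows "uconv (\<lambda>n t. inverse (F n t)) (\<lambda>t. inverse (f t))"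
proof -
  obtain b where "0 < b" "\<And>t. b \<le> cmod (f t)" using assms(2-4) by (rule per_bounded_below) (rule that)
  then show ?thesis using uniform_lim_inverse[OF assms(1), of b] by (simp add: o_def)
qed

lemma prim_inverse:
  assumes "prim f g" "\<And>t. f t \<noteq> 0"
  shows "prim (\<lambda>t. inverse (f t)) (\<lambda>t. - (inverse (f t) * inverse (f t)) * g t)"
proof -
  obtain P p where P: "\<And>n. smooth_loop (P n)" "\<And>n. smooth_loop (p n)"
    "\<And>n t. (P n has_vector_derivative p n t) (at t)" "\<And>n. prim (P n) (p n)" "l2conv p g" "uconv P f"
    by (rule prim_approx[OF assms(1)]) (rule that)
  have pf: "per f" and cf: "continuous_on UNIV f" by (rule prim_per[OF assms(1)], rule prim_continuous[OF assms(1)])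
  obtain b where b: "0 < b" "\<And>t. b \<le> cmod (f t)" using pf cf assms(2) by (rule per_bounded_below) (rule that)
  obtain N where N: "\<And>n t. N \<le> n \<Longrightarrow> dist (P n t) (f t) < b"
    using uniform_limitD[OF P(6) b(1)] by (auto simp: eventually_sequentially)
  \<comment> \<open>The smooth approximants vanish nowhere only from some index on, so a tail is
    taken.\<close>
  define Q where "Q n = P (n + N)" for n
  define q where "q n = p (n + N)" for n
  have Q0: "Q n t \<noteq> 0" for n t
    using N[of "n + N" t] b(2)[of t] by (auto simp: Q_def dist_norm)
  have sm: "strict_mono (\<lambda>n. n + N)" by (simp add: strict_mono_def)
  have uQ: "uconv Q f" unfolding Q_def
    by (rule filterlim_compose[OF P(6) filterlim_subseq[OF sm]])
  have lq: "l2conv q g"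
    using P(5) LIMSEQ_subseq_LIMSEQ[OF l2conv_D(4)[OF P(5)] sm] by (simp add: l2conv_def q_def o_def)
  have sQ: "smooth_loop (Q n)" and sq: "smooth_loop (q n)" for n by (simp_all add: Q_def q_def P)
  have ui: "uconv (\<lambda>n t. inverse (Q n t)) (\<lambda>t. inverse (f t))" by (rule uconv_inverse[OF uQ pf cf assms(2)])
  have ci: "continuous_on UNIV (\<lambda>t. inverse (Q n t))" for n
    using smooth_loop_continuous[OF sQ] Q0 by (intro continuous_intros) auto
  have cif: "continuous_on UNIV (\<lambda>t. inverse (f t))" using cf assms(2) by (intro continuous_intros) auto
  have pi: "per (\<lambda>t. inverse (Q n t))" for n using smooth_loop_per[OF sQ] by simp
  have pif: "per (\<lambda>t. inverse (f t))" using pf by simp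
  have uii: "uconv (\<lambda>n t. - (inverse (Q n t) * inverse (Q n t))) (\<lambda>t. - (inverse (f t) * inverse (f t)))"
    by (rule uniform_limit_uminus[OF uconv_mult[OF ui ui pif pif cif cif]])
  have l: "l2conv (\<lambda>n t. - (inverse (Q n t) * inverse (Q n t)) * q n t) (\<lambda>t. - (inverse (f t) * inverse (f t)) * g t)"
    by (rule l2conv_mult[OF lq uii]) (use smooth_loop_per[OF sQ] ci in \<open>auto intro!: continuous_on_minus continuous_on_mult\<close>)
  show ?thesis
  proof (rule prim_limit[OF _ l])
    show "prim (\<lambda>t. inverse (Q n t)) (\<lambda>t. - (inverse (Q n t) * inverse (Q n t)) * q n t)" for n
    proof (rule prim_smooth)
      show "((\<lambda>t. inverse (Q n t)) has_vector_derivative - (inverse (Q n t) * inverse (Q n t)) * q n t) (at t)" for t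
        using field_vector_diff_chain_at[of "Q n" "q n t" t inverse, OF _ DERIV_inverse[OF Q0]] P(3)[of "n + N" t]
        by (simp add: o_def Q_def q_def power2_eq_square mult_ac)
      show "per (\<lambda>t. inverse (Q n t))" by (rule pi)
      show "circle_L2 (\<lambda>t. - (inverse (Q n t) * inverse (Q n t)) * q n t)" by (rule l2conv_D(1)[OF l])
    qed
    show "(\<lambda>n. inverse (Q n t)) \<longlonglongrightarrow> inverse (f t)" for t by (rule tendsto_uniform_limitI[OF ui UNIV_I])
  qed
qed

text \<open>The derivative -x^(-2) x' contains the inverse at one order less, which the induction
  supplies. At order one uniform convergence of the inverses takes its place.\<close>

lemma cv_inverse_Suc:
  assumes "cv (Suc m) X x" "\<And>n t. X n t \<noteq> 0" "\<And>t. x t \<noteq> 0"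
  shows "cv (Suc m) (\<lambda>n t. inverse (X n t)) (\<lambda>t. inverse (x t))"
  using assms(1)
proof (induction m)
  case 0
  obtain G g where G: "\<And>n. prim (X n) (G n)" "prim x g" "cv 0 G g" using 0 by (rule cv_SucE) (rule that)
  have pX: "per (X n)" "continuous_on UNIV (X n)" for n by (rule prim_per[OF G(1)], rule prim_continuous[OF G(1)])
  have px: "per x" "continuous_on UNIV x" by (rule prim_per[OF G(2)], rule prim_continuous[OF G(2)])
  have u: "uconv X x" by (rule cv_uconv[OF 0]) simp
  have ui: "uconv (\<lambda>n t. inverse (X n t)) (\<lambda>t. inverse (x t))" by (rule uconv_inverse[OF u px assms(3)])
  have cX: "continuous_on UNIV (\<lambda>t. inverse (X n t))" for n using pX assms(2) by (intro continuous_intros) auto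
  have cx: "continuous_on UNIV (\<lambda>t. inverse (x t))" using px assms(3) by (intro continuous_intros) auto
  have pi: "per (\<lambda>t. inverse (X n t))" for n using pX by simp
  have pix: "per (\<lambda>t. inverse (x t))" using px by simp
  have uii: "uconv (\<lambda>n t. - (inverse (X n t) * inverse (X n t))) (\<lambda>t. - (inverse (x t) * inverse (x t)))"
    by (rule uniform_limit_uminus[OF uconv_mult[OF ui ui pix pix cx cx]])
  have l: "l2conv (\<lambda>n t. - (inverse (X n t) * inverse (X n t)) * G n t) (\<lambda>t. - (inverse (x t) * inverse (x t)) * g t)"
    by (rule l2conv_mult[OF cv_l2conv[OF G(3)] uii]) (use pX cX in \<open>auto intro!: continuous_on_minus continuous_on_mult\<close>)
  show ?case
  proof (rule cv_SucI[OF prim_inverse[OF G(1) assms(2)] prim_inverse[OF G(2) assms(3)]])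
    show "l2conv (\<lambda>n t. inverse (X n t)) (\<lambda>t. inverse (x t))"
      by (rule uconv_l2conv[OF ui circle_L2_continuous[OF cX] circle_L2_continuous[OF cx]]) (use pX px in auto)
  qed (use l in \<open>simp add: cv_0\<close>)
next
  case (Suc m)
  obtain G g where G: "\<And>n. prim (X n) (G n)" "prim x g" "cv (Suc m) G g" using Suc.prems by (rule cv_SucE) (rule that)
  have i: "cv (Suc m) (\<lambda>n t. inverse (X n t)) (\<lambda>t. inverse (x t))" by (rule Suc.IH[OF cv_antimono[OF Suc.prems]]) simp
  have ii: "cv (Suc m) (\<lambda>n t. - 1 * (inverse (X n t) * inverse (X n t))) (\<lambda>t. - 1 * (inverse (x t) * inverse (x t)))"
    by (rule cv_cmult[OF cv_mult'[OF i i]]) simp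
  have iig: "cv (Suc m) (\<lambda>n t. (- 1 * (inverse (X n t) * inverse (X n t))) * G n t) (\<lambda>t. (- 1 * (inverse (x t) * inverse (x t))) * g t)"
    by (rule cv_mult'[OF ii G(3)]) simp
  show ?case
    by (rule cv_SucI[OF prim_inverse[OF G(1) assms(2)] prim_inverse[OF G(2) assms(3)] _ cv_l2conv[OF i]])
      (use iig in simp)
qed

lemma cv_inverse:
  assumes "cv m X x" "1 \<le> m" "\<And>n t. X n t \<noteq> 0" "\<And>t. x t \<noteq> 0"
  shows "cv m (\<lambda>n t. inverse (X n t)) (\<lambda>t. inverse (x t))"
  using cv_inverse_Suc[of "m - 1" X x] assms by simp

section \<open>Reparametrisation of loops\<close>

text \<open>Densities are real but kept complex-valued, so that they belong to the same spaces
  \<open>W m\<close> as the loops they act on.\<close>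

definition loop_density :: "(real \<Rightarrow> complex) \<Rightarrow> bool"
  where "loop_density \<rho> \<longleftrightarrow> \<rho> \<in> W 1 \<and> (\<forall>t. 0 < Re (\<rho> t) \<and> Im (\<rho> t) = 0) \<and> mean \<rho> = 1"

text \<open>For \<open>\<rho> = |z|\<^sup>2 / \<parallel>z\<parallel>\<^sup>2\<close> these are the lifts of \<open>t\<^sub>z\<close> and \<open>\<tau>\<^sub>z\<close> to the real line.\<close>

definition clock :: "(real \<Rightarrow> complex) \<Rightarrow> real \<Rightarrow> real"
  where "clock \<rho> t = t + Re (J \<rho> t)"

definition tick :: "(real \<Rightarrow> complex) \<Rightarrow> real \<Rightarrow> real"
  where "tick \<rho> t = (THE s. clock \<rho> s = t)"

definition rep :: "(real \<Rightarrow> complex) \<Rightarrow> (real \<Rightarrow> complex) \<Rightarrow> real \<Rightarrow> complex"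
  where "rep \<rho> u = (\<lambda>t. u (tick \<rho> t))"

text \<open>The conjugate of \<open>J f\<close> is a primitive of the same function and also
  vanishes at 0.\<close>

lemma J_real: assumes "circle_L2 f" "\<And>t. Im (f t) = 0" shows "Im (J f t) = 0"
proof -
  have f: "(\<lambda>t. cnj (f t)) = f" using assms(2) by (auto simp: complex_eq_iff)
  have m: "cnj (mean f) = mean f"
  proof -
    have "mean (\<lambda>t. cnj (f t)) = cnj (mean f)" unfolding mean_def by simp
    then show ?thesis unfolding f by simp
  qed
  have "(\<lambda>t. cnj (J f t)) = J f"
  proof (rule prim_zero_unique[OF prim_cnj[OF prim_J[OF assms(1)]]])
    have "(\<lambda>t. cnj (f t - mean f)) = (\<lambda>t. f t - mean f)" using f m by (simp add: fun_eq_iff)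
    then show "prim (J f) (\<lambda>t. cnj (f t - mean f))" using prim_J[OF assms(1)] by simp
  qed (simp add: J_0)
  then have "cnj (J f t) = J f t" by (rule fun_cong)
  then show ?thesis by (simp add: complex_eq_iff)
qed

context
  fixes \<rho> assumes dens: "loop_density \<rho>"
begin

lemma density_W: "\<rho> \<in> W 1" and density_pos: "0 < Re (\<rho> t)" and density_Im: "Im (\<rho> t) = 0" and density_mean: "mean \<rho> = 1"
  using dens by (auto simp: loop_density_def)

lemma density_L2: "circle_L2 \<rho>" by (rule W_L2[OF density_W])

lemma density_continuous: "continuous_on UNIV \<rho>" by (rule W_continuous[OF density_W]) simp

lemma density_per: "per \<rho>" by (rule W_per[OF density_W])

lemma density_real: "\<rho> t = of_real (Re (\<rho> t))"
  using density_Im[of t] by (simp add: complex_eq_iff)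

lemma density_nonzero: "\<rho> t \<noteq> 0"
  using density_pos[of t] by auto

lemma density_bounds:
  obtains b M where "0 < b" "\<And>t. b \<le> Re (\<rho> t)" "\<And>t. Re (\<rho> t) \<le> M" "0 < M"
proof -
  have n: "cmod (\<rho> t) = Re (\<rho> t)" for t using density_real[of t] density_pos[of t] by (metis abs_of_pos norm_of_real)
  obtain b where "0 < b" "\<And>t. b \<le> cmod (\<rho> t)"
    using density_per density_continuous density_nonzero by (rule per_bounded_below) (rule that)
  moreover obtain M where "0 < M" "\<And>t. norm (\<rho> t) \<le> M"
    using density_per density_continuous by (rule per_bounded) (rule that)
  ultimately show ?thesis using that unfolding n by blast
qed

lemma clock_deriv: "(clock \<rho> has_real_derivative Re (\<rho> t)) (at t)"
proof -
  have c: "continuous_on UNIV (\<lambda>s. \<rho> s - mean \<rho>)" using density_continuous by (intro continuous_intros)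
  have "(J \<rho> has_vector_derivative (\<rho> t - mean \<rho>)) (at t)"
    by (rule prim_continuous_deriv[OF prim_J[OF density_L2] c])
  from bounded_linear.has_vector_derivative[OF bounded_linear_Re this]
  have "((\<lambda>t. Re (J \<rho> t)) has_real_derivative Re (\<rho> t) - 1) (at t)"
    by (simp add: has_real_derivative_iff_has_vector_derivative density_mean)
  from DERIV_add[OF DERIV_ident this] show ?thesis by (simp add: clock_def[abs_def])
qed

lemma clock_add1: "clock \<rho> (t + 1) = clock \<rho> t + 1"
  using prim_per[OF prim_J[OF density_L2]] by (simp add: clock_def)

lemma clock_int: "clock \<rho> (of_int n) = of_int n"
  using per_int[OF prim_per[OF prim_J[OF density_L2]], of 0 n] by (simp add: clock_def J_0)

text \<open>Mean value theorem. The expansion yields both the injectivity of the clock and the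
  Lipschitz bound of its inverse.\<close>

lemma clock_expand: assumes "\<And>t. b \<le> Re (\<rho> t)" shows "b * \<bar>x - y\<bar> \<le> \<bar>clock \<rho> x - clock \<rho> y\<bar>"
proof -
  have *: "b * (v - u) \<le> clock \<rho> v - clock \<rho> u" if uv: "u < v" for u v
  proof -
    obtain c where "clock \<rho> v - clock \<rho> u = (v - u) * Re (\<rho> c)"
      using MVT2[OF uv, of "clock \<rho>" "\<lambda>t. Re (\<rho> t)"] clock_deriv by blast
    then show ?thesis using assms[of c] uv by (simp add: mult.commute mult_right_mono)
  qed
  show ?thesis using *[of x y] *[of y x] by (cases x y rule: linorder_cases) (auto simp: abs_if)
qed

lemma clock_inj: assumes "clock \<rho> x = clock \<rho> y" shows "x = y"
proof -
  obtain b where b: "0 < b" "\<And>t. b \<le> Re (\<rho> t)" by (rule density_bounds) (rule that)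
  then show ?thesis using clock_expand[OF b(2), of x y] assms by (simp add: mult_le_0_iff)
qed

text \<open>The clock fixes the integers, so the intermediate value theorem applies between the two
  integers around t.\<close>

lemma clock_surj: "\<exists>s. clock \<rho> s = t"
proof -
  have "\<exists>s\<ge>of_int \<lfloor>t\<rfloor>. s \<le> of_int (\<lfloor>t\<rfloor> + 1) \<and> clock \<rho> s = t"
  proof (rule IVT)
    show "clock \<rho> (of_int \<lfloor>t\<rfloor>) \<le> t" "t \<le> clock \<rho> (of_int (\<lfloor>t\<rfloor> + 1))"
      unfolding clock_int by linarith+
    show "\<forall>x. of_int \<lfloor>t\<rfloor> \<le> x \<and> x \<le> of_int (\<lfloor>t\<rfloor> + 1) \<longrightarrow> isCont (clock \<rho>) x"
      using DERIV_isCont[OF clock_deriv] by blast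
  qed simp
  then show ?thesis by blast
qed

lemma clock_tick: "clock \<rho> (tick \<rho> t) = t"
proof -
  obtain s where s: "clock \<rho> s = t" using clock_surj by blast
  show ?thesis unfolding tick_def by (rule theI[of _ s]) (use s clock_inj in auto)
qed

lemma tick_eqI: "clock \<rho> s = t \<Longrightarrow> tick \<rho> t = s"
  by (rule clock_inj) (simp add: clock_tick)

lemma tick_add1: "tick \<rho> (t + 1) = tick \<rho> t + 1"
  by (rule tick_eqI) (simp add: clock_add1 clock_tick)

lemma tick_0: "tick \<rho> 0 = 0" and tick_1: "tick \<rho> 1 = 1"
  using tick_eqI[OF clock_int[of 0]] tick_eqI[OF clock_int[of 1]] by simp_all

lemma tick_Lipschitz: assumes "0 < b" "\<And>t. b \<le> Re (\<rho> t)" shows "\<bar>tick \<rho> x - tick \<rho> y\<bar> \<le> \<bar>x - y\<bar> / b"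
  using clock_expand[OF assms(2), of "tick \<rho> x" "tick \<rho> y"] assms(1) by (simp add: clock_tick pos_le_divide_eq mult.commute)

lemma tick_continuous: "isCont (tick \<rho>) t"
proof -
  obtain b where b: "0 < b" "\<And>t. b \<le> Re (\<rho> t)" by (rule density_bounds) (rule that)
  have "(\<lambda>x. tick \<rho> x - tick \<rho> t) \<midarrow>t\<rightarrow> 0"
  proof (rule Lim_null_comparison[OF always_eventually])
    show "\<forall>x. norm (tick \<rho> x - tick \<rho> t) \<le> \<bar>x - t\<bar> / b" using tick_Lipschitz[OF b] by simp
    show "(\<lambda>x. \<bar>x - t\<bar> / b) \<midarrow>t\<rightarrow> 0" using b(1) by (auto intro!: tendsto_eq_intros)
  qed
  then show ?thesis unfolding isCont_def by (simp add: LIM_zero_iff)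
qed

lemma tick_deriv: "(tick \<rho> has_real_derivative inverse (Re (\<rho> (tick \<rho> t)))) (at t)"
  by (rule DERIV_inverse_function[where f="clock \<rho>" and a="t - 1" and b="t + 1", OF clock_deriv])
    (use density_pos[of "tick \<rho> t"] tick_continuous clock_tick in auto)

lemma rep_per: "per u \<Longrightarrow> per (rep \<rho> u)"
  by (simp add: rep_def tick_add1)

text \<open>Substitution along \<open>tick\<close>, whose derivative is 1 / \<rho> at the moved
  point. With nonnegative integrals, integrability is a result of the substitution and not a
  premise.\<close>

lemma rep_L2:
  assumes u: "circle_L2 u" and M: "\<And>t. Re (\<rho> t) \<le> M"
  shows "circle_L2 (rep \<rho> u)" "l2 (rep \<rho> u) \<le> sqrt M * l2 u"
proof -
  have M0: "0 < M" using density_pos[of 0] M[of 0] by linarith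
  have [measurable]: "u \<in> borel_measurable borel" using u by (rule circle_L2_measurable)
  have [measurable]: "\<rho> \<in> borel_measurable borel" by (rule borel_measurable_continuous_onI[OF density_continuous])
  have [measurable]: "tick \<rho> \<in> borel_measurable borel"
    by (intro borel_measurable_continuous_onI continuous_at_imp_continuous_on ballI tick_continuous)
  have rm[measurable]: "rep \<rho> u \<in> borel_measurable borel" unfolding rep_def by measurable
  have nnc: "(\<integral>\<^sup>+t. f t \<partial>circ) = (\<integral>\<^sup>+t. f t * indicator {0..1} t \<partial>lborel)" for f
    unfolding circ_def by (rule nn_integral_restrict_space) simp
  have sub: "(\<integral>\<^sup>+x. ennreal ((cmod (u x))\<^sup>2 * indicator {tick \<rho> 0..tick \<rho> 1} x) \<partial>lborel) =
      (\<integral>\<^sup>+x. ennreal ((cmod (u (tick \<rho> x)))\<^sup>2 * inverse (Re (\<rho> (tick \<rho> x))) * indicator {0..1} x) \<partial>lborel)"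
  proof (rule nn_integral_substitution)
    show "set_borel_measurable borel {tick \<rho> 0..tick \<rho> 1} (\<lambda>x. (cmod (u x))\<^sup>2)"
      unfolding set_borel_measurable_def by measurable
    have "continuous_on UNIV (\<lambda>x. inverse (Re (\<rho> (tick \<rho> x))))"
    proof -
      have t: "continuous_on UNIV (tick \<rho>)" by (intro continuous_at_imp_continuous_on ballI tick_continuous)
      have "continuous_on UNIV (\<lambda>x. \<rho> (tick \<rho> x))" by (rule continuous_on_compose2[OF density_continuous t]) simp
      then show ?thesis using density_pos by (intro continuous_intros) (auto simp: less_imp_neq[symmetric])
    qed
    then show "continuous_on {0..1} (\<lambda>x. inverse (Re (\<rho> (tick \<rho> x))))" by (rule continuous_on_subset) simp
    show "0 \<le> inverse (Re (\<rho> (tick \<rho> x)))" for x using density_pos[of "tick \<rho> x"] by simp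
  qed (simp_all add: tick_deriv)
  have "(\<integral>\<^sup>+t. ennreal ((cmod (rep \<rho> u t))\<^sup>2) \<partial>circ)
    \<le> (\<integral>\<^sup>+t. ennreal M * ennreal ((cmod (u (tick \<rho> t)))\<^sup>2 * inverse (Re (\<rho> (tick \<rho> t))) * indicator {0..1} t) \<partial>lborel)"
    unfolding nnc
  proof (rule nn_integral_mono)
    fix t
    have p: "0 < Re (\<rho> (tick \<rho> t))" by (rule density_pos)
    \<comment> \<open>Inserts the derivative of \<open>tick\<close> into the integrand at the price
      of the factor M.\<close>
    have "1 \<le> M * inverse (Re (\<rho> (tick \<rho> t)))" using M[of "tick \<rho> t"] p by (simp add: field_simps)
    then have "(cmod (u (tick \<rho> t)))\<^sup>2 * 1 \<le> (cmod (u (tick \<rho> t)))\<^sup>2 * (M * inverse (Re (\<rho> (tick \<rho> t))))"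
      by (rule mult_left_mono) simp
    then show "ennreal ((cmod (rep \<rho> u t))\<^sup>2) * indicator {0..1} t
      \<le> ennreal M * ennreal ((cmod (u (tick \<rho> t)))\<^sup>2 * inverse (Re (\<rho> (tick \<rho> t))) * indicator {0..1} t)"
      using M0 p by (auto simp: rep_def ennreal_mult'[symmetric] mult_ac intro!: ennreal_leI split: split_indicator)
  qed
  also have "\<dots> = ennreal M * (\<integral>\<^sup>+t. ennreal ((cmod (u t))\<^sup>2) * indicator {0..1} t \<partial>lborel)"
    by (subst nn_integral_cmult, measurable) (simp add: sub[symmetric] tick_0 tick_1 ennreal_mult' ennreal_indicator)
  also have "\<dots> = ennreal (M * l2ip u u)"
    using nn_integral_l2[OF u] M0 unfolding nnc by (simp add: ennreal_mult' L2.nonneg u)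
  finally have le: "(\<integral>\<^sup>+t. ennreal ((cmod (rep \<rho> u t))\<^sup>2) \<partial>circ) \<le> ennreal (M * l2ip u u)" .
  show L: "circle_L2 (rep \<rho> u)" unfolding circle_L2_iff
  proof (intro conjI)
    show "per (rep \<rho> u)" by (rule rep_per) (use u in \<open>simp add: circle_L2_iff\<close>)
    show "rep \<rho> u \<in> borel_measurable borel" by (rule rm)
    show "integrable circ (\<lambda>t. (cmod (rep \<rho> u t))\<^sup>2)"
    proof (rule integrableI_bounded)
      have "(\<lambda>t. (cmod (rep \<rho> u t))\<^sup>2) \<in> borel_measurable borel" by measurable
      then show "(\<lambda>t. (cmod (rep \<rho> u t))\<^sup>2) \<in> borel_measurable circ" by (rule borel_circ)
      show "(\<integral>\<^sup>+t. ennreal (norm ((cmod (rep \<rho> u t))\<^sup>2)) \<partial>circ) < \<infinity>"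
        using le_less_trans[OF le] by simp
    qed
  qed
  have "l2ip (rep \<rho> u) (rep \<rho> u) \<le> M * l2ip u u"
    using le M0 L2.nonneg[of u] u unfolding nn_integral_l2[OF L] by (simp add: ennreal_le_iff)
  then show "l2 (rep \<rho> u) \<le> sqrt M * l2 u" by (metis real_sqrt_le_iff real_sqrt_mult)
qed

lemma rep_L2': "circle_L2 u \<Longrightarrow> circle_L2 (rep \<rho> u)"
  by (rule density_bounds) (rule rep_L2)

end

lemma J_fun_diff: "circle_L2 f \<Longrightarrow> circle_L2 g \<Longrightarrow> J (\<lambda>t. f t - g t) = (\<lambda>t. J f t - J g t)"
  using J_lincomb[of f g 1 "-1"] by simp

lemma J_cmult: "circle_L2 f \<Longrightarrow> J (\<lambda>t. c * f t) = (\<lambda>t. c * J f t)"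
  using J_lincomb[of f f c 0] by simp

text \<open>At the time \<open>tick (P n) t\<close> the clock of \<rho> misses t by at most the
  uniform distance of the two primitives, and this clock expands distances by the factor b at
  least.\<close>

lemma tick_uconv:
  assumes P: "\<And>n. loop_density (P n)" and \<rho>: "loop_density \<rho>" and c: "cv 1 P \<rho>"
  shows "uconv (\<lambda>n. tick (P n)) (tick \<rho>)"
proof (rule uniform_limitI)
  fix e :: real assume e: "0 < e"
  obtain b where b: "0 < b" "\<And>t. b \<le> Re (\<rho> t)" by (rule density_bounds[OF \<rho>]) (rule that)
  have "uconv (\<lambda>n. J (P n)) (J \<rho>)" by (rule cv_uconv[OF cv_J[OF c]]) simp
  then have "\<forall>\<^sub>F n in sequentially. \<forall>t\<in>UNIV. dist (J (P n) t) (J \<rho> t) < b * e" by (rule uniform_limitD) (use b e in simp)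
  then show "\<forall>\<^sub>F n in sequentially. \<forall>t\<in>UNIV. dist (tick (P n) t) (tick \<rho> t) < e"
  proof eventually_elim
    case (elim n)
    show ?case
    proof
      fix t
      let ?x = "tick (P n) t"
      have "\<bar>clock \<rho> ?x - clock (P n) ?x\<bar> \<le> cmod (J (P n) ?x - J \<rho> ?x)"
        using abs_Re_le_cmod[of "J (P n) ?x - J \<rho> ?x"] by (simp add: clock_def abs_minus_commute)
      also have "\<dots> < b * e" using elim by (simp add: dist_norm)
      finally have "\<bar>clock \<rho> ?x - clock \<rho> (tick \<rho> t)\<bar> < b * e" by (simp add: clock_tick P \<rho>)
      then have "b * \<bar>?x - tick \<rho> t\<bar> < b * e" using clock_expand[OF \<rho> b(2), of ?x "tick \<rho> t"] by linarith
      then show "dist ?x (tick \<rho> t) < e" using b(1) by (simp add: dist_real_def)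
    qed
  qed
qed

lemma smooth_loop_Lipschitz:
  assumes "smooth_loop w" obtains K where "0 < K" "\<And>x y. cmod (w x - w y) \<le> K * \<bar>x - y\<bar>"
proof -
  obtain v where v: "smooth_loop v" "\<And>t. (w has_vector_derivative v t) (at t)" using assms by (rule prim_smooth_loop) (rule that)
  obtain K where K: "0 < K" "\<And>t. cmod (v t) \<le> K"
    by (rule per_bounded[OF smooth_loop_per[OF v(1)] smooth_loop_continuous[OF v(1)]]) (rule that)
  have "norm (w x - w y) \<le> K * norm (x - y)" for x y
  proof (rule differentiable_bound[where S=UNIV and f'="\<lambda>x h. h *\<^sub>R v x"])
    show "(w has_derivative (\<lambda>h. h *\<^sub>R v x)) (at x)" for x using v(2)[of x] by (simp add: has_vector_derivative_def)
    show "onorm (\<lambda>h. h *\<^sub>R v x) \<le> K" for x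
      by (rule onorm_le) (simp add: mult.commute[of K] mult_left_mono K(2))
  qed auto
  then show ?thesis using that K(1) by simp
qed

text \<open>Composition operators are uniformly bounded on \<open>L\<^sup>2\<close>, and on the dense set of
  smooth loops convergence is uniform.\<close>

lemma rep_l2conv:
  assumes U: "l2conv U u" and P: "\<And>n. loop_density (P n)" and \<rho>: "loop_density \<rho>" and c: "cv 1 P \<rho>"
  shows "l2conv (\<lambda>n. rep (P n) (U n)) (rep \<rho> u)"
  unfolding l2conv_def
proof (intro conjI allI LIMSEQ_I)
  show repU: "circle_L2 (rep (P n) (U n))" for n by (rule rep_L2'[OF P l2conv_D(1)[OF U]])
  show repu: "circle_L2 (rep \<rho> u)" by (rule rep_L2'[OF \<rho> l2conv_D(2)[OF U]])
  fix e :: real assume e: "0 < e"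
  obtain M0 where M0: "\<And>t. Re (\<rho> t) \<le> M0" "0 < M0" by (rule density_bounds[OF \<rho>]) (rule that)
  \<comment> \<open>A common bound for \<rho> and for all \<open>P n\<close> that are uniformly
    within 1 of it.\<close>
  define M where "M = M0 + 1"
  have sM: "0 < sqrt M" using M0 by (simp add: M_def)
  have M: "Re (\<rho> t) \<le> M" for t using M0(1)[of t] by (simp add: M_def)
  \<comment> \<open>Chosen so that the three terms below are at most e/2, e/8 and e/4.\<close>
  define d where "d = e / (4 * sqrt M)"
  have d: "0 < d" "sqrt M * d = e / 4" using e sM by (simp_all add: d_def)
  obtain w where w: "smooth_loop w" "l2 (w - u) < d" using smooth_loop_dense[OF l2conv_D(2)[OF U] d(1)] by blast
  have wL: "circle_L2 w" by (rule smooth_loop_L2[OF w(1)])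
  have uL: "circle_L2 u" and UL: "\<And>n. circle_L2 (U n)" by (rule l2conv_D[OF U])+
  obtain K where K: "0 < K" "\<And>x y. cmod (w x - w y) \<le> K * \<bar>x - y\<bar>" using w(1) by (rule smooth_loop_Lipschitz) (rule that)
  have e1: "\<forall>\<^sub>F n in sequentially. l2 (U n - u) < d" by (rule order_tendstoD(2)[OF l2conv_D(4)[OF U] d(1)])
  have e2: "\<forall>\<^sub>F n in sequentially. \<forall>t\<in>UNIV. dist (tick (P n) t) (tick \<rho> t) < e / (8 * K)"
    by (rule uniform_limitD[OF tick_uconv[OF P \<rho> c]]) (use e K in simp)
  have e3: "\<forall>\<^sub>F n in sequentially. \<forall>t\<in>UNIV. dist (P n t) (\<rho> t) < 1"
    by (rule uniform_limitD[OF cv_uconv[OF c]]) simp_all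
  from e1 e2 e3 have "\<forall>\<^sub>F n in sequentially. norm (l2 (rep (P n) (U n) - rep \<rho> u) - 0) < e"
  proof eventually_elim
    case (elim n)
    have Mn: "Re (P n t) \<le> M" for t
    proof -
      have "cmod (P n t - \<rho> t) < 1" using elim(3) by (simp add: dist_norm)
      then have "Re (P n t) - Re (\<rho> t) < 1" using complex_Re_le_cmod[of "P n t - \<rho> t"] by simp
      then show ?thesis using M0(1)[of t] by (simp add: M_def)
    qed
    have Uw: "circle_L2 (U n - w)" and wu: "circle_L2 (w - u)" and Uu: "circle_L2 (U n - u)" by (rule circle_L2_diff[OF UL wL] circle_L2_diff[OF wL uL] circle_L2_diff[OF UL uL])+
    have "l2 (U n - w) \<le> l2 (U n - u) + l2 (w - u)"
      using L2.triangle3[of "U n" u w] L2.N_minus_commute[of u w] UL uL wL by simp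
    then have a: "l2 (U n - w) \<le> 2 * d" using elim(1) w(2) by linarith
    have A: "l2 (rep (P n) (U n - w)) \<le> e / 2"
    proof -
      have "l2 (rep (P n) (U n - w)) \<le> sqrt M * l2 (U n - w)" by (rule rep_L2(2)[OF P Uw Mn])
      also have "\<dots> \<le> sqrt M * (2 * d)" using a sM by (simp del: real_sqrt_gt_0_iff)
      also have "\<dots> = e / 2" using d(2) by simp
      finally show ?thesis .
    qed
    have C: "l2 (rep \<rho> (w - u)) \<le> e / 4"
    proof -
      have "l2 (rep \<rho> (w - u)) \<le> sqrt M * l2 (w - u)" by (rule rep_L2(2)[OF \<rho> wu M])
      also have "\<dots> \<le> sqrt M * d" using w(2) sM by (simp del: real_sqrt_gt_0_iff)
      finally show ?thesis using d(2) by simp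
    qed
    have Bw: "circle_L2 (rep (P n) w - rep \<rho> w)" by (rule circle_L2_diff[OF rep_L2'[OF P wL] rep_L2'[OF \<rho> wL]])
    have B: "l2 (rep (P n) w - rep \<rho> w) \<le> e / 8"
    proof (rule l2_bound[OF Bw])
      fix t
      have "cmod ((rep (P n) w - rep \<rho> w) t) \<le> K * \<bar>tick (P n) t - tick \<rho> t\<bar>" using K(2) by (simp add: rep_def)
      also have "\<dots> \<le> K * (e / (8 * K))" using elim(2) K(1) by (intro mult_left_mono) (auto simp: dist_real_def less_imp_le)
      finally show "cmod ((rep (P n) w - rep \<rho> w) t) \<le> e / 8" using K(1) by simp
    qed (use e in simp)
    \<comment> \<open>Both loops are replaced by the smooth w; only the middle term compares two
      different reparametrisations, and there w is Lipschitz.\<close>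
    have "rep (P n) (U n) - rep \<rho> u = (rep (P n) (U n - w) + (rep (P n) w - rep \<rho> w)) + rep \<rho> (w - u)"
      by (simp add: rep_def fun_eq_iff)
    then have "l2 (rep (P n) (U n) - rep \<rho> u) \<le> (l2 (rep (P n) (U n - w)) + l2 (rep (P n) w - rep \<rho> w)) + l2 (rep \<rho> (w - u))"
      using L2.triangle[of "rep (P n) (U n - w)" "rep (P n) w - rep \<rho> w"]
        L2.triangle[of "rep (P n) (U n - w) + (rep (P n) w - rep \<rho> w)" "rep \<rho> (w - u)"]
        L2.add_in[of "rep (P n) (U n - w)" "rep (P n) w - rep \<rho> w"] Bw rep_L2'[OF P Uw] rep_L2'[OF \<rho> wu] by simp
    then have "l2 (rep (P n) (U n) - rep \<rho> u) < e" using A B C e by linarith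
    moreover have "0 \<le> l2 (rep (P n) (U n) - rep \<rho> u)" by (simp add: l2ip_self)
    ultimately show ?case by (simp only: real_norm_def diff_0_right abs_of_nonneg)
  qed
  then show "\<exists>N. \<forall>n\<ge>N. norm (l2 (rep (P n) (U n) - rep \<rho> u) - 0) < e" by (simp only: eventually_sequentially)
qed

text \<open>For smooth u this is the chain rule with tick' = 1 / \<rho> o tick; it extends to
  primitives because \<open>rep \<rho>\<close> is continuous on L^2.\<close>

lemma prim_rep:
  assumes "prim u g" and \<rho>: "loop_density \<rho>"
  shows "prim (rep \<rho> u) (rep \<rho> (\<lambda>t. inverse (\<rho> t) * g t))"
proof -
  obtain P p where P: "\<And>n. smooth_loop (P n)" "\<And>n. smooth_loop (p n)"
    "\<And>n t. (P n has_vector_derivative p n t) (at t)" "\<And>n. prim (P n) (p n)" "l2conv p g" "uconv P u"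
    by (rule prim_approx[OF assms(1)]) (rule that)
  have ci: "continuous_on UNIV (\<lambda>t. inverse (\<rho> t))"
    using density_continuous[OF \<rho>] density_nonzero[OF \<rho>] by (intro continuous_intros) auto
  have l: "l2conv (\<lambda>n t. inverse (\<rho> t) * p n t) (\<lambda>t. inverse (\<rho> t) * g t)"
    by (rule l2conv_mult[OF P(5), where H="\<lambda>n t. inverse (\<rho> t)"]) (use ci density_per[OF \<rho>] in \<open>auto intro: uniform_limit_const\<close>)
  have rl: "l2conv (\<lambda>n. rep \<rho> (\<lambda>t. inverse (\<rho> t) * p n t)) (rep \<rho> (\<lambda>t. inverse (\<rho> t) * g t))"
    by (rule rep_l2conv[OF l \<rho> \<rho> cv_const[OF density_W[OF \<rho>]]])
  show ?thesis
  proof (rule prim_limit[OF _ rl])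
    show "prim (rep \<rho> (P n)) (rep \<rho> (\<lambda>t. inverse (\<rho> t) * p n t))" for n
    proof (rule prim_smooth)
      show "(rep \<rho> (P n) has_vector_derivative rep \<rho> (\<lambda>t. inverse (\<rho> t) * p n t) t) (at t)" for t
      proof -
        have "((P n \<circ> tick \<rho>) has_vector_derivative inverse (Re (\<rho> (tick \<rho> t))) *\<^sub>R p n (tick \<rho> t)) (at t)"
          by (rule vector_diff_chain_at[OF tick_deriv[OF \<rho>, unfolded has_real_derivative_iff_has_vector_derivative] P(3)])
        moreover have "inverse (Re (\<rho> (tick \<rho> t))) *\<^sub>R p n (tick \<rho> t) = inverse (\<rho> (tick \<rho> t)) * p n (tick \<rho> t)"
          by (subst density_real[OF \<rho>, of "tick \<rho> t"]) (simp add: scaleR_conv_of_real)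
        ultimately show ?thesis by (simp add: rep_def o_def)
      qed
      show "per (rep \<rho> (P n))" by (rule rep_per[OF \<rho> smooth_loop_per[OF P(1)]])
      show "circle_L2 (rep \<rho> (\<lambda>t. inverse (\<rho> t) * p n t))" by (rule l2conv_D(1)[OF rl])
    qed
    show "(\<lambda>n. rep \<rho> (P n) t) \<longlonglongrightarrow> rep \<rho> u t" for t
      unfolding rep_def by (rule tendsto_uniform_limitI[OF P(6) UNIV_I])
  qed
qed

text \<open>The derivative of a reparametrised loop is again a reparametrised loop, of one order
  less and with the same density. So the claim descends to L^2, where order one suffices for the
  densities.\<close>

theorem cv_rep:
  assumes "cv m U u" "cv (max m 1) P \<rho>" and P: "\<And>n. loop_density (P n)" and \<rho>: "loop_density \<rho>"
  shows "cv m (\<lambda>n. rep (P n) (U n)) (rep \<rho> u)"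
  using assms(1,2)
proof (induction m arbitrary: U u)
  case 0
  then show ?case unfolding cv_0 using rep_l2conv[OF _ P \<rho>, of U u] by simp
next
  case (Suc m)
  obtain G g where G: "\<And>n. prim (U n) (G n)" "prim u g" "cv m G g" using Suc.prems(1) by (rule cv_SucE) (rule that)
  have cP: "cv (max m 1) P \<rho>" by (rule cv_antimono[OF Suc.prems(2)]) simp
  have c1: "cv 1 P \<rho>" by (rule cv_antimono[OF Suc.prems(2)]) simp
  have ci: "cv (max m 1) (\<lambda>n t. inverse (P n t)) (\<lambda>t. inverse (\<rho> t))"
    by (rule cv_inverse[OF cP]) (simp_all add: density_nonzero P \<rho>)
  show ?case
    by (rule cv_SucI[OF prim_rep[OF G(1) P] prim_rep[OF G(2) \<rho>] Suc.IH[OF cv_mult[OF G(3) ci] cP]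
       rep_l2conv[OF cv_l2conv[OF Suc.prems(1)] P \<rho> c1]])
qed

section \<open>Difference quotients of the reparametrisation\<close>

lemma vector_derivative_sequence:
  fixes f :: "real \<Rightarrow> 'a::real_normed_vector"
  assumes f: "(f has_vector_derivative D) (at x)" and s: "s \<longlonglongrightarrow> 0" "\<And>n. s n \<noteq> 0"
    and y: "(\<lambda>n. y n / s n) \<longlonglongrightarrow> b"
  shows "(\<lambda>n. (f (x + y n) - f x) /\<^sub>R s n) \<longlonglongrightarrow> b *\<^sub>R D"
proof -
  \<comment> \<open>The value D at 0 makes the difference quotient continuous there, so indices with
    y n = 0 need no separate treatment.\<close>
  define G where "G h = (if h = 0 then D else (f (x + h) - f x) /\<^sub>R h)" for h
  have l: "(\<lambda>h. norm (f (x + h) - f x - h *\<^sub>R D) / norm h) \<midarrow>0\<rightarrow> 0"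
    using f by (simp add: has_vector_derivative_def has_derivative_at)
  have e: "norm (f (x + h) - f x - h *\<^sub>R D) / norm h = norm (G h - D)" if "h \<noteq> 0" for h
  proof -
    have "G h - D = (f (x + h) - f x - h *\<^sub>R D) /\<^sub>R h" using that by (simp add: G_def scaleR_diff_right)
    then show ?thesis by (simp add: divide_inverse mult.commute)
  qed
  have "(\<lambda>h. norm (G h - D)) \<midarrow>0\<rightarrow> 0" by (rule iffD1[OF LIM_equal l]) (use e in blast)
  then have "G \<midarrow>0\<rightarrow> D" by (rule LIM_zero_cancel[OF tendsto_norm_zero_cancel])
  then have G: "isCont G 0" unfolding isCont_def by (simp add: G_def[of 0])
  have "(\<lambda>n. y n / s n * s n) \<longlonglongrightarrow> b * 0" by (intro tendsto_mult y s)
  then have "y \<longlonglongrightarrow> 0" using s(2) by simp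
  then have "(\<lambda>n. G (y n)) \<longlonglongrightarrow> G 0" by (rule isCont_tendsto_compose[OF G])
  then have "(\<lambda>n. (y n / s n) *\<^sub>R G (y n)) \<longlonglongrightarrow> b *\<^sub>R D"
    using tendsto_scaleR[OF y] by (simp add: G_def)
  moreover have "(y n / s n) *\<^sub>R G (y n) = (f (x + y n) - f x) /\<^sub>R s n" for n
    by (simp add: G_def field_simps)
  ultimately show ?thesis by simp
qed

lemma uconv_compose_tendsto:
  fixes F :: "nat \<Rightarrow> real \<Rightarrow> 'a::real_normed_vector"
  assumes "uconv F f" "isCont f x" "y \<longlonglongrightarrow> x" shows "(\<lambda>n. F n (y n)) \<longlonglongrightarrow> f x"
proof -
  have "(\<lambda>n. F n (y n) - f (y n)) \<longlonglongrightarrow> 0"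
  proof (rule LIMSEQ_I)
    fix e :: real assume "0 < e"
    from uniform_limitD[OF assms(1) this] show "\<exists>N. \<forall>n\<ge>N. norm (F n (y n) - f (y n) - 0) < e"
      by (auto simp: eventually_sequentially dist_norm)
  qed
  from tendsto_add[OF this isCont_tendsto_compose[OF assms(2,3)]] show ?thesis by simp
qed

text \<open>The moved point \<open>tick (P n) t\<close> is the value of the fixed function
  \<open>tick \<rho>\<close> at a slightly shifted time. The limit thus follows from the derivative
  of \<open>tick \<rho>\<close> and the limit of the shift divided by s n.\<close>

lemma tick_difference_quotient:
  assumes P: "\<And>n. loop_density (P n)" and \<rho>: "loop_density \<rho>" and c: "cv 1 P \<rho>"
    and s: "s \<longlonglongrightarrow> 0" "\<And>n. s n \<noteq> 0"
    and q: "cv 1 (\<lambda>n t. (P n t - \<rho> t) / of_real (s n)) q"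
  shows "(\<lambda>n. (tick (P n) t - tick \<rho> t) / s n) \<longlonglongrightarrow> - Re (J q (tick \<rho> t)) / Re (\<rho> (tick \<rho> t))"
proof -
  define B where "B n = J (\<lambda>t. (P n t - \<rho> t) / of_real (s n))" for n
  have B: "cv 1 B (J q)" unfolding B_def by (rule cv_J[OF q])
  have PL: "circle_L2 (P n)" for n by (rule density_L2[OF P])
  have rL: "circle_L2 \<rho>" by (rule density_L2[OF \<rho>])
  define x where "x n = tick (P n) t" for n
  have x: "x \<longlonglongrightarrow> tick \<rho> t" unfolding x_def by (rule tendsto_uniform_limitI[OF tick_uconv[OF P \<rho> c] UNIV_I])
  have JB: "J (P n) y - J \<rho> y = of_real (s n) * B n y" for n y
  proof -
    have d: "circle_L2 (\<lambda>t. P n t - \<rho> t)" using circle_L2_diff[OF PL rL] by (simp add: fun_diff_def)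
    have "B n y = J (\<lambda>t. (1 / of_real (s n)) * (P n t - \<rho> t)) y" by (simp add: B_def)
    also have "\<dots> = (1 / of_real (s n)) * (J (P n) y - J \<rho> y)" by (simp only: J_cmult[OF d] J_fun_diff[OF PL rL])
    finally show ?thesis using s(2)[of n] by simp
  qed
  have cl: "clock \<rho> (x n) = t - s n * Re (B n (x n))" for n
  proof -
    have "t = clock (P n) (x n)" by (simp add: x_def clock_tick P)
    also have "\<dots> = clock \<rho> (x n) + Re (J (P n) (x n) - J \<rho> (x n))" by (simp add: clock_def)
    also have "\<dots> = clock \<rho> (x n) + s n * Re (B n (x n))" by (simp add: JB)
    finally show ?thesis by simp
  qed
  \<comment> \<open>The shift contains x n itself; it converges because \<open>B n\<close> does so
    uniformly and x n tends to \<open>tick \<rho> t\<close>.\<close>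
  have xe: "x n = tick \<rho> (t + - s n * Re (B n (x n)))" for n
    by (rule tick_eqI[OF \<rho>, symmetric]) (simp add: cl)
  have "isCont (J q) (tick \<rho> t)"
    using W_continuous[OF cv_D(2)[OF B]] by (simp add: continuous_on_eq_continuous_at)
  then have "(\<lambda>n. B n (x n)) \<longlonglongrightarrow> J q (tick \<rho> t)" by (rule uconv_compose_tendsto[OF cv_uconv[OF B order_refl] _ x])
  then have "(\<lambda>n. - Re (B n (x n))) \<longlonglongrightarrow> - Re (J q (tick \<rho> t))" by (intro tendsto_minus tendsto_Re)
  then have y: "(\<lambda>n. (- s n * Re (B n (x n))) / s n) \<longlonglongrightarrow> - Re (J q (tick \<rho> t))" using s(2) by simp
  have "(\<lambda>n. (tick \<rho> (t + - s n * Re (B n (x n))) - tick \<rho> t) /\<^sub>R s n) \<longlonglongrightarrow> (- Re (J q (tick \<rho> t))) *\<^sub>R inverse (Re (\<rho> (tick \<rho> t)))"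
    by (rule vector_derivative_sequence[OF tick_deriv[OF \<rho>, unfolded has_real_derivative_iff_has_vector_derivative] s y])
  then show ?thesis unfolding xe[symmetric] by (simp add: x_def divide_inverse mult.commute)
qed

text \<open>The increment splits into U n - u at the moved point and the increment of the fixed u
  between the two points. As u lies in W 2, it is differentiable everywhere, so the second part has
  a limit at each t.\<close>

theorem rep_difference_quotient:
  assumes P: "\<And>n. loop_density (P n)" and \<rho>: "loop_density \<rho>" and c: "cv 1 P \<rho>"
    and s: "s \<longlonglongrightarrow> 0" "\<And>n. s n \<noteq> 0"
    and q: "cv 1 (\<lambda>n t. (P n t - \<rho> t) / of_real (s n)) q"
    and u: "u \<in> W 2" and v: "cv 1 (\<lambda>n t. (U n t - u t) / of_real (s n)) v"
  shows "(\<lambda>n. (rep (P n) (U n) t - rep \<rho> u t) / of_real (s n)) \<longlonglongrightarrow>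
    rep \<rho> (\<lambda>t. v t - loop_deriv u t * J q t * inverse (\<rho> t)) t"
proof -
  let ?x = "tick \<rho> t" and ?xn = "\<lambda>n. tick (P n) t"
  have x: "?xn \<longlonglongrightarrow> ?x" by (rule tendsto_uniform_limitI[OF tick_uconv[OF P \<rho> c] UNIV_I])
  have "isCont v ?x" using W_continuous[OF cv_D(2)[OF v]] by (simp add: continuous_on_eq_continuous_at)
  then have 1: "(\<lambda>n. (U n (?xn n) - u (?xn n)) / of_real (s n)) \<longlonglongrightarrow> v ?x"
    by (rule uconv_compose_tendsto[OF cv_uconv[OF v order_refl] _ x])
  have u2: "u \<in> W (Suc 1)" using u by (simp add: numeral_2_eq_2)
  have "(\<lambda>n. (u (?x + (?xn n - ?x)) - u ?x) /\<^sub>R s n) \<longlonglongrightarrow> (- Re (J q ?x) / Re (\<rho> ?x)) *\<^sub>R loop_deriv u ?x"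
    by (rule vector_derivative_sequence[OF W_loop_deriv(3)[OF u2 order_refl] s tick_difference_quotient[OF P \<rho> c s q]])
  then have 2: "(\<lambda>n. (u (?xn n) - u ?x) / of_real (s n)) \<longlonglongrightarrow> (- Re (J q ?x) / Re (\<rho> ?x)) *\<^sub>R loop_deriv u ?x"
    by (simp add: scaleR_conv_of_real divide_inverse mult.commute)
  have sum: "(U n (?xn n) - u (?xn n)) / of_real (s n) + (u (?xn n) - u ?x) / of_real (s n) = (rep (P n) (U n) t - rep \<rho> u t) / of_real (s n)" for n
    by (simp add: rep_def diff_divide_distrib)
  \<comment> \<open>The quotient of \<open>tick\<close> yields real parts, the asserted formula does
    not take them; q is real as a limit of real functions.\<close>
  have qi: "Im (q y) = 0" for y
  proof -
    have "(\<lambda>n. Im ((P n y - \<rho> y) / of_real (s n))) \<longlonglongrightarrow> Im (q y)"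
      by (rule tendsto_Im[OF cv_pointwise[OF q order_refl]])
    moreover have z: "Im ((P n y - \<rho> y) / of_real (s n)) = 0" for n
      by (simp add: density_Im P \<rho>)
    ultimately show ?thesis unfolding z by (simp add: LIMSEQ_const_iff)
  qed
  have Jq: "J q ?x = of_real (Re (J q ?x))"
    using J_real[OF W_L2[OF cv_D(2)[OF q]] qi, of ?x] by (simp add: complex_eq_iff)
  have "v ?x + (- Re (J q ?x) / Re (\<rho> ?x)) *\<^sub>R loop_deriv u ?x = rep \<rho> (\<lambda>t. v t - loop_deriv u t * J q t * inverse (\<rho> t)) t"
    unfolding rep_def
    by (subst Jq, subst density_real[OF \<rho>, of ?x]) (simp add: scaleR_conv_of_real divide_inverse mult_ac)
  with tendsto_add[OF 1 2] show ?thesis by (simp add: sum)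
qed

section \<open>A mean value inequality\<close>

text \<open>A curve in \<open>W m\<close> need only be differentiable pointwise: pairing it with a smooth loop gives a
  differentiable real function.\<close>

theorem W_mean_value:
  assumes m: "1 \<le> m"
    and G: "\<And>s. s \<in> {0..1} \<Longrightarrow> G s \<in> W m" and G': "\<And>s. s \<in> {0..1} \<Longrightarrow> G' s \<in> W m"
    and d: "\<And>s t. s \<in> {0..1} \<Longrightarrow> ((\<lambda>s. G s t) has_vector_derivative G' s t) (at s within {0..1})"
    and c: "\<And>\<sigma> s. s \<in> {0..1} \<Longrightarrow> (\<And>n. \<sigma> n \<in> {0..1}) \<Longrightarrow> \<sigma> \<longlonglongrightarrow> s \<Longrightarrow> uconv (\<lambda>n. G' (\<sigma> n)) (G' s)"
    and v: "v \<in> W m" and B: "\<And>s. s \<in> {0..1} \<Longrightarrow> wn m (G' s - v) \<le> B"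
  shows "wn m (G 1 - G 0 - v) \<le> B"
proof -
  define D where "D = G 1 - G 0 - v"
  have D: "D \<in> W m" unfolding D_def by (intro Wm.diff_in G v) auto
  \<comment> \<open>Paired with a smooth w, the inner product of order m becomes an integral against
    V. It can be differentiated under the integral sign, and the ordinary mean value theorem
    applies.\<close>
  have key: "wip m D w \<le> B * wn m w" if w: "smooth_loop w" for w
  proof -
    obtain V where V: "smooth_loop V" "\<And>f. f \<in> W m \<Longrightarrow> wip m f w = l2ip f V" using smooth_loop_dual[OF w, of m] by blast
    have ipi: "l2ip f V = integral {0..1} (\<lambda>t. f t \<bullet> V t)" if f: "f \<in> W m" for f
    proof -
      have "integrable circ (\<lambda>t. f t \<bullet> V t)" by (rule circle_L2_inner_integrable[OF W_L2[OF f] smooth_loop_L2[OF V(1)]])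
      then have "set_integrable lborel {0..1} (\<lambda>t. f t \<bullet> V t)" by (simp add: set_integrable_circ)
      from set_borel_integral_eq_integral(2)[OF this] show ?thesis by (simp add: l2ip_def set_integral_circ)
    qed
    have cV: "continuous_on {0..1} V" by (rule smooth_loop_continuous[OF V(1)])
    have cW: "continuous_on {0..1} f" if "f \<in> W m" for f using W_continuous[OF that m] by (rule continuous_on_subset) simp
    have der: "((\<lambda>s. integral (cbox 0 1) (\<lambda>t. G s t \<bullet> V t)) has_vector_derivative
        integral (cbox 0 1) (\<lambda>t. G' s t \<bullet> V t)) (at s within {0..1})" if s: "s \<in> {0..1}" for s
    proof (rule leibniz_rule_vector_derivative[OF _ _ _ s])
      show "((\<lambda>s. G s t \<bullet> V t) has_vector_derivative G' s t \<bullet> V t) (at s within {0..1})" if "s \<in> {0..1}" for s t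
        by (rule bounded_linear.has_vector_derivative[OF bounded_linear_inner_left d[OF that]])
      show "(\<lambda>t. G s t \<bullet> V t) integrable_on cbox 0 1" if "s \<in> {0..1}" for s
        using cW[OF G[OF that]] cV by (intro integrable_continuous continuous_on_inner) auto
      \<comment> \<open>Joint continuity combines uniform convergence in s with continuity in
        t.\<close>
      show "continuous_on ({0..1} \<times> cbox 0 1) (\<lambda>(s, t). G' s t \<bullet> V t)"
        unfolding continuous_on_sequentially
      proof (intro allI ballI impI)
        fix x and a :: "real \<times> real"
        assume a: "a \<in> {0..1} \<times> cbox 0 1" and x: "(\<forall>n. x n \<in> {0..1} \<times> cbox 0 (1::real)) \<and> x \<longlonglongrightarrow> a"
        have l1: "(\<lambda>n. fst (x n)) \<longlonglongrightarrow> fst a" and l2: "(\<lambda>n. snd (x n)) \<longlonglongrightarrow> snd a"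
          using x by (auto intro: tendsto_fst tendsto_snd)
        have f: "fst a \<in> {0..1}" "fst (x n) \<in> {0..1}" for n using a x by (auto simp: mem_Times_iff)
        have "isCont (G' (fst a)) (snd a)" using W_continuous[OF G'[OF f(1)] m] by (simp add: continuous_on_eq_continuous_at)
        then have "(\<lambda>n. G' (fst (x n)) (snd (x n))) \<longlonglongrightarrow> G' (fst a) (snd a)"
          by (rule uconv_compose_tendsto[OF c[OF f(1) f(2) l1] _ l2])
        moreover have "isCont V (snd a)" using smooth_loop_continuous[OF V(1), of UNIV] by (simp add: continuous_on_eq_continuous_at)
        then have "(\<lambda>n. V (snd (x n))) \<longlonglongrightarrow> V (snd a)" by (rule isCont_tendsto_compose[OF _ l2])
        ultimately show "((\<lambda>(s, t). G' s t \<bullet> V t) \<circ> x) \<longlonglongrightarrow> (case a of (s, t) \<Rightarrow> G' s t \<bullet> V t)"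
          by (simp add: o_def case_prod_unfold tendsto_inner)
      qed
    qed simp
    obtain \<xi> where xi: "\<xi> \<in> {0<..<1::real}" and eq: "integral (cbox 0 1) (\<lambda>t. G 1 t \<bullet> V t) - integral (cbox 0 1) (\<lambda>t. G 0 t \<bullet> V t)
        = (1 - 0) *\<^sub>R integral (cbox 0 1) (\<lambda>t. G' \<xi> t \<bullet> V t)"
      using mvt_simple[of 0 1 "\<lambda>s. integral (cbox 0 1) (\<lambda>t. G s t \<bullet> V t)" "\<lambda>s h. h *\<^sub>R integral (cbox 0 1) (\<lambda>t. G' s t \<bullet> V t)"]
        der unfolding has_vector_derivative_def by auto
    have xi: "\<xi> \<in> {0..1}" using xi by simp
    have "l2ip (G 1) V - l2ip (G 0) V = l2ip (G' \<xi>) V"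
      using eq by (simp add: ipi G G'[OF xi])
    then have "wip m (G 1) w - wip m (G 0) w = wip m (G' \<xi>) w" by (simp add: V(2) G G'[OF xi])
    then have "wip m D w = wip m (G' \<xi> - v) w"
      using G[of 1] G[of 0] G'[OF xi] v smooth_loop_W[OF w, of m] unfolding D_def by (simp add: Wm.diff Wm.diff_in)
    also have "\<dots> \<le> wn m (G' \<xi> - v) * wn m w"
      using Wm.Cauchy_Schwarz[OF Wm.diff_in[OF G'[OF xi] v] smooth_loop_W[OF w]] by linarith
    also have "\<dots> \<le> B * wn m w"
      by (rule mult_right_mono[OF B[OF xi] Wm.N_nonneg[OF smooth_loop_W[OF w]]])
    finally show ?thesis .
  qed
  \<comment> \<open>Smooth loops w tending to D turn \<open>key\<close> into the bound B * wn m D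
    for wip m D D.\<close>
  obtain P where P: "\<And>n. smooth_loop (P n)" "cv m P D" using W_dense_sequence[OF D] by blast
  have "(\<lambda>n. wip m (P n) D) \<longlonglongrightarrow> wip m D D" by (rule Wm.tendsto_B[OF cv_D(1)[OF P(2)] D cv_D(4)[OF P(2)] D])
  moreover have "(\<lambda>n. B * wn m (P n)) \<longlonglongrightarrow> B * wn m D"
    by (intro tendsto_mult tendsto_const Wm.tendsto_N[OF cv_D(1)[OF P(2)] D cv_D(4)[OF P(2)]])
  moreover have "wip m (P n) D \<le> B * wn m (P n)" for n
    using key[OF P(1)] Wm.sym[OF cv_D(1)[OF P(2)] D] by metis
  ultimately have le: "wip m D D \<le> B * wn m D" by (intro LIMSEQ_le) auto
  have sq: "wip m D D = wn m D * wn m D" using Wm.nonneg[OF D] by simp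
  show ?thesis
  proof (cases "wn m D = 0")
    \<comment> \<open>No division by the norm of D is possible here; B is nonnegative because it
      bounds a norm.\<close>
    case True
    have "0 \<le> wn m (G' 0 - v)" by (rule Wm.N_nonneg[OF Wm.diff_in[OF G' v]]) simp
    also have "\<dots> \<le> B" by (rule B) simp
    finally show ?thesis using True unfolding D_def by linarith
  next
    case False
    then have p: "0 < wn m D" using Wm.N_nonneg[OF D] by linarith
    have "wn m D * wn m D \<le> B * wn m D" unfolding sq[symmetric] by (rule le)
    then have "wn m D \<le> B" by (rule mult_right_le_imp_le[OF _ p])
    then show ?thesis unfolding D_def .
  qed
qed

section \<open>The scale of loops\<close>

lemma level_loop: "level loop_scale k = W (2 + k)" and ip_loop: "ip loop_scale k = wip (2 + k)"
  by (simp_all add: loop_scale_def W_def wip_def)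

lemma topspace_level: "topspace (level_topology E k) = level E k"
proof
  show "topspace (level_topology E k) \<subseteq> level E k"
    using openin_topspace[of "level_topology E k"] by (simp only: openin_level_topology)
  have "openin (level_topology E k) (level E k)"
    unfolding openin_level_topology by (auto intro: exI[of _ 1])
  then show "level E k \<subseteq> topspace (level_topology E k)" by (rule openin_subset)
qed

lemma hilbert_on_W: assumes "1 \<le> m" shows "hilbert_on (W m) (wip m)"
  unfolding hilbert_on_def
proof (intro conjI allI ballI impI)
  show "subspace (W m)" by (rule Wm.sub)
  show "wip m x y = wip m y x" if "x \<in> W m" "y \<in> W m" for x y by (rule Wm.sym[OF that])
  show "wip m (x + y) z = wip m x z + wip m y z" if "x \<in> W m" "y \<in> W m" "z \<in> W m" for x y z by (rule Wm.add[OF that])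
  show "wip m (c *\<^sub>R x) y = c * wip m x y" if "x \<in> W m" "y \<in> W m" for c x y by (rule Wm.scale[OF that])
  show "0 \<le> wip m x x" if "x \<in> W m" for x by (rule Wm.nonneg[OF that])
  show "(wip m x x = 0) = (x = 0)" if "x \<in> W m" for x using wip_eq_0[OF that assms] Wm.zero_zero by blast
  fix X :: "nat \<Rightarrow> real \<Rightarrow> complex" assume X: "(\<forall>n. X n \<in> W m) \<and> (\<forall>\<epsilon>>0. \<exists>N. \<forall>i\<ge>N. \<forall>j\<ge>N. sqrt (wip m (X i - X j) (X i - X j)) < \<epsilon>)"
  obtain l where "cv m X l" using W_complete[of X m] X by blast
  then show "\<exists>l\<in>W m. (\<lambda>n. sqrt (wip m (X n - l) (X n - l))) \<longlonglongrightarrow> 0" unfolding cv_def by blast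
qed

lemma scale_hilbert_space_loop: "scale_hilbert_space loop_scale"
  unfolding scale_hilbert_space_def
proof (intro conjI allI impI)
  fix k
  show "hilbert_on (level loop_scale k) (ip loop_scale k)"
    unfolding level_loop ip_loop by (rule hilbert_on_W) simp
  show "level loop_scale (Suc k) \<subseteq> level loop_scale k"
    unfolding level_loop using W_Suc_subset[of _ "2 + k"] by auto
  show "level_topology loop_scale k closure_of (\<Inter>j. level loop_scale j) = level loop_scale k"
  proof
    show "level_topology loop_scale k closure_of (\<Inter>j. level loop_scale j) \<subseteq> level loop_scale k"
      using closure_of_subset_topspace[of "level_topology loop_scale k"] by (simp only: topspace_level)
    show "level loop_scale k \<subseteq> level_topology loop_scale k closure_of (\<Inter>j. level loop_scale j)"
    proof
      fix x assume x: "x \<in> level loop_scale k"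
      then have xW: "x \<in> W (2 + k)" by (simp only: level_loop)
      obtain P where P: "\<And>n. smooth_loop (P n)" "cv (2 + k) P x" using W_dense_sequence[OF xW] by blast
      show "x \<in> level_topology loop_scale k closure_of (\<Inter>j. level loop_scale j)"
        unfolding in_closure_of topspace_level
      proof (intro conjI allI impI)
        fix T assume T: "x \<in> T \<and> openin (level_topology loop_scale k) T"
        then obtain r where r: "r > 0" "\<And>y. y \<in> level loop_scale k \<Longrightarrow> lnorm loop_scale k (y - x) < r \<Longrightarrow> y \<in> T"
          by (auto simp: openin_level_topology)
        obtain n where n: "wn (2 + k) (P n - x) < r" using order_tendstoD(2)[OF cv_D(4)[OF P(2)] r(1)] by (auto simp only: eventually_sequentially)
        have "P n \<in> T" by (rule r(2)) (use n smooth_loop_W[OF P(1)] in \<open>simp_all only: level_loop lnorm_def ip_loop\<close>)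
        moreover have "P n \<in> (\<Inter>j. level loop_scale j)" using smooth_loop_W[OF P(1)] by (simp add: level_loop)
        ultimately show "\<exists>y. y \<in> (\<Inter>j. level loop_scale j) \<and> y \<in> T" by blast
      qed (rule x)
    qed
  qed
  fix X :: "nat \<Rightarrow> real \<Rightarrow> complex" assume X: "(\<forall>n. X n \<in> level loop_scale (Suc k)) \<and> (\<exists>C. \<forall>n. lnorm loop_scale (Suc k) (X n) \<le> C)"
  then obtain C where C: "\<And>n. X n \<in> W (Suc (2 + k))" "\<And>n. wn (Suc (2 + k)) (X n) \<le> C"
    by (auto simp: level_loop lnorm_def ip_loop)
  obtain r x where "strict_mono (r :: nat \<Rightarrow> nat)" "cv (2 + k) (\<lambda>n. X (r n)) x" using W_compact[of X, OF C] by blast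
  then show "\<exists>l\<in>level loop_scale k. \<exists>r::nat \<Rightarrow> nat. strict_mono r \<and> (\<lambda>n. lnorm loop_scale k (X (r n) - l)) \<longlonglongrightarrow> 0"
    unfolding level_loop lnorm_def ip_loop cv_def by blast
qed

section \<open>The open set of nonvanishing loops\<close>

lemma punctured_loops_iff: "z \<in> punctured_loops \<longleftrightarrow> z \<in> W 2 \<and> (\<forall>t. z t \<noteq> 0)"
  by (simp add: punctured_loops_def W_def)

lemma nonvanishing_open:
  assumes "z \<in> W m" "1 \<le> m" "\<And>t. z t \<noteq> 0"
  obtains r where "0 < r" "\<And>y t. y \<in> W m \<Longrightarrow> wn m (y - z) < r \<Longrightarrow> y t \<noteq> 0"
proof -
  obtain b where b: "0 < b" "\<And>t. b \<le> cmod (z t)"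
    using W_per[OF assms(1)] W_continuous[OF assms(1,2)] assms(3) by (rule per_bounded_below) (rule that)
  show ?thesis
  \<comment> \<open>The 3 is the embedding constant of \<open>W_sup_le\<close>.\<close>
  proof (rule that[of "b / 3"])
    fix y t assume y: "y \<in> W m" "wn m (y - z) < b / 3"
    have "cmod ((y - z) t) \<le> 3 * wn m (y - z)" by (rule W_sup_le[OF Wm.diff_in[OF y(1) assms(1)] assms(2)])
    then have "cmod (y t - z t) < b" using y(2) by simp
    then show "y t \<noteq> 0" using b(2)[of t] by auto
  qed (use b in simp)
qed

lemma openin_punctured_loops: "openin (level_topology loop_scale 0) punctured_loops"
  unfolding openin_level_topology
proof (intro conjI ballI)
  show "punctured_loops \<subseteq> level loop_scale 0" by (auto simp: punctured_loops_iff level_loop)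
  fix z assume "z \<in> punctured_loops"
  then have z: "z \<in> W 2" "\<And>t. z t \<noteq> 0" by (auto simp: punctured_loops_iff)
  obtain r where r: "0 < r" "\<And>y t. y \<in> W 2 \<Longrightarrow> wn 2 (y - z) < r \<Longrightarrow> y t \<noteq> 0"
    by (rule nonvanishing_open[OF z(1) _ z(2)]) (simp, rule that)
  show "\<exists>r>0. \<forall>y\<in>level loop_scale 0. lnorm loop_scale 0 (y - z) < r \<longrightarrow> y \<in> punctured_loops"
    using r by (intro exI[of _ r]) (simp add: punctured_loops_iff level_loop lnorm_def ip_loop)
qed

section \<open>The rescale-square map as a reparametrisation\<close>

text \<open>The density |z|^2 / ||z||^2, written with conjugation, mean, product and inverse only,
  so that it can be recognised as a tame map.\<close>

definition dens :: "(real \<Rightarrow> complex) \<Rightarrow> real \<Rightarrow> complex"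
  where "dens z = (\<lambda>t. inverse (mean (\<lambda>s. z s * cnj (z s))) * (z t * cnj (z t)))"

lemma mean_cmod_sq: "mean (\<lambda>s. z s * cnj (z s)) = of_real (l2ip z z)"
  unfolding mean_def l2ip_self by (simp add: complex_norm_square[symmetric] flip: integral_complex_of_real)

lemma W_mult: "f \<in> W m \<Longrightarrow> g \<in> W m \<Longrightarrow> 1 \<le> m \<Longrightarrow> (\<lambda>t. f t * g t) \<in> W m"
  using cv_D(2)[OF cv_mult'[OF cv_const cv_const]] by blast

lemma W_cnj: "f \<in> W m \<Longrightarrow> (\<lambda>t. cnj (f t)) \<in> W m"
  using cv_D(2)[OF cv_cnj[OF cv_const]] by blast

lemma l2ip_pos: assumes "z \<in> W 1" "\<And>t. z t \<noteq> 0" shows "0 < l2ip z z"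
proof -
  have "l2ip z z \<noteq> 0"
    using l2_eq_0_continuous[OF W_continuous[OF assms(1) order_refl] W_per[OF assms(1)]] assms(2) by (auto simp: fun_eq_iff)
  then show ?thesis using L2.nonneg[of z] W_L2[OF assms(1)] by simp
qed

lemma dens_eq: "dens z t = of_real ((cmod (z t))\<^sup>2 / l2ip z z)"
  unfolding dens_def mean_cmod_sq by (simp add: complex_norm_square[symmetric] divide_inverse mult.commute)

lemma density_dens: assumes "z \<in> W 1" "\<And>t. z t \<noteq> 0" shows "loop_density (dens z)"
  unfolding loop_density_def
proof (intro conjI allI)
  have p: "0 < l2ip z z" by (rule l2ip_pos[OF assms])
  show "dens z \<in> W 1" unfolding dens_def
    by (intro W_mult W_const W_cnj assms(1) order_refl)
  show "0 < Re (dens z t)" "Im (dens z t) = 0" for t using assms(2)[of t] p by (simp_all add: dens_eq)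
  show "mean (dens z) = 1" unfolding dens_def mean_cmult unfolding mean_cmod_sq using p by simp
qed

lemma clock_mono: assumes "loop_density \<rho>" "s < t" shows "clock \<rho> s < clock \<rho> t"
  by (rule DERIV_pos_imp_increasing[OF assms(2)]) (use clock_deriv[OF assms(1)] density_pos[OF assms(1)] in blast)

text \<open>\<open>loop_time_inv\<close> inverts on [0, 1) and is extended by \<open>frac\<close>,
  while \<open>tick\<close> inverts on the whole line. The clock fixes 0 and 1, so the two agree on
  [0, 1); elsewhere periodicity of z * z closes the gap.\<close>

lemma rescale_square_eq:
  assumes "z \<in> punctured_loops" shows "rescale_square z = rep (dens z) (\<lambda>t. z t * z t)"
proof
  fix t
  have z: "z \<in> W 2" "\<And>t. z t \<noteq> 0" using assms by (auto simp: punctured_loops_iff)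
  have z1: "z \<in> W 1" using W_antimono[of 1 2 z] z(1) by simp
  have d: "loop_density (dens z)" by (rule density_dens[OF z1 z(2)])
  have zL: "circle_L2 z" by (rule W_L2[OF z1])
  have lt: "loop_time z \<tau> = clock (dens z) \<tau>" if tau: "\<tau> \<in> {0..1}" for \<tau>
  proof -
    have "(dens z has_integral of_real (clock (dens z) \<tau>)) {0..\<tau>}"
    proof -
      have "((\<lambda>s. dens z s - 1) has_integral (J (dens z) \<tau>)) {0..\<tau>}"
        using prim_J[OF density_L2[OF d]] tau unfolding prim_def density_mean[OF d] by (simp add: J_0)
      from has_integral_add[OF this has_integral_const_real[of "1::complex" 0 \<tau>]]
      have "(dens z has_integral (J (dens z) \<tau> + of_real \<tau>)) {0..\<tau>}" using tau by (simp add: scaleR_conv_of_real)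
      moreover have "J (dens z) \<tau> + of_real \<tau> = of_real (clock (dens z) \<tau>)"
        using J_real[OF density_L2[OF d] density_Im[OF d], of \<tau>] by (simp add: clock_def complex_eq_iff)
      ultimately show ?thesis by simp
    qed
    from has_integral_linear[OF this bounded_linear_Re]
    have 1: "((\<lambda>s. (cmod (z s))\<^sup>2 / l2ip z z) has_integral clock (dens z) \<tau>) {0..\<tau>}"
      by (simp add: o_def dens_eq)
    have si: "set_integrable lborel {0..\<tau>} (\<lambda>s. (cmod (z s))\<^sup>2)"
      by (rule set_integrable_subset[of _ "{0..1}"]) (use zL tau in \<open>auto simp: circle_L2_def\<close>)
    have "loop_time z \<tau> = integral {0..\<tau>} (\<lambda>s. (cmod (z s))\<^sup>2) / l2ip z z"
      using L2.nonneg[of z] zL by (simp add: loop_time_def circle_L2_norm_eq set_borel_integral_eq_integral(2)[OF si])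
    also have "\<dots> = clock (dens z) \<tau>" using integral_unique[OF 1] by simp
    finally show ?thesis .
  qed
  have tk: "tick (dens z) (frac t) \<in> {0..<1}"
  proof -
    let ?s = "tick (dens z) (frac t)"
    have c: "clock (dens z) ?s = frac t" by (rule clock_tick[OF d])
    have "\<not> ?s < 0"
    proof
      assume "?s < 0"
      then have "frac t < 0" using clock_mono[OF d, of ?s 0] clock_int[OF d, of 0] c by simp
      then show False using frac_ge_0[of t] by linarith
    qed
    moreover have "\<not> 1 < ?s"
    proof
      assume "1 < ?s"
      then have "1 < frac t" using clock_mono[OF d, of 1 ?s] clock_int[OF d, of 1] c by simp
      then show False using frac_lt_1[of t] by linarith
    qed
    moreover have "?s \<noteq> 1" using clock_int[OF d, of 1] c frac_lt_1[of t] by auto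
    ultimately show ?thesis by auto
  qed
  have "loop_time_inv z t = tick (dens z) (frac t)"
    unfolding loop_time_inv_def
  proof (rule the_inv_into_f_eq[OF _ _ tk])
    show "inj_on (loop_time z) {0..<1}" by (rule inj_onI) (use lt clock_inj[OF d] in auto)
    show "loop_time z (tick (dens z) (frac t)) = frac t" using lt tk clock_tick[OF d] by auto
  qed
  then have "rescale_square z t = rep (dens z) (\<lambda>t. z t * z t) (frac t)"
    by (simp add: rescale_square_def rep_def power2_eq_square)
  also have "\<dots> = rep (dens z) (\<lambda>t. z t * z t) t"
    by (rule per_frac[OF rep_per[OF d]]) (use W_per[OF z1] in simp)
  finally show "rescale_square z t = rep (dens z) (\<lambda>t. z t * z t) t" .
qed

section \<open>Iterated tangent spaces\<close>

type_synonym loop = "real \<Rightarrow> complex"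

text \<open>A letter False marks the base of a tangent space, where levels are shifted by one; this
  is the total shift of a component.\<close>

definition nF :: "bool list \<Rightarrow> nat" where "nF w = length (filter Not w)"

lemma nF_simps [simp]: "nF [] = 0" "nF (True # w) = nF w" "nF (False # w) = Suc (nF w)"
  by (simp_all add: nF_def)

lemma nF_replicate [simp]: "nF (replicate n False) = n"
  by (induction n) simp_all

definition words :: "nat \<Rightarrow> bool list set" where "words n = {w. length w = n}"

lemma words_0 [simp]: "words 0 = {[]}" by (auto simp: words_def)

lemma words_Suc: "words (Suc n) = Cons False ` words n \<union> Cons True ` words n"
proof
  show "words (Suc n) \<subseteq> Cons False ` words n \<union> Cons True ` words n"
  proof
    fix w assume "w \<in> words (Suc n)"
    then obtain b v where "w = b # v" "length v = n" by (auto simp: words_def length_Suc_conv)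
    then show "w \<in> Cons False ` words n \<union> Cons True ` words n" by (cases b) (auto simp: words_def)
  qed
qed (auto simp: words_def)

lemma Cons_words [simp]: "b # w \<in> words (Suc n) \<longleftrightarrow> w \<in> words n" and Nil_words [simp]: "[] \<notin> words (Suc n)"
  by (auto simp: words_def)

lemma finite_words [simp]: "finite (words n)"
  by (induction n) (simp_all add: words_Suc)

lemma replicate_words [simp]: "replicate n b \<in> words n" by (simp add: words_def)

lemma tower_word_cases: "(\<forall>w. P w) \<longleftrightarrow> P [] \<and> (\<forall>v. P (False # v)) \<and> (\<forall>v. P (True # v))"
proof
  assume *: "P [] \<and> (\<forall>v. P (False # v)) \<and> (\<forall>v. P (True # v))"
  show "\<forall>w. P w"
  proof
    fix w show "P w"
    proof (cases w)
      case (Cons b v)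
      then show ?thesis using * by (cases b) auto
    qed (use * in simp)
  qed
qed auto

lemma tpair_eta: "a [] = 0 \<Longrightarrow> tpair (tfst a) (tsnd a) = a"
  by (rule ext) (auto simp: tpair_def tfst_def tsnd_def split: list.split)

lemma tpair_Nil [simp]: "tpair x h [] = 0" and tpair_Cons [simp]: "tpair x h (b # w) = (if b then h w else x w)"
  by (simp_all add: tpair_def)

lemma level_sc_tangent: "a \<in> level (sc_tangent E) k \<longleftrightarrow> a [] = 0 \<and> tfst a \<in> level E (Suc k) \<and> tsnd a \<in> level E k"
proof
  assume "a [] = 0 \<and> tfst a \<in> level E (Suc k) \<and> tsnd a \<in> level E k"
  then show "a \<in> level (sc_tangent E) k"
    by (simp add: sc_tangent_def sc_sum_def sc_shift_def) (metis tpair_eta)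
qed (auto simp: sc_tangent_def sc_sum_def sc_shift_def)

lemma ip_sc_tangent: "ip (sc_tangent E) k a b = ip E (Suc k) (tfst a) (tfst b) + ip E k (tsnd a) (tsnd b)"
  by (simp add: sc_tangent_def sc_sum_def sc_shift_def)

lemma tip_image_iff: "a \<in> tip ` S \<longleftrightarrow> (\<forall>w. w \<noteq> [] \<longrightarrow> a w = 0) \<and> a [] \<in> S"
proof
  assume *: "(\<forall>w. w \<noteq> [] \<longrightarrow> a w = 0) \<and> a [] \<in> S"
  have "a = tip (a [])"
  proof
    fix w show "a w = tip (a []) w" using * by (cases w) (simp_all only: tip_def list.case, blast)
  qed
  then show "a \<in> tip ` S" using * by blast
qed (auto simp only: tip_def split: list.split)

definition TS :: "nat \<Rightarrow> loop tower scale" where "TS n = (sc_tangent ^^ n) (sc_tip loop_scale)"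

lemma TS_0: "TS 0 = sc_tip loop_scale" and TS_Suc: "TS (Suc n) = sc_tangent (TS n)"
  by (simp_all add: TS_def)

primrec TU :: "nat \<Rightarrow> loop tower set" where
  "TU 0 = tip ` punctured_loops"
| "TU (Suc n) = tangent_set (TS n) (TU n)"

text \<open>Replaces the nested sums and shifts by a condition on each word, which is the form used
  in all that follows.\<close>

lemma level_TS: "a \<in> level (TS n) k \<longleftrightarrow> (\<forall>w. w \<notin> words n \<longrightarrow> a w = 0) \<and> (\<forall>w\<in>words n. a w \<in> W (2 + nF w + k))"
proof (induction n arbitrary: a k)
  case 0
  have "a \<in> level (TS 0) k \<longleftrightarrow> a \<in> tip ` W (2 + k)" by (simp only: TS_0 sc_tip_def level_loop scale.select_convs)
  then show ?case unfolding tip_image_iff by (simp only: words_0 singleton_iff ball_simps nF_simps add_0_right simp_thms)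
next
  case (Suc n)
  show ?case unfolding TS_Suc level_sc_tangent Suc.IH Ball_def
    unfolding tower_word_cases[of "\<lambda>w. w \<notin> words (Suc n) \<longrightarrow> a w = 0"] tower_word_cases[of "\<lambda>w. w \<in> words (Suc n) \<longrightarrow> a w \<in> W (2 + nF w + k)"]
    by (auto simp: tfst_def tsnd_def)
qed

lemma ip_TS: "ip (TS n) k a b = (\<Sum>w\<in>words n. wip (2 + nF w + k) (a w) (b w))"
proof (induction n arbitrary: a b k)
  case 0
  show ?case by (simp add: TS_0 sc_tip_def ip_loop untip_def)
next
  case (Suc n)
  have d: "Cons False ` words n \<inter> Cons True ` words n = {}" by auto
  have i: "inj_on (Cons b) (words n)" for b by simp
  show ?case unfolding TS_Suc ip_sc_tangent Suc.IH words_Suc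
    by (subst sum.union_disjoint[OF _ _ d]) (simp_all add: sum.reindex[OF i] tfst_def tsnd_def)
qed

lemma lnorm_TS: "lnorm (TS n) k a = sqrt (ip (TS n) k a a)" by (simp add: lnorm_def)

lemma level_TS_W: "a \<in> level (TS n) k \<Longrightarrow> w \<in> words n \<Longrightarrow> a w \<in> W (2 + nF w + k)"
  by (simp add: level_TS)

lemma tower_add: "(x + y) w = x w + y w" for x y :: "loop tower"
  by (simp only: plus_fun_def)

lemma tower_scaleR: "(c *\<^sub>R x) w = c *\<^sub>R x w" for x :: "loop tower"
  by (simp only: scaleR_fun_def)

lemma level_TS_zero: "a \<in> level (TS n) k \<Longrightarrow> w \<notin> words n \<Longrightarrow> a w = 0"
  unfolding level_TS by blast

lemma level_TSI: "(\<And>w. w \<notin> words n \<Longrightarrow> a w = 0) \<Longrightarrow> (\<And>w. w \<in> words n \<Longrightarrow> a w \<in> W (2 + nF w + k)) \<Longrightarrow> a \<in> level (TS n) k"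
  unfolding level_TS by blast

interpretation TS: semi_ip "level (TS n) k" "ip (TS n) k" for n k
proof
  show "subspace (level (TS n) k)"
  proof (rule subspaceI)
    show "0 \<in> level (TS n) k" unfolding level_TS using Wm.zero_in by simp
    show "x + y \<in> level (TS n) k" if "x \<in> level (TS n) k" "y \<in> level (TS n) k" for x y
    proof (rule level_TSI)
      show "(x + y) w = 0" if w: "w \<notin> words n" for w
        unfolding tower_add level_TS_zero[OF \<open>x \<in> level (TS n) k\<close> w] level_TS_zero[OF \<open>y \<in> level (TS n) k\<close> w] by (rule add_0_left)
      show "(x + y) w \<in> W (2 + nF w + k)" if w: "w \<in> words n" for w
        unfolding tower_add
        by (rule Wm.add_in[OF level_TS_W[OF \<open>x \<in> level (TS n) k\<close> w] level_TS_W[OF \<open>y \<in> level (TS n) k\<close> w]])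
    qed
    show "c *\<^sub>R x \<in> level (TS n) k" if "x \<in> level (TS n) k" for c x
    proof (rule level_TSI)
      show "(c *\<^sub>R x) w = 0" if w: "w \<notin> words n" for w
        unfolding tower_scaleR level_TS_zero[OF \<open>x \<in> level (TS n) k\<close> w] by (rule scaleR_zero_right)
      show "(c *\<^sub>R x) w \<in> W (2 + nF w + k)" if w: "w \<in> words n" for w
        unfolding tower_scaleR by (rule Wm.scale_in[OF level_TS_W[OF \<open>x \<in> level (TS n) k\<close> w]])
    qed
  qed
  fix x y z c
  assume x: "x \<in> level (TS n) k"
  show "0 \<le> ip (TS n) k x x" unfolding ip_TS by (intro sum_nonneg Wm.nonneg level_TS_W[OF x])
  assume y: "y \<in> level (TS n) k"
  show "ip (TS n) k x y = ip (TS n) k y x" unfolding ip_TS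
    by (intro sum.cong refl Wm.sym level_TS_W[OF x] level_TS_W[OF y])
  show "ip (TS n) k (c *\<^sub>R x) y = c * ip (TS n) k x y" unfolding ip_TS sum_distrib_left tower_scaleR
    by (intro sum.cong refl Wm.scale level_TS_W[OF x] level_TS_W[OF y])
  assume z: "z \<in> level (TS n) k"
  show "ip (TS n) k (x + y) z = ip (TS n) k x z + ip (TS n) k y z" unfolding ip_TS sum.distrib[symmetric] tower_add
    by (intro sum.cong refl Wm.add level_TS_W[OF x] level_TS_W[OF y] level_TS_W[OF z])
qed

lemma wn_le_lnorm_TS: assumes "a \<in> level (TS n) k" "w \<in> words n" shows "wn (2 + nF w + k) (a w) \<le> lnorm (TS n) k a"
  unfolding lnorm_TS ip_TS
  by (intro real_sqrt_le_mono member_le_sum assms(2) finite_words Wm.nonneg level_TS_W[OF assms(1)]) auto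

lemma lnorm_TS_tendsto:
  assumes "\<And>i. X i \<in> level (TS n) k" "\<And>w. w \<in> words n \<Longrightarrow> (\<lambda>i. wn (2 + nF w + k) (X i w)) \<longlonglongrightarrow> 0"
  shows "(\<lambda>i. lnorm (TS n) k (X i)) \<longlonglongrightarrow> 0"
proof -
  have "(\<lambda>i. \<Sum>w\<in>words n. (wn (2 + nF w + k) (X i w))\<^sup>2) \<longlonglongrightarrow> (\<Sum>w\<in>words n. 0\<^sup>2)"
    by (intro tendsto_sum tendsto_power assms(2))
  moreover have "(\<Sum>w\<in>words n. (wn (2 + nF w + k) (X i w))\<^sup>2) = ip (TS n) k (X i) (X i)" for i
    unfolding ip_TS by (intro sum.cong refl real_sqrt_pow2 Wm.nonneg level_TS_W[OF assms(1)])
  ultimately have "(\<lambda>i. ip (TS n) k (X i) (X i)) \<longlonglongrightarrow> 0" by simp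
  from tendsto_real_sqrt[OF this] show ?thesis by (simp add: lnorm_TS)
qed

text \<open>Only the words of length n are tested; elsewhere the elements of a level are
  zero.\<close>

definition tcv :: "nat \<Rightarrow> nat \<Rightarrow> (nat \<Rightarrow> loop tower) \<Rightarrow> loop tower \<Rightarrow> bool"
  where "tcv n k A a \<longleftrightarrow> (\<forall>w\<in>words n. cv (2 + nF w + k) (\<lambda>i. A i w) (a w))"

lemma tcvI_lnorm:
  assumes "\<And>i. A i \<in> level (TS n) k" "a \<in> level (TS n) k" "(\<lambda>i. lnorm (TS n) k (A i - a)) \<longlonglongrightarrow> 0"
  shows "tcv n k A a"
  unfolding tcv_def
proof
  fix w assume w: "w \<in> words n"
  show "cv (2 + nF w + k) (\<lambda>i. A i w) (a w)"
  proof (rule cvI[OF level_TS_W[OF assms(1) w] level_TS_W[OF assms(2) w] _ assms(3)])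
    show "wn (2 + nF w + k) (A i w - a w) \<le> lnorm (TS n) k (A i - a)" for i
      using wn_le_lnorm_TS[OF TS.diff_in[OF assms(1,2)] w] by (simp only: minus_apply)
  qed
qed

lemma tcv_lnorm:
  assumes "\<And>i. A i \<in> level (TS n) k" "a \<in> level (TS n) k" "tcv n k A a"
  shows "(\<lambda>i. lnorm (TS n) k (A i - a)) \<longlonglongrightarrow> 0"
proof (rule lnorm_TS_tendsto[OF TS.diff_in[OF assms(1,2)]])
  fix w assume "w \<in> words n"
  then have "cv (2 + nF w + k) (\<lambda>i. A i w) (a w)" using assms(3) by (simp add: tcv_def)
  from cv_D(4)[OF this] show "(\<lambda>i. wn (2 + nF w + k) ((A i - a) w)) \<longlonglongrightarrow> 0" by (simp only: minus_apply)
qed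

lemma level_TS_antimono: "k \<le> l \<Longrightarrow> a \<in> level (TS n) l \<Longrightarrow> a \<in> level (TS n) k"
  unfolding level_TS using W_antimono[of "2 + nF w + k" "2 + nF w + l" for w] by simp

lemma tcv_antimono: "k \<le> l \<Longrightarrow> tcv n l A a \<Longrightarrow> tcv n k A a"
  unfolding tcv_def using cv_antimono[of "2 + nF w + l" _ _ "2 + nF w + k" for w] by simp

lemma tcv_const: "a \<in> level (TS n) k \<Longrightarrow> tcv n k (\<lambda>i. a) a"
  unfolding tcv_def by (intro ballI cv_const level_TS_W)

lemma tpair_level_TS: "tpair a h \<in> level (TS (Suc n)) k \<longleftrightarrow> a \<in> level (TS n) (Suc k) \<and> h \<in> level (TS n) k"
  unfolding TS_Suc level_sc_tangent by simp

lemma tcv_tpair: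
  assumes "tcv n (Suc k) A a" "tcv n k H h" shows "tcv (Suc n) k (\<lambda>i. tpair (A i) (H i)) (tpair a h)"
  unfolding tcv_def words_Suc
proof
  fix w assume "w \<in> Cons False ` words n \<union> Cons True ` words n"
  then show "cv (2 + nF w + k) (\<lambda>i. tpair (A i) (H i) w) (tpair a h w)"
    using assms unfolding tcv_def by (auto simp: tpair_Cons)
qed

text \<open>The all-False word carries the original loop, the base point of all base points; it
  alone is constrained by the open set.\<close>

lemma TU_iff: "a \<in> TU n \<longleftrightarrow> a \<in> level (TS n) 0 \<and> (\<forall>t. a (replicate n False) t \<noteq> 0)"
proof (induction n arbitrary: a)
  case 0
  show ?case unfolding TU.simps tip_image_iff level_TS punctured_loops_iff
    by (simp only: words_0 singleton_iff ball_simps nF_simps add_0_right replicate_0 simp_thms conj_assoc)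
next
  case (Suc n)
  have "a \<in> TU (Suc n) \<longleftrightarrow> a [] = 0 \<and> tfst a \<in> TU n \<and> tfst a \<in> level (TS n) 1 \<and> tsnd a \<in> level (TS n) 0"
  proof
    assume "a [] = 0 \<and> tfst a \<in> TU n \<and> tfst a \<in> level (TS n) 1 \<and> tsnd a \<in> level (TS n) 0"
    then show "a \<in> TU (Suc n)"
      by (simp add: tangent_set_def) (metis tpair_eta)
  qed (auto simp: tangent_set_def)
  also have "\<dots> \<longleftrightarrow> a \<in> level (TS (Suc n)) 0 \<and> (\<forall>t. a (replicate (Suc n) False) t \<noteq> 0)"
    unfolding TS_Suc level_sc_tangent Suc.IH using level_TS_antimono[of 0 "Suc 0" "tfst a" n] by (auto simp: tfst_def)
  finally show ?case .
qed

lemma TU_level: "a \<in> TU n \<Longrightarrow> a \<in> level (TS n) 0" by (simp add: TU_iff)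

lemma tpair_TU: "tpair a h \<in> TU (Suc n) \<longleftrightarrow> a \<in> TU n \<and> a \<in> level (TS n) 1 \<and> h \<in> level (TS n) 0"
  unfolding TU_iff tpair_level_TS using level_TS_antimono[of 0 1 a n] by auto

lemma TU_Suc_iff: "a \<in> TU (Suc n) \<longleftrightarrow> a [] = 0 \<and> tfst a \<in> TU n \<and> tfst a \<in> level (TS n) 1 \<and> tsnd a \<in> level (TS n) 0"
proof (cases "a [] = 0")
  case True
  then show ?thesis using tpair_TU[of "tfst a" "tsnd a" n] by (simp add: tpair_eta)
next
  case False
  then show ?thesis using TU_level[of a "Suc n"] by (auto simp: level_TS)
qed

lemma TU_open:
  assumes "a \<in> TU n" "a \<in> level (TS n) k"
  obtains r where "0 < r" "\<And>y. y \<in> level (TS n) k \<Longrightarrow> lnorm (TS n) k (y - a) < r \<Longrightarrow> y \<in> TU n"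
proof -
  let ?w = "replicate n False"
  have z: "a ?w \<in> W (2 + n + k)" "\<And>t. a ?w t \<noteq> 0"
    using level_TS_W[OF assms(2), of ?w] assms(1) by (auto simp: TU_iff)
  obtain r where r: "0 < r" "\<And>y t. y \<in> W (2 + n + k) \<Longrightarrow> wn (2 + n + k) (y - a ?w) < r \<Longrightarrow> y t \<noteq> 0"
    by (rule nonvanishing_open[OF z(1) _ z(2)]) (simp, rule that)
  show ?thesis
  proof (rule that[OF r(1)])
    fix y assume y: "y \<in> level (TS n) k" "lnorm (TS n) k (y - a) < r"
    have "wn (2 + nF ?w + k) ((y - a) ?w) \<le> lnorm (TS n) k (y - a)"
      by (rule wn_le_lnorm_TS[OF TS.diff_in[OF y(1) assms(2)] replicate_words])
    then have "wn (2 + n + k) (y ?w - a ?w) < r" using y(2) unfolding minus_apply nF_replicate by linarith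
    moreover have "y ?w \<in> W (2 + n + k)" using level_TS_W[OF y(1) replicate_words[of n False]] by simp
    ultimately have "y ?w t \<noteq> 0" for t using r(2) by blast
    then show "y \<in> TU n" using level_TS_antimono[OF _ y(1), of 0] by (simp add: TU_iff)
  qed
qed

text \<open>The words are finitely many, so one subsequence after the other is extracted, one for
  each component.\<close>

lemma compact_TS:
  assumes "\<And>i. A i \<in> level (TS n) 1" "\<And>i. lnorm (TS n) 1 (A i) \<le> C"
  obtains r a where "strict_mono (r :: nat \<Rightarrow> nat)" "a \<in> level (TS n) 0" "tcv n 0 (\<lambda>i. A (r i)) a"
proof -
  have "\<exists>r. strict_mono (r :: nat \<Rightarrow> nat) \<and> (\<forall>w\<in>S. \<exists>x. cv (2 + nF w) (\<lambda>i. A (r i) w) x)" if "finite S" "S \<subseteq> words n" for S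
    using that
  proof induction
    case empty
    have "strict_mono (\<lambda>i::nat. i)" by (simp add: strict_mono_def)
    then show ?case by blast
  next
    case (insert v S)
    then obtain r where r: "strict_mono (r :: nat \<Rightarrow> nat)" "\<And>w. w \<in> S \<Longrightarrow> \<exists>x. cv (2 + nF w) (\<lambda>i. A (r i) w) x" by auto
    have v: "v \<in> words n" using insert by simp
    have 1: "A (r i) v \<in> W (Suc (2 + nF v))" for i using level_TS_W[OF assms(1) v] by simp
    have 2: "wn (Suc (2 + nF v)) (A (r i) v) \<le> C" for i
      using order.trans[OF wn_le_lnorm_TS[OF assms(1) v] assms(2)] by simp
    obtain r' x where r': "strict_mono (r' :: nat \<Rightarrow> nat)" "cv (2 + nF v) (\<lambda>i. A (r (r' i)) v) x"
      using W_compact[of "\<lambda>i. A (r i) v", OF 1 2] by blast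
    have "\<exists>x. cv (2 + nF w) (\<lambda>i. A (r (r' i)) w) x" if wv: "w \<in> insert v S" for w
    proof (cases "w = v")
      case False
      then have "w \<in> S" using wv by blast
      then obtain x where "cv (2 + nF w) (\<lambda>i. A (r i) w) x" using r(2) by blast
      then show ?thesis using cv_subseq[OF _ r'(1)] by blast
    qed (use r' in blast)
    moreover have "strict_mono (\<lambda>i. r (r' i))" using r(1) r'(1) by (simp add: strict_mono_def)
    ultimately show ?case by blast
  qed
  from this[OF finite_words order_refl] obtain r where r: "strict_mono (r :: nat \<Rightarrow> nat)"
    "\<forall>w\<in>words n. \<exists>x. cv (2 + nF w) (\<lambda>i. A (r i) w) x" by blast
  then obtain x where x: "\<And>w. w \<in> words n \<Longrightarrow> cv (2 + nF w) (\<lambda>i. A (r i) w) (x w)" by metis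
  define a where "a = (\<lambda>w. if w \<in> words n then x w else 0)"
  have t: "tcv n 0 (\<lambda>i. A (r i)) a" using x by (simp add: tcv_def a_def)
  have "a \<in> level (TS n) 0" unfolding level_TS using cv_D(2)[OF x] by (simp add: a_def)
  with r(1) t show ?thesis using that by blast
qed

text \<open>The level topologies come from norms, so sequential continuity suffices: a failure would
  give points within 1 / (i + 1) of a with values a fixed distance away. Openness of
  \<open>TU n\<close> on each level then allows arguing with balls of the full level.\<close>

lemma sc0_TS:
  assumes maps: "\<And>k a. a \<in> TU n \<Longrightarrow> a \<in> level (TS n) k \<Longrightarrow> f a \<in> TU n \<and> f a \<in> level (TS n) k"
    and cont: "\<And>k A a. (\<And>i. A i \<in> TU n) \<Longrightarrow> a \<in> TU n \<Longrightarrow> tcv n k A a \<Longrightarrow> tcv n k (\<lambda>i. f (A i)) (f a)"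
  shows "sc0 (TS n) (TU n) (TS n) (TU n) f"
  unfolding sc0_def
proof
  fix k
  have eps: "\<exists>d>0. \<forall>y. y \<in> TU n \<and> y \<in> level (TS n) k \<and> lnorm (TS n) k (y - a) < d \<longrightarrow> lnorm (TS n) k (f y - f a) < e"
    if a: "a \<in> TU n" "a \<in> level (TS n) k" and e: "0 < e" for a e
  proof (rule ccontr)
    assume "\<not> ?thesis"
    then have *: "\<exists>y. y \<in> TU n \<and> y \<in> level (TS n) k \<and> lnorm (TS n) k (y - a) < d \<and> \<not> lnorm (TS n) k (f y - f a) < e" if "d > 0" for d
      using that by blast
    have "\<exists>y. y \<in> TU n \<and> y \<in> level (TS n) k \<and> lnorm (TS n) k (y - a) < 1 / real (Suc i) \<and> \<not> lnorm (TS n) k (f y - f a) < e" for i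
      by (rule *) simp
    then obtain Y where Y: "\<And>i. Y i \<in> TU n" "\<And>i. Y i \<in> level (TS n) k" "\<And>i. lnorm (TS n) k (Y i - a) < 1 / real (Suc i)"
      "\<And>i. \<not> lnorm (TS n) k (f (Y i) - f a) < e" by metis
    have "(\<lambda>i. lnorm (TS n) k (Y i - a)) \<longlonglongrightarrow> 0"
    proof (rule tendsto_sandwich[OF always_eventually always_eventually tendsto_const])
      show "(\<lambda>i. 1 / real (Suc i)) \<longlonglongrightarrow> 0" using LIMSEQ_inverse_real_of_nat by (simp add: inverse_eq_divide)
      show "\<forall>i. 0 \<le> lnorm (TS n) k (Y i - a)" unfolding lnorm_TS using TS.N_nonneg[OF TS.diff_in[OF Y(2) a(2)]] by blast
      show "\<forall>i. lnorm (TS n) k (Y i - a) \<le> 1 / real (Suc i)" using Y(3) less_imp_le by blast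
    qed
    then have "tcv n k Y a" by (rule tcvI_lnorm[OF Y(2) a(2)])
    then have t: "tcv n k (\<lambda>i. f (Y i)) (f a)" by (rule cont[OF Y(1) a(1)])
    have "(\<lambda>i. lnorm (TS n) k (f (Y i) - f a)) \<longlonglongrightarrow> 0"
      by (rule tcv_lnorm[OF _ _ t]) (use maps Y a in blast)+
    then have "\<forall>\<^sub>F i in sequentially. lnorm (TS n) k (f (Y i) - f a) < e" by (rule order_tendstoD(2)[OF _ e])
    then show False using Y(4) by (auto simp only: eventually_sequentially)
  qed
  show "continuous_map (subtopology (level_topology (TS n) k) (TU n)) (subtopology (level_topology (TS n) k) (TU n)) f"
    unfolding continuous_map_alt
  proof (intro conjI allI impI)
    show "f \<in> topspace (subtopology (level_topology (TS n) k) (TU n)) \<rightarrow> topspace (subtopology (level_topology (TS n) k) (TU n))"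
      using maps by (auto simp: topspace_level)
    fix S assume "openin (subtopology (level_topology (TS n) k) (TU n)) S"
    then obtain T where T: "openin (level_topology (TS n) k) T" "S = T \<inter> TU n" by (auto simp: openin_subtopology)
    define R where "R = f -` S \<inter> topspace (subtopology (level_topology (TS n) k) (TU n))"
    have "openin (level_topology (TS n) k) R" unfolding openin_level_topology
    proof (intro conjI ballI)
      show "R \<subseteq> level (TS n) k" by (auto simp: R_def topspace_level)
      fix a assume "a \<in> R"
      then have a: "a \<in> TU n" "a \<in> level (TS n) k" "f a \<in> T" using T by (auto simp: R_def topspace_level)
      obtain e where e: "0 < e" "\<And>y. y \<in> level (TS n) k \<Longrightarrow> lnorm (TS n) k (y - f a) < e \<Longrightarrow> y \<in> T"
        using T(1) a(3) unfolding openin_level_topology by blast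
      obtain d where d: "0 < d" "\<And>y. y \<in> TU n \<Longrightarrow> y \<in> level (TS n) k \<Longrightarrow> lnorm (TS n) k (y - a) < d \<Longrightarrow> lnorm (TS n) k (f y - f a) < e"
        using eps[OF a(1,2) e(1)] by blast
      obtain r where r: "0 < r" "\<And>y. y \<in> level (TS n) k \<Longrightarrow> lnorm (TS n) k (y - a) < r \<Longrightarrow> y \<in> TU n"
        by (rule TU_open[OF a(1,2)]) (rule that)
      show "\<exists>r>0. \<forall>y\<in>level (TS n) k. lnorm (TS n) k (y - a) < r \<longrightarrow> y \<in> R"
      proof (intro exI[of _ "min d r"] conjI ballI impI)
        show "0 < min d r" using d r by simp
        fix y assume y: "y \<in> level (TS n) k" "lnorm (TS n) k (y - a) < min d r"
        have yU: "y \<in> TU n" by (rule r(2)[OF y(1)]) (use y(2) in simp)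
        have "lnorm (TS n) k (f y - f a) < e" by (rule d(2)[OF yU y(1)]) (use y(2) in simp)
        then have "f y \<in> T" using e(2) maps[OF yU y(1)] by blast
        then show "y \<in> R" using yU y(1) maps[OF yU y(1)] T(2) by (simp add: R_def topspace_level)
      qed
    qed
    moreover have "R = R \<inter> TU n" by (auto simp: R_def)
    ultimately show "openin (subtopology (level_topology (TS n) k) (TU n)) (f -` S \<inter> topspace (subtopology (level_topology (TS n) k) (TU n)))"
      unfolding R_def[symmetric] openin_subtopology by blast
  qed
qed

section \<open>A class of maps closed under tangents\<close>

text \<open>Linearity is over the reals because conjugation is one of the operators. It is required
  on all of L^2, which contains every \<open>W m\<close>.\<close>

definition cv_op :: "(loop \<Rightarrow> loop) \<Rightarrow> bool"
  where "cv_op L \<longleftrightarrow> (\<forall>m X x. cv m X x \<longrightarrow> cv m (\<lambda>i. L (X i)) (L x)) \<and>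
    (\<forall>f g a b. circle_L2 f \<longrightarrow> circle_L2 g \<longrightarrow>
      L (\<lambda>t. of_real a * f t + of_real b * g t) = (\<lambda>t. of_real a * L f t + of_real b * L g t))"

lemma cv_op_cv: "cv_op L \<Longrightarrow> cv m X x \<Longrightarrow> cv m (\<lambda>i. L (X i)) (L x)"
  unfolding cv_op_def by blast

lemma cv_op_linear: "cv_op L \<Longrightarrow> circle_L2 f \<Longrightarrow> circle_L2 g \<Longrightarrow>
    L (\<lambda>t. of_real a * f t + of_real b * g t) = (\<lambda>t. of_real a * L f t + of_real b * L g t)"
  unfolding cv_op_def by blast

lemma cv_op_cnj: "cv_op (\<lambda>f t. cnj (f t))"
  unfolding cv_op_def by (intro conjI allI impI cv_cnj) simp_all

lemma cv_op_cmult: "cv_op (\<lambda>f t. c * f t)"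
  unfolding cv_op_def by (intro conjI allI impI cv_cmult) (simp_all add: algebra_simps)

lemma cv_op_mean: "cv_op (\<lambda>f t. mean f)"
  unfolding cv_op_def
proof (intro conjI allI impI cv_mean)
  fix f g and a b :: real assume fg: "circle_L2 f" "circle_L2 g"
  show "(\<lambda>t. mean (\<lambda>t. of_real a * f t + of_real b * g t)) = (\<lambda>t. of_real a * mean f + of_real b * mean g)"
    by (simp add: mean_add[OF circle_L2_cmult[OF fg(1)] circle_L2_cmult[OF fg(2)]] mean_cmult)
qed

lemma cv_op_J: "cv_op J"
  unfolding cv_op_def by (intro conjI allI impI cv_J J_lincomb)

text \<open>A map in \<open>tame n r\<close> takes level \<open>k\<close> of the \<open>n\<close>-th tangent space to loops of level \<open>r + k\<close>; the
  component at the word \<open>w\<close> gains \<open>r = nF w\<close> levels by the shift of the base in a tangent space.\<close>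

inductive tame :: "nat \<Rightarrow> nat \<Rightarrow> (loop tower \<Rightarrow> loop) \<Rightarrow> bool" where
  var: "w \<in> words n \<Longrightarrow> r \<le> nF w \<Longrightarrow> tame n r (\<lambda>a. a w)"
| add: "tame n r \<Phi> \<Longrightarrow> tame n r \<Psi> \<Longrightarrow> tame n r (\<lambda>a t. \<Phi> a t + \<Psi> a t)"
| mult: "tame n r \<Phi> \<Longrightarrow> tame n r \<Psi> \<Longrightarrow> tame n r (\<lambda>a t. \<Phi> a t * \<Psi> a t)"
| lin: "cv_op L \<Longrightarrow> tame n r \<Phi> \<Longrightarrow> tame n r (\<lambda>a. L (\<Phi> a))"
| deriv: "tame n (Suc r) \<Phi> \<Longrightarrow> tame n r (\<lambda>a. loop_deriv (\<Phi> a))"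
| inv: "tame n r \<Phi> \<Longrightarrow> (\<And>a t. a \<in> TU n \<Longrightarrow> \<Phi> a t \<noteq> 0) \<Longrightarrow> tame n r (\<lambda>a t. inverse (\<Phi> a t))"
| rep: "tame n r \<Psi> \<Longrightarrow> tame n r \<Phi> \<Longrightarrow> (\<And>a. a \<in> TU n \<Longrightarrow> loop_density (\<Psi> a)) \<Longrightarrow> tame n r (\<lambda>a. rep (\<Psi> a) (\<Phi> a))"

text \<open>The order 2 + r + k is at least 2, so the order-one demands of products, inverses,
  derivatives and densities are always met.\<close>

lemma tame_cont:
  assumes "tame n r \<Phi>" "\<And>i. A i \<in> TU n" "a \<in> TU n" "tcv n k A a"
  shows "cv (2 + r + k) (\<lambda>i. \<Phi> (A i)) (\<Phi> a)"
  using assms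
proof (induction rule: tame.induct)
  case (var w n r)
  then have "cv (2 + nF w + k) (\<lambda>i. A i w) (a w)" by (simp add: tcv_def)
  then show ?case by (rule cv_antimono) (use var in simp)
next
  case (add n r \<Phi> \<Psi>)
  then show ?case by (intro cv_add) simp_all
next
  case (mult n r \<Phi> \<Psi>)
  then show ?case by (intro cv_mult') simp_all
next
  case (lin L n r \<Phi>)
  have "cv (2 + r + k) (\<lambda>i. \<Phi> (A i)) (\<Phi> a)" by (rule lin.IH[OF lin.prems])
  then show ?case by (rule cv_op_cv[OF lin.hyps(1)])
next
  case (deriv n r \<Phi>)
  have "cv (2 + Suc r + k) (\<lambda>i. \<Phi> (A i)) (\<Phi> a)" by (rule deriv.IH[OF deriv.prems])
  then have "cv (Suc (2 + r + k)) (\<lambda>i. \<Phi> (A i)) (\<Phi> a)" by simp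
  then show ?case by (rule cv_loop_deriv) simp
next
  case (inv n r \<Phi>)
  have "cv (2 + r + k) (\<lambda>i. \<Phi> (A i)) (\<Phi> a)" by (rule inv.IH[OF inv.prems])
  then show ?case by (rule cv_inverse[OF _ _ inv.hyps(2)[OF inv.prems(1)] inv.hyps(2)[OF inv.prems(2)]]) simp
next
  case (rep n r \<Psi> \<Phi>)
  have 1: "cv (2 + r + k) (\<lambda>i. \<Phi> (A i)) (\<Phi> a)" by (rule rep.IH(2)[OF rep.prems])
  have 2: "cv (max (2 + r + k) 1) (\<lambda>i. \<Psi> (A i)) (\<Psi> a)" using rep.IH(1)[OF rep.prems] by (simp add: max_absorb1)
  show ?case by (rule cv_rep[OF 1 2 rep.hyps(3)[OF rep.prems(1)] rep.hyps(3)[OF rep.prems(2)]])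
qed

lemma tame_W: "tame n r \<Phi> \<Longrightarrow> a \<in> TU n \<Longrightarrow> a \<in> level (TS n) k \<Longrightarrow> \<Phi> a \<in> W (2 + r + k)"
  using cv_D(2)[OF tame_cont[of n r \<Phi> "\<lambda>i. a" a k]] tcv_const by blast

lemma tame_W0: "tame n r \<Phi> \<Longrightarrow> a \<in> TU n \<Longrightarrow> \<Phi> a \<in> W (2 + r)"
  using tame_W[of n r \<Phi> a 0] TU_level by simp

lemma tame_cont0:
  assumes "tame n r \<Phi>" "\<And>i. A i \<in> TU n" "a \<in> TU n" "tcv n 0 A a" shows "cv (2 + r) (\<lambda>i. \<Phi> (A i)) (\<Phi> a)"
  using tame_cont[OF assms] by simp

lemma tame_weaken: "tame n r \<Phi> \<Longrightarrow> r' \<le> r \<Longrightarrow> tame n r' \<Phi>"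
proof (induction arbitrary: r' rule: tame.induct)
  case (deriv n r \<Phi>)
  then show ?case by (intro tame.deriv) simp
qed (auto intro: tame.intros)

text \<open>The base of a tangent vector lies one level higher than before, which is where the
  additional order comes from.\<close>

lemma tame_lift: "tame n r \<Phi> \<Longrightarrow> tame (Suc n) (Suc r) (\<lambda>b. \<Phi> (tfst b))"
proof (induction rule: tame.induct)
  case (var w n r)
  have "tame (Suc n) (Suc r) (\<lambda>b. b (False # w))" by (rule tame.var) (use var in simp_all)
  then show ?case by (simp add: tfst_def)
next
  case (inv n r \<Phi>)
  have "\<Phi> (tfst b) t \<noteq> 0" if "b \<in> TU (Suc n)" for b t using that inv.hyps(2) unfolding TU_Suc_iff by blast
  then show ?case by (rule tame.inv[OF inv.IH])
next
  case (rep n r \<Psi> \<Phi>)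
  have "loop_density (\<Psi> (tfst b))" if "b \<in> TU (Suc n)" for b using that rep.hyps(3) unfolding TU_Suc_iff by blast
  then show ?case by (rule tame.rep[OF rep.IH])
qed (auto intro: tame.intros)

lemma tame_lift': "tame n r \<Phi> \<Longrightarrow> tame (Suc n) r (\<lambda>b. \<Phi> (tfst b))"
  by (rule tame_weaken[OF tame_lift]) (assumption, simp)

subsection \<open>Directional derivatives\<close>

definition diff_quot :: "(loop tower \<Rightarrow> loop) \<Rightarrow> loop tower \<Rightarrow> loop tower \<Rightarrow> real \<Rightarrow> loop"
  where "diff_quot \<Phi> a h s = (\<lambda>t. (\<Phi> (a + s *\<^sub>R h) t - \<Phi> a t) / of_real s)"

text \<open>Base point and direction both lie in level 1, as do the increments in
  \<open>sc_derivative\<close>; directions of level 0 are reached only by \<Phi>' as a tame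
  map.\<close>

definition dir_deriv :: "nat \<Rightarrow> nat \<Rightarrow> (loop tower \<Rightarrow> loop) \<Rightarrow> (loop tower \<Rightarrow> loop) \<Rightarrow> bool"
  where "dir_deriv n r \<Phi> \<Phi>' \<longleftrightarrow> (\<forall>a h s. a \<in> TU n \<longrightarrow> a \<in> level (TS n) 1 \<longrightarrow> h \<in> level (TS n) 1 \<longrightarrow>
     (\<forall>i. a + s i *\<^sub>R h \<in> TU n) \<longrightarrow> (\<forall>i. s i \<noteq> 0) \<longrightarrow> s \<longlonglongrightarrow> 0 \<longrightarrow>
     cv (2 + r) (\<lambda>i. diff_quot \<Phi> a h (s i)) (\<Phi>' (tpair a h)))"

definition lin_deriv :: "nat \<Rightarrow> (loop tower \<Rightarrow> loop) \<Rightarrow> bool"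
  where "lin_deriv n \<Phi>' \<longleftrightarrow> (\<forall>a h k \<alpha> \<beta>. a \<in> TU n \<longrightarrow> a \<in> level (TS n) 1 \<longrightarrow> h \<in> level (TS n) 0 \<longrightarrow> k \<in> level (TS n) 0 \<longrightarrow>
     \<Phi>' (tpair a (\<alpha> *\<^sub>R h + \<beta> *\<^sub>R k)) = (\<lambda>t. of_real \<alpha> * \<Phi>' (tpair a h) t + of_real \<beta> * \<Phi>' (tpair a k) t))"

lemma lin_derivD:
  "lin_deriv n \<Phi>' \<Longrightarrow> a \<in> TU n \<Longrightarrow> a \<in> level (TS n) 1 \<Longrightarrow> h \<in> level (TS n) 0 \<Longrightarrow> k \<in> level (TS n) 0 \<Longrightarrow>
     \<Phi>' (tpair a (\<alpha> *\<^sub>R h + \<beta> *\<^sub>R k)) = (\<lambda>t. of_real \<alpha> * \<Phi>' (tpair a h) t + of_real \<beta> * \<Phi>' (tpair a k) t)"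
  unfolding lin_deriv_def by blast

lemma lin_deriv_scale:
  assumes "lin_deriv n \<Phi>'" "a \<in> TU n" "a \<in> level (TS n) 1" "h \<in> level (TS n) 0"
  shows "\<Phi>' (tpair a (\<alpha> *\<^sub>R h)) = (\<lambda>t. of_real \<alpha> * \<Phi>' (tpair a h) t)"
proof -
  have "\<alpha> *\<^sub>R h = \<alpha> *\<^sub>R h + 0 *\<^sub>R h" by (simp only: scaleR_zero_left add_0_right)
  then show ?thesis using lin_derivD[OF assms(1-4) assms(4), of \<alpha> 0] by (simp only: of_real_0 mult_zero_left add_0_right)
qed

lemma lin_deriv_add:
  assumes "lin_deriv n \<Phi>'" "a \<in> TU n" "a \<in> level (TS n) 1" "h \<in> level (TS n) 0" "k \<in> level (TS n) 0"
  shows "\<Phi>' (tpair a (h + k)) = (\<lambda>t. \<Phi>' (tpair a h) t + \<Phi>' (tpair a k) t)"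
  using lin_derivD[OF assms, of 1 1] by (simp only: scaleR_one of_real_1 mult_1)

lemma tcv_add_null:
  assumes "a \<in> level (TS n) k" "\<And>i. H i \<in> level (TS n) k" "(\<lambda>i. lnorm (TS n) k (H i)) \<longlonglongrightarrow> 0"
  shows "tcv n k (\<lambda>i. a + H i) a"
  by (rule tcvI_lnorm[OF TS.add_in[OF assms(1,2)] assms(1)]) (use assms(3) in \<open>simp only: add_diff_cancel_left'\<close>)

lemma lnorm_scale_tendsto:
  assumes "h \<in> level (TS n) k" "s \<longlonglongrightarrow> 0" shows "(\<lambda>i. lnorm (TS n) k (s i *\<^sub>R h)) \<longlonglongrightarrow> 0"
  unfolding lnorm_TS TS.N_scale[OF assms(1)] by (rule tendsto_mult_left_zero[OF tendsto_rabs_zero[OF assms(2)]])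

lemma seq_has_vector_derivative:
  fixes f :: "real \<Rightarrow> complex"
  assumes "\<And>x. (\<And>i. x i \<in> S) \<Longrightarrow> (\<And>i. x i \<noteq> s) \<Longrightarrow> x \<longlonglongrightarrow> s \<Longrightarrow> (\<lambda>i. (f (x i) - f s) / of_real (x i - s)) \<longlonglongrightarrow> D"
  shows "(f has_vector_derivative D) (at s within S)"
proof -
  have "((\<lambda>y. norm (f y - f s - (y - s) *\<^sub>R D) / norm (y - s)) \<longlongrightarrow> 0) (at s within S)"
    unfolding tendsto_at_iff_sequentially
  proof (intro allI impI)
    fix x assume x: "\<forall>i. x i \<in> S - {s}" "x \<longlonglongrightarrow> s"
    have "(\<lambda>i. (f (x i) - f s) / of_real (x i - s)) \<longlonglongrightarrow> D" by (rule assms) (use x in auto)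
    then have "(\<lambda>i. norm ((f (x i) - f s) / of_real (x i - s) - D)) \<longlonglongrightarrow> 0" by (intro tendsto_norm_zero LIM_zero)
    moreover have "norm ((f (x i) - f s) / of_real (x i - s) - D) = norm (f (x i) - f s - (x i - s) *\<^sub>R D) / norm (x i - s)" for i
    proof -
      have "x i \<noteq> s" using x(1) by blast
      then have "(f (x i) - f s) / of_real (x i - s) - D = (f (x i) - f s - (x i - s) *\<^sub>R D) / of_real (x i - s)"
        by (simp add: scaleR_conv_of_real diff_divide_distrib)
      then show ?thesis by (simp only: norm_divide norm_of_real real_norm_def)
    qed
    ultimately show "((\<lambda>y. norm (f y - f s - (y - s) *\<^sub>R D) / norm (y - s)) \<circ> x) \<longlonglongrightarrow> 0" by (simp add: o_def)
  qed
  then show ?thesis by (simp add: has_vector_derivative_def has_derivative_iff_norm bounded_linear_scaleR_left)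
qed

lemma W_cmult: "f \<in> W m \<Longrightarrow> (\<lambda>t. c * f t) \<in> W m"
  using W_lincomb[of f m f c 0] by simp

lemma W_divide: "f \<in> W m \<Longrightarrow> (\<lambda>t. f t / c) \<in> W m"
  using W_cmult[of f m "inverse c"] by (simp add: divide_inverse mult.commute)

lemma W_diff: "f \<in> W m \<Longrightarrow> g \<in> W m \<Longrightarrow> (\<lambda>t. f t - g t) \<in> W m"
  using W_lincomb[of f m g 1 "-1"] by simp

lemma diff_quot_W: assumes "tame n r \<Phi>" "a \<in> TU n" "a + s *\<^sub>R h \<in> TU n" shows "diff_quot \<Phi> a h s \<in> W (2 + r)"
  unfolding diff_quot_def by (intro W_divide W_diff tame_W0[OF assms(1)] assms(2,3))

text \<open>Pointwise directional derivatives suffice for the secants to approximate the derivative in norm,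
  locally uniformly in directions that vary in a compact set: the mean value inequality reduces this to
  the continuity of the tangent map.\<close>

lemma secant_limit:
  assumes \<Phi>: "tame n r \<Phi>" and \<Phi>': "tame (Suc n) r \<Phi>'" and L: "lin_deriv n \<Phi>'"
    and pw: "\<And>a h s t. a \<in> TU n \<Longrightarrow> a \<in> level (TS n) 1 \<Longrightarrow> h \<in> level (TS n) 1 \<Longrightarrow>
      (\<And>i. a + s i *\<^sub>R h \<in> TU n) \<Longrightarrow> (\<And>i. s i \<noteq> 0) \<Longrightarrow> s \<longlonglongrightarrow> 0 \<Longrightarrow>
      (\<lambda>i. diff_quot \<Phi> a h (s i) t) \<longlonglongrightarrow> \<Phi>' (tpair a h) t"
    and a: "a \<in> TU n" "a \<in> level (TS n) 1"
    and k: "\<And>i. k i \<in> level (TS n) 1" "\<kappa> \<in> level (TS n) 0" "tcv n 0 k \<kappa>"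
    and \<rho>: "\<And>i. \<rho> i \<noteq> 0" "(\<lambda>i. lnorm (TS n) 1 (\<rho> i *\<^sub>R k i)) \<longlonglongrightarrow> 0"
    and seg: "\<And>i \<sigma>. \<sigma> \<in> {0..1} \<Longrightarrow> a + (\<sigma> * \<rho> i) *\<^sub>R k i \<in> TU n"
  shows "(\<lambda>i. wn (2 + r) (diff_quot \<Phi> a (k i) (\<rho> i) - \<Phi>' (tpair a (k i)))) \<longlonglongrightarrow> 0"
proof -
  define p where "p i \<sigma> = a + (\<sigma> * \<rho> i) *\<^sub>R k i" for i \<sigma>
  have pU: "p i \<sigma> \<in> TU n" if "\<sigma> \<in> {0..1}" for i \<sigma> unfolding p_def by (rule seg[OF that])
  have p1: "p i \<sigma> \<in> level (TS n) 1" for i \<sigma> unfolding p_def by (intro TS.add_in TS.scale_in a(2) k(1))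
  have k0: "k i \<in> level (TS n) 0" for i using level_TS_antimono[OF _ k(1), of 0] by simp
  have tpU: "tpair (p i \<sigma>) (k i) \<in> TU (Suc n)" if "\<sigma> \<in> {0..1}" for i \<sigma>
    unfolding tpair_TU using pU[OF that] p1 k0 by blast
  have taU: "tpair a (k i) \<in> TU (Suc n)" for i unfolding tpair_TU using a k0 by blast
  have p_diff: "p i \<sigma> + (\<tau> - \<sigma>) *\<^sub>R \<rho> i *\<^sub>R k i = p i \<tau>" for i \<sigma> \<tau>
    unfolding p_def by (simp only: scaleR_scaleR add.assoc scaleR_add_left[symmetric] distrib_right[symmetric]) simp
  define E where "E i = wn (2 + r) (diff_quot \<Phi> a (k i) (\<rho> i) - \<Phi>' (tpair a (k i)))" for i
  define v where "v i = \<Phi>' (tpair a (k i))" for i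
  have v: "v i \<in> W (2 + r)" for i unfolding v_def by (rule tame_W0[OF \<Phi>' taU])
  \<comment> \<open>The mean value inequality forces a point of the segment where the derivative
    deviates almost as much as the secant. The slack turns the negation into a bound for the whole
    segment that is strictly below E i.\<close>
  have ex: "\<exists>\<sigma>\<in>{0..1}. E i - 1 / real (Suc i) \<le> wn (2 + r) (\<Phi>' (tpair (p i \<sigma>) (k i)) - v i)" for i
  proof (rule ccontr)
    assume "\<not> ?thesis"
    then have B: "wn (2 + r) (\<Phi>' (tpair (p i \<sigma>) (k i)) - v i) \<le> E i - 1 / real (Suc i)" if "\<sigma> \<in> {0..1}" for \<sigma>
      using that by (meson linear)
    \<comment> \<open>Divided by \<rho> i, the increment over [0, 1] is the difference quotient, and
      the velocity is \<Phi>' in the direction k i without a factor.\<close>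
    define G where "G \<sigma> = (\<lambda>t. \<Phi> (p i \<sigma>) t / of_real (\<rho> i))" for \<sigma>
    have "wn (2 + r) (G 1 - G 0 - v i) \<le> E i - 1 / real (Suc i)"
    proof (rule W_mean_value[where G=G and G'="\<lambda>\<sigma>. \<Phi>' (tpair (p i \<sigma>) (k i))"])
      show "1 \<le> 2 + r" by simp
      show "G \<sigma> \<in> W (2 + r)" if "\<sigma> \<in> {0..1}" for \<sigma>
        unfolding G_def by (rule W_divide[OF tame_W0[OF \<Phi> pU[OF that]]])
      show "\<Phi>' (tpair (p i \<sigma>) (k i)) \<in> W (2 + r)" if "\<sigma> \<in> {0..1}" for \<sigma>
        by (rule tame_W0[OF \<Phi>' tpU[OF that]])
      show "((\<lambda>\<sigma>. G \<sigma> t) has_vector_derivative \<Phi>' (tpair (p i \<sigma>) (k i)) t) (at \<sigma> within {0..1})" if \<sigma>: "\<sigma> \<in> {0..1}" for \<sigma> t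
      proof (rule seq_has_vector_derivative)
        fix x :: "nat \<Rightarrow> real" assume x: "\<And>j. x j \<in> {0..1}" "\<And>j. x j \<noteq> \<sigma>" "x \<longlonglongrightarrow> \<sigma>"
        have st: "p i \<sigma> + ((x j - \<sigma>) * \<rho> i) *\<^sub>R k i = p i (x j)" for j using p_diff[of i \<sigma> "x j"] by (simp only: scaleR_scaleR)
        have "(\<lambda>j. diff_quot \<Phi> (p i \<sigma>) (k i) ((x j - \<sigma>) * \<rho> i) t) \<longlonglongrightarrow> \<Phi>' (tpair (p i \<sigma>) (k i)) t"
        proof (rule pw[OF pU[OF \<sigma>] p1 k(1)])
          show "p i \<sigma> + ((x j - \<sigma>) * \<rho> i) *\<^sub>R k i \<in> TU n" for j unfolding st by (rule pU[OF x(1)])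
          show "(x j - \<sigma>) * \<rho> i \<noteq> 0" for j using x(2)[of j] \<rho>(1)[of i] by simp
          show "(\<lambda>j. (x j - \<sigma>) * \<rho> i) \<longlonglongrightarrow> 0" by (rule tendsto_mult_left_zero[OF LIM_zero[OF x(3)]])
        qed
        moreover have "diff_quot \<Phi> (p i \<sigma>) (k i) ((x j - \<sigma>) * \<rho> i) t = (G (x j) t - G \<sigma> t) / of_real (x j - \<sigma>)" for j
          unfolding diff_quot_def st G_def by (simp add: diff_divide_distrib mult.commute)
        ultimately show "(\<lambda>j. (G (x j) t - G \<sigma> t) / of_real (x j - \<sigma>)) \<longlonglongrightarrow> \<Phi>' (tpair (p i \<sigma>) (k i)) t" by simp
      qed
      show "uconv (\<lambda>j. \<Phi>' (tpair (p i (x j)) (k i))) (\<Phi>' (tpair (p i \<sigma>) (k i)))"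
        if \<sigma>: "\<sigma> \<in> {0..1}" and x: "\<And>j. x j \<in> {0..1}" "x \<longlonglongrightarrow> \<sigma>" for x \<sigma>
      proof -
        have "tcv n 1 (\<lambda>j. p i \<sigma> + (x j - \<sigma>) *\<^sub>R \<rho> i *\<^sub>R k i) (p i \<sigma>)"
          by (rule tcv_add_null[OF p1 TS.scale_in[OF TS.scale_in[OF k(1)]] lnorm_scale_tendsto[OF TS.scale_in[OF k(1)] LIM_zero[OF x(2)]]])
        then have "tcv n (Suc 0) (\<lambda>j. p i (x j)) (p i \<sigma>)" unfolding p_diff One_nat_def .
        then have "tcv (Suc n) 0 (\<lambda>j. tpair (p i (x j)) (k i)) (tpair (p i \<sigma>) (k i))"
          by (rule tcv_tpair[OF _ tcv_const[OF k0]])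
        then have "cv (2 + r) (\<lambda>j. \<Phi>' (tpair (p i (x j)) (k i))) (\<Phi>' (tpair (p i \<sigma>) (k i)))"
          by (rule tame_cont0[OF \<Phi>' tpU[OF x(1)] tpU[OF \<sigma>]])
        then show ?thesis by (rule cv_uconv) simp
      qed
      show "v i \<in> W (2 + r)" by (rule v)
      show "wn (2 + r) (\<Phi>' (tpair (p i \<sigma>) (k i)) - v i) \<le> E i - 1 / real (Suc i)" if "\<sigma> \<in> {0..1}" for \<sigma> by (rule B[OF that])
    qed
    moreover have "G 1 - G 0 = diff_quot \<Phi> a (k i) (\<rho> i)"
    proof -
      have pp: "p i 0 = a" "p i 1 = a + \<rho> i *\<^sub>R k i" unfolding p_def by (simp_all only: mult_zero_left mult_1 scaleR_zero_left add_0_right)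
      show ?thesis by (simp only: G_def diff_quot_def pp fun_diff_def diff_divide_distrib)
    qed
    ultimately have "E i \<le> E i - 1 / real (Suc i)" unfolding E_def v_def by (simp only:)
    moreover have "0 < 1 / real (Suc i)" by simp
    ultimately show False by linarith
  qed
  then obtain \<sigma> where \<sigma>: "\<And>i. \<sigma> i \<in> {0..1}" "\<And>i. E i - 1 / real (Suc i) \<le> wn (2 + r) (\<Phi>' (tpair (p i (\<sigma> i)) (k i)) - v i)" by metis
  have tp: "tcv n (Suc 0) (\<lambda>i. p i (\<sigma> i)) a"
  proof -
    have "(\<lambda>i. lnorm (TS n) 1 ((\<sigma> i * \<rho> i) *\<^sub>R k i)) \<longlonglongrightarrow> 0"
    proof (rule Lim_null_comparison[OF always_eventually \<rho>(2)], rule allI)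
      fix i
      have N: "0 \<le> lnorm (TS n) 1 (\<rho> i *\<^sub>R k i)" unfolding lnorm_TS by (rule TS.N_nonneg[OF TS.scale_in[OF k(1)]])
      have "lnorm (TS n) 1 ((\<sigma> i * \<rho> i) *\<^sub>R k i) = \<bar>\<sigma> i\<bar> * lnorm (TS n) 1 (\<rho> i *\<^sub>R k i)"
        unfolding lnorm_TS scaleR_scaleR[symmetric] by (rule TS.N_scale[OF TS.scale_in[OF k(1)]])
      then show "norm (lnorm (TS n) 1 ((\<sigma> i * \<rho> i) *\<^sub>R k i)) \<le> lnorm (TS n) 1 (\<rho> i *\<^sub>R k i)"
        using \<sigma>(1)[of i] N mult_left_le_one_le[OF N, of "\<bar>\<sigma> i\<bar>"] by (simp add: abs_mult)
    qed
    from tcv_add_null[OF a(2) TS.scale_in[OF k(1)] this] show ?thesis unfolding p_def One_nat_def .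
  qed
  have ta: "tpair a \<kappa> \<in> TU (Suc n)" unfolding tpair_TU using a k(2) by blast
  \<comment> \<open>In the tangent space (p i (\<sigma> i), k i) and (a, k i) have the same limit
    (a, \<kappa>), with bases converging in level 1 and directions in level 0. This is where
    convergence of the directions enters; by continuity the values of \<Phi>' come together.\<close>
  have c1: "cv (2 + r) (\<lambda>i. \<Phi>' (tpair (p i (\<sigma> i)) (k i))) (\<Phi>' (tpair a \<kappa>))"
    by (rule tame_cont0[OF \<Phi>' tpU[OF \<sigma>(1)] ta tcv_tpair[OF tp k(3)]])
  have c2: "cv (2 + r) v (\<Phi>' (tpair a \<kappa>))" unfolding v_def
    by (rule tame_cont0[OF \<Phi>' taU ta tcv_tpair[OF tcv_const k(3)]]) (use a(2) in simp)
  let ?b = "\<lambda>i. (wn (2 + r) (\<Phi>' (tpair (p i (\<sigma> i)) (k i)) - \<Phi>' (tpair a \<kappa>)) + wn (2 + r) (v i - \<Phi>' (tpair a \<kappa>))) + 1 / real (Suc i)"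
  have b0: "?b \<longlonglongrightarrow> 0"
  proof -
    have "(\<lambda>i. 1 / real (Suc i)) \<longlonglongrightarrow> 0" using LIMSEQ_inverse_real_of_nat by (simp add: inverse_eq_divide)
    from tendsto_add[OF tendsto_add[OF cv_D(4)[OF c1] cv_D(4)[OF c2]] this] show ?thesis by (simp only: add_0_right)
  qed
  have "E \<longlonglongrightarrow> 0"
  proof (rule Lim_null_comparison[OF always_eventually b0], rule allI)
    fix i
    have EW: "diff_quot \<Phi> a (k i) (\<rho> i) - \<Phi>' (tpair a (k i)) \<in> W (2 + r)"
      by (rule Wm.diff_in[OF diff_quot_W[OF \<Phi> a(1)] v[unfolded v_def]]) (use seg[of 1 i] in simp)
    have "0 \<le> E i" unfolding E_def by (rule Wm.N_nonneg[OF EW])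
    moreover have "wn (2 + r) (\<Phi>' (tpair (p i (\<sigma> i)) (k i)) - v i)
        \<le> wn (2 + r) (\<Phi>' (tpair (p i (\<sigma> i)) (k i)) - \<Phi>' (tpair a \<kappa>)) + wn (2 + r) (v i - \<Phi>' (tpair a \<kappa>))"
      using Wm.triangle3[OF cv_D(1)[OF c1] cv_D(2)[OF c1] v, of i i] Wm.N_minus_commute[OF cv_D(2)[OF c1] v, of i] by linarith
    ultimately show "norm (E i) \<le> ?b i" using \<sigma>(2)[of i] by (simp only: real_norm_def abs_of_nonneg)
  qed
  then show ?thesis unfolding E_def .
qed

lemma eventually_segment:
  assumes a: "a \<in> TU n" "a \<in> level (TS n) 1" and h: "\<And>i. h i \<in> level (TS n) 1" "(\<lambda>i. lnorm (TS n) 1 (h i)) \<longlonglongrightarrow> 0"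
  obtains N where "\<And>i \<sigma>. N \<le> i \<Longrightarrow> \<sigma> \<in> {0..1} \<Longrightarrow> a + \<sigma> *\<^sub>R h i \<in> TU n"
proof -
  obtain r where r: "0 < r" "\<And>y. y \<in> level (TS n) 1 \<Longrightarrow> lnorm (TS n) 1 (y - a) < r \<Longrightarrow> y \<in> TU n"
    by (rule TU_open[OF a]) (rule that)
  obtain N where N: "\<And>i. N \<le> i \<Longrightarrow> lnorm (TS n) 1 (h i) < r"
    using order_tendstoD(2)[OF h(2) r(1)] by (auto simp only: eventually_sequentially)
  show ?thesis
  proof (rule that[of N])
    fix i \<sigma> assume i: "N \<le> i" and \<sigma>: "\<sigma> \<in> {0..1::real}"
    show "a + \<sigma> *\<^sub>R h i \<in> TU n"
    proof (rule r(2)[OF TS.add_in[OF a(2) TS.scale_in[OF h(1)]]])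
      have N0: "0 \<le> lnorm (TS n) 1 (h i)" unfolding lnorm_TS by (rule TS.N_nonneg[OF h(1)])
      have "lnorm (TS n) 1 (\<sigma> *\<^sub>R h i) = \<bar>\<sigma>\<bar> * lnorm (TS n) 1 (h i)" unfolding lnorm_TS by (rule TS.N_scale[OF h(1)])
      also have "\<dots> \<le> lnorm (TS n) 1 (h i)" by (rule mult_left_le_one_le[OF N0]) (use \<sigma> in auto)
      finally show "lnorm (TS n) 1 (a + \<sigma> *\<^sub>R h i - a) < r" using N[OF i] by (simp only: add_diff_cancel_left')
    qed
  qed
qed

text \<open>The special case of \<open>secant_limit\<close> in which the direction does not
  vary.\<close>

lemma dir_derivI_pointwise:
  assumes \<Phi>: "tame n r \<Phi>" and \<Phi>': "tame (Suc n) r \<Phi>'" and L: "lin_deriv n \<Phi>'"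
    and pw: "\<And>a h s t. a \<in> TU n \<Longrightarrow> a \<in> level (TS n) 1 \<Longrightarrow> h \<in> level (TS n) 1 \<Longrightarrow>
      (\<And>i. a + s i *\<^sub>R h \<in> TU n) \<Longrightarrow> (\<And>i. s i \<noteq> 0) \<Longrightarrow> s \<longlonglongrightarrow> 0 \<Longrightarrow>
      (\<lambda>i. diff_quot \<Phi> a h (s i) t) \<longlonglongrightarrow> \<Phi>' (tpair a h) t"
  shows "dir_deriv n r \<Phi> \<Phi>'"
  unfolding dir_deriv_def
proof (intro allI impI)
  fix a h s assume a: "a \<in> TU n" "a \<in> level (TS n) 1" and h: "h \<in> level (TS n) 1"
    and U: "\<forall>i. a + s i *\<^sub>R h \<in> TU n" and s: "\<forall>i. s i \<noteq> 0" "s \<longlonglongrightarrow> 0"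
  have h0: "h \<in> level (TS n) 0" using level_TS_antimono[OF _ h, of 0] by simp
  \<comment> \<open>The hypothesis puts only the endpoints into the open set, while
    \<open>secant_limit\<close> needs whole segments; these lie in it from some index on.\<close>
  obtain N where N: "\<And>i \<sigma>. N \<le> i \<Longrightarrow> \<sigma> \<in> {0..1} \<Longrightarrow> a + \<sigma> *\<^sub>R s i *\<^sub>R h \<in> TU n"
    by (rule eventually_segment[OF a TS.scale_in[OF h] lnorm_scale_tendsto[OF h s(2)]]) (rule that)
  have sN: "(\<lambda>i. s (i + N)) \<longlonglongrightarrow> 0" by (rule LIMSEQ_ignore_initial_segment[OF s(2)])
  have "(\<lambda>i. wn (2 + r) (diff_quot \<Phi> a h (s (i + N)) - \<Phi>' (tpair a h))) \<longlonglongrightarrow> 0"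
  proof (rule secant_limit[OF \<Phi> \<Phi>' L pw a h h0 tcv_const[OF h0] _ lnorm_scale_tendsto[OF h sN]])
    show "s (i + N) \<noteq> 0" for i using s(1) by blast
    show "a + (\<sigma> * s (i + N)) *\<^sub>R h \<in> TU n" if "\<sigma> \<in> {0..1}" for i \<sigma>
      using N[OF le_add2 that, of i] by (simp only: scaleR_scaleR)
  qed
  then have "(\<lambda>i. wn (2 + r) (diff_quot \<Phi> a h (s i) - \<Phi>' (tpair a h))) \<longlonglongrightarrow> 0" by (rule LIMSEQ_offset)
  moreover have "diff_quot \<Phi> a h (s i) \<in> W (2 + r)" for i using diff_quot_W[OF \<Phi> a(1)] U by blast
  moreover have "\<Phi>' (tpair a h) \<in> W (2 + r)" by (rule tame_W0[OF \<Phi>']) (unfold tpair_TU, use a h0 in blast)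
  ultimately show "cv (2 + r) (\<lambda>i. diff_quot \<Phi> a h (s i)) (\<Phi>' (tpair a h))" unfolding cv_def by blast
qed

lemma diff_quot_lincomb: "diff_quot \<Phi> a h s = (\<lambda>t. of_real (1 / s) * \<Phi> (a + s *\<^sub>R h) t + of_real (- 1 / s) * \<Phi> a t)"
  by (simp add: diff_quot_def diff_divide_distrib)

lemma loop_deriv_lincomb:
  assumes "f \<in> W (Suc m)" "g \<in> W (Suc m)" "1 \<le> m"
  shows "loop_deriv (\<lambda>t. a * f t + b * g t) = (\<lambda>t. a * loop_deriv f t + b * loop_deriv g t)"
proof
  fix t
  have "((\<lambda>t. a * f t + b * g t) has_vector_derivative a * loop_deriv f t + b * loop_deriv g t) (at t)"
    by (rule has_vector_derivative_add; rule has_vector_derivative_mult_right; rule W_loop_deriv(3)[OF assms(1,3)] W_loop_deriv(3)[OF assms(2,3)])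
  then show "loop_deriv (\<lambda>t. a * f t + b * g t) t = a * loop_deriv f t + b * loop_deriv g t"
    unfolding loop_deriv_def[of "\<lambda>t. a * f t + b * g t"] by (rule vector_derivative_at)
qed

lemma line_tcv:
  assumes "a \<in> level (TS n) 1" "h \<in> level (TS n) 1" "s \<longlonglongrightarrow> 0" shows "tcv n 1 (\<lambda>i. a + s i *\<^sub>R h) a"
  by (rule tcv_add_null[OF assms(1) TS.scale_in[OF assms(2)] lnorm_scale_tendsto[OF assms(2,3)]])

lemma line_cont:
  assumes "tame n r \<Phi>" "a \<in> TU n" "a \<in> level (TS n) 1" "h \<in> level (TS n) 1" "\<forall>i. a + s i *\<^sub>R h \<in> TU n" "s \<longlonglongrightarrow> 0"
  shows "cv (2 + r) (\<lambda>i. \<Phi> (a + s i *\<^sub>R h)) (\<Phi> a)"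
  by (rule tame_cont0[OF assms(1) _ assms(2) tcv_antimono[OF _ line_tcv[OF assms(3,4,6)]]]) (use assms(5) in simp_all)

lemma tpair_in_TU:
  assumes "a \<in> TU n" "a \<in> level (TS n) 1" "h \<in> level (TS n) 0" shows "tpair a h \<in> TU (Suc n)"
  unfolding tpair_TU using assms by blast

lemma dir_derivD:
  assumes "dir_deriv n r \<Phi> \<Phi>'" "a \<in> TU n" "a \<in> level (TS n) 1" "h \<in> level (TS n) 1"
    "\<forall>i. a + s i *\<^sub>R h \<in> TU n" "\<forall>i. s i \<noteq> 0" "s \<longlonglongrightarrow> 0"
  shows "cv (2 + r) (\<lambda>i. diff_quot \<Phi> a h (s i)) (\<Phi>' (tpair a h))"
  using assms unfolding dir_deriv_def by blast

text \<open>The algebraic cases converge in norm by the continuity of the operations. Only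
  \<open>rep\<close> takes the detour through pointwise limits. Linearity is carried along because
  boundedness of the derivative and the detour both rest on it.\<close>

theorem tame_has_deriv:
  "tame n r \<Phi> \<Longrightarrow> \<exists>\<Phi>'. tame (Suc n) r \<Phi>' \<and> dir_deriv n r \<Phi> \<Phi>' \<and> lin_deriv n \<Phi>'"
proof (induction rule: tame.induct)
  case (var w n r)
  let ?D = "\<lambda>b. b (True # w)"
  have "tame (Suc n) r ?D" by (rule tame.var) (use var in simp_all)
  moreover have "dir_deriv n r (\<lambda>a. a w) ?D"
    unfolding dir_deriv_def
  proof (intro allI impI)
    fix a h and s :: "nat \<Rightarrow> real" assume h: "h \<in> level (TS n) 1" and s: "\<forall>i. s i \<noteq> (0::real)"
    have "diff_quot (\<lambda>a. a w) a h (s i) = h w" for i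
      using s by (simp add: diff_quot_def tower_add tower_scaleR scaleR_conv_of_real)
    moreover have "h w \<in> W (2 + r)" using W_antimono[of "2 + r" "2 + nF w + 1" "h w"] level_TS_W[OF h var(1)] var(2) by simp
    ultimately show "cv (2 + r) (\<lambda>i. diff_quot (\<lambda>a. a w) a h (s i)) (tpair a h (True # w))"
      by (simp only: tpair_Cons if_True cv_const)
  qed
  moreover have "lin_deriv n ?D"
    unfolding lin_deriv_def tpair_Cons if_True tower_add tower_scaleR by (simp add: fun_eq_iff scaleR_conv_of_real)
  ultimately show ?case by blast
next
  case (add n r \<Phi> \<Psi>)
  obtain \<Phi>' where F: "tame (Suc n) r \<Phi>'" "dir_deriv n r \<Phi> \<Phi>'" "lin_deriv n \<Phi>'" using add.IH(1) by blast
  obtain \<Psi>' where G: "tame (Suc n) r \<Psi>'" "dir_deriv n r \<Psi> \<Psi>'" "lin_deriv n \<Psi>'" using add.IH(2) by blast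
  let ?D = "\<lambda>b t. \<Phi>' b t + \<Psi>' b t"
  have "tame (Suc n) r ?D" by (rule tame.add[OF F(1) G(1)])
  moreover have "dir_deriv n r (\<lambda>a t. \<Phi> a t + \<Psi> a t) ?D"
    unfolding dir_deriv_def
  proof (intro allI impI)
    fix a h s assume h: "a \<in> TU n" "a \<in> level (TS n) 1" "h \<in> level (TS n) 1" "\<forall>i. a + s i *\<^sub>R h \<in> TU n" "\<forall>i. s i \<noteq> 0" "s \<longlonglongrightarrow> 0"
    have "diff_quot (\<lambda>a t. \<Phi> a t + \<Psi> a t) a h (s i) = (\<lambda>t. diff_quot \<Phi> a h (s i) t + diff_quot \<Psi> a h (s i) t)" for i
      unfolding diff_quot_def by (rule ext) (simp add: divide_inverse algebra_simps)
    then show "cv (2 + r) (\<lambda>i. diff_quot (\<lambda>a t. \<Phi> a t + \<Psi> a t) a h (s i)) (\<lambda>t. \<Phi>' (tpair a h) t + \<Psi>' (tpair a h) t)"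
      using cv_add[OF dir_derivD[OF F(2) h] dir_derivD[OF G(2) h]] by simp
  qed
  moreover have "lin_deriv n ?D"
    unfolding lin_deriv_def
  proof (intro allI impI)
    fix a h k \<alpha> \<beta> assume *: "a \<in> TU n" "a \<in> level (TS n) 1" "h \<in> level (TS n) 0" "k \<in> level (TS n) 0"
    show "(\<lambda>t. \<Phi>' (tpair a (\<alpha> *\<^sub>R h + \<beta> *\<^sub>R k)) t + \<Psi>' (tpair a (\<alpha> *\<^sub>R h + \<beta> *\<^sub>R k)) t) =
      (\<lambda>t. of_real \<alpha> * (\<Phi>' (tpair a h) t + \<Psi>' (tpair a h) t) + of_real \<beta> * (\<Phi>' (tpair a k) t + \<Psi>' (tpair a k) t))"
      unfolding lin_derivD[OF F(3) *] lin_derivD[OF G(3) *] by (simp add: algebra_simps)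
  qed
  ultimately show ?case by blast
next
  case (mult n r \<Phi> \<Psi>)
  obtain \<Phi>' where F: "tame (Suc n) r \<Phi>'" "dir_deriv n r \<Phi> \<Phi>'" "lin_deriv n \<Phi>'" using mult.IH(1) by blast
  obtain \<Psi>' where G: "tame (Suc n) r \<Psi>'" "dir_deriv n r \<Psi> \<Psi>'" "lin_deriv n \<Psi>'" using mult.IH(2) by blast
  let ?D = "\<lambda>b t. \<Phi>' b t * \<Psi> (tfst b) t + \<Phi> (tfst b) t * \<Psi>' b t"
  have "tame (Suc n) r ?D" by (intro tame.add tame.mult F(1) G(1) tame_lift' mult.hyps)
  moreover have "dir_deriv n r (\<lambda>a t. \<Phi> a t * \<Psi> a t) ?D"
    unfolding dir_deriv_def tfst_tpair
  proof (intro allI impI)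
    fix a h s assume h: "a \<in> TU n" "a \<in> level (TS n) 1" "h \<in> level (TS n) 1" "\<forall>i. a + s i *\<^sub>R h \<in> TU n" "\<forall>i. s i \<noteq> 0" "s \<longlonglongrightarrow> 0"
    \<comment> \<open>Discrete product rule; one factor stays at the displaced point, where
      \<open>line_cont\<close> gives its limit.\<close>
    have eq: "diff_quot (\<lambda>a t. \<Phi> a t * \<Psi> a t) a h (s i) = (\<lambda>t. diff_quot \<Phi> a h (s i) t * \<Psi> (a + s i *\<^sub>R h) t + \<Phi> a t * diff_quot \<Psi> a h (s i) t)" for i
      unfolding diff_quot_def by (rule ext) (simp add: divide_inverse algebra_simps)
    have "cv (2 + r) (\<lambda>i t. diff_quot \<Phi> a h (s i) t * \<Psi> (a + s i *\<^sub>R h) t + \<Phi> a t * diff_quot \<Psi> a h (s i) t)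
       (\<lambda>t. \<Phi>' (tpair a h) t * \<Psi> a t + \<Phi> a t * \<Psi>' (tpair a h) t)"
      by (rule cv_add[OF cv_mult'[OF dir_derivD[OF F(2) h] line_cont[OF mult.hyps(2) h(1-4,6)]]
            cv_mult'[OF cv_const[OF tame_W0[OF mult.hyps(1) h(1)]] dir_derivD[OF G(2) h]]]) simp_all
    then show "cv (2 + r) (\<lambda>i. diff_quot (\<lambda>a t. \<Phi> a t * \<Psi> a t) a h (s i)) (\<lambda>t. \<Phi>' (tpair a h) t * \<Psi> a t + \<Phi> a t * \<Psi>' (tpair a h) t)"
      unfolding eq .
  qed
  moreover have "lin_deriv n ?D"
    unfolding lin_deriv_def tfst_tpair
  proof (intro allI impI)
    fix a h k \<alpha> \<beta> assume *: "a \<in> TU n" "a \<in> level (TS n) 1" "h \<in> level (TS n) 0" "k \<in> level (TS n) 0"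
    show "(\<lambda>t. \<Phi>' (tpair a (\<alpha> *\<^sub>R h + \<beta> *\<^sub>R k)) t * \<Psi> a t + \<Phi> a t * \<Psi>' (tpair a (\<alpha> *\<^sub>R h + \<beta> *\<^sub>R k)) t) =
      (\<lambda>t. of_real \<alpha> * (\<Phi>' (tpair a h) t * \<Psi> a t + \<Phi> a t * \<Psi>' (tpair a h) t) +
           of_real \<beta> * (\<Phi>' (tpair a k) t * \<Psi> a t + \<Phi> a t * \<Psi>' (tpair a k) t))"
      unfolding lin_derivD[OF F(3) *] lin_derivD[OF G(3) *] by (simp add: algebra_simps)
  qed
  ultimately show ?case by blast
next
  case (lin L n r \<Phi>)
  obtain \<Phi>' where F: "tame (Suc n) r \<Phi>'" "dir_deriv n r \<Phi> \<Phi>'" "lin_deriv n \<Phi>'" using lin.IH by blast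
  let ?D = "\<lambda>b. L (\<Phi>' b)"
  have "tame (Suc n) r ?D" by (rule tame.lin[OF lin.hyps(1) F(1)])
  moreover have "dir_deriv n r (\<lambda>a. L (\<Phi> a)) ?D"
    unfolding dir_deriv_def
  proof (intro allI impI)
    fix a h s assume h: "a \<in> TU n" "a \<in> level (TS n) 1" "h \<in> level (TS n) 1" "\<forall>i. a + s i *\<^sub>R h \<in> TU n" "\<forall>i. s i \<noteq> 0" "s \<longlonglongrightarrow> 0"
    have eq: "diff_quot (\<lambda>a. L (\<Phi> a)) a h (s i) = L (diff_quot \<Phi> a h (s i))" for i
    proof -
      have "a + s i *\<^sub>R h \<in> TU n" using h(4) by blast
      then show ?thesis unfolding diff_quot_lincomb
        by (intro cv_op_linear[OF lin.hyps(1), symmetric] W_L2[OF tame_W0[OF lin.hyps(2)]] h(1))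
    qed
    show "cv (2 + r) (\<lambda>i. diff_quot (\<lambda>a. L (\<Phi> a)) a h (s i)) (L (\<Phi>' (tpair a h)))"
      unfolding eq by (rule cv_op_cv[OF lin.hyps(1) dir_derivD[OF F(2) h]])
  qed
  moreover have "lin_deriv n ?D"
    unfolding lin_deriv_def
  proof (intro allI impI)
    fix a h k \<alpha> \<beta> assume *: "a \<in> TU n" "a \<in> level (TS n) 1" "h \<in> level (TS n) 0" "k \<in> level (TS n) 0"
    show "L (\<Phi>' (tpair a (\<alpha> *\<^sub>R h + \<beta> *\<^sub>R k))) = (\<lambda>t. of_real \<alpha> * L (\<Phi>' (tpair a h)) t + of_real \<beta> * L (\<Phi>' (tpair a k)) t)"
      unfolding lin_derivD[OF F(3) *]
      by (rule cv_op_linear[OF lin.hyps(1) W_L2[OF tame_W0[OF F(1) tpair_in_TU[OF *(1,2,3)]]] W_L2[OF tame_W0[OF F(1) tpair_in_TU[OF *(1,2,4)]]]])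
  qed
  ultimately show ?case by blast
next
  case (deriv n r \<Phi>)
  obtain \<Phi>' where F: "tame (Suc n) (Suc r) \<Phi>'" "dir_deriv n (Suc r) \<Phi> \<Phi>'" "lin_deriv n \<Phi>'" using deriv.IH by blast
  let ?D = "\<lambda>b. loop_deriv (\<Phi>' b)"
  have W: "\<Phi> a \<in> W (Suc (2 + r))" if "a \<in> TU n" for a using tame_W0[OF deriv.hyps that] by simp
  have W': "\<Phi>' b \<in> W (Suc (2 + r))" if "b \<in> TU (Suc n)" for b using tame_W0[OF F(1) that] by simp
  have 1: "1 \<le> 2 + r" by simp
  have "tame (Suc n) r ?D" by (rule tame.deriv[OF F(1)])
  moreover have "dir_deriv n r (\<lambda>a. loop_deriv (\<Phi> a)) ?D"
    unfolding dir_deriv_def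
  proof (intro allI impI)
    fix a h s assume h: "a \<in> TU n" "a \<in> level (TS n) 1" "h \<in> level (TS n) 1" "\<forall>i. a + s i *\<^sub>R h \<in> TU n" "\<forall>i. s i \<noteq> 0" "s \<longlonglongrightarrow> 0"
    have eq: "diff_quot (\<lambda>a. loop_deriv (\<Phi> a)) a h (s i) = loop_deriv (diff_quot \<Phi> a h (s i))" for i
    proof -
      have "a + s i *\<^sub>R h \<in> TU n" using h(4) by blast
      then show ?thesis unfolding diff_quot_lincomb by (intro loop_deriv_lincomb[OF W W 1, symmetric] h(1))
    qed
    have "cv (Suc (2 + r)) (\<lambda>i. diff_quot \<Phi> a h (s i)) (\<Phi>' (tpair a h))" using dir_derivD[OF F(2) h] by simp
    then show "cv (2 + r) (\<lambda>i. diff_quot (\<lambda>a. loop_deriv (\<Phi> a)) a h (s i)) (loop_deriv (\<Phi>' (tpair a h)))"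
      unfolding eq by (rule cv_loop_deriv[OF _ 1])
  qed
  moreover have "lin_deriv n ?D"
    unfolding lin_deriv_def
  proof (intro allI impI)
    fix a h k \<alpha> \<beta> assume *: "a \<in> TU n" "a \<in> level (TS n) 1" "h \<in> level (TS n) 0" "k \<in> level (TS n) 0"
    show "loop_deriv (\<Phi>' (tpair a (\<alpha> *\<^sub>R h + \<beta> *\<^sub>R k))) = (\<lambda>t. of_real \<alpha> * loop_deriv (\<Phi>' (tpair a h)) t + of_real \<beta> * loop_deriv (\<Phi>' (tpair a k)) t)"
      unfolding lin_derivD[OF F(3) *]
      by (rule loop_deriv_lincomb[OF W'[OF tpair_in_TU[OF *(1,2,3)]] W'[OF tpair_in_TU[OF *(1,2,4)]] 1])
  qed
  ultimately show ?case by blast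
next
  case (inv n r \<Phi>)
  obtain \<Phi>' where F: "tame (Suc n) r \<Phi>'" "dir_deriv n r \<Phi> \<Phi>'" "lin_deriv n \<Phi>'" using inv.IH by blast
  let ?D = "\<lambda>b t. (- 1) * (\<Phi>' b t * (inverse (\<Phi> (tfst b) t) * inverse (\<Phi> (tfst b) t)))"
  have ci: "tame n r (\<lambda>a t. inverse (\<Phi> a t))" by (rule tame.inv[OF inv.hyps])
  have ci': "tame (Suc n) r (\<lambda>b t. inverse (\<Phi> (tfst b) t))" by (rule tame_lift'[OF ci])
  have "tame (Suc n) r ?D"
    using tame.lin[OF cv_op_cmult[of "- 1"] tame.mult[OF F(1) tame.mult[OF ci' ci']]] .
  moreover have "dir_deriv n r (\<lambda>a t. inverse (\<Phi> a t)) ?D"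
    unfolding dir_deriv_def tfst_tpair
  proof (intro allI impI)
    fix a h s assume h: "a \<in> TU n" "a \<in> level (TS n) 1" "h \<in> level (TS n) 1" "\<forall>i. a + s i *\<^sub>R h \<in> TU n" "\<forall>i. s i \<noteq> 0" "s \<longlonglongrightarrow> 0"
    \<comment> \<open>An exact identity, with one of the two inverses at the displaced
      point.\<close>
    have eq: "diff_quot (\<lambda>a t. inverse (\<Phi> a t)) a h (s i) =
      (\<lambda>t. (- 1) * (diff_quot \<Phi> a h (s i) t * (inverse (\<Phi> (a + s i *\<^sub>R h) t) * inverse (\<Phi> a t))))" for i
    proof
      fix t
      have "\<Phi> (a + s i *\<^sub>R h) t \<noteq> 0" "\<Phi> a t \<noteq> 0" using inv.hyps(2) h(1,4) by blast+
      then show "diff_quot (\<lambda>a t. inverse (\<Phi> a t)) a h (s i) t =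
        (- 1) * (diff_quot \<Phi> a h (s i) t * (inverse (\<Phi> (a + s i *\<^sub>R h) t) * inverse (\<Phi> a t)))"
        using h(5) by (simp add: diff_quot_def field_simps)
    qed
    show "cv (2 + r) (\<lambda>i. diff_quot (\<lambda>a t. inverse (\<Phi> a t)) a h (s i)) (\<lambda>t. (- 1) * (\<Phi>' (tpair a h) t * (inverse (\<Phi> a t) * inverse (\<Phi> a t))))"
      unfolding eq
      by (rule cv_cmult[OF cv_mult'[OF dir_derivD[OF F(2) h] cv_mult'[OF line_cont[OF ci h(1-4,6)] cv_const[OF tame_W0[OF ci h(1)]]]]]) simp_all
  qed
  moreover have "lin_deriv n ?D"
    unfolding lin_deriv_def tfst_tpair
  proof (intro allI impI)
    fix a h k \<alpha> \<beta> assume *: "a \<in> TU n" "a \<in> level (TS n) 1" "h \<in> level (TS n) 0" "k \<in> level (TS n) 0"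
    show "(\<lambda>t. (- 1) * (\<Phi>' (tpair a (\<alpha> *\<^sub>R h + \<beta> *\<^sub>R k)) t * (inverse (\<Phi> a t) * inverse (\<Phi> a t)))) =
      (\<lambda>t. of_real \<alpha> * ((- 1) * (\<Phi>' (tpair a h) t * (inverse (\<Phi> a t) * inverse (\<Phi> a t)))) +
           of_real \<beta> * ((- 1) * (\<Phi>' (tpair a k) t * (inverse (\<Phi> a t) * inverse (\<Phi> a t)))))"
      unfolding lin_derivD[OF F(3) *] by (simp add: algebra_simps)
  qed
  ultimately show ?case by blast
next
  case (rep n r \<Psi> \<Phi>)
  obtain \<Psi>' where G: "tame (Suc n) r \<Psi>'" "dir_deriv n r \<Psi> \<Psi>'" "lin_deriv n \<Psi>'" using rep.IH(1) by blast
  obtain \<Phi>' where F: "tame (Suc n) r \<Phi>'" "dir_deriv n r \<Phi> \<Phi>'" "lin_deriv n \<Phi>'" using rep.IH(2) by blast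
  \<comment> \<open>The limit found in \<open>rep_difference_quotient\<close>; the minus sign is
    written as multiplication by -1, which is a \<open>cv_op\<close>.\<close>
  let ?E = "\<lambda>b t. \<Phi>' b t + (- 1) * ((loop_deriv (\<Phi> (tfst b)) t * J (\<Psi>' b) t) * inverse (\<Psi> (tfst b) t))"
  let ?D = "\<lambda>b. rep (\<Psi> (tfst b)) (?E b)"
  have dens: "loop_density (\<Psi> (tfst b))" if "b \<in> TU (Suc n)" for b using that rep.hyps(3) unfolding TU_Suc_iff by blast
  have ci: "tame (Suc n) r (\<lambda>b t. inverse (\<Psi> (tfst b) t))"
    by (rule tame.inv[OF tame_lift'[OF rep.hyps(1)] density_nonzero[OF dens]])
  \<comment> \<open>Here the orders balance: \<open>tame_lift\<close> raises \<Phi> at the base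
    point to Suc r, and \<open>loop_deriv\<close> brings it back to r.\<close>
  have "tame (Suc n) r ?E"
    by (rule tame.add[OF F(1) tame.lin[OF cv_op_cmult[of "- 1"] tame.mult[OF tame.mult[OF tame.deriv[OF tame_lift[OF rep.hyps(2)]] tame.lin[OF cv_op_J G(1)]] ci]]])
  then have D: "tame (Suc n) r ?D" by (rule tame.rep[OF tame_lift'[OF rep.hyps(1)] _ dens])
  have lin: "lin_deriv n ?D"
    unfolding lin_deriv_def tfst_tpair
  proof (intro allI impI)
    fix a h k \<alpha> \<beta> assume *: "a \<in> TU n" "a \<in> level (TS n) 1" "h \<in> level (TS n) 0" "k \<in> level (TS n) 0"
    have J: "J (\<lambda>t. of_real \<alpha> * \<Psi>' (tpair a h) t + of_real \<beta> * \<Psi>' (tpair a k) t)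
       = (\<lambda>t. of_real \<alpha> * J (\<Psi>' (tpair a h)) t + of_real \<beta> * J (\<Psi>' (tpair a k)) t)"
      by (rule J_lincomb[OF W_L2[OF tame_W0[OF G(1) tpair_in_TU[OF *(1,2,3)]]] W_L2[OF tame_W0[OF G(1) tpair_in_TU[OF *(1,2,4)]]]])
    show "rep (\<Psi> a) (\<lambda>t. \<Phi>' (tpair a (\<alpha> *\<^sub>R h + \<beta> *\<^sub>R k)) t +
          (- 1) * ((loop_deriv (\<Phi> a) t * J (\<Psi>' (tpair a (\<alpha> *\<^sub>R h + \<beta> *\<^sub>R k))) t) * inverse (\<Psi> a t))) =
      (\<lambda>t. of_real \<alpha> * rep (\<Psi> a) (\<lambda>t. \<Phi>' (tpair a h) t + (- 1) * ((loop_deriv (\<Phi> a) t * J (\<Psi>' (tpair a h)) t) * inverse (\<Psi> a t))) t +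
           of_real \<beta> * rep (\<Psi> a) (\<lambda>t. \<Phi>' (tpair a k) t + (- 1) * ((loop_deriv (\<Phi> a) t * J (\<Psi>' (tpair a k)) t) * inverse (\<Psi> a t))) t)"
      unfolding lin_derivD[OF F(3) *] lin_derivD[OF G(3) *] J rep_def by (simp add: algebra_simps)
  qed
  \<comment> \<open>Pointwise limits suffice; the norm limit comes from the mean value inequality,
    which is where tameness of the derivative is used.\<close>
  have "dir_deriv n r (\<lambda>a. rep (\<Psi> a) (\<Phi> a)) ?D"
  proof (rule dir_derivI_pointwise[OF tame.rep[OF rep.hyps] D lin])
    fix a h s t assume h: "a \<in> TU n" "a \<in> level (TS n) 1" "h \<in> level (TS n) 1" "\<And>i. a + s i *\<^sub>R h \<in> TU n" "\<And>i. s i \<noteq> (0::real)" "s \<longlonglongrightarrow> 0"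
    have h': "\<forall>i. a + s i *\<^sub>R h \<in> TU n" "\<forall>i. s i \<noteq> 0" using h by blast+
    have c: "cv 1 (\<lambda>i. \<Psi> (a + s i *\<^sub>R h)) (\<Psi> a)" by (rule cv_antimono[OF line_cont[OF rep.hyps(1) h(1-3) h'(1) h(6)]]) simp
    have q: "cv 1 (\<lambda>i. diff_quot \<Psi> a h (s i)) (\<Psi>' (tpair a h))" by (rule cv_antimono[OF dir_derivD[OF G(2) h(1-3) h' h(6)]]) simp
    have v: "cv 1 (\<lambda>i. diff_quot \<Phi> a h (s i)) (\<Phi>' (tpair a h))" by (rule cv_antimono[OF dir_derivD[OF F(2) h(1-3) h' h(6)]]) simp
    have u: "\<Phi> a \<in> W 2" using W_antimono[OF _ tame_W0[OF rep.hyps(2) h(1)], of 2] by simp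
    have "(\<lambda>i. (rep (\<Psi> (a + s i *\<^sub>R h)) (\<Phi> (a + s i *\<^sub>R h)) t - rep (\<Psi> a) (\<Phi> a) t) / of_real (s i)) \<longlonglongrightarrow>
      rep (\<Psi> a) (\<lambda>t. \<Phi>' (tpair a h) t - loop_deriv (\<Phi> a) t * J (\<Psi>' (tpair a h)) t * inverse (\<Psi> a t)) t"
      by (rule rep_difference_quotient[OF rep.hyps(3)[OF h(4)] rep.hyps(3)[OF h(1)] c h(6,5) q[unfolded diff_quot_def] u v[unfolded diff_quot_def]])
    then show "(\<lambda>i. diff_quot (\<lambda>a. rep (\<Psi> a) (\<Phi> a)) a h (s i) t) \<longlonglongrightarrow> ?D (tpair a h) t"
      by (simp add: diff_quot_def)
  qed
  with D lin show ?case by blast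
qed

section \<open>Scale smoothness\<close>

definition tower_map :: "nat \<Rightarrow> (bool list \<Rightarrow> loop tower \<Rightarrow> loop) \<Rightarrow> loop tower \<Rightarrow> loop tower"
  where "tower_map n \<Phi> a = (\<lambda>w. if w \<in> words n then \<Phi> w a else 0)"

lemma tower_map_in: "w \<in> words n \<Longrightarrow> tower_map n \<Phi> a w = \<Phi> w a" and tower_map_out: "w \<notin> words n \<Longrightarrow> tower_map n \<Phi> a w = 0"
  by (simp_all only: tower_map_def if_True if_False)

text \<open>An unbounded homogeneous map would have a null sequence of arguments with images of norm
  one, contrary to continuity at 0.\<close>

lemma bounded_TS:
  assumes maps: "\<And>h. h \<in> level (TS n) 0 \<Longrightarrow> L h \<in> level (TS n) 0"
    and scale: "\<And>c h. h \<in> level (TS n) 0 \<Longrightarrow> L (c *\<^sub>R h) = c *\<^sub>R L h"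
    and cont: "\<And>H. (\<And>i. H i \<in> level (TS n) 0) \<Longrightarrow> tcv n 0 H 0 \<Longrightarrow> tcv n 0 (\<lambda>i. L (H i)) (L 0)"
  shows "\<exists>C. \<forall>h\<in>level (TS n) 0. lnorm (TS n) 0 (L h) \<le> C * lnorm (TS n) 0 h"
proof (rule ccontr)
  assume "\<not> ?thesis"
  then have "\<exists>h\<in>level (TS n) 0. real (Suc i) * lnorm (TS n) 0 h < lnorm (TS n) 0 (L h)" for i :: nat
    by (meson not_le)
  then obtain h where h: "\<And>i. h i \<in> level (TS n) 0" "\<And>i. real (Suc i) * lnorm (TS n) 0 (h i) < lnorm (TS n) 0 (L (h i))" by metis
  \<comment> \<open>Normalises the images to norm one; the arguments then have norm at most 1 / (i +
    1).\<close>
  define c where "c i = inverse (lnorm (TS n) 0 (L (h i)))" for i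
  have N0: "0 \<le> lnorm (TS n) 0 (h i)" for i unfolding lnorm_TS by (rule TS.N_nonneg[OF h(1)])
  have p: "0 < lnorm (TS n) 0 (L (h i))" for i
    using h(2)[of i] mult_nonneg_nonneg[OF _ N0[of i], of "real (Suc i)"] by linarith
  have cp: "0 < c i" for i using p[of i] by (simp add: c_def)
  have ck: "c i *\<^sub>R h i \<in> level (TS n) 0" for i by (rule TS.scale_in[OF h(1)])
  have sc: "lnorm (TS n) 0 (c i *\<^sub>R x) = c i * lnorm (TS n) 0 x" if "x \<in> level (TS n) 0" for i x
    unfolding lnorm_TS using TS.N_scale[OF that, of "c i"] cp[of i] by (simp only: abs_of_pos)
  have "(\<lambda>i. lnorm (TS n) 0 (c i *\<^sub>R h i)) \<longlonglongrightarrow> 0"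
  proof (rule tendsto_sandwich[OF always_eventually always_eventually tendsto_const])
    show "(\<lambda>i. 1 / real (Suc i)) \<longlonglongrightarrow> 0" using LIMSEQ_inverse_real_of_nat by (simp add: inverse_eq_divide)
    show "\<forall>i. 0 \<le> lnorm (TS n) 0 (c i *\<^sub>R h i)" unfolding lnorm_TS using TS.N_nonneg[OF ck] by blast
    show "\<forall>i. lnorm (TS n) 0 (c i *\<^sub>R h i) \<le> 1 / real (Suc i)"
    proof
      fix i
      have "lnorm (TS n) 0 (h i) \<le> lnorm (TS n) 0 (L (h i)) / real (Suc i)"
        using h(2)[of i] by (simp add: pos_le_divide_eq mult.commute del: of_nat_Suc)
      then have "c i * lnorm (TS n) 0 (h i) \<le> c i * (lnorm (TS n) 0 (L (h i)) / real (Suc i))" using cp[of i] by (intro mult_left_mono) auto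
      also have "\<dots> = 1 / real (Suc i)" using p[of i] by (simp add: c_def)
      finally show "lnorm (TS n) 0 (c i *\<^sub>R h i) \<le> 1 / real (Suc i)" unfolding sc[OF h(1)] .
    qed
  qed
  then have "tcv n 0 (\<lambda>i. c i *\<^sub>R h i) 0" by (intro tcvI_lnorm[OF ck TS.zero_in]) (simp only: diff_zero)
  from cont[OF ck this] have t: "tcv n 0 (\<lambda>i. L (c i *\<^sub>R h i)) (L 0)" .
  have L0: "L 0 = 0" using scale[OF TS.zero_in, of 0] by (simp only: scaleR_zero_left)
  have "(\<lambda>i. lnorm (TS n) 0 (L (c i *\<^sub>R h i) - 0)) \<longlonglongrightarrow> 0"
    by (rule tcv_lnorm[OF maps[OF ck] TS.zero_in]) (use t L0 in simp)
  moreover have "lnorm (TS n) 0 (L (c i *\<^sub>R h i) - 0) = 1" for i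
    unfolding diff_zero scale[OF h(1)] sc[OF maps[OF h(1)]] using p[of i] by (simp add: c_def)
  ultimately show False by (simp add: LIMSEQ_const_iff)
qed

text \<open>A failure gives increments tending to zero in level 1 with quotients bounded away from
  zero. Their normalised directions are bounded in level 1, so some subsequence converges in level
  0, which is all that \<open>secant_limit\<close> asks of directions.\<close>

lemma sc_derivative_tower_map:
  assumes \<Phi>: "\<And>w. w \<in> words n \<Longrightarrow> tame n (nF w) (\<Phi> w)"
    and \<Phi>': "\<And>w. w \<in> words n \<Longrightarrow> tame (Suc n) (nF w) (\<Phi>' w)"
    and D: "\<And>w. w \<in> words n \<Longrightarrow> dir_deriv n (nF w) (\<Phi> w) (\<Phi>' w)"
    and L: "\<And>w. w \<in> words n \<Longrightarrow> lin_deriv n (\<Phi>' w)"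
    and f: "\<And>a. a \<in> TU n \<Longrightarrow> f a = tower_map n \<Phi> a"
  shows "sc_derivative (TS n) (TU n) (TS n) f (\<lambda>x h. tower_map n \<Phi>' (tpair x h))"
  unfolding sc_derivative_def
proof (intro ballI conjI allI impI)
  fix x assume "x \<in> TU n \<inter> level (TS n) 1"
  then have x: "x \<in> TU n" "x \<in> level (TS n) 1" by auto
  have DW: "tower_map n \<Phi>' (tpair x h) \<in> level (TS n) 0" if "h \<in> level (TS n) 0" for h
  proof (rule level_TSI)
    show "tower_map n \<Phi>' (tpair x h) w \<in> W (2 + nF w + 0)" if w: "w \<in> words n" for w
      using tame_W0[OF \<Phi>'[OF w] tpair_in_TU[OF x \<open>h \<in> level (TS n) 0\<close>]] by (simp only: tower_map_in[OF w] add_0_right)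
  qed (rule tower_map_out)
  have scale: "tower_map n \<Phi>' (tpair x (c *\<^sub>R h)) = c *\<^sub>R tower_map n \<Phi>' (tpair x h)" if h: "h \<in> level (TS n) 0" for c h
  proof
    fix w show "tower_map n \<Phi>' (tpair x (c *\<^sub>R h)) w = (c *\<^sub>R tower_map n \<Phi>' (tpair x h)) w"
    proof (cases "w \<in> words n")
      case True
      show ?thesis unfolding tower_scaleR tower_map_in[OF True] lin_deriv_scale[OF L[OF True] x h]
        by (simp add: fun_eq_iff scaleR_conv_of_real)
    next
      case False
      show ?thesis unfolding tower_scaleR tower_map_out[OF False] by (rule scaleR_zero_right[symmetric])
    qed
  qed
  have ta: "tpair x h \<in> TU (Suc n)" if "h \<in> level (TS n) 0" for h by (rule tpair_in_TU[OF x that])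
  have x1: "tcv n (Suc 0) (\<lambda>i. x) x" by (rule tcv_const) (use x(2) in simp)
  show "bounded_linear_levels (TS n) (TS n) (\<lambda>h. tower_map n \<Phi>' (tpair x h))"
    unfolding bounded_linear_levels_def
  proof (intro conjI ballI allI)
    show "tower_map n \<Phi>' (tpair x h) \<in> level (TS n) 0" if "h \<in> level (TS n) 0" for h by (rule DW[OF that])
    show "tower_map n \<Phi>' (tpair x (c *\<^sub>R h)) = c *\<^sub>R tower_map n \<Phi>' (tpair x h)" if "h \<in> level (TS n) 0" for c h by (rule scale[OF that])
    show "tower_map n \<Phi>' (tpair x (h + k)) = tower_map n \<Phi>' (tpair x h) + tower_map n \<Phi>' (tpair x k)"
      if h: "h \<in> level (TS n) 0" and k: "k \<in> level (TS n) 0" for h k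
    proof
      fix w show "tower_map n \<Phi>' (tpair x (h + k)) w = (tower_map n \<Phi>' (tpair x h) + tower_map n \<Phi>' (tpair x k)) w"
      proof (cases "w \<in> words n")
        case True
        show ?thesis unfolding tower_add tower_map_in[OF True] lin_deriv_add[OF L[OF True] x h k]
          by (simp add: fun_eq_iff)
      next
        case False
        show ?thesis unfolding tower_add tower_map_out[OF False] by (rule add_0_right[symmetric])
      qed
    qed
    show "\<exists>C. \<forall>h\<in>level (TS n) 0. lnorm (TS n) 0 (tower_map n \<Phi>' (tpair x h)) \<le> C * lnorm (TS n) 0 h"
    proof (rule bounded_TS[OF DW scale])
      fix H assume H: "\<And>i. H i \<in> level (TS n) 0" "tcv n 0 H 0"
      have t: "tcv (Suc n) 0 (\<lambda>i. tpair x (H i)) (tpair x 0)" by (rule tcv_tpair[OF x1 H(2)])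
      show "tcv n 0 (\<lambda>i. tower_map n \<Phi>' (tpair x (H i))) (tower_map n \<Phi>' (tpair x 0))"
        unfolding tcv_def
      proof
        fix w assume w: "w \<in> words n"
        show "cv (2 + nF w + 0) (\<lambda>i. tower_map n \<Phi>' (tpair x (H i)) w) (tower_map n \<Phi>' (tpair x 0) w)"
          using tame_cont0[OF \<Phi>'[OF w] ta[OF H(1)] ta[OF TS.zero_in] t] by (simp only: tower_map_in[OF w] add_0_right)
      qed
    qed
  qed
  fix \<epsilon> :: real assume \<epsilon>: "0 < \<epsilon>"
  let ?R = "\<lambda>h. f (x + h) - f x - tower_map n \<Phi>' (tpair x h)"
  show "\<exists>\<delta>>0. \<forall>h\<in>level (TS n) 1. 0 < lnorm (TS n) 1 h \<and> lnorm (TS n) 1 h < \<delta> \<longrightarrow> lnorm (TS n) 0 (?R h) / lnorm (TS n) 1 h < \<epsilon>"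
  proof (rule ccontr)
    assume neg: "\<not> ?thesis"
    have "\<exists>h\<in>level (TS n) 1. (0 < lnorm (TS n) 1 h \<and> lnorm (TS n) 1 h < 1 / real (Suc i)) \<and> \<not> lnorm (TS n) 0 (?R h) / lnorm (TS n) 1 h < \<epsilon>" for i
    proof -
      have "0 < 1 / real (Suc i)" by simp
      then show ?thesis using neg by blast
    qed
    then obtain h where h: "\<And>i. h i \<in> level (TS n) 1" "\<And>i. 0 < lnorm (TS n) 1 (h i)" "\<And>i. lnorm (TS n) 1 (h i) < 1 / real (Suc i)"
      "\<And>i. \<not> lnorm (TS n) 0 (?R (h i)) / lnorm (TS n) 1 (h i) < \<epsilon>" by metis
    have h0: "(\<lambda>i. lnorm (TS n) 1 (h i)) \<longlonglongrightarrow> 0"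
    proof (rule tendsto_sandwich[OF always_eventually always_eventually tendsto_const])
      show "(\<lambda>i. 1 / real (Suc i)) \<longlonglongrightarrow> 0" using LIMSEQ_inverse_real_of_nat by (simp add: inverse_eq_divide)
    qed (use h(2,3) less_imp_le in blast)+
    obtain N where N: "\<And>i \<sigma>. N \<le> i \<Longrightarrow> \<sigma> \<in> {0..1} \<Longrightarrow> x + \<sigma> *\<^sub>R h i \<in> TU n"
      by (rule eventually_segment[OF x h(1) h0]) (rule that)
    \<comment> \<open>The shift by N puts all segments from x into the open set.\<close>
    define k where "k i = inverse (lnorm (TS n) 1 (h (i + N))) *\<^sub>R h (i + N)" for i
    have k: "k i \<in> level (TS n) 1" for i unfolding k_def by (rule TS.scale_in[OF h(1)])
    have "lnorm (TS n) 1 (k i) \<le> 1" for i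
    proof -
      have "lnorm (TS n) 1 (k i) = \<bar>inverse (lnorm (TS n) 1 (h (i + N)))\<bar> * lnorm (TS n) 1 (h (i + N))"
        unfolding k_def lnorm_TS by (rule TS.N_scale[OF h(1)])
      then show ?thesis using h(2)[of "i + N"] by simp
    qed
    then obtain r \<kappa> where r: "strict_mono (r :: nat \<Rightarrow> nat)" "\<kappa> \<in> level (TS n) 0" "tcv n 0 (\<lambda>i. k (r i)) \<kappa>"
      by (rule compact_TS[OF k]) (rule that)
    define \<rho> where "\<rho> i = lnorm (TS n) 1 (h (r i + N))" for i
    have \<rho>: "0 < \<rho> i" for i unfolding \<rho>_def by (rule h(2))
    have hk: "\<rho> i *\<^sub>R k (r i) = h (r i + N)" for i
      unfolding k_def \<rho>_def[symmetric] scaleR_scaleR using \<rho>[of i] by (simp only: right_inverse less_imp_neq[symmetric] scaleR_one not_False_eq_True) 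
    have lh: "(\<lambda>i. lnorm (TS n) 1 (\<rho> i *\<^sub>R k (r i))) \<longlonglongrightarrow> 0"
    proof -
      have "(\<lambda>i. lnorm (TS n) 1 (h (i + N))) \<longlonglongrightarrow> 0" by (rule LIMSEQ_ignore_initial_segment[OF h0])
      from LIMSEQ_subseq_LIMSEQ[OF this r(1)] show ?thesis unfolding hk by (simp only: o_def)
    qed
    have seg: "x + (\<sigma> * \<rho> i) *\<^sub>R k (r i) \<in> TU n" if "\<sigma> \<in> {0..1}" for i \<sigma>
      using N[OF le_add2 that, of "r i"] by (simp only: scaleR_scaleR[symmetric] hk)
    have seg1: "x + \<rho> i *\<^sub>R k (r i) \<in> TU n" for i using seg[of 1 i] by simp
    \<comment> \<open>The remainder divided by the size of the increment; its norm is the quotient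
      in the definition of the derivative.\<close>
    define V where "V i = inverse (\<rho> i) *\<^sub>R ?R (h (r i + N))" for i
    have k0: "k i \<in> level (TS n) 0" for i by (rule level_TS_antimono[OF _ k]) simp
    have fl: "f y \<in> level (TS n) 0" if y: "y \<in> TU n" for y
      unfolding f[OF y]
    proof (rule level_TSI)
      show "tower_map n \<Phi> y w \<in> W (2 + nF w + 0)" if w: "w \<in> words n" for w
        using tame_W0[OF \<Phi>[OF w] y] by (simp only: tower_map_in[OF w] add_0_right)
    qed (rule tower_map_out)
    have Rl: "?R (h (r i + N)) \<in> level (TS n) 0" for i
      using TS.diff_in[OF TS.diff_in[OF fl[OF seg1[of i]] fl[OF x(1)]] DW[OF TS.scale_in[OF k0]], of "\<rho> i" "r i"] unfolding hk .
    have Vl: "V i \<in> level (TS n) 0" for i unfolding V_def by (rule TS.scale_in[OF Rl])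
    have Vw: "V i w = diff_quot (\<Phi> w) x (k (r i)) (\<rho> i) - \<Phi>' w (tpair x (k (r i)))" if w: "w \<in> words n" for i w
    proof
      fix t
      have e: "tower_map n \<Phi>' (tpair x (h (r i + N))) w t = of_real (\<rho> i) * \<Phi>' w (tpair x (k (r i))) t"
        unfolding hk[symmetric] tower_map_in[OF w] lin_deriv_scale[OF L[OF w] x k0] ..
      have "V i w t = (\<Phi> w (x + \<rho> i *\<^sub>R k (r i)) t - \<Phi> w x t - tower_map n \<Phi>' (tpair x (h (r i + N))) w t) / of_real (\<rho> i)"
        unfolding V_def tower_scaleR minus_apply scaleR_fun_apply f[OF x(1)] hk[symmetric] f[OF seg1] tower_map_in[OF w]
        by (simp only: scaleR_conv_of_real of_real_inverse divide_inverse mult.commute)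
      also have "\<dots> = diff_quot (\<Phi> w) x (k (r i)) (\<rho> i) t - \<Phi>' w (tpair x (k (r i))) t"
        unfolding e diff_quot_def using \<rho>[of i] by (simp add: diff_divide_distrib)
      finally show "V i w t = (diff_quot (\<Phi> w) x (k (r i)) (\<rho> i) - \<Phi>' w (tpair x (k (r i)))) t" by (simp only: minus_apply)
    qed
    have "(\<lambda>i. lnorm (TS n) 0 (V i)) \<longlonglongrightarrow> 0"
    proof (rule lnorm_TS_tendsto[OF Vl])
      fix w assume w: "w \<in> words n"
      have "(\<lambda>i. wn (2 + nF w) (diff_quot (\<Phi> w) x (k (r i)) (\<rho> i) - \<Phi>' w (tpair x (k (r i))))) \<longlonglongrightarrow> 0"
      proof (rule secant_limit[OF \<Phi>[OF w] \<Phi>'[OF w] L[OF w] _ x k r(2,3) _ lh seg])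
        show "(\<lambda>i. diff_quot (\<Phi> w) a h (s i) t) \<longlonglongrightarrow> \<Phi>' w (tpair a h) t"
          if "a \<in> TU n" "a \<in> level (TS n) 1" "h \<in> level (TS n) 1" "\<And>i. a + s i *\<^sub>R h \<in> TU n" "\<And>i. s i \<noteq> 0" "s \<longlonglongrightarrow> 0" for a h s t
          by (rule cv_pointwise[OF dir_derivD[OF D[OF w] that(1-3)]]) (use that in auto)
        show "\<rho> i \<noteq> 0" for i using \<rho>[of i] by simp
      qed
      then show "(\<lambda>i. wn (2 + nF w + 0) (V i w)) \<longlonglongrightarrow> 0" unfolding Vw[OF w] add_0_right .
    qed
    then have "\<forall>\<^sub>F i in sequentially. lnorm (TS n) 0 (V i) < \<epsilon>" by (rule order_tendstoD(2)[OF _ \<epsilon>])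
    then obtain i where "lnorm (TS n) 0 (V i) < \<epsilon>" using eventually_happens'[OF sequentially_bot] by blast
    moreover have "lnorm (TS n) 0 (V i) = lnorm (TS n) 0 (?R (h (r i + N))) / lnorm (TS n) 1 (h (r i + N))"
    proof -
      have "lnorm (TS n) 0 (V i) = \<bar>inverse (\<rho> i)\<bar> * lnorm (TS n) 0 (?R (h (r i + N)))"
        unfolding V_def lnorm_TS by (rule TS.N_scale[OF Rl])
      then show ?thesis unfolding \<rho>_def[symmetric] using \<rho>[of i] by (simp only: abs_of_pos positive_imp_inverse_positive divide_inverse mult.commute)
    qed
    ultimately show False using h(4)[of "r i + N"] by simp
  qed
qed

text \<open>The induction on the order must vary the height: order N + 1 at height n needs order N
  of the tangent map, which is of the same form at height n + 1. The condition on the all-False word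
  keeps the values inside the open set.\<close>

theorem sc_pow_tower_map:
  assumes "\<And>w. w \<in> words n \<Longrightarrow> tame n (nF w) (\<Phi> w)"
    and "\<And>a t. a \<in> TU n \<Longrightarrow> \<Phi> (replicate n False) a t \<noteq> 0"
    and "\<And>a. a \<in> TU n \<Longrightarrow> f a = tower_map n \<Phi> a"
  shows "sc_pow N (TS n) (TU n) (TS n) (TU n) f"
  using assms
proof (induction N arbitrary: n \<Phi> f)
  have sc0: "sc0 (TS n) (TU n) (TS n) (TU n) f"
    if \<Phi>: "\<And>w. w \<in> words n \<Longrightarrow> tame n (nF w) (\<Phi> w)"
      and nz: "\<And>a t. a \<in> TU n \<Longrightarrow> \<Phi> (replicate n False) a t \<noteq> 0"
      and f: "\<And>a. a \<in> TU n \<Longrightarrow> f a = tower_map n \<Phi> a" for n \<Phi> f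
  proof (rule sc0_TS)
    have lev: "f a \<in> level (TS n) k" if a: "a \<in> TU n" "a \<in> level (TS n) k" for a k
      unfolding f[OF a(1)]
    proof (rule level_TSI)
      show "tower_map n \<Phi> a w \<in> W (2 + nF w + k)" if w: "w \<in> words n" for w
        unfolding tower_map_in[OF w] by (rule tame_W[OF \<Phi>[OF w] a])
    qed (rule tower_map_out)
    show "f a \<in> TU n \<and> f a \<in> level (TS n) k" if a: "a \<in> TU n" "a \<in> level (TS n) k" for k a
    proof
      show "f a \<in> TU n" unfolding TU_iff
        using lev[OF a(1) TU_level[OF a(1)]] nz[OF a(1)] by (simp only: f[OF a(1)] tower_map_in[OF replicate_words] not_False_eq_True simp_thms)
    qed (rule lev[OF a])
    fix k A a assume A: "\<And>i. A i \<in> TU n" "a \<in> TU n" "tcv n k A a"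
    show "tcv n k (\<lambda>i. f (A i)) (f a)" unfolding tcv_def f[OF A(1)] f[OF A(2)]
    proof
      fix w assume w: "w \<in> words n"
      show "cv (2 + nF w + k) (\<lambda>i. tower_map n \<Phi> (A i) w) (tower_map n \<Phi> a w)"
        unfolding tower_map_in[OF w] by (rule tame_cont[OF \<Phi>[OF w] A])
    qed
  qed
  {
    case 0
    show ?case unfolding sc_pow.simps by (rule sc0[OF 0])
  next
    case (Suc N)
    have "\<forall>w. \<exists>\<Phi>'. w \<in> words n \<longrightarrow> tame (Suc n) (nF w) \<Phi>' \<and> dir_deriv n (nF w) (\<Phi> w) \<Phi>' \<and> lin_deriv n \<Phi>'"
      using tame_has_deriv[OF Suc.prems(1)] by blast
    then obtain \<Phi>' where \<Phi>': "\<And>w. w \<in> words n \<Longrightarrow> tame (Suc n) (nF w) (\<Phi>' w)"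
      "\<And>w. w \<in> words n \<Longrightarrow> dir_deriv n (nF w) (\<Phi> w) (\<Phi>' w)" "\<And>w. w \<in> words n \<Longrightarrow> lin_deriv n (\<Phi>' w)" by metis
    let ?D = "\<lambda>x h. tower_map n \<Phi>' (tpair x h)"
    \<comment> \<open>The letter True selects the derivative, False the old component at the base
      point; the latter gains an order by \<open>tame_lift\<close>, just as \<open>nF\<close> grows
      by one. The empty word is not of length n + 1.\<close>
    define \<Psi> where "\<Psi> w b = (case w of [] \<Rightarrow> 0 | c # v \<Rightarrow> if c then \<Phi>' v b else \<Phi> v (tfst b))" for w and b :: "loop tower"
    have "sc_pow N (TS (Suc n)) (TU (Suc n)) (TS (Suc n)) (TU (Suc n)) (tangent_map f ?D)"
    proof (rule Suc.IH[where \<Phi>=\<Psi>])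
      show "tame (Suc n) (nF w) (\<Psi> w)" if w: "w \<in> words (Suc n)" for w
      proof (cases w)
        case (Cons c v)
        then have v: "v \<in> words n" using w by simp
        show ?thesis
        proof (cases c)
          case True
          then show ?thesis using \<Phi>'(1)[OF v] Cons by (simp add: \<Psi>_def[abs_def])
        next
          case False
          then show ?thesis using tame_lift[OF Suc.prems(1)[OF v]] Cons by (simp add: \<Psi>_def[abs_def])
        qed
      qed (use w in simp)
      show "\<Psi> (replicate (Suc n) False) b t \<noteq> 0" if "b \<in> TU (Suc n)" for b t
        using that Suc.prems(2)[of "tfst b" t] unfolding TU_Suc_iff by (simp add: \<Psi>_def)
      show "tangent_map f ?D b = tower_map (Suc n) \<Psi> b" if b: "b \<in> TU (Suc n)" for b
      proof
        fix w
        have b': "b [] = 0" "tfst b \<in> TU n" using b unfolding TU_Suc_iff by blast+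
        show "tangent_map f ?D b w = tower_map (Suc n) \<Psi> b w"
        proof (cases w)
          case Nil
          then show ?thesis unfolding tangent_map_def Nil tpair_Nil by (simp only: tower_map_out[OF Nil_words])
        next
          case (Cons c v)
          have "tangent_map f ?D b w = (if c then tower_map n \<Phi>' b v else tower_map n \<Phi> (tfst b) v)"
            unfolding tangent_map_def Cons tpair_Cons tpair_eta[of b, OF b'(1)] Suc.prems(3)[OF b'(2)] ..
          also have "\<dots> = tower_map (Suc n) \<Psi> b w"
            unfolding tower_map_def Cons Cons_words \<Psi>_def list.case by (simp only: if_distrib split: if_split) blast
          finally show ?thesis .
        qed
      qed
    qed
    then have sp: "sc_pow N (sc_tangent (TS n)) (tangent_set (TS n) (TU n)) (sc_tangent (TS n)) (tangent_set (TS n) (TU n)) (tangent_map f ?D)"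
      unfolding TS_Suc TU.simps .
    have sd: "sc_derivative (TS n) (TU n) (TS n) f ?D"
      by (rule sc_derivative_tower_map[OF Suc.prems(1) \<Phi>' Suc.prems(3)])
    show ?case unfolding sc_pow.simps using sc0[OF Suc.prems] sd sp by blast
  }
qed

theorem theorem1:
  shows "scale_smooth loop_scale punctured_loops loop_scale punctured_loops rescale_square"
  unfolding scale_smooth_def
proof (intro conjI allI scale_hilbert_space_loop openin_punctured_loops)
  fix N
  define D :: "loop tower \<Rightarrow> loop" where "D a = dens (a [])" for a
  define \<Phi> :: "bool list \<Rightarrow> loop tower \<Rightarrow> loop" where "\<Phi> w a = rep (D a) (\<lambda>t. a [] t * a [] t)" for w a
  have v: "tame 0 0 (\<lambda>a. a [])" by (rule tame.var) simp_all
  have zz: "tame 0 0 (\<lambda>a t. a [] t * cnj (a [] t))" by (rule tame.mult[OF v tame.lin[OF cv_op_cnj v]])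
  have TU0: "a [] \<in> punctured_loops" if "a \<in> TU 0" for a using that by (auto simp: tip_def)
  have W1: "z \<in> W 1" "\<And>t. z t \<noteq> 0" if "z \<in> punctured_loops" for z
    using that W_antimono[of 1 2 z] by (auto simp: punctured_loops_iff)
  have mz: "mean (\<lambda>s. a [] s * cnj (a [] s)) \<noteq> 0" if "a \<in> TU 0" for a
    using l2ip_pos[OF W1[OF TU0[OF that]]] by (simp add: mean_cmod_sq)
  \<comment> \<open>The mean enters as a constant loop; it is the squared L^2 norm of a nonvanishing
    loop, hence nonzero, and may be inverted.\<close>
  have cD: "tame 0 0 D" unfolding D_def[abs_def] dens_def
    by (rule tame.mult[OF tame.inv[OF tame.lin[OF cv_op_mean zz]] zz]) (rule mz)
  have dD: "loop_density (D a)" if "a \<in> TU 0" for a unfolding D_def by (rule density_dens[OF W1[OF TU0[OF that]]])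
  have c\<Phi>: "tame 0 (nF w) (\<Phi> w)" if "w \<in> words 0" for w
    using tame.rep[OF cD tame.mult[OF v v] dD] that by (simp add: \<Phi>_def[abs_def])
  have "sc_pow N (TS 0) (TU 0) (TS 0) (TU 0) (\<lambda>a. tip (rescale_square (untip a)))"
  proof (rule sc_pow_tower_map[where \<Phi>=\<Phi>, OF c\<Phi>])
    show "\<Phi> (replicate 0 False) a t \<noteq> 0" if "a \<in> TU 0" for a t
      using W1(2)[OF TU0[OF that]] by (simp add: \<Phi>_def rep_def)
    show "tip (rescale_square (untip a)) = tower_map 0 \<Phi> a" if a: "a \<in> TU 0" for a
    proof
      fix w show "tip (rescale_square (untip a)) w = tower_map 0 \<Phi> a w"
        using rescale_square_eq[OF TU0[OF a]]
        by (cases w) (simp_all only: tip_def untip_def tower_map_def words_0 singleton_iff list.case \<Phi>_def D_def if_True if_False list.distinct simp_thms)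
    qed
  qed
  then show "sc_pow N (sc_tip loop_scale) (tip ` punctured_loops) (sc_tip loop_scale) (tip ` punctured_loops) (\<lambda>a. tip (rescale_square (untip a)))"
    unfolding TS_0 TU.simps .
qed

end
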